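(* Let $E_1,E_2,H$ be directed graphs, $X$ a set, and $\iota_{E_1}\colon X\to E_1^0$, $\iota_{E_2}\colon X\to E_2^0$, $\iota_H\colon X\to H^0$ injective maps such that $\iota_{E_1}(X)$ consists of sinks of $E_1$ and $\iota_{E_2}(X)$ consists of sinks of $E_2$. Let $A,B$ be C*-algebras and let $$\delta\colon C^*(E_1)\to A,\quad \phi\colon C^*(E_1)\to C^*(E_2),\quad \rho\colon A\to B,\quad \theta\colon C^*(E_2)\to B$$ be $*$-homomorphisms forming a pullback diagram of C*-algebras, i.e. $\rho\circ\delta=\theta\circ\phi$ and $c\mapsto(\delta(c),\phi(c))$ is an isomorphism of $C^*(E_1)$ onto $\{(a,b)\in A\oplus C^*(E_2):\rho(a)=\theta(b)\}$. Assume that: (i) $\phi$ is injective, sends every vertex projection to a vertex projection, and sends every partial isometry $S_e$, $e\in E_1^1$, to a partial isometry $S_\alpha$ associated with a path $\alpha$ in $E_2$; (ii) $\phi(P_{\iota_{E_1}(x)})=P_{\iota_{E_2}(x)}$ for all $x\in X$, and for every $v\in E_1^0\setminus\iota_{E_1}(X)$ one has $\phi(P_v)=P_w$ for some $w\in E_2^0\setminus\iota_{E_2}(X)$; (iii) for every path $\alpha$ in $E_2$ ending in $\iota_{E_2}(X)$, the partial isometry $S_\alpha$ is in the image of $\phi$; (iv) $\delta(P_{\iota_{E_1}(x)})=0$ for all $x\in X$. Then the induced $*$-homomorphisms $$\delta'\colon C^*(E_1\sqcup_X H)\to A,\quad \psi\colon C^*(E_1\sqcup_X H)\to C^*(E_2\sqcup_X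 H),\quad \theta'\colon C^*(E_2\sqcup_X H)\to B$$ together with $\rho\colon A\to B$ form a pullback diagram of C*-algebras; that is, $\rho\circ\delta'=\theta'\circ\psi$ and $c\mapsto(\delta'(c),\psi(c))$ is an isomorphism of $C^*(E_1\sqcup_XH)$ onto $\{(a,b)\in A\oplus C^*(E_2\sqcup_XH):\rho(a)=\theta'(b)\}$.
   Context: A directed graph is $E=(E^0,E^1,s_E,r_E)$ with countable vertex set $E^0$, countable edge set $E^1$, source map $s_E$ and range map $r_E\colon E^1\to E^0$. A sink is a vertex emitting no edges. A path is a finite sequence $(e_1,\dots,e_n)$ of edges with $r(e_i)=s(e_{i+1})$; vertices are paths of length zero. $S_\alpha=S_{e_1}\cdots S_{e_n}$ for a path $\alpha=(e_1,\dots,e_n)$, and $S_v=P_v$ for a vertex $v$. The graph C*-algebra $C^*(E)$ is the universal C*-algebra generated by mutually orthogonal projections $\{P_v : v\in E^0\}$ (vertex projections) and partial isometries $\{S_e : e\in E^1\}$ subject to: (GA1) $S_e^*S_f=\delta_{e,f}P_{r(e)}$ for all $e,f\in E^1$; (GA2) $\sum_{e\in s^{-1}(v)}S_eS_e^*=P_v$ for all $v\in E^0$ with $0<|s^{-1}(v)|<\infty$; (GA3) $S_eS_e^*\le P_{s(e)}$ for all $e\in E^1$. For $i=1,2$, $E_i\sqcup_X H$ is the graph with vertex set the pushout $E_i^0\sqcup_X H^0$ (the disjoint union with $\iota_{E_i}(x)$ identified with $\iota_H(x)$ for each $x\in X$), edge set $E_i^1\sqcup H^1$, and source and range maps $\pi\circ(s_{E_i}\sqcup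 s_H)$ and $\pi\circ(r_{E_i}\sqcup r_H)$, where $\pi\colon E_i^0\sqcup H^0\to E_i^0\sqcup_XH^0$ is the quotient map. Let $j_{E_i}\colon C^*(E_i)\to C^*(E_i\sqcup_XH)$ and $j_H^i\colon C^*(H)\to C^*(E_i\sqcup_XH)$ be the $*$-homomorphisms sending vertex projections and edge partial isometries to those with the corresponding labels (these exist because $\iota_{E_i}(X)$ consists of sinks); their images generate $C^*(E_i\sqcup_XH)$. The induced maps are the unique $*$-homomorphisms such that: $\delta'\circ j_{E_1}=\delta$ and $\delta'\circ j_H^1=0$; $\theta'\circ j_{E_2}=\theta$ and $\theta'\circ j_H^2=0$ (note that $\theta$ annihilates the projections $P_{\iota_{E_2}(x)}$, by commutativity of the given diagram); $\psi\circ j_{E_1}=j_{E_2}\circ\phi$ and $\psi\circ j_H^1=j_H^2$. *)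

theory Defs
  imports
    Complex_Main
    "HOL-Library.Poly_Mapping"
    "HOL-Algebra.Module"
    "Graph_Theory.Arc_Walk"
begin

section \<open>C*-algebras\<close>

definition complex_ring :: "complex ring" where
  "complex_ring = \<lparr>carrier = UNIV, mult = (*), one = 1, zero = 0, add = (+)\<rparr>"

text \<open>C*-algebras need not be unital: the field \<open>one\<close> inherited from \<^typ>\<open>(complex, 'a) module\<close>
  is never used and never constrained.\<close>

record 'a cstar = "(complex, 'a) module" +
  adj :: "'a \<Rightarrow> 'a" ("_\<^sup>\<star>\<index>" [1000] 999)
  cnorm :: "'a \<Rightarrow> real" ("\<parallel>_\<parallel>\<index>")

locale cstar_algebra = Module.module complex_ring A for A :: "('a, 'm) cstar_scheme" (structure) +
  assumes mult_closed: "\<lbrakk>x \<in> carrier A; y \<in> carrier A\<rbrakk> \<Longrightarrow> x \<otimes>\<^bsub>A\<^esub> y \<in> carrier A"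
    and mult_assoc: "\<lbrakk>x \<in> carrier A; y \<in> carrier A; z \<in> carrier A\<rbrakk> \<Longrightarrow>
      (x \<otimes>\<^bsub>A\<^esub> y) \<otimes>\<^bsub>A\<^esub> z = x \<otimes>\<^bsub>A\<^esub> (y \<otimes>\<^bsub>A\<^esub> z)"
    and mult_distrib_right: "\<lbrakk>x \<in> carrier A; y \<in> carrier A; z \<in> carrier A\<rbrakk> \<Longrightarrow>
      (x \<oplus>\<^bsub>A\<^esub> y) \<otimes>\<^bsub>A\<^esub> z = (x \<otimes>\<^bsub>A\<^esub> z) \<oplus>\<^bsub>A\<^esub> (y \<otimes>\<^bsub>A\<^esub> z)"
    and mult_distrib_left: "\<lbrakk>x \<in> carrier A; y \<in> carrier A; z \<in> carrier A\<rbrakk> \<Longrightarrow>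
      x \<otimes>\<^bsub>A\<^esub> (y \<oplus>\<^bsub>A\<^esub> z) = (x \<otimes>\<^bsub>A\<^esub> y) \<oplus>\<^bsub>A\<^esub> (x \<otimes>\<^bsub>A\<^esub> z)"
    and smult_mult_left: "\<lbrakk>x \<in> carrier A; y \<in> carrier A\<rbrakk> \<Longrightarrow>
      (c \<odot>\<^bsub>A\<^esub> x) \<otimes>\<^bsub>A\<^esub> y = c \<odot>\<^bsub>A\<^esub> (x \<otimes>\<^bsub>A\<^esub> y)"
    and smult_mult_right: "\<lbrakk>x \<in> carrier A; y \<in> carrier A\<rbrakk> \<Longrightarrow>
      x \<otimes>\<^bsub>A\<^esub> (c \<odot>\<^bsub>A\<^esub> y) = c \<odot>\<^bsub>A\<^esub> (x \<otimes>\<^bsub>A\<^esub> y)"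
    and adj_closed: "x \<in> carrier A \<Longrightarrow> x\<^sup>\<star>\<^bsub>A\<^esub> \<in> carrier A"
    and adj_adj: "x \<in> carrier A \<Longrightarrow> (x\<^sup>\<star>\<^bsub>A\<^esub>)\<^sup>\<star>\<^bsub>A\<^esub> = x"
    and adj_add: "\<lbrakk>x \<in> carrier A; y \<in> carrier A\<rbrakk> \<Longrightarrow> (x \<oplus>\<^bsub>A\<^esub> y)\<^sup>\<star>\<^bsub>A\<^esub> = x\<^sup>\<star>\<^bsub>A\<^esub> \<oplus>\<^bsub>A\<^esub> y\<^sup>\<star>\<^bsub>A\<^esub>"
    and adj_smult: "x \<in> carrier A \<Longrightarrow> (c \<odot>\<^bsub>A\<^esub> x)\<^sup>\<star>\<^bsub>A\<^esub> = cnj c \<odot>\<^bsub>A\<^esub> x\<^sup>\<star>\<^bsub>A\<^esub>"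
    and adj_mult: "\<lbrakk>x \<in> carrier A; y \<in> carrier A\<rbrakk> \<Longrightarrow> (x \<otimes>\<^bsub>A\<^esub> y)\<^sup>\<star>\<^bsub>A\<^esub> = y\<^sup>\<star>\<^bsub>A\<^esub> \<otimes>\<^bsub>A\<^esub> x\<^sup>\<star>\<^bsub>A\<^esub>"
    and cnorm_eq_zero: "x \<in> carrier A \<Longrightarrow> \<parallel>x\<parallel>\<^bsub>A\<^esub> = 0 \<longleftrightarrow> x = \<zero>\<^bsub>A\<^esub>"
    and cnorm_add: "\<lbrakk>x \<in> carrier A; y \<in> carrier A\<rbrakk> \<Longrightarrow> \<parallel>x \<oplus>\<^bsub>A\<^esub> y\<parallel>\<^bsub>A\<^esub> \<le> \<parallel>x\<parallel>\<^bsub>A\<^esub> + \<parallel>y\<parallel>\<^bsub>A\<^esub>"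
    and cnorm_smult: "x \<in> carrier A \<Longrightarrow> \<parallel>c \<odot>\<^bsub>A\<^esub> x\<parallel>\<^bsub>A\<^esub> = cmod c * \<parallel>x\<parallel>\<^bsub>A\<^esub>"
    and cnorm_mult: "\<lbrakk>x \<in> carrier A; y \<in> carrier A\<rbrakk> \<Longrightarrow> \<parallel>x \<otimes>\<^bsub>A\<^esub> y\<parallel>\<^bsub>A\<^esub> \<le> \<parallel>x\<parallel>\<^bsub>A\<^esub> * \<parallel>y\<parallel>\<^bsub>A\<^esub>"
    and cstar_identity: "x \<in> carrier A \<Longrightarrow> \<parallel>x\<^sup>\<star>\<^bsub>A\<^esub> \<otimes>\<^bsub>A\<^esub> x\<parallel>\<^bsub>A\<^esub> = (\<parallel>x\<parallel>\<^bsub>A\<^esub>)\<^sup>2"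
    and complete: "\<lbrakk>range s \<subseteq> carrier A;
        \<And>\<epsilon>. \<epsilon> > 0 \<Longrightarrow> \<exists>N. \<forall>m\<ge>N. \<forall>n\<ge>N. \<parallel>s m \<ominus>\<^bsub>A\<^esub> s n\<parallel>\<^bsub>A\<^esub> < \<epsilon>\<rbrakk> \<Longrightarrow>
      \<exists>x\<in>carrier A. (\<lambda>n. \<parallel>s n \<ominus>\<^bsub>A\<^esub> x\<parallel>\<^bsub>A\<^esub>) \<longlonglongrightarrow> 0"

text \<open>Homomorphisms are extensional (\<^const>\<open>undefined\<close> off the carrier of the domain), so that equality
  of homomorphisms is equality of functions.\<close>

definition star_homs :: "('a, 'm) cstar_scheme \<Rightarrow> ('b, 'n) cstar_scheme \<Rightarrow> ('a \<Rightarrow> 'b) set" where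
  "star_homs A B = {h \<in> carrier A \<rightarrow>\<^sub>E carrier B.
     (\<forall>x\<in>carrier A. \<forall>y\<in>carrier A. h (x \<oplus>\<^bsub>A\<^esub> y) = h x \<oplus>\<^bsub>B\<^esub> h y) \<and>
     (\<forall>c. \<forall>x\<in>carrier A. h (c \<odot>\<^bsub>A\<^esub> x) = c \<odot>\<^bsub>B\<^esub> h x) \<and>
     (\<forall>x\<in>carrier A. \<forall>y\<in>carrier A. h (x \<otimes>\<^bsub>A\<^esub> y) = h x \<otimes>\<^bsub>B\<^esub> h y) \<and>
     (\<forall>x\<in>carrier A. h (x\<^sup>\<star>\<^bsub>A\<^esub>) = (h x)\<^sup>\<star>\<^bsub>B\<^esub>)}"

definition star_isos :: "('a, 'm) cstar_scheme \<Rightarrow> ('b, 'n) cstar_scheme \<Rightarrow> ('a \<Rightarrow> 'b) set" where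
  "star_isos A B = {h \<in> star_homs A B. bij_betw h (carrier A) (carrier B)}"

definition zero_hom :: "('a, 'm) cstar_scheme \<Rightarrow> ('b, 'n) cstar_scheme \<Rightarrow> 'a \<Rightarrow> 'b" where
  "zero_hom A B = (\<lambda>x\<in>carrier A. \<zero>\<^bsub>B\<^esub>)"

definition direct_sum :: "('a, 'm) cstar_scheme \<Rightarrow> ('b, 'n) cstar_scheme \<Rightarrow> ('a \<times> 'b) cstar" where
  "direct_sum A B =
    \<lparr>carrier = carrier A \<times> carrier B,
     mult = (\<lambda>(a, b) (a', b'). (a \<otimes>\<^bsub>A\<^esub> a', b \<otimes>\<^bsub>B\<^esub> b')),
     one = undefined,
     zero = (\<zero>\<^bsub>A\<^esub>, \<zero>\<^bsub>B\<^esub>),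
     add = (\<lambda>(a, b) (a', b'). (a \<oplus>\<^bsub>A\<^esub> a', b \<oplus>\<^bsub>B\<^esub> b')),
     smult = (\<lambda>c (a, b). (c \<odot>\<^bsub>A\<^esub> a, c \<odot>\<^bsub>B\<^esub> b)),
     adj = (\<lambda>(a, b). (a\<^sup>\<star>\<^bsub>A\<^esub>, b\<^sup>\<star>\<^bsub>B\<^esub>)),
     cnorm = (\<lambda>(a, b). max \<parallel>a\<parallel>\<^bsub>A\<^esub> \<parallel>b\<parallel>\<^bsub>B\<^esub>)\<rparr>"

definition fibre_product ::
  "('a, 'm) cstar_scheme \<Rightarrow> ('c, 'n) cstar_scheme \<Rightarrow> ('a \<Rightarrow> 'b) \<Rightarrow> ('c \<Rightarrow> 'b) \<Rightarrow> ('a \<times> 'c) cstar" where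
  "fibre_product A C \<rho> \<theta> =
    (direct_sum A C)\<lparr>carrier := {(a, c) \<in> carrier A \<times> carrier C. \<rho> a = \<theta> c}\<rparr>"

text \<open>The square \<open>P \<rightarrow> A\<close> (by \<open>\<delta>\<close>), \<open>P \<rightarrow> C\<close> (by \<open>\<phi>\<close>), \<open>A \<rightarrow> B\<close> (by \<open>\<rho>\<close>), \<open>C \<rightarrow> B\<close> (by \<open>\<theta>\<close>).\<close>

definition pullback_diagram ::
  "('p, 'k) cstar_scheme \<Rightarrow> ('a, 'l) cstar_scheme \<Rightarrow> ('c, 'm) cstar_scheme \<Rightarrow> ('b, 'n) cstar_scheme \<Rightarrow>
   ('p \<Rightarrow> 'a) \<Rightarrow> ('p \<Rightarrow> 'c) \<Rightarrow> ('a \<Rightarrow> 'b) \<Rightarrow> ('c \<Rightarrow> 'b) \<Rightarrow> bool" where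
  "pullback_diagram P A C B \<delta> \<phi> \<rho> \<theta> \<longleftrightarrow>
     \<delta> \<in> star_homs P A \<and> \<phi> \<in> star_homs P C \<and> \<rho> \<in> star_homs A B \<and> \<theta> \<in> star_homs C B \<and>
     compose (carrier P) \<rho> \<delta> = compose (carrier P) \<theta> \<phi> \<and>
     (\<lambda>c\<in>carrier P. (\<delta> c, \<phi> c)) \<in> star_isos P (fibre_product A C \<rho> \<theta>)"


section \<open>Universal C*-algebras given by generators and relations\<close>

text \<open>A letter \<open>(g, False)\<close> is the generator \<open>g\<close>, and \<open>(g, True)\<close> is its formal adjoint. Words form
  the free monoid, written additively so that the convolution product of \<^theory>\<open>HOL-Library.Poly_Mapping\<close>
  is the product of noncommutative polynomials.\<close>

datatype 'g word = Word (letters: "('g \<times> bool) list")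

instantiation word :: (type) monoid_add
begin

definition zero_word :: "'a word" where
  "0 = Word []"

definition plus_word :: "'a word \<Rightarrow> 'a word \<Rightarrow> 'a word" where
  "u + v = Word (letters u @ letters v)"

instance
  by standard (simp_all add: zero_word_def plus_word_def)

end

type_synonym 'g star_poly = "'g word \<Rightarrow>\<^sub>0 complex"

definition gen :: "'g \<Rightarrow> 'g star_poly" where
  "gen g = Poly_Mapping.single (Word [(g, False)]) 1"

definition poly_scale :: "complex \<Rightarrow> 'g star_poly \<Rightarrow> 'g star_poly" where
  "poly_scale c = Poly_Mapping.map ((*) c)"

definition word_adj :: "'g word \<Rightarrow> 'g word" where
  "word_adj w = Word (rev (map (\<lambda>(g, b). (g, \<not> b)) (letters w)))"

definition poly_adj :: "'g star_poly \<Rightarrow> 'g star_poly" where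
  "poly_adj a = (\<Sum>w\<in>Poly_Mapping.keys a.
     Poly_Mapping.single (word_adj w) (cnj (Poly_Mapping.lookup a w)))"

text \<open>The free non-unital *-algebra on \<open>G\<close>: *-polynomials in \<open>G\<close> without constant term.\<close>

definition free_star_algebra :: "'g set \<Rightarrow> 'g star_poly set" where
  "free_star_algebra G = {a. \<forall>w\<in>Poly_Mapping.keys a. w \<noteq> 0 \<and> fst ` set (letters w) \<subseteq> G}"

definition cstar_seminorm :: "'g set \<Rightarrow> ('g star_poly \<Rightarrow> real) \<Rightarrow> bool" where
  "cstar_seminorm G p \<longleftrightarrow>
     (\<forall>a\<in>free_star_algebra G. \<forall>b\<in>free_star_algebra G. p (a + b) \<le> p a + p b) \<and>
     (\<forall>c. \<forall>a\<in>free_star_algebra G. p (poly_scale c a) = cmod c * p a) \<and>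
     (\<forall>a\<in>free_star_algebra G. \<forall>b\<in>free_star_algebra G. p (a * b) \<le> p a * p b) \<and>
     (\<forall>a\<in>free_star_algebra G. p (poly_adj a * a) = (p a)\<^sup>2)"

text \<open>The universal C*-algebra on generators \<open>G\<close> subject to relations \<open>r = 0\<close> for \<open>r \<in> R\<close> is the
  Hausdorff completion of the free *-algebra in the largest C*-seminorm that vanishes on \<open>R\<close>. The
  supremum has to be finite; this holds for graph relations because they make the generators
  partial isometries.\<close>

definition universal_seminorm :: "'g set \<Rightarrow> 'g star_poly set \<Rightarrow> 'g star_poly \<Rightarrow> real" where
  "universal_seminorm G R a = (SUP p\<in>{p. cstar_seminorm G p \<and> (\<forall>r\<in>R. p r = 0)}. p a)"

definition cauchy_seqs :: "'g set \<Rightarrow> 'g star_poly set \<Rightarrow> (nat \<Rightarrow> 'g star_poly) set" where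
  "cauchy_seqs G R = {s. (\<forall>n. s n \<in> free_star_algebra G) \<and>
     (\<forall>\<epsilon>>0. \<exists>N. \<forall>m\<ge>N. \<forall>n\<ge>N. universal_seminorm G R (s m - s n) < \<epsilon>)}"

definition null_rel ::
  "'g set \<Rightarrow> 'g star_poly set \<Rightarrow> ((nat \<Rightarrow> 'g star_poly) \<times> (nat \<Rightarrow> 'g star_poly)) set" where
  "null_rel G R = {(s, t). s \<in> cauchy_seqs G R \<and> t \<in> cauchy_seqs G R \<and>
     (\<lambda>n. universal_seminorm G R (s n - t n)) \<longlonglongrightarrow> 0}"

definition universal_cstar :: "'g set \<Rightarrow> 'g star_poly set \<Rightarrow> (nat \<Rightarrow> 'g star_poly) set cstar" where
  "universal_cstar G R =
    \<lparr>carrier = cauchy_seqs G R // null_rel G R,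
     mult = (\<lambda>X Y. \<Union>s\<in>X. \<Union>t\<in>Y. null_rel G R `` {\<lambda>n. s n * t n}),
     one = undefined,
     zero = null_rel G R `` {\<lambda>n. 0},
     add = (\<lambda>X Y. \<Union>s\<in>X. \<Union>t\<in>Y. null_rel G R `` {\<lambda>n. s n + t n}),
     smult = (\<lambda>c X. \<Union>s\<in>X. null_rel G R `` {\<lambda>n. poly_scale c (s n)}),
     adj = (\<lambda>X. \<Union>s\<in>X. null_rel G R `` {\<lambda>n. poly_adj (s n)}),
     cnorm = (\<lambda>X. lim (\<lambda>n. universal_seminorm G R ((SOME s. s \<in> X) n)))\<rparr>"

definition universal_gen :: "'g set \<Rightarrow> 'g star_poly set \<Rightarrow> 'g \<Rightarrow> (nat \<Rightarrow> 'g star_poly) set" where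
  "universal_gen G R g = null_rel G R `` {\<lambda>n. gen g}"


section \<open>Graph C*-algebras\<close>

text \<open>In \<^typ>\<open>('v, 'e) pre_digraph\<close>, \<^const>\<open>tail\<close> is the source map and \<^const>\<open>head\<close> the range map.\<close>

definition directed_graph :: "('v, 'e) pre_digraph \<Rightarrow> bool" where
  "directed_graph E \<longleftrightarrow> wf_digraph E \<and> countable (verts E) \<and> countable (arcs E)"

definition sinks :: "('v, 'e) pre_digraph \<Rightarrow> 'v set" where
  "sinks E = {v \<in> verts E. out_arcs E v = {}}"

abbreviation (input) pgen :: "'v \<Rightarrow> ('v + 'e) star_poly" where
  "pgen v \<equiv> gen (Inl v)"

abbreviation (input) sgen :: "'e \<Rightarrow> ('v + 'e) star_poly" where
  "sgen e \<equiv> gen (Inr e)"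

text \<open>The first four families say that the \<open>P\<^sub>v\<close> are mutually orthogonal projections and the \<open>S\<^sub>e\<close>
  partial isometries; the last three are (GA1), (GA2), (GA3). For projections, \<open>p \<le> q\<close> is
  the equation \<open>q p = p\<close>.\<close>

definition graph_relations :: "('v, 'e) pre_digraph \<Rightarrow> ('v + 'e) star_poly set" where
  "graph_relations E =
     {poly_adj (pgen v) - pgen v | v. v \<in> verts E} \<union>
     {pgen v * pgen v - pgen v | v. v \<in> verts E} \<union>
     {pgen v * pgen w | v w. v \<in> verts E \<and> w \<in> verts E \<and> v \<noteq> w} \<union>
     {sgen e * poly_adj (sgen e) * sgen e - sgen e | e. e \<in> arcs E} \<union>
     {poly_adj (sgen e) * sgen f - (if e = f then pgen (head E e) else 0) | e f.
        e \<in> arcs E \<and> f \<in> arcs E} \<union>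
     {(\<Sum>e\<in>out_arcs E v. sgen e * poly_adj (sgen e)) - pgen v | v.
        v \<in> verts E \<and> finite (out_arcs E v) \<and> out_arcs E v \<noteq> {}} \<union>
     {pgen (tail E e) * (sgen e * poly_adj (sgen e)) - sgen e * poly_adj (sgen e) | e. e \<in> arcs E}"

definition graph_cstar ::
  "('v, 'e) pre_digraph \<Rightarrow> (nat \<Rightarrow> ('v + 'e) star_poly) set cstar" where
  "graph_cstar E = universal_cstar (verts E <+> arcs E) (graph_relations E)"

definition vproj :: "('v, 'e) pre_digraph \<Rightarrow> 'v \<Rightarrow> (nat \<Rightarrow> ('v + 'e) star_poly) set" where
  "vproj E v = universal_gen (verts E <+> arcs E) (graph_relations E) (Inl v)"

definition eiso :: "('v, 'e) pre_digraph \<Rightarrow> 'e \<Rightarrow> (nat \<Rightarrow> ('v + 'e) star_poly) set" where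
  "eiso E e = universal_gen (verts E <+> arcs E) (graph_relations E) (Inr e)"

text \<open>Paths are the arc walks of \<^theory>\<open>Graph_Theory.Arc_Walk\<close>. \<open>path_iso E u p\<close> is the partial
  isometry of the path \<open>p\<close> with source \<open>u\<close>; the source only matters for the path of length zero at \<open>u\<close>.\<close>

fun path_iso :: "('v, 'e) pre_digraph \<Rightarrow> 'v \<Rightarrow> 'e awalk \<Rightarrow> (nat \<Rightarrow> ('v + 'e) star_poly) set" where
  "path_iso E u [] = vproj E u"
| "path_iso E u [e] = eiso E e"
| "path_iso E u (e # f # p) = eiso E e \<otimes>\<^bsub>graph_cstar E\<^esub> path_iso E (head E e) (f # p)"

text \<open>The *-homomorphisms that relabel generators.\<close>

definition label_homs ::
  "('v, 'e) pre_digraph \<Rightarrow> ('w, 'f) pre_digraph \<Rightarrow> ('v \<Rightarrow> 'w) \<Rightarrow> ('e \<Rightarrow> 'f) \<Rightarrow>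
   ((nat \<Rightarrow> ('v + 'e) star_poly) set \<Rightarrow> (nat \<Rightarrow> ('w + 'f) star_poly) set) set" where
  "label_homs E F fv fe = {h \<in> star_homs (graph_cstar E) (graph_cstar F).
     (\<forall>v\<in>verts E. h (vproj E v) = vproj F (fv v)) \<and>
     (\<forall>e\<in>arcs E. h (eiso E e) = eiso F (fe e))}"


section \<open>Pushouts of graphs along vertices\<close>

text \<open>The equivalence relation on \<open>E\<^sup>0 \<squnion> H\<^sup>0\<close> generated by identifying \<open>\<iota>E x\<close> with \<open>\<iota>H x\<close>
  for \<open>x \<in> X\<close>.\<close>

definition glue_rel ::
  "('v, 'e) pre_digraph \<Rightarrow> ('w, 'f) pre_digraph \<Rightarrow> 'x set \<Rightarrow> ('x \<Rightarrow> 'v) \<Rightarrow> ('x \<Rightarrow> 'w) \<Rightarrow>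
   (('v + 'w) \<times> ('v + 'w)) set" where
  "glue_rel E H X \<iota>E \<iota>H =
     (let r = {(Inl (\<iota>E x), Inr (\<iota>H x)) | x. x \<in> X}
      in Restr ((r \<union> r\<inverse>)\<^sup>*) (verts E <+> verts H))"

definition glue_class ::
  "('v, 'e) pre_digraph \<Rightarrow> ('w, 'f) pre_digraph \<Rightarrow> 'x set \<Rightarrow> ('x \<Rightarrow> 'v) \<Rightarrow> ('x \<Rightarrow> 'w) \<Rightarrow>
   'v + 'w \<Rightarrow> ('v + 'w) set" where
  "glue_class E H X \<iota>E \<iota>H v = glue_rel E H X \<iota>E \<iota>H `` {v}"

definition pushout_graph ::
  "('v, 'e) pre_digraph \<Rightarrow> ('w, 'f) pre_digraph \<Rightarrow> 'x set \<Rightarrow> ('x \<Rightarrow> 'v) \<Rightarrow> ('x \<Rightarrow> 'w) \<Rightarrow>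
   (('v + 'w) set, 'e + 'f) pre_digraph" where
  "pushout_graph E H X \<iota>E \<iota>H =
    \<lparr>verts = (verts E <+> verts H) // glue_rel E H X \<iota>E \<iota>H,
     arcs = arcs E <+> arcs H,
     tail = glue_class E H X \<iota>E \<iota>H \<circ> map_sum (tail E) (tail H),
     head = glue_class E H X \<iota>E \<iota>H \<circ> map_sum (head E) (head H)\<rparr>"

definition pushout_left_homs where
  "pushout_left_homs E H X \<iota>E \<iota>H =
     label_homs E (pushout_graph E H X \<iota>E \<iota>H) (glue_class E H X \<iota>E \<iota>H \<circ> Inl) Inl"

definition pushout_right_homs where
  "pushout_right_homs E H X \<iota>E \<iota>H =
     label_homs H (pushout_graph E H X \<iota>E \<iota>H) (glue_class E H X \<iota>E \<iota>H \<circ> Inr) Inr"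

text \<open>The *-homomorphisms \<open>h : C*(E \<squnion>\<^sub>X H) \<rightarrow> D\<close> with \<open>h \<circ> jE = f\<close> and \<open>h \<circ> jH = g\<close>, where
  \<open>jE\<close> and \<open>jH\<close> are maps from \<open>C*(E)\<close> and \<open>C*(H)\<close> to \<open>C*(E \<squnion>\<^sub>X H)\<close>.\<close>

definition induced_homs where
  "induced_homs E H X \<iota>E \<iota>H D jE jH f g =
     {h \<in> star_homs (graph_cstar (pushout_graph E H X \<iota>E \<iota>H)) D.
        compose (carrier (graph_cstar E)) h jE = f \<and> compose (carrier (graph_cstar H)) h jH = g}"

end

theory Submission
  imports Defs
begin

text \<open>
  Write \<open>C\<^sub>i\<close> for the algebra of \<open>E\<^sub>i\<close>, write \<open>D\<^sub>i\<close> for the algebra of the glued graph, \<open>I\<^sub>i\<close> for the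
  closed ideal of \<open>C\<^sub>i\<close> generated by the projections of the sinks \<open>\<iota>\<^sub>i x\<close>, and \<open>J\<^sub>i\<close> for the closed ideal of
  \<open>D\<^sub>i\<close> generated by the vertex projections of \<open>H\<close>. The proof rests on three facts.

  \<^item> \<open>D\<^sub>i = jE\<^sub>i C\<^sub>i + J\<^sub>i\<close>, and an element of \<open>C\<^sub>i\<close> whose image lies in \<open>J\<^sub>i\<close> belongs to \<open>I\<^sub>i\<close> (lemmas
    \<open>decompose\<close> and \<open>ideal_detect\<close>). The maps \<open>\<delta>'\<close> and \<open>\<theta>'\<close> kill \<open>J\<^sub>1\<close> and \<open>J\<^sub>2\<close>, hence they only see the first
    summand.
  \<^item> \<open>\<phi>\<close> maps \<open>I\<^sub>1\<close> onto \<open>I\<^sub>2\<close>. Indeed \<open>\<theta>\<close> kills \<open>I\<^sub>2\<close>, so that the pullback property puts \<open>(0, c)\<close> into the range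
    of \<open>(\<delta>, \<phi>)\<close> for every \<open>c\<close> in \<open>I\<^sub>2\<close>; that the preimage lies in \<open>I\<^sub>1\<close> follows with an approximate unit of
    \<open>I\<^sub>1\<close> (lemma \<open>lift_ideal\<close>).
  \<^item> \<open>\<psi>\<close> maps \<open>J\<^sub>1\<close> isometrically onto \<open>J\<^sub>2\<close> (lemmas \<open>psi_isometric\<close> and \<open>psi_onto\<close>).

  Given these facts, the pullback property of the square of the \<open>D\<^sub>i\<close> follows by a diagram chase from that of
  the square of the \<open>C\<^sub>i\<close>.

  The third fact is the heart of the matter, and it is obtained without any uniqueness theorem for graph
  algebras. Let \<open>h = jE\<^sub>1 \<circ> \<phi>\<^sup>-\<^sup>1\<close> on \<open>I\<^sub>2\<close>. The ideal \<open>J\<^sub>1\<close> is the closed span of the products \<open>h x y\<close> and of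
  the elements \<open>P\<^sub>w y\<close> for the vertices \<open>w\<close> of \<open>H\<close> outside \<open>\<iota>H X\<close>, which \<open>h I\<^sub>2\<close> annihilates. Therefore \<open>h\<close>
  extends to an action of all of \<open>C\<^sub>2\<close> on \<open>J\<^sub>1\<close> by adjointable operators, \<open>c \<cdot> h x y = h (c x) y\<close>. Together
  with the multiplication by elements of the algebra of \<open>H\<close> it defines, by the universal property of \<open>D\<^sub>2\<close>,
  a homomorphism from \<open>D\<^sub>2\<close> to the adjointable operators on \<open>J\<^sub>1\<close> whose composition with \<open>\<psi>\<close> is the left
  multiplication of \<open>D\<^sub>1\<close> on \<open>J\<^sub>1\<close>. The C*-identity for \<open>z z\<^sup>*\<close> shows that left multiplication is isometric
  on \<open>J\<^sub>1\<close>; as homomorphisms are contractive, so is \<open>\<psi>\<close>. Hence \<open>\<psi> J\<^sub>1\<close> is closed, and by the same action it is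
  an ideal of \<open>D\<^sub>2\<close>, which contains the generators of \<open>J\<^sub>2\<close>.

  What the argument needs of the general theory is developed along the way: homomorphisms of
  C*-algebras are contractive (proved with a square root obtained by iteration, instead of spectral theory);
  the completed free *-algebra is a C*-algebra with the expected universal property; and the ideal generated
  by sinks is spanned by the products \<open>S\<^sub>\<alpha> S\<^sub>\<beta>\<^sup>*\<close> of paths that end in them, so that it has an
  approximate unit of projections, by which norms in the quotient can be computed.
\<close>

section \<open>Norm limits in C*-algebras\<close>

text \<open>Convergence includes membership of the whole sequence and of the limit in the carrier, so that a
  single hypothesis suffices for all limit arguments.\<close>

definition conv :: "('a, 'm) cstar_scheme \<Rightarrow> (nat \<Rightarrow> 'a) \<Rightarrow> 'a \<Rightarrow> bool" where
  "conv A s x \<longleftrightarrow> (\<forall>n. s n \<in> carrier A) \<and> x \<in> carrier A \<and>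
     (\<lambda>n. \<parallel>s n \<ominus>\<^bsub>A\<^esub> x\<parallel>\<^bsub>A\<^esub>) \<longlonglongrightarrow> 0"

lemma complex_ring_simps [simp]:
  "carrier complex_ring = UNIV" "x \<otimes>\<^bsub>complex_ring\<^esub> y = x * y" "\<one>\<^bsub>complex_ring\<^esub> = 1"
  "\<zero>\<^bsub>complex_ring\<^esub> = 0" "x \<oplus>\<^bsub>complex_ring\<^esub> y = x + y"
  by (simp_all add: complex_ring_def)

context cstar_algebra
begin

lemmas [simp, intro] = mult_closed adj_closed
lemmas [simp] = adj_adj

lemma sc_closed [simp, intro]: "x \<in> carrier A \<Longrightarrow> c \<odot> x \<in> carrier A"
  by (rule smult_closed) simp_all

lemma sc_add_left: "x \<in> carrier A \<Longrightarrow> (c + d) \<odot> x = c \<odot> x \<oplus> d \<odot> x"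
  using smult_l_distr[of c d x] by simp

lemma sc_add_right: "x \<in> carrier A \<Longrightarrow> y \<in> carrier A \<Longrightarrow> c \<odot> (x \<oplus> y) = c \<odot> x \<oplus> c \<odot> y"
  using smult_r_distr[of c x y] by simp

lemma sc_sc [simp]: "x \<in> carrier A \<Longrightarrow> c \<odot> (d \<odot> x) = (c * d) \<odot> x"
  using smult_assoc1[of c d x] by simp

lemma sc_one [simp]: "x \<in> carrier A \<Longrightarrow> 1 \<odot> x = x"
  using smult_one[of x] by simp

lemma sc_zero_left [simp]: "x \<in> carrier A \<Longrightarrow> 0 \<odot> x = \<zero>"
  using smult_l_null[of x] by simp

lemma sc_zero_right [simp]: "c \<odot> \<zero> = \<zero>"
  using smult_r_null[of c] by simp

lemma minus_sc: "x \<in> carrier A \<Longrightarrow> \<ominus> x = (- 1) \<odot> x"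
proof -
  assume x: "x \<in> carrier A"
  have "(1 + - 1) \<odot> x = 1 \<odot> x \<oplus> (- 1) \<odot> x" by (rule sc_add_left[OF x])
  then have "(- 1) \<odot> x \<oplus> x = \<zero>" using x by (simp add: M.a_comm)
  then show ?thesis using x by (metis M.minus_equality sc_closed)
qed

lemma diff_sc: "x \<in> carrier A \<Longrightarrow> y \<in> carrier A \<Longrightarrow> x \<ominus> y = x \<oplus> (- 1) \<odot> y"
  by (simp add: M.minus_eq minus_sc)

lemma sc_diff_right: "x \<in> carrier A \<Longrightarrow> y \<in> carrier A \<Longrightarrow> c \<odot> (x \<ominus> y) = c \<odot> x \<ominus> c \<odot> y"
  by (simp add: diff_sc sc_add_right)

lemma mult_zero_left [simp]: "x \<in> carrier A \<Longrightarrow> \<zero> \<otimes> x = \<zero>"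
  using smult_mult_left[of \<zero> x 0] by simp

lemma mult_zero_right [simp]: "x \<in> carrier A \<Longrightarrow> x \<otimes> \<zero> = \<zero>"
  using smult_mult_right[of x \<zero> 0] by simp

lemma adj_zero [simp]: "\<zero>\<^sup>\<star> = \<zero>"
  using adj_smult[of \<zero> 0] by simp

lemma mult_diff_left: "x \<in> carrier A \<Longrightarrow> y \<in> carrier A \<Longrightarrow> z \<in> carrier A \<Longrightarrow>
    (x \<ominus> y) \<otimes> z = x \<otimes> z \<ominus> y \<otimes> z"
  by (simp add: diff_sc mult_distrib_right smult_mult_left)

lemma mult_diff_right: "x \<in> carrier A \<Longrightarrow> y \<in> carrier A \<Longrightarrow> z \<in> carrier A \<Longrightarrow>
    z \<otimes> (x \<ominus> y) = z \<otimes> x \<ominus> z \<otimes> y"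
  by (simp add: diff_sc mult_distrib_left smult_mult_right)

lemma adj_diff: "x \<in> carrier A \<Longrightarrow> y \<in> carrier A \<Longrightarrow> (x \<ominus> y)\<^sup>\<star> = x\<^sup>\<star> \<ominus> y\<^sup>\<star>"
  by (simp add: diff_sc adj_add adj_smult)

lemma diff_self [simp]: "x \<in> carrier A \<Longrightarrow> x \<ominus> x = \<zero>"
  by (simp add: M.minus_eq M.r_neg)

lemma diff_zero [simp]: "x \<in> carrier A \<Longrightarrow> x \<ominus> \<zero> = x"
  by (simp add: M.minus_eq)

lemma zero_diff: "x \<in> carrier A \<Longrightarrow> \<zero> \<ominus> x = (- 1) \<odot> x"
  by (simp add: diff_sc)

lemma diff_add_cancel: "x \<in> carrier A \<Longrightarrow> y \<in> carrier A \<Longrightarrow> (x \<ominus> y) \<oplus> y = x"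
  by (simp add: M.minus_eq M.a_assoc M.l_neg)

lemma add_diff_cancel: "x \<in> carrier A \<Longrightarrow> y \<in> carrier A \<Longrightarrow> (x \<oplus> y) \<ominus> y = x"
  by (simp add: M.minus_eq M.a_assoc M.r_neg)

lemma diff_eq_zero: "x \<in> carrier A \<Longrightarrow> y \<in> carrier A \<Longrightarrow> x \<ominus> y = \<zero> \<longleftrightarrow> x = y"
  using diff_add_cancel[of x y] by auto

lemma add_diff_add: "\<lbrakk>x \<in> carrier A; y \<in> carrier A; z \<in> carrier A; w \<in> carrier A\<rbrakk> \<Longrightarrow>
    (x \<oplus> y) \<ominus> (z \<oplus> w) = (x \<ominus> z) \<oplus> (y \<ominus> w)"
  by (simp add: M.minus_eq M.minus_add M.a_ac)

text \<open>The telescoping step behind the estimates of differences of products.\<close>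

lemma diff_split: "\<lbrakk>x \<in> carrier A; y \<in> carrier A; z \<in> carrier A\<rbrakk> \<Longrightarrow>
    x \<ominus> z = (x \<ominus> y) \<oplus> (y \<ominus> z)"
  by (simp add: M.minus_eq M.a_assoc M.r_neg1)

lemma norm_zero [simp]: "\<parallel>\<zero>\<parallel> = 0"
  using cnorm_eq_zero by simp

lemma norm_sc: "x \<in> carrier A \<Longrightarrow> \<parallel>c \<odot> x\<parallel> = cmod c * \<parallel>x\<parallel>"
  by (rule cnorm_smult)

lemma norm_uminus [simp]: "x \<in> carrier A \<Longrightarrow> \<parallel>\<ominus> x\<parallel> = \<parallel>x\<parallel>"
  by (simp add: minus_sc norm_sc)

lemma norm_nonneg [simp]: "x \<in> carrier A \<Longrightarrow> 0 \<le> \<parallel>x\<parallel>"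
  using cnorm_add[of x "\<ominus> x"] by (simp add: M.r_neg)

lemma norm_diff_le: "x \<in> carrier A \<Longrightarrow> y \<in> carrier A \<Longrightarrow> \<parallel>x \<ominus> y\<parallel> \<le> \<parallel>x\<parallel> + \<parallel>y\<parallel>"
  using cnorm_add[of x "\<ominus> y"] by (simp add: M.minus_eq)

lemma norm_diff_comm: "x \<in> carrier A \<Longrightarrow> y \<in> carrier A \<Longrightarrow> \<parallel>x \<ominus> y\<parallel> = \<parallel>y \<ominus> x\<parallel>"
proof -
  assume "x \<in> carrier A" "y \<in> carrier A"
  then have "y \<ominus> x = \<ominus> (x \<ominus> y)" by (simp add: M.minus_eq M.minus_add M.a_ac)
  then show ?thesis using \<open>x \<in> carrier A\<close> \<open>y \<in> carrier A\<close> by simp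
qed

lemma norm_triangle: "\<lbrakk>x \<in> carrier A; y \<in> carrier A; z \<in> carrier A\<rbrakk> \<Longrightarrow>
    \<parallel>x \<ominus> z\<parallel> \<le> \<parallel>x \<ominus> y\<parallel> + \<parallel>y \<ominus> z\<parallel>"
  using cnorm_add[of "x \<ominus> y" "y \<ominus> z"] diff_split[of x y z] by simp

lemma norm_diff_bound: "\<lbrakk>x \<in> carrier A; y \<in> carrier A\<rbrakk> \<Longrightarrow> \<bar>\<parallel>x\<parallel> - \<parallel>y\<parallel>\<bar> \<le> \<parallel>x \<ominus> y\<parallel>"
  using norm_triangle[of x y \<zero>] norm_triangle[of y x \<zero>] norm_diff_comm[of x y] by simp

lemma norm_adj [simp]: "x \<in> carrier A \<Longrightarrow> \<parallel>x\<^sup>\<star>\<parallel> = \<parallel>x\<parallel>"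
proof -
  have le: "\<parallel>x\<parallel> \<le> \<parallel>x\<^sup>\<star>\<parallel>" if x: "x \<in> carrier A" for x
  proof (cases "\<parallel>x\<parallel> = 0")
    case False
    then have "0 < \<parallel>x\<parallel>" using norm_nonneg[OF x] by simp
    moreover have "\<parallel>x\<parallel> * \<parallel>x\<parallel> \<le> \<parallel>x\<^sup>\<star>\<parallel> * \<parallel>x\<parallel>"
      using cstar_identity[OF x] cnorm_mult[of "x\<^sup>\<star>" x] x by (simp add: power2_eq_square)
    ultimately show ?thesis by simp
  qed (use x in simp)
  assume "x \<in> carrier A"
  then show ?thesis using le[of x] le[of "x\<^sup>\<star>"] by (simp add: antisym)
qed

lemma cstar_zero: "x \<in> carrier A \<Longrightarrow> x\<^sup>\<star> \<otimes> x = \<zero> \<Longrightarrow> x = \<zero>"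
  using cstar_identity[of x] cnorm_eq_zero[of x] by simp

lemma convD: "conv A s x \<Longrightarrow> s n \<in> carrier A" "conv A s x \<Longrightarrow> x \<in> carrier A"
    "conv A s x \<Longrightarrow> (\<lambda>n. \<parallel>s n \<ominus> x\<parallel>) \<longlonglongrightarrow> 0"
  by (auto simp: conv_def)

lemma conv_bound:
  assumes "\<And>n. s n \<in> carrier A" "x \<in> carrier A" "\<And>n. \<parallel>s n \<ominus> x\<parallel> \<le> f n" "f \<longlonglongrightarrow> 0"
  shows "conv A s x"
  unfolding conv_def
proof (intro conjI allI)
  show "(\<lambda>n. \<parallel>s n \<ominus> x\<parallel>) \<longlonglongrightarrow> 0"
    by (rule tendsto_sandwich[OF _ _ tendsto_const assms(4)]) (simp_all add: assms(1-3))
qed (use assms(1,2) in blast)+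

lemma conv_const [simp]: "x \<in> carrier A \<Longrightarrow> conv A (\<lambda>n. x) x"
  by (auto simp: conv_def)

lemma conv_add: assumes "conv A s x" "conv A t y" shows "conv A (\<lambda>n. s n \<oplus> t n) (x \<oplus> y)"
proof (rule conv_bound)
  show "\<parallel>(s n \<oplus> t n) \<ominus> (x \<oplus> y)\<parallel> \<le> \<parallel>s n \<ominus> x\<parallel> + \<parallel>t n \<ominus> y\<parallel>" for n
    using assms[THEN convD(1), of n] assms[THEN convD(2)] cnorm_add[of "s n \<ominus> x" "t n \<ominus> y"]
    by (simp add: add_diff_add)
  show "(\<lambda>n. \<parallel>s n \<ominus> x\<parallel> + \<parallel>t n \<ominus> y\<parallel>) \<longlonglongrightarrow> 0"
    using tendsto_add[OF assms[THEN convD(3)]] by simp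
qed (simp_all add: assms[THEN convD(1)] assms[THEN convD(2)])

lemma conv_sc: assumes "conv A s x" shows "conv A (\<lambda>n. c \<odot> s n) (c \<odot> x)"
proof (rule conv_bound)
  show "\<parallel>c \<odot> s n \<ominus> c \<odot> x\<parallel> \<le> cmod c * \<parallel>s n \<ominus> x\<parallel>" for n
    using convD(1)[OF assms, of n] convD(2)[OF assms] by (simp flip: sc_diff_right add: norm_sc)
  show "(\<lambda>n. cmod c * \<parallel>s n \<ominus> x\<parallel>) \<longlonglongrightarrow> 0"
    using tendsto_mult_left[OF convD(3)[OF assms], of "cmod c"] by simp
qed (simp_all add: convD(1,2)[OF assms])

lemma conv_diff: "conv A s x \<Longrightarrow> conv A t y \<Longrightarrow> conv A (\<lambda>n. s n \<ominus> t n) (x \<ominus> y)"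
  using conv_add[of s x "\<lambda>n. (-1) \<odot> t n" "(-1) \<odot> y"] conv_sc[of t y "-1"]
  by (simp add: diff_sc convD(1,2))

lemma conv_adj: assumes "conv A s x" shows "conv A (\<lambda>n. (s n)\<^sup>\<star>) (x\<^sup>\<star>)"
proof (rule conv_bound)
  show "\<parallel>(s n)\<^sup>\<star> \<ominus> x\<^sup>\<star>\<parallel> \<le> \<parallel>s n \<ominus> x\<parallel>" for n
    using convD(1)[OF assms, of n] convD(2)[OF assms] by (simp flip: adj_diff)
qed (simp_all add: convD[OF assms])

lemma conv_norm: assumes "conv A s x" shows "(\<lambda>n. \<parallel>s n\<parallel>) \<longlonglongrightarrow> \<parallel>x\<parallel>"
proof -
  have "(\<lambda>n. \<parallel>s n\<parallel> - \<parallel>x\<parallel>) \<longlonglongrightarrow> 0"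
    by (rule tendsto_rabs_zero_cancel, rule tendsto_sandwich[OF _ _ tendsto_const convD(3)[OF assms]])
      (use norm_diff_bound convD(1,2)[OF assms] in auto)
  then show ?thesis by (simp add: LIM_zero_iff)
qed

lemma conv_mult: assumes "conv A s x" "conv A t y" shows "conv A (\<lambda>n. s n \<otimes> t n) (x \<otimes> y)"
proof (rule conv_bound)
  note [simp] = assms[THEN convD(1)] assms[THEN convD(2)]
  show "\<parallel>s n \<otimes> t n \<ominus> x \<otimes> y\<parallel> \<le> \<parallel>s n \<ominus> x\<parallel> * \<parallel>t n\<parallel> + \<parallel>x\<parallel> * \<parallel>t n \<ominus> y\<parallel>" for n
  proof -
    have "\<parallel>s n \<otimes> t n \<ominus> x \<otimes> y\<parallel> \<le> \<parallel>(s n \<ominus> x) \<otimes> t n\<parallel> + \<parallel>x \<otimes> (t n \<ominus> y)\<parallel>"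
      using norm_triangle[of "s n \<otimes> t n" "x \<otimes> t n" "x \<otimes> y"] by (simp add: mult_diff_left mult_diff_right)
    then show ?thesis
      using cnorm_mult[of "s n \<ominus> x" "t n"] cnorm_mult[of x "t n \<ominus> y"] by simp
  qed
  have "(\<lambda>n. \<parallel>s n \<ominus> x\<parallel> * \<parallel>t n\<parallel> + \<parallel>x\<parallel> * \<parallel>t n \<ominus> y\<parallel>) \<longlonglongrightarrow> 0 * \<parallel>y\<parallel> + \<parallel>x\<parallel> * 0"
    by (rule tendsto_add[OF tendsto_mult[OF convD(3)[OF assms(1)] conv_norm[OF assms(2)]]
        tendsto_mult[OF tendsto_const convD(3)[OF assms(2)]]])
  then show "(\<lambda>n. \<parallel>s n \<ominus> x\<parallel> * \<parallel>t n\<parallel> + \<parallel>x\<parallel> * \<parallel>t n \<ominus> y\<parallel>) \<longlonglongrightarrow> 0" by simp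
qed (simp_all add: assms[THEN convD(1)] assms[THEN convD(2)])

lemma conv_unique: assumes "conv A s x" "conv A s y" shows "x = y"
proof -
  have "conv A (\<lambda>n. s n \<ominus> s n) (x \<ominus> y)" by (rule conv_diff[OF assms])
  from conv_norm[OF this] have "\<parallel>x \<ominus> y\<parallel> = 0"
    using assms(1)[THEN convD(1)] by (simp add: LIMSEQ_const_iff)
  then show ?thesis using assms[THEN convD(2)] by (simp add: cnorm_eq_zero diff_eq_zero)
qed

lemma conv_norm_le:
  assumes "conv A s x" "\<And>n. \<parallel>s n\<parallel> \<le> C" shows "\<parallel>x\<parallel> \<le> C"
  using LIMSEQ_le_const2[OF conv_norm[OF assms(1)]] assms(2) by blast

lemma conv_subseq: "conv A s x \<Longrightarrow> strict_mono f \<Longrightarrow> conv A (\<lambda>n. s (f n)) x"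
  using LIMSEQ_subseq_LIMSEQ[of "\<lambda>n. \<parallel>s n \<ominus> x\<parallel>" 0 f] by (auto simp: conv_def o_def)

lemma conv_shift: "conv A s x \<Longrightarrow> conv A (\<lambda>n. s (Suc n)) x"
  by (erule conv_subseq) (simp add: strict_mono_Suc_iff)

lemma conv_eventually:
  assumes "\<And>n. s n \<in> carrier A" "x \<in> carrier A" "\<And>n. n \<ge> N \<Longrightarrow> s n = x"
  shows "conv A s x"
  unfolding conv_def using assms
  by (auto intro!: tendsto_eventually eventually_sequentiallyI[of N])

lemma Cauchy_conv:
  assumes "\<And>n. s n \<in> carrier A"
    and "\<And>e. e > 0 \<Longrightarrow> \<exists>N. \<forall>m\<ge>N. \<forall>n\<ge>N. \<parallel>s m \<ominus> s n\<parallel> < e"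
  obtains x where "conv A s x"
proof -
  have "range s \<subseteq> carrier A" using assms(1) by blast
  from complete[OF this assms(2)] obtain x where "x \<in> carrier A" "(\<lambda>n. \<parallel>s n \<ominus> x\<parallel>) \<longlonglongrightarrow> 0" by blast
  then show ?thesis using that assms(1) by (simp add: conv_def)
qed

lemma conv_Cauchy:
  assumes "conv A s x" "e > 0"
  shows "\<exists>N. \<forall>m\<ge>N. \<forall>n\<ge>N. \<parallel>s m \<ominus> s n\<parallel> < e"
proof -
  note [simp] = convD(1,2)[OF assms(1)]
  have "0 < e / 2" using assms(2) by simp
  from LIMSEQ_D[OF convD(3)[OF assms(1)] this] obtain N where N: "\<And>n. n \<ge> N \<Longrightarrow> \<parallel>s n \<ominus> x\<parallel> < e / 2"
    by auto
  have "\<parallel>s m \<ominus> s n\<parallel> < e" if "m \<ge> N" "n \<ge> N" for m n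
    using norm_triangle[of "s m" x "s n"] norm_diff_comm[of x "s n"] N[OF that(1)] N[OF that(2)]
    by simp
  then show ?thesis by blast
qed

lemma geometric_conv:
  assumes s: "\<And>n. s n \<in> carrier A" and r: "0 \<le> r" "r < 1"
    and d: "\<And>n. \<parallel>s (Suc n) \<ominus> s n\<parallel> \<le> C * r ^ n"
  obtains x where "conv A s x"
proof -
  have C: "0 \<le> C" using order_trans[OF norm_nonneg[OF M.minus_closed[OF s s]] d[of 0]] by simp
  have tail: "\<parallel>s (n + k) \<ominus> s n\<parallel> \<le> C * r ^ n / (1 - r)" for n k
  proof -
    have "\<parallel>s (n + k) \<ominus> s n\<parallel> \<le> C * r ^ n * (\<Sum>i<k. r ^ i)"
    proof (induction k)
      case (Suc k)
      have "\<parallel>s (n + Suc k) \<ominus> s n\<parallel> \<le> \<parallel>s (Suc (n + k)) \<ominus> s (n + k)\<parallel> + \<parallel>s (n + k) \<ominus> s n\<parallel>"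
        using norm_triangle[of "s (Suc (n + k))" "s (n + k)" "s n"] s by simp
      also have "\<dots> \<le> C * r ^ (n + k) + C * r ^ n * (\<Sum>i<k. r ^ i)" using Suc d by (intro add_mono)
      finally show ?case by (simp add: algebra_simps power_add)
    qed (use s in simp)
    also have "\<dots> \<le> C * r ^ n * (1 / (1 - r))"
    proof (rule mult_left_mono)
      show "(\<Sum>i<k. r ^ i) \<le> 1 / (1 - r)"
        using r by (simp add: sum_gp_strict divide_right_mono)
    qed (use C r in simp)
    finally show ?thesis by simp
  qed
  have lim: "(\<lambda>n. C * r ^ n / (1 - r)) \<longlonglongrightarrow> 0"
    using tendsto_divide_zero[OF tendsto_mult_right_zero[OF LIMSEQ_realpow_zero[OF r]]] by simp
  have "\<exists>N. \<forall>m\<ge>N. \<forall>n\<ge>N. \<parallel>s m \<ominus> s n\<parallel> < e" if "e > 0" for e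
  proof -
    have "0 < e / 2" using that by simp
    from LIMSEQ_D[OF lim this] obtain N where "norm (C * r ^ N / (1 - r) - 0) < e / 2" by blast
    then have N: "\<bar>C * r ^ N / (1 - r)\<bar> < e / 2" unfolding real_norm_def diff_0_right .
    have b: "\<parallel>s m \<ominus> s N\<parallel> < e / 2" if "m \<ge> N" for m
      using tail[of N "m - N"] N that abs_ge_self[of "C * r ^ N / (1 - r)"] by (simp del: abs_divide abs_mult)
    have "\<parallel>s m \<ominus> s n\<parallel> < e" if "m \<ge> N" "n \<ge> N" for m n
      using norm_triangle[of "s m" "s N" "s n"] norm_diff_comm[of "s N" "s n"] b[OF that(1)] b[OF that(2)] s
      by simp
    then show ?thesis by blast
  qed
  then show ?thesis using Cauchy_conv[of s, OF s] that by blast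
qed

end

section \<open>Homomorphisms are contractive\<close>

definition closed_star_subalgebra :: "('a, 'm) cstar_scheme \<Rightarrow> 'a set \<Rightarrow> bool" where
  "closed_star_subalgebra A S \<longleftrightarrow> S \<subseteq> carrier A \<and> \<zero>\<^bsub>A\<^esub> \<in> S \<and>
     (\<forall>x\<in>S. \<forall>y\<in>S. x \<oplus>\<^bsub>A\<^esub> y \<in> S) \<and> (\<forall>c. \<forall>x\<in>S. c \<odot>\<^bsub>A\<^esub> x \<in> S) \<and>
     (\<forall>x\<in>S. \<forall>y\<in>S. x \<otimes>\<^bsub>A\<^esub> y \<in> S) \<and> (\<forall>x\<in>S. x\<^sup>\<star>\<^bsub>A\<^esub> \<in> S) \<and>
     (\<forall>s x. (\<forall>n. s n \<in> S) \<longrightarrow> conv A s x \<longrightarrow> x \<in> S)"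

text \<open>Homomorphisms given on a closed subalgebra only: the inverse of \<open>\<phi>\<close> will be one,
  without an ambient algebra of its own.\<close>

definition star_hom_on :: "'a set \<Rightarrow> ('a, 'm) cstar_scheme \<Rightarrow> ('b, 'n) cstar_scheme \<Rightarrow> ('a \<Rightarrow> 'b) \<Rightarrow> bool"
  where
  "star_hom_on S A B h \<longleftrightarrow> (\<forall>x\<in>S. h x \<in> carrier B) \<and>
     (\<forall>x\<in>S. \<forall>y\<in>S. h (x \<oplus>\<^bsub>A\<^esub> y) = h x \<oplus>\<^bsub>B\<^esub> h y) \<and>
     (\<forall>c. \<forall>x\<in>S. h (c \<odot>\<^bsub>A\<^esub> x) = c \<odot>\<^bsub>B\<^esub> h x) \<and>
     (\<forall>x\<in>S. \<forall>y\<in>S. h (x \<otimes>\<^bsub>A\<^esub> y) = h x \<otimes>\<^bsub>B\<^esub> h y) \<and>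
     (\<forall>x\<in>S. h (x\<^sup>\<star>\<^bsub>A\<^esub>) = (h x)\<^sup>\<star>\<^bsub>B\<^esub>)"

context cstar_algebra
begin

lemma closed_star_subalgebra_carrier: "closed_star_subalgebra A (carrier A)"
  by (auto simp: closed_star_subalgebra_def convD)

text \<open>In the unitization, \<open>1 - y\<close> is the square root of \<open>1 - a\<^sup>2\<close>: the
  equation for \<open>y\<close> says \<open>(1 - y)\<^sup>2 = 1 - a\<^sup>2\<close>. It is solved by the
  iteration \<open>y \<mapsto> (a\<^sup>2 + y\<^sup>2) / 2\<close>, which stays in the subalgebra and commutes
  with everything that commutes with \<open>a\<close>.\<close>

lemma sqrt_complement:
  assumes S: "closed_star_subalgebra A S" and a: "a \<in> S" "a\<^sup>\<star> = a" "\<parallel>a\<parallel> < 1"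
  obtains y where "y \<in> S" "y\<^sup>\<star> = y" "a \<otimes> y = y \<otimes> a" "a \<otimes> a \<oplus> y \<otimes> y = 2 \<odot> y"
proof -
  have SD: "x \<in> S \<Longrightarrow> x \<in> carrier A" "x \<in> S \<Longrightarrow> z \<in> S \<Longrightarrow> x \<oplus> z \<in> S" "x \<in> S \<Longrightarrow> c \<odot> x \<in> S"
    "x \<in> S \<Longrightarrow> z \<in> S \<Longrightarrow> x \<otimes> z \<in> S" "\<zero> \<in> S"
    "(\<And>n. s n \<in> S) \<Longrightarrow> conv A s x \<Longrightarrow> x \<in> S" for x z c s
    using S unfolding closed_star_subalgebra_def by blast+
  define k where "k = \<parallel>a\<parallel>\<^sup>2"
  have aA: "a \<in> carrier A" using a SD by blast
  have k: "0 \<le> k" "k < 1" using a aA by (auto simp: k_def abs_square_less_1)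
  \<comment> \<open>\<open>r\<close> is the smaller fixed point of \<open>r \<mapsto> (k + r\<^sup>2) /
    2\<close>, hence a bound for the iterates.\<close>
  define r where "r = 1 - sqrt (1 - k)"
  have r: "0 \<le> r" "r < 1" using k by (auto simp: r_def)
  have "(sqrt (1 - k))\<^sup>2 = 1 - k" using k by simp
  then have r2: "(k + r * r) / 2 = r" by (simp add: r_def power2_eq_square field_simps)
  define y where "y = rec_nat \<zero> (\<lambda>n z. (1 / 2) \<odot> (a \<otimes> a \<oplus> z \<otimes> z))"
  have y0: "y 0 = \<zero>" and yS: "y (Suc n) = (1 / 2) \<odot> (a \<otimes> a \<oplus> y n \<otimes> y n)" for n
    by (simp_all add: y_def)
  have yin: "y n \<in> S" for n by (induction n) (simp_all add: y0 yS SD a)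
  note yA [simp] = SD(1)[OF yin]
  have ysa: "(y n)\<^sup>\<star> = y n" for n
    by (induction n) (simp_all add: y0 yS adj_smult adj_add adj_mult aA a)
  have ycom: "a \<otimes> y n = y n \<otimes> a" for n
  proof (induction n)
    case (Suc n)
    have "a \<otimes> (y n \<otimes> y n) = (y n \<otimes> y n) \<otimes> a"
      using Suc aA yA[of n] by (metis mult_assoc)
    then show ?case
      by (simp add: yS aA smult_mult_left smult_mult_right mult_distrib_left mult_distrib_right mult_assoc)
  qed (simp add: y0 aA)
  have yn: "\<parallel>y n\<parallel> \<le> r" for n
  proof (induction n)
    case (Suc n)
    have "\<parallel>y (Suc n)\<parallel> \<le> (\<parallel>a \<otimes> a\<parallel> + \<parallel>y n \<otimes> y n\<parallel>) / 2"
      using cnorm_add[of "a \<otimes> a" "y n \<otimes> y n"] aA by (simp add: yS norm_sc)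
    also have "\<dots> \<le> (k + r * r) / 2"
      using cnorm_mult[of a a] cnorm_mult[of "y n" "y n"] aA
        mult_mono[OF Suc Suc] r by (simp add: k_def power2_eq_square)
    finally show ?case using r2 by simp
  qed (simp add: y0 r)
  have yd: "\<parallel>y (Suc n) \<ominus> y n\<parallel> \<le> k * r ^ n" for n
  proof (induction n)
    case 0
    have "\<parallel>y (Suc 0) \<ominus> y 0\<parallel> = \<parallel>a \<otimes> a\<parallel> / 2" by (simp add: yS y0 aA norm_sc)
    also have "\<dots> \<le> \<parallel>a\<parallel> * \<parallel>a\<parallel> / 2" using cnorm_mult[of a a] aA by simp
    also have "\<dots> \<le> \<parallel>a\<parallel> * \<parallel>a\<parallel>" by simp
    finally show ?case using k by (simp add: k_def power2_eq_square)
  next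
    case (Suc n)
    let ?d = "y (Suc n) \<ominus> y n"
    have d: "?d \<in> carrier A" by simp
    have "y (Suc (Suc n)) \<ominus> y (Suc n) = (1 / 2) \<odot> ((a \<otimes> a \<oplus> y (Suc n) \<otimes> y (Suc n)) \<ominus> (a \<otimes> a \<oplus> y n \<otimes> y n))"
      by (subst yS, subst (2) yS, rule sc_diff_right[symmetric]) (simp_all add: aA)
    also have "(a \<otimes> a \<oplus> y (Suc n) \<otimes> y (Suc n)) \<ominus> (a \<otimes> a \<oplus> y n \<otimes> y n)
       = (a \<otimes> a \<ominus> a \<otimes> a) \<oplus> (y (Suc n) \<otimes> y (Suc n) \<ominus> y n \<otimes> y n)"
      by (rule add_diff_add) (simp_all add: aA)
    also have "\<dots> = y (Suc n) \<otimes> ?d \<oplus> ?d \<otimes> y n"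
      using diff_split[of "y (Suc n) \<otimes> y (Suc n)" "y (Suc n) \<otimes> y n" "y n \<otimes> y n"] aA
      by (simp add: mult_diff_left mult_diff_right)
    finally have "\<parallel>y (Suc (Suc n)) \<ominus> y (Suc n)\<parallel> = \<parallel>y (Suc n) \<otimes> ?d \<oplus> ?d \<otimes> y n\<parallel> / 2"
      by (simp add: norm_sc)
    also have "\<dots> \<le> (\<parallel>y (Suc n)\<parallel> * \<parallel>?d\<parallel> + \<parallel>?d\<parallel> * \<parallel>y n\<parallel>) / 2"
      using cnorm_add[of "y (Suc n) \<otimes> ?d" "?d \<otimes> y n"] cnorm_mult[of "y (Suc n)" ?d]
        cnorm_mult[of ?d "y n"] by simp
    also have "\<dots> \<le> (r * \<parallel>?d\<parallel> + \<parallel>?d\<parallel> * r) / 2"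
      using yn[of "Suc n"] yn[of n] norm_nonneg[OF d]
      by (intro divide_right_mono add_mono mult_right_mono mult_left_mono) auto
    also have "\<dots> = r * \<parallel>?d\<parallel>" by simp
    also have "\<dots> \<le> r * (k * r ^ n)" using Suc r(1) by (rule mult_left_mono)
    finally show ?case by (simp add: mult_ac)
  qed
  obtain z where z: "conv A y z" using geometric_conv[OF yA r yd] .
  have zS: "z \<in> S" using SD(6)[OF yin z] .
  have zA: "z \<in> carrier A" using zS SD by blast
  have "conv A (\<lambda>n. (y n)\<^sup>\<star>) (z\<^sup>\<star>)" by (rule conv_adj[OF z])
  then have "z\<^sup>\<star> = z" unfolding ysa using z by (rule conv_unique)
  moreover have "conv A (\<lambda>n. y n \<otimes> a) (a \<otimes> z)"
    using conv_mult[OF conv_const[OF aA] z] unfolding ycom .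
  from this conv_mult[OF z conv_const[OF aA]] have "a \<otimes> z = z \<otimes> a"
    by (rule conv_unique)
  moreover have "conv A (\<lambda>n. y (Suc n)) ((1 / 2) \<odot> (a \<otimes> a \<oplus> z \<otimes> z))"
    unfolding yS by (intro conv_sc conv_add conv_const conv_mult z) (simp add: aA)
  then have "z = (1 / 2) \<odot> (a \<otimes> a \<oplus> z \<otimes> z)"
    using conv_shift[OF z] by (metis conv_unique)
  then have "2 \<odot> z = 2 \<odot> ((1 / 2) \<odot> (a \<otimes> a \<oplus> z \<otimes> z))" by simp
  then have "a \<otimes> a \<oplus> z \<otimes> z = 2 \<odot> z" using aA zA by simp
  ultimately show ?thesis using that zS by blast
qed

text \<open>The hypotheses say that \<open>b\<^sup>2 + (1 - y)\<^sup>2 = 1\<close> in the unitization, so that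
  \<open>b \<plusminus> \<i> (1 - y)\<close> are unitary and their products with \<open>b\<close> have norm
  \<open>\<parallel>b\<parallel>\<close>. The sum of the products is \<open>2 b\<^sup>2\<close>, which gives
  \<open>\<parallel>b\<parallel>\<^sup>2 \<le> \<parallel>b\<parallel>\<close> without leaving the
  algebra.\<close>

lemma circle_contraction:
  assumes b: "b \<in> carrier A" "b\<^sup>\<star> = b" and y: "y \<in> carrier A" "y\<^sup>\<star> = y"
    and com: "b \<otimes> y = y \<otimes> b" and eq: "b \<otimes> b \<oplus> y \<otimes> y = 2 \<odot> y"
  shows "\<parallel>b\<parallel> \<le> 1"
proof -
  let ?X = "b \<otimes> b" let ?w = "b \<ominus> y \<otimes> b"
  note [simp] = b y
  have c1: "?X\<^sup>\<star> \<otimes> ?w = ?w\<^sup>\<star> \<otimes> ?X"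
  proof -
    have "?X\<^sup>\<star> \<otimes> ?w = b \<otimes> b \<otimes> b \<ominus> b \<otimes> (b \<otimes> y) \<otimes> b"
      by (simp add: adj_mult mult_diff_right mult_assoc)
    also have "\<dots> = b \<otimes> b \<otimes> b \<ominus> b \<otimes> (y \<otimes> b) \<otimes> b" by (simp add: com)
    also have "\<dots> = ?w\<^sup>\<star> \<otimes> ?X"
      by (simp add: adj_diff adj_mult mult_diff_left mult_assoc)
    finally show ?thesis .
  qed
  have c2: "?X\<^sup>\<star> \<otimes> ?X \<oplus> ?w\<^sup>\<star> \<otimes> ?w = b \<otimes> b"
  proof -
    have "?w\<^sup>\<star> \<otimes> ?w = b \<otimes> b \<oplus> ((-2) \<odot> (b \<otimes> (y \<otimes> b)) \<oplus> b \<otimes> (y \<otimes> (y \<otimes> b)))"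
      using sc_add_left[of "b \<otimes> (y \<otimes> b)" "-1" "-1"]
      by (simp add: adj_add adj_smult adj_mult mult_distrib_left mult_distrib_right smult_mult_left smult_mult_right mult_assoc diff_sc sc_add_right M.a_ac)
    moreover have "?X\<^sup>\<star> \<otimes> ?X \<oplus> b \<otimes> (y \<otimes> (y \<otimes> b)) = 2 \<odot> (b \<otimes> (y \<otimes> b))"
    proof -
      have "?X\<^sup>\<star> \<otimes> ?X \<oplus> b \<otimes> (y \<otimes> (y \<otimes> b)) = b \<otimes> ((b \<otimes> b \<oplus> y \<otimes> y) \<otimes> b)"
        by (simp add: adj_mult mult_distrib_left mult_distrib_right mult_assoc)
      then show ?thesis by (simp add: eq smult_mult_left smult_mult_right)
    qed
    then have "?X\<^sup>\<star> \<otimes> ?X \<oplus> ((-2) \<odot> (b \<otimes> (y \<otimes> b)) \<oplus> b \<otimes> (y \<otimes> (y \<otimes> b))) = \<zero>"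
      using sc_add_left[of "b \<otimes> (y \<otimes> b)" "-2" "2"]
        M.a_lcomm[of "?X\<^sup>\<star> \<otimes> ?X" "(-2) \<odot> (b \<otimes> (y \<otimes> b))" "b \<otimes> (y \<otimes> (y \<otimes> b))"] by simp
    ultimately show ?thesis
      using M.a_lcomm[of "?X\<^sup>\<star> \<otimes> ?X" "b \<otimes> b" "(-2) \<odot> (b \<otimes> (y \<otimes> b)) \<oplus> b \<otimes> (y \<otimes> (y \<otimes> b))"]
      by simp
  qed
  have v: "\<parallel>?X \<oplus> c \<odot> ?w\<parallel> = \<parallel>b\<parallel>" if c: "cnj c = - c" "c * c = -1" for c
  proof -
    have X: "?X \<in> carrier A" and w: "?w \<in> carrier A" by simp_all
    have "(?X \<oplus> c \<odot> ?w)\<^sup>\<star> \<otimes> (?X \<oplus> c \<odot> ?w) =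
      ?X\<^sup>\<star> \<otimes> ?X \<oplus> (c \<odot> (?X\<^sup>\<star> \<otimes> ?w) \<oplus> ((- c) \<odot> (?w\<^sup>\<star> \<otimes> ?X) \<oplus> ?w\<^sup>\<star> \<otimes> ?w))"
      using X w c by (simp add: adj_add adj_smult mult_distrib_left mult_distrib_right sc_add_right
        smult_mult_left smult_mult_right M.a_ac)
    also have "\<dots> = ?X\<^sup>\<star> \<otimes> ?X \<oplus> ((c + - c) \<odot> (?w\<^sup>\<star> \<otimes> ?X) \<oplus> ?w\<^sup>\<star> \<otimes> ?w)"
      using X w by (subst sc_add_left) (simp_all add: c1 M.a_assoc)
    also have "\<dots> = b\<^sup>\<star> \<otimes> b" using X w c2 by simp
    finally have "\<parallel>?X \<oplus> c \<odot> ?w\<parallel>\<^sup>2 = \<parallel>b\<parallel>\<^sup>2"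
      using cstar_identity[of "?X \<oplus> c \<odot> ?w"] cstar_identity[of b] by simp
    then show ?thesis by (simp add: power2_eq_iff_nonneg)
  qed
  have X: "?X \<in> carrier A" and w: "?w \<in> carrier A" by simp_all
  have "(?X \<oplus> \<i> \<odot> ?w) \<oplus> (?X \<oplus> (- \<i>) \<odot> ?w) = (1 + 1) \<odot> ?X \<oplus> (\<i> + - \<i>) \<odot> ?w"
    using X w by (simp only: sc_add_left) (simp add: M.a_ac)
  then have "(?X \<oplus> \<i> \<odot> ?w) \<oplus> (?X \<oplus> (- \<i>) \<odot> ?w) = 2 \<odot> ?X" using X w by simp
  then have "2 * \<parallel>?X\<parallel> \<le> \<parallel>b\<parallel> + \<parallel>b\<parallel>"
    using cnorm_add[of "?X \<oplus> \<i> \<odot> ?w" "?X \<oplus> (- \<i>) \<odot> ?w"] v[of \<i>] v[of "- \<i>"] X w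
    by (simp add: norm_sc)
  moreover have "\<parallel>?X\<parallel> = \<parallel>b\<parallel>\<^sup>2" using cstar_identity[of b] by simp
  ultimately have "\<parallel>b\<parallel> * \<parallel>b\<parallel> \<le> \<parallel>b\<parallel> * 1" by (simp add: power2_eq_square)
  then show ?thesis
    using norm_nonneg[OF b(1)] by (metis mult_le_cancel_left_pos linorder_not_less order.trans zero_le_one)
qed

end

text \<open>A self-adjoint \<open>a\<close> with \<open>\<parallel>a\<parallel> < 1\<close> lies on a circle
  \<open>a\<^sup>2 + (1 - y)\<^sup>2 = 1\<close>. This equation is preserved by homomorphisms and bounds the
  image by 1. The general case follows from the C*-identity by scaling \<open>x\<^sup>\<star>
  x\<close>.\<close>

lemma star_hom_contractive:
  assumes A: "cstar_algebra A" and B: "cstar_algebra B"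
    and S: "closed_star_subalgebra A S" and h: "star_hom_on S A B h" and x: "x \<in> S"
  shows "\<parallel>h x\<parallel>\<^bsub>B\<^esub> \<le> \<parallel>x\<parallel>\<^bsub>A\<^esub>"
proof -
  interpret A: cstar_algebra A by fact
  interpret B: cstar_algebra B by fact
  have SD: "x \<in> S \<Longrightarrow> x \<in> carrier A" "x \<in> S \<Longrightarrow> z \<in> S \<Longrightarrow> x \<oplus>\<^bsub>A\<^esub> z \<in> S" "x \<in> S \<Longrightarrow> c \<odot>\<^bsub>A\<^esub> x \<in> S"
    "x \<in> S \<Longrightarrow> z \<in> S \<Longrightarrow> x \<otimes>\<^bsub>A\<^esub> z \<in> S" "x \<in> S \<Longrightarrow> x\<^sup>\<star>\<^bsub>A\<^esub> \<in> S" for x z c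
    using S unfolding closed_star_subalgebra_def by blast+
  have hD: "x \<in> S \<Longrightarrow> h x \<in> carrier B" "x \<in> S \<Longrightarrow> y \<in> S \<Longrightarrow> h (x \<oplus>\<^bsub>A\<^esub> y) = h x \<oplus>\<^bsub>B\<^esub> h y"
    "x \<in> S \<Longrightarrow> h (c \<odot>\<^bsub>A\<^esub> x) = c \<odot>\<^bsub>B\<^esub> h x" "x \<in> S \<Longrightarrow> y \<in> S \<Longrightarrow> h (x \<otimes>\<^bsub>A\<^esub> y) = h x \<otimes>\<^bsub>B\<^esub> h y"
    "x \<in> S \<Longrightarrow> h (x\<^sup>\<star>\<^bsub>A\<^esub>) = (h x)\<^sup>\<star>\<^bsub>B\<^esub>" for x y c
    using h unfolding star_hom_on_def by blast+
  have sa: "\<parallel>h a\<parallel>\<^bsub>B\<^esub> \<le> 1" if a: "a \<in> S" "a\<^sup>\<star>\<^bsub>A\<^esub> = a" "\<parallel>a\<parallel>\<^bsub>A\<^esub> < 1" for a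
  proof -
    obtain y where y: "y \<in> S" "y\<^sup>\<star>\<^bsub>A\<^esub> = y" "a \<otimes>\<^bsub>A\<^esub> y = y \<otimes>\<^bsub>A\<^esub> a"
      "a \<otimes>\<^bsub>A\<^esub> a \<oplus>\<^bsub>A\<^esub> y \<otimes>\<^bsub>A\<^esub> y = 2 \<odot>\<^bsub>A\<^esub> y"
      using A.sqrt_complement[OF S a] .
    show ?thesis
    proof (rule B.circle_contraction[of _ "h y"])
      show "(h a)\<^sup>\<star>\<^bsub>B\<^esub> = h a" "(h y)\<^sup>\<star>\<^bsub>B\<^esub> = h y" using hD(5) a y by metis+
      show "h a \<otimes>\<^bsub>B\<^esub> h y = h y \<otimes>\<^bsub>B\<^esub> h a" using hD(4) a y by metis
      show "h a \<otimes>\<^bsub>B\<^esub> h a \<oplus>\<^bsub>B\<^esub> h y \<otimes>\<^bsub>B\<^esub> h y = 2 \<odot>\<^bsub>B\<^esub> h y"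
        using hD(2)[of "a \<otimes>\<^bsub>A\<^esub> a" "y \<otimes>\<^bsub>A\<^esub> y"] hD(3)[of y 2] hD(4) a y SD by metis
    qed (simp_all add: hD(1) a y)
  qed
  have sq: "(\<parallel>h x\<parallel>\<^bsub>B\<^esub>)\<^sup>2 \<le> t" if t: "t > (\<parallel>x\<parallel>\<^bsub>A\<^esub>)\<^sup>2" for t :: real
  proof -
    let ?z = "x\<^sup>\<star>\<^bsub>A\<^esub> \<otimes>\<^bsub>A\<^esub> x"
    have t0: "t > 0" using t by (smt (verit) zero_le_power2)
    have z: "?z \<in> S" "?z \<in> carrier A" "x \<in> carrier A" using SD(1,4,5) x by simp_all
    let ?a = "complex_of_real (1 / t) \<odot>\<^bsub>A\<^esub> ?z"
    have "\<parallel>h ?a\<parallel>\<^bsub>B\<^esub> \<le> 1"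
    proof (rule sa)
      show "\<parallel>?a\<parallel>\<^bsub>A\<^esub> < 1" using z t t0 A.cstar_identity[of x] by (simp add: A.norm_sc norm_divide)
    qed (simp_all add: z SD(3) A.adj_smult A.adj_mult)
    moreover have "h ?a = complex_of_real (1 / t) \<odot>\<^bsub>B\<^esub> ((h x)\<^sup>\<star>\<^bsub>B\<^esub> \<otimes>\<^bsub>B\<^esub> h x)"
      using z x hD SD by simp
    ultimately show ?thesis
      using B.cstar_identity[of "h x"] hD(1)[OF x] t0 by (simp add: B.norm_sc norm_divide field_simps)
  qed
  have "(\<parallel>h x\<parallel>\<^bsub>B\<^esub>)\<^sup>2 \<le> (\<parallel>x\<parallel>\<^bsub>A\<^esub>)\<^sup>2" using sq by (rule dense_ge)
  then show ?thesis by (rule power2_le_imp_le) (use SD(1)[OF x] in simp)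
qed

section \<open>Noncommutative *-polynomials\<close>

lemma lookup_poly_scale [simp]: "Poly_Mapping.lookup (poly_scale c a) w = c * Poly_Mapping.lookup a w"
  by (simp add: poly_scale_def Poly_Mapping.map.rep_eq when_def)

lemma poly_scale_add: "poly_scale c (a + b) = poly_scale c a + poly_scale c b"
  by (rule poly_mapping_eqI) (simp add: lookup_add algebra_simps)

lemma poly_scale_add_left: "poly_scale (c + d) a = poly_scale c a + poly_scale d a"
  by (rule poly_mapping_eqI) (simp add: lookup_add algebra_simps)

lemma poly_scale_scale [simp]: "poly_scale c (poly_scale d a) = poly_scale (c * d) a"
  by (rule poly_mapping_eqI) simp

lemma poly_scale_one [simp]: "poly_scale 1 a = a"
  by (rule poly_mapping_eqI) simp

lemma poly_scale_zero [simp]: "poly_scale 0 a = 0" "poly_scale c 0 = 0"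
  by (rule poly_mapping_eqI, simp)+

lemma poly_scale_minus: "poly_scale (- 1) a = - a"
  by (rule poly_mapping_eqI) simp

lemma poly_scale_single [simp]: "poly_scale c (Poly_Mapping.single w d) = Poly_Mapping.single w (c * d)"
  by (rule poly_mapping_eqI) (simp add: lookup_single when_def)

lemma update_eq_add: "w \<notin> Poly_Mapping.keys f \<Longrightarrow> Poly_Mapping.update w c f = f + Poly_Mapping.single w c"
  by (rule poly_mapping_eqI) (auto simp: lookup_add lookup_single lookup_update when_def in_keys_iff)

text \<open>The polynomial operations are additive, so that their laws need only be checked on
  monomials.\<close>

lemma star_poly_induct [case_names zero single add]:
  assumes "P 0" "\<And>w c. P (Poly_Mapping.single w c)" "\<And>a b. P a \<Longrightarrow> P b \<Longrightarrow> P (a + b)"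
  shows "P (a :: 'g star_poly)"
  by (induction a rule: update_induct) (simp_all add: assms update_eq_add)

lemma poly_scale_mult_left: "poly_scale c a * b = poly_scale c (a * b)"
proof (induction a rule: star_poly_induct)
  case (single w d)
  show ?case by (induction b rule: star_poly_induct)
      (simp_all add: mult_single distrib_left poly_scale_add mult.assoc)
qed (simp_all add: distrib_right poly_scale_add)

lemma poly_scale_mult_right: "a * poly_scale c b = poly_scale c (a * b)"
proof (induction a rule: star_poly_induct)
  case (single w d)
  show ?case by (induction b rule: star_poly_induct)
      (simp_all add: mult_single distrib_left poly_scale_add mult_ac)
qed (simp_all add: distrib_right poly_scale_add)

lemma poly_adj_superset:
  assumes "finite S" "Poly_Mapping.keys a \<subseteq> S"
  shows "poly_adj a = (\<Sum>w\<in>S. Poly_Mapping.single (word_adj w) (cnj (Poly_Mapping.lookup a w)))"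
  unfolding poly_adj_def
  by (rule sum.mono_neutral_left) (use assms in \<open>auto simp: in_keys_iff\<close>)

lemma poly_adj_zero [simp]: "poly_adj 0 = 0"
  by (simp add: poly_adj_def)

lemma poly_adj_add: "poly_adj (a + b) = poly_adj a + poly_adj b"
proof -
  let ?S = "Poly_Mapping.keys a \<union> Poly_Mapping.keys b"
  have "finite ?S" "Poly_Mapping.keys (a + b) \<subseteq> ?S" by (simp_all add: Poly_Mapping.keys_add)
  then show ?thesis
    by (simp add: poly_adj_superset[of ?S] lookup_add single_add sum.distrib)
qed

lemma poly_adj_single [simp]: "poly_adj (Poly_Mapping.single w c) = Poly_Mapping.single (word_adj w) (cnj c)"
  by (subst poly_adj_superset[of "{w}"]) (auto simp: lookup_single)

lemma word_adj_add: "word_adj (u + v) = word_adj v + word_adj u"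
  by (simp add: word_adj_def plus_word_def)

lemma word_adj_adj [simp]: "word_adj (word_adj w) = w"
  by (cases w) (simp add: word_adj_def rev_map comp_def case_prod_unfold)

lemma word_adj_eq_zero [simp]: "word_adj w = 0 \<longleftrightarrow> w = 0"
  by (cases w) (simp add: word_adj_def zero_word_def)

lemma letters_word_adj: "fst ` set (letters (word_adj w)) = fst ` set (letters w)"
  by (cases w) (force simp: word_adj_def)

lemma poly_adj_adj [simp]: "poly_adj (poly_adj a) = a"
  by (induction a rule: star_poly_induct) (simp_all add: poly_adj_add)

lemma poly_adj_scale: "poly_adj (poly_scale c a) = poly_scale (cnj c) (poly_adj a)"
  by (induction a rule: star_poly_induct) (simp_all add: poly_adj_add poly_scale_add)

lemma poly_adj_mult: "poly_adj (a * b) = poly_adj b * poly_adj a"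
proof (induction a rule: star_poly_induct)
  case (single w c)
  show ?case by (induction b rule: star_poly_induct)
      (simp_all add: mult_single distrib_left distrib_right poly_adj_add word_adj_add mult_ac)
qed (simp_all add: distrib_left distrib_right poly_adj_add)

lemma poly_adj_minus: "poly_adj (- a) = - poly_adj a"
  using poly_adj_scale[of "-1" a] by (simp add: poly_scale_minus)

lemma poly_adj_diff: "poly_adj (a - b) = poly_adj a - poly_adj b"
  using poly_adj_add[of a "- b"] by (simp add: poly_adj_minus)

lemma free_zero [simp]: "0 \<in> free_star_algebra G"
  by (simp add: free_star_algebra_def)

lemma free_single: "w \<noteq> 0 \<Longrightarrow> fst ` set (letters w) \<subseteq> G \<Longrightarrow> Poly_Mapping.single w c \<in> free_star_algebra G"
  by (simp add: free_star_algebra_def)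

lemma free_gen: "g \<in> G \<Longrightarrow> gen g \<in> free_star_algebra G"
  unfolding gen_def by (rule free_single) (simp_all add: zero_word_def)

lemma free_add [simp]: "a \<in> free_star_algebra G \<Longrightarrow> b \<in> free_star_algebra G \<Longrightarrow> a + b \<in> free_star_algebra G"
  unfolding free_star_algebra_def using Poly_Mapping.keys_add[of a b] by blast

lemma free_scale [simp]: "a \<in> free_star_algebra G \<Longrightarrow> poly_scale c a \<in> free_star_algebra G"
  unfolding free_star_algebra_def by (auto simp: in_keys_iff)

lemma free_uminus [simp]: "a \<in> free_star_algebra G \<Longrightarrow> - a \<in> free_star_algebra G"
  using free_scale[of a G "-1"] by (simp add: poly_scale_minus)

lemma free_diff [simp]: "a \<in> free_star_algebra G \<Longrightarrow> b \<in> free_star_algebra G \<Longrightarrow> a - b \<in> free_star_algebra G"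
  using free_add[of a G "- b"] by simp

lemma free_sum: "(\<And>i. i \<in> I \<Longrightarrow> f i \<in> free_star_algebra G) \<Longrightarrow> (\<Sum>i\<in>I. f i) \<in> free_star_algebra G"
  by (induction I rule: infinite_finite_induct) simp_all

lemma free_mult [simp]: "a \<in> free_star_algebra G \<Longrightarrow> b \<in> free_star_algebra G \<Longrightarrow> a * b \<in> free_star_algebra G"
proof -
  assume a: "a \<in> free_star_algebra G" and b: "b \<in> free_star_algebra G"
  have "u + v \<noteq> 0 \<and> fst ` set (letters (u + v)) \<subseteq> G"
    if "u \<in> Poly_Mapping.keys a" "v \<in> Poly_Mapping.keys b" for u v
  proof -
    have "u \<noteq> 0 \<and> fst ` set (letters u) \<subseteq> G" "v \<noteq> 0 \<and> fst ` set (letters v) \<subseteq> G"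
      using a b that unfolding free_star_algebra_def by blast+
    then show ?thesis by (cases u; cases v; simp add: plus_word_def zero_word_def image_Un)
  qed
  note * = this
  show ?thesis
    unfolding free_star_algebra_def
  proof (intro CollectI ballI)
    fix w assume "w \<in> Poly_Mapping.keys (a * b)"
    then obtain u v where "w = u + v" "u \<in> Poly_Mapping.keys a" "v \<in> Poly_Mapping.keys b"
      using Poly_Mapping.keys_mult[of a b] by blast
    then show "w \<noteq> 0 \<and> fst ` set (letters w) \<subseteq> G" using * by simp
  qed
qed

lemma free_star_induct [consumes 1, case_names zero single add]:
  assumes "a \<in> free_star_algebra G" "P 0"
    and "\<And>w c. w \<noteq> 0 \<Longrightarrow> fst ` set (letters w) \<subseteq> G \<Longrightarrow> P (Poly_Mapping.single w c)"
    and "\<And>a b. a \<in> free_star_algebra G \<Longrightarrow> b \<in> free_star_algebra G \<Longrightarrow> P a \<Longrightarrow> P b \<Longrightarrow> P (a + b)"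
  shows "P a"
  using assms(1)
proof (induction a rule: update_induct)
  case (update f w c)
  have k: "Poly_Mapping.keys (Poly_Mapping.update w c f) = insert w (Poly_Mapping.keys f)"
    using update(2) by (auto simp: in_keys_iff lookup_update split: if_splits)
  have f: "f \<in> free_star_algebra G" and w: "w \<noteq> 0" "fst ` set (letters w) \<subseteq> G"
    using update.prems k by (auto simp: free_star_algebra_def)
  show ?case unfolding update_eq_add[OF update(1)]
    by (intro assms(4) f free_single w update.IH assms(3))
qed (rule assms(2))

lemma free_adj [simp]: "a \<in> free_star_algebra G \<Longrightarrow> poly_adj a \<in> free_star_algebra G"
proof (induction rule: free_star_induct)
  case (single w c)
  then show ?case by (simp add: free_single letters_word_adj)
qed (simp_all add: poly_adj_add)

section \<open>C*-seminorms and the universal C*-algebra\<close>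

locale poly_seminorm =
  fixes G :: "'g set" and p :: "'g star_poly \<Rightarrow> real"
  assumes seminorm: "cstar_seminorm G p"
begin

abbreviation "FG \<equiv> free_star_algebra G"

lemma sn_add: "a \<in> FG \<Longrightarrow> b \<in> FG \<Longrightarrow> p (a + b) \<le> p a + p b"
  and sn_scale: "a \<in> FG \<Longrightarrow> p (poly_scale c a) = cmod c * p a"
  and sn_mult: "a \<in> FG \<Longrightarrow> b \<in> FG \<Longrightarrow> p (a * b) \<le> p a * p b"
  and sn_star: "a \<in> FG \<Longrightarrow> p (poly_adj a * a) = (p a)\<^sup>2"
  using seminorm by (simp_all add: cstar_seminorm_def)

lemma sn_zero [simp]: "p 0 = 0"
  using sn_scale[of 0 0] by simp

lemma sn_uminus: "a \<in> FG \<Longrightarrow> p (- a) = p a"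
  using sn_scale[of a "-1"] by (simp add: poly_scale_minus)

lemma sn_nonneg: "a \<in> FG \<Longrightarrow> 0 \<le> p a"
  using sn_add[of a "- a"] sn_uminus[of a] by simp

lemma sn_comm: "a \<in> FG \<Longrightarrow> b \<in> FG \<Longrightarrow> p (a - b) = p (b - a)"
  using sn_uminus[of "a - b"] by simp

lemma sn_triangle: "a \<in> FG \<Longrightarrow> b \<in> FG \<Longrightarrow> c \<in> FG \<Longrightarrow> p (a - c) \<le> p (a - b) + p (b - c)"
  using sn_add[of "a - b" "b - c"] by simp

lemma sn_bound: "a \<in> FG \<Longrightarrow> b \<in> FG \<Longrightarrow> \<bar>p a - p b\<bar> \<le> p (a - b)"
  using sn_add[of "a - b" b] sn_add[of "b - a" a] sn_comm[of a b] by simp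

text \<open>As in a C*-algebra, the adjoint is isometric because \<open>p (a\<^sup>\<star> a) = (p
  a)\<^sup>2\<close>.\<close>

lemma sn_adj: "a \<in> FG \<Longrightarrow> p (poly_adj a) = p a"
proof -
  have le: "p a \<le> p (poly_adj a)" if a: "a \<in> FG" for a
  proof (cases "p a = 0")
    case False
    then have "0 < p a" using sn_nonneg[OF a] by simp
    moreover have "p a * p a \<le> p (poly_adj a) * p a"
      using sn_star[OF a] sn_mult[of "poly_adj a" a] a by (simp add: power2_eq_square)
    ultimately show ?thesis by simp
  qed (use sn_nonneg[of "poly_adj a"] a in simp)
  assume "a \<in> FG"
  then show ?thesis using le[of a] le[of "poly_adj a"] by (simp add: antisym)
qed

lemma sn_eq: "a \<in> FG \<Longrightarrow> b \<in> FG \<Longrightarrow> p (a - b) = 0 \<Longrightarrow> p a = p b"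
  using sn_bound[of a b] by simp

end

text \<open>Relations that bound all admissible seminorms on each *-polynomial. Without this bound the
  supremum defining the universal seminorm would be meaningless.\<close>

locale cstar_presentation =
  fixes G :: "'g set" and R :: "'g star_poly set"
  assumes bounded: "\<And>a. a \<in> free_star_algebra G \<Longrightarrow>
      \<exists>C. \<forall>p. cstar_seminorm G p \<longrightarrow> (\<forall>r\<in>R. p r = 0) \<longrightarrow> p a \<le> C"
    and relations_free: "R \<subseteq> free_star_algebra G"
begin

abbreviation "N \<equiv> universal_seminorm G R"
abbreviation "U \<equiv> universal_cstar G R"
abbreviation "adm \<equiv> {p. cstar_seminorm G p \<and> (\<forall>r\<in>R. p r = 0)}"

lemma adm_zero: "(\<lambda>_. 0) \<in> adm"
  by (simp add: cstar_seminorm_def)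

lemma adm_bdd: "a \<in> free_star_algebra G \<Longrightarrow> bdd_above ((\<lambda>p. p a) ` adm)"
  using bounded[of a] by (fastforce simp: bdd_above_def)

lemma N_upper: "p \<in> adm \<Longrightarrow> a \<in> free_star_algebra G \<Longrightarrow> p a \<le> N a"
  unfolding universal_seminorm_def by (rule cSUP_upper[OF _ adm_bdd])

lemma N_least: "(\<And>p. p \<in> adm \<Longrightarrow> p a \<le> C) \<Longrightarrow> N a \<le> C"
  unfolding universal_seminorm_def using adm_zero by (intro cSUP_least) auto

lemma N_nonneg: "a \<in> free_star_algebra G \<Longrightarrow> 0 \<le> N a"
  using N_upper[OF adm_zero, of a] by simp

lemma adm_seminorm: "p \<in> adm \<Longrightarrow> poly_seminorm G p"
  by (simp add: poly_seminorm_def)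

lemma N_seminorm: "cstar_seminorm G N"
  unfolding cstar_seminorm_def
proof (intro conjI ballI allI)
  fix a b assume a: "a \<in> free_star_algebra G" and b: "b \<in> free_star_algebra G"
  show "N (a + b) \<le> N a + N b"
  proof (rule N_least)
    fix p assume p: "p \<in> adm"
    interpret poly_seminorm G p by (rule adm_seminorm[OF p])
    show "p (a + b) \<le> N a + N b"
      using sn_add[OF a b] N_upper[OF p a] N_upper[OF p b] by simp
  qed
  show "N (a * b) \<le> N a * N b"
  proof (rule N_least)
    fix p assume p: "p \<in> adm"
    interpret poly_seminorm G p by (rule adm_seminorm[OF p])
    have "p a * p b \<le> N a * N b"
      by (intro mult_mono N_upper p a b N_nonneg sn_nonneg)
    then show "p (a * b) \<le> N a * N b" using sn_mult[OF a b] by simp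
  qed
next
  fix a c assume a: "a \<in> free_star_algebra G"
  have le: "N (poly_scale c a) \<le> cmod c * N a" if a: "a \<in> free_star_algebra G" for c a
  proof (rule N_least)
    fix p assume p: "p \<in> adm"
    interpret poly_seminorm G p by (rule adm_seminorm[OF p])
    show "p (poly_scale c a) \<le> cmod c * N a"
      using sn_scale[OF a] N_upper[OF p a] by (simp add: mult_left_mono)
  qed
  show "N (poly_scale c a) = cmod c * N a"
  proof (cases "c = 0")
    case True
    then show ?thesis using le[OF a, of 0] N_nonneg[of 0] by simp
  next
    case False
    have "cmod c * N a \<le> cmod c * (cmod (1 / c) * N (poly_scale c a))"
      using le[of "poly_scale c a" "1 / c"] a False by (intro mult_left_mono) simp_all
    also have "\<dots> = N (poly_scale c a)" using False by (simp add: norm_divide)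
    finally show ?thesis using le[OF a, of c] by simp
  qed
next
  fix a assume a: "a \<in> free_star_algebra G"
  have aa: "poly_adj a * a \<in> free_star_algebra G" using a by simp
  show "N (poly_adj a * a) = (N a)\<^sup>2"
  proof (rule antisym)
    show "N (poly_adj a * a) \<le> (N a)\<^sup>2"
    proof (rule N_least)
      fix p assume p: "p \<in> adm"
      interpret poly_seminorm G p by (rule adm_seminorm[OF p])
      show "p (poly_adj a * a) \<le> (N a)\<^sup>2"
        unfolding sn_star[OF a] by (intro power_mono N_upper p a sn_nonneg)
    qed
    have "N a \<le> sqrt (N (poly_adj a * a))"
    proof (rule N_least)
      fix p assume p: "p \<in> adm"
      interpret poly_seminorm G p by (rule adm_seminorm[OF p])
      show "p a \<le> sqrt (N (poly_adj a * a))"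
        using N_upper[OF p aa] sn_star[OF a] by (intro real_le_rsqrt) simp
    qed
    then have "(N a)\<^sup>2 \<le> (sqrt (N (poly_adj a * a)))\<^sup>2"
      by (intro power_mono N_nonneg a)
    then show "(N a)\<^sup>2 \<le> N (poly_adj a * a)" using N_nonneg[OF aa] by simp
  qed
qed

sublocale poly_seminorm G N
  by (simp add: poly_seminorm_def N_seminorm)

lemma N_relation: "r \<in> R \<Longrightarrow> N r = 0"
  using N_least[of r 0] N_nonneg[of r] relations_free by force

abbreviation "CS \<equiv> cauchy_seqs G R"
abbreviation "cls s \<equiv> null_rel G R `` {s}"

lemma CS_free: "s \<in> CS \<Longrightarrow> s n \<in> FG"
  by (simp add: cauchy_seqs_def)

lemma CS_const: "a \<in> FG \<Longrightarrow> (\<lambda>n. a) \<in> CS"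
  by (simp add: cauchy_seqs_def)

lemma CS_D: "s \<in> CS \<Longrightarrow> e > 0 \<Longrightarrow> \<exists>M. \<forall>m\<ge>M. \<forall>n\<ge>M. N (s m - s n) < e"
  by (simp add: cauchy_seqs_def)

lemma CS_convergent: assumes s: "s \<in> CS" shows "convergent (\<lambda>n. N (s n))"
proof (rule Cauchy_convergent, rule CauchyI)
  fix e :: real assume "0 < e"
  from CS_D[OF s this] obtain M where M: "\<forall>m\<ge>M. \<forall>n\<ge>M. N (s m - s n) < e" by blast
  have "norm (N (s m) - N (s n)) < e" if "m \<ge> M" "n \<ge> M" for m n
    using sn_bound[OF CS_free[OF s, of m] CS_free[OF s, of n]] M that by force
  then show "\<exists>M. \<forall>m\<ge>M. \<forall>n\<ge>M. norm (N (s m) - N (s n)) < e" by blast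
qed

text \<open>A criterion covering all algebraic operations at once.\<close>

lemma CS_dominated:
  assumes s: "s \<in> CS" and t: "t \<in> CS" and f: "\<And>n. f n \<in> FG" and "0 \<le> C"
    and le: "\<And>m n. N (f m - f n) \<le> C * (N (s m - s n) + N (t m - t n))"
  shows "f \<in> CS"
  unfolding cauchy_seqs_def
proof (intro CollectI conjI allI impI f)
  fix e :: real assume e: "0 < e"
  \<comment> \<open>\<open>C + 1\<close> instead of \<open>C\<close>, as \<open>C\<close> may be zero.\<close>
  define d where "d = e / (C + 1) / 2"
  have d: "0 < d" using e assms(4) by (simp add: d_def)
  have "d + d = e / (C + 1)" unfolding d_def by (rule field_sum_of_halves)
  then have dd: "C * (d + d) < e" using e assms(4) by (simp only:) (simp add: field_simps)
  obtain M1 where M1: "\<forall>m\<ge>M1. \<forall>n\<ge>M1. N (s m - s n) < d" using CS_D[OF s d] by blast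
  obtain M2 where M2: "\<forall>m\<ge>M2. \<forall>n\<ge>M2. N (t m - t n) < d" using CS_D[OF t d] by blast
  show "\<exists>M. \<forall>m\<ge>M. \<forall>n\<ge>M. N (f m - f n) < e"
  proof (intro exI[of _ "max M1 M2"] allI impI)
    fix m n assume "max M1 M2 \<le> m" "max M1 M2 \<le> n"
    then have "N (s m - s n) + N (t m - t n) \<le> d + d" using M1 M2 by (intro add_mono) (simp_all add: less_imp_le)
    then have "C * (N (s m - s n) + N (t m - t n)) \<le> C * (d + d)" using assms(4) by (rule mult_left_mono)
    also note dd
    finally show "N (f m - f n) < e" using le[of m n] by simp
  qed
qed

lemma CS_add: "s \<in> CS \<Longrightarrow> t \<in> CS \<Longrightarrow> (\<lambda>n. s n + t n) \<in> CS"
proof (rule CS_dominated[where C = 1])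
  assume st: "s \<in> CS" "t \<in> CS"
  show "N (s m + t m - (s n + t n)) \<le> 1 * (N (s m - s n) + N (t m - t n))" for m n
    using sn_add[of "s m - s n" "t m - t n"] CS_free[OF st(1)] CS_free[OF st(2)] by (simp add: algebra_simps)
  show "s n + t n \<in> FG" for n using CS_free[OF st(1)] CS_free[OF st(2)] by simp
qed simp_all

lemma CS_scale: "s \<in> CS \<Longrightarrow> (\<lambda>n. poly_scale c (s n)) \<in> CS"
proof (rule CS_dominated[where s = s and t = s and C = "cmod c"])
  assume s: "s \<in> CS"
  show "N (poly_scale c (s m) - poly_scale c (s n)) \<le> cmod c * (N (s m - s n) + N (s m - s n))" for m n
  proof -
    have "poly_scale c (s m) - poly_scale c (s n) = poly_scale c (s m - s n)"
      by (rule poly_mapping_eqI) (simp add: lookup_minus algebra_simps)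
    then show ?thesis using sn_scale[of "s m - s n" c] sn_nonneg[of "s m - s n"] CS_free[OF s]
      by (simp add: mult_left_mono)
  qed
  show "poly_scale c (s n) \<in> FG" for n using CS_free[OF s] by simp
qed simp_all

lemma CS_adj: "s \<in> CS \<Longrightarrow> (\<lambda>n. poly_adj (s n)) \<in> CS"
proof (rule CS_dominated[where s = s and t = s and C = "1"])
  assume s: "s \<in> CS"
  show "N (poly_adj (s m) - poly_adj (s n)) \<le> 1 * (N (s m - s n) + N (s m - s n))" for m n
    using sn_adj[of "s m - s n"] sn_nonneg[of "s m - s n"] CS_free[OF s] by (simp add: poly_adj_diff)
  show "poly_adj (s n) \<in> FG" for n using CS_free[OF s] by simp
qed simp_all

lemma CS_bounded: assumes "s \<in> CS" shows "\<exists>C\<ge>0. \<forall>n. N (s n) \<le> C"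
proof -
  obtain C where "\<And>n. norm (N (s n)) \<le> C"
    using convergent_imp_Bseq[OF CS_convergent[OF assms]] by (auto simp: Bseq_def)
  then show ?thesis using sn_nonneg[OF CS_free[OF assms]] by (auto intro!: exI[of _ C] intro: order_trans)
qed

lemma N_mult_diff:
  assumes "a \<in> FG" "b \<in> FG" "c \<in> FG" "d \<in> FG"
  shows "N (a * b - c * d) \<le> N (a - c) * N b + N c * N (b - d)"
proof -
  have "a * b - c * d = (a - c) * b + c * (b - d)" by (simp add: algebra_simps)
  then show ?thesis
    using sn_add[of "(a - c) * b" "c * (b - d)"] sn_mult[of "a - c" b] sn_mult[of c "b - d"] assms by simp
qed

lemma CS_mult: "s \<in> CS \<Longrightarrow> t \<in> CS \<Longrightarrow> (\<lambda>n. s n * t n) \<in> CS"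
proof -
  assume s: "s \<in> CS" and t: "t \<in> CS"
  obtain C where C: "0 \<le> C" "\<And>n. N (s n) \<le> C" using CS_bounded[OF s] by blast
  obtain D where D: "0 \<le> D" "\<And>n. N (t n) \<le> D" using CS_bounded[OF t] by blast
  show ?thesis
  proof (rule CS_dominated[OF s t, where C = "C + D"])
    fix m n
    have "N (s m * t m - s n * t n) \<le> N (s m - s n) * N (t m) + N (s n) * N (t m - t n)"
      by (rule N_mult_diff) (simp_all add: CS_free[OF s] CS_free[OF t])
    also have "\<dots> \<le> N (s m - s n) * (C + D) + (C + D) * N (t m - t n)"
      using C D add_mono[OF C(2)[of n] D(1)] add_mono[OF C(1) D(2)[of m]]
      by (intro add_mono mult_left_mono mult_right_mono sn_nonneg) (simp_all add: CS_free[OF s] CS_free[OF t])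
    finally show "N (s m * t m - s n * t n) \<le> (C + D) * (N (s m - s n) + N (t m - t n))"
      by (simp add: algebra_simps)
  qed (use C D CS_free[OF s] CS_free[OF t] in simp_all)
qed

lemma null_rel_iff: "(s, t) \<in> null_rel G R \<longleftrightarrow> s \<in> CS \<and> t \<in> CS \<and> (\<lambda>n. N (s n - t n)) \<longlonglongrightarrow> 0"
  by (simp add: null_rel_def)

lemma null_squeeze:
  assumes "\<And>n. 0 \<le> f n" "\<And>n. f n \<le> g n" "g \<longlonglongrightarrow> 0" shows "f \<longlonglongrightarrow> (0::real)"
  by (rule tendsto_sandwich[OF _ _ tendsto_const assms(3)]) (simp_all add: assms(1,2))

lemma equiv_null: "equiv CS (null_rel G R)"
proof (rule equivI)
  show "null_rel G R \<subseteq> CS \<times> CS" by (auto simp: null_rel_def)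
  show "refl_on CS (null_rel G R)" by (rule refl_onI) (simp_all add: null_rel_iff)
  show "sym (null_rel G R)"
  proof (rule symI)
    fix s t assume st: "(s, t) \<in> null_rel G R"
    then have "(\<lambda>n. N (s n - t n)) = (\<lambda>n. N (t n - s n))"
      using sn_comm CS_free unfolding null_rel_iff by blast
    then show "(t, s) \<in> null_rel G R" using st by (simp add: null_rel_iff)
  qed
  show "trans (null_rel G R)"
  proof (rule transI)
    fix s t u assume st: "(s, t) \<in> null_rel G R" and tu: "(t, u) \<in> null_rel G R"
    then have lim: "(\<lambda>n. N (s n - t n) + N (t n - u n)) \<longlonglongrightarrow> 0"
      unfolding null_rel_iff using tendsto_add[of "\<lambda>n. N (s n - t n)" 0 _ "\<lambda>n. N (t n - u n)" 0] by simp
    have "0 \<le> N (s n - u n)" "N (s n - u n) \<le> N (s n - t n) + N (t n - u n)" for n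
      using st tu sn_triangle[of "s n" "t n" "u n"] sn_nonneg[of "s n - u n"] CS_free[of s n] CS_free[of t n] CS_free[of u n]
      by (simp_all add: null_rel_iff)
    then have "(\<lambda>n. N (s n - u n)) \<longlonglongrightarrow> 0" using lim by (rule null_squeeze)
    then show "(s, u) \<in> null_rel G R" using st tu by (simp add: null_rel_iff)
  qed
qed

lemma cls_eq: "s \<in> CS \<Longrightarrow> t \<in> CS \<Longrightarrow> cls s = cls t \<longleftrightarrow> (\<lambda>n. N (s n - t n)) \<longlonglongrightarrow> 0"
  using eq_equiv_class_iff[OF equiv_null] by (simp add: null_rel_iff)

lemma carrier_U: "carrier U = CS // null_rel G R"
  by (simp add: universal_cstar_def)

lemma cls_carrier [simp]: "s \<in> CS \<Longrightarrow> cls s \<in> carrier U"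
  by (simp add: carrier_U quotientI)

lemma carrier_cls: "X \<in> carrier U \<Longrightarrow> (\<And>s. s \<in> CS \<Longrightarrow> X = cls s \<Longrightarrow> thesis) \<Longrightarrow> thesis"
  unfolding carrier_U by (erule quotientE) blast

lemma U_add: assumes s: "s \<in> CS" and t: "t \<in> CS" shows "cls s \<oplus>\<^bsub>U\<^esub> cls t = cls (\<lambda>n. s n + t n)"
proof -
  have "congruent2 (null_rel G R) (null_rel G R) (\<lambda>s t. cls (\<lambda>n. s n + t n))"
  proof (rule congruent2I'[OF], unfold null_rel_iff, elim conjE)
    fix s s' t t' assume *: "s \<in> CS" "s' \<in> CS" "t \<in> CS" "t' \<in> CS"
      "(\<lambda>n. N (s n - s' n)) \<longlonglongrightarrow> 0" "(\<lambda>n. N (t n - t' n)) \<longlonglongrightarrow> 0"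
    have "(\<lambda>n. N (s n + t n - (s' n + t' n))) \<longlonglongrightarrow> 0"
    proof (rule null_squeeze)
      show "N (s n + t n - (s' n + t' n)) \<le> N (s n - s' n) + N (t n - t' n)" for n
        using sn_add[of "s n - s' n" "t n - t' n"] *(1-4)[THEN CS_free] by (simp add: algebra_simps)
      show "(\<lambda>n. N (s n - s' n) + N (t n - t' n)) \<longlonglongrightarrow> 0" using tendsto_add[OF *(5,6)] by simp
    qed (use *(1-4)[THEN CS_free] sn_nonneg in simp)
    then show "cls (\<lambda>n. s n + t n) = cls (\<lambda>n. s' n + t' n)" using * by (simp add: cls_eq CS_add)
  qed
  from UN_equiv_class2[OF equiv_null equiv_null this s t] show ?thesis
    by (simp add: universal_cstar_def)
qed

lemma U_mult: assumes s: "s \<in> CS" and t: "t \<in> CS" shows "cls s \<otimes>\<^bsub>U\<^esub> cls t = cls (\<lambda>n. s n * t n)"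
proof -
  have "congruent2 (null_rel G R) (null_rel G R) (\<lambda>s t. cls (\<lambda>n. s n * t n))"
  proof (rule congruent2I'[OF], unfold null_rel_iff, elim conjE)
    fix s s' t t' assume *: "s \<in> CS" "s' \<in> CS" "t \<in> CS" "t' \<in> CS"
      "(\<lambda>n. N (s n - s' n)) \<longlonglongrightarrow> 0" "(\<lambda>n. N (t n - t' n)) \<longlonglongrightarrow> 0"
    obtain C where C: "\<And>n. N (s' n) \<le> C" using CS_bounded[OF *(2)] by blast
    obtain D where D: "\<And>n. N (t n) \<le> D" using CS_bounded[OF *(3)] by blast
    have "(\<lambda>n. N (s n * t n - s' n * t' n)) \<longlonglongrightarrow> 0"
    proof (rule null_squeeze)
      fix n
      have "N (s n * t n - s' n * t' n) \<le> N (s n - s' n) * N (t n) + N (s' n) * N (t n - t' n)"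
        by (rule N_mult_diff) (simp_all add: *(1-4)[THEN CS_free])
      also have "\<dots> \<le> N (s n - s' n) * D + C * N (t n - t' n)"
        by (intro add_mono mult_left_mono mult_right_mono C D sn_nonneg) (simp_all add: *(1-4)[THEN CS_free])
      finally show "N (s n * t n - s' n * t' n) \<le> N (s n - s' n) * D + C * N (t n - t' n)" .
      show "(\<lambda>n. N (s n - s' n) * D + C * N (t n - t' n)) \<longlonglongrightarrow> 0"
        using tendsto_add[OF tendsto_mult_left_zero[OF *(5)] tendsto_mult_right_zero[OF *(6)]] by simp
    qed (use *(1-4)[THEN CS_free] sn_nonneg in simp)
    then show "cls (\<lambda>n. s n * t n) = cls (\<lambda>n. s' n * t' n)" using * by (simp add: cls_eq CS_mult)
  qed
  from UN_equiv_class2[OF equiv_null equiv_null this s t] show ?thesis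
    by (simp add: universal_cstar_def)
qed

lemma scale_diff: "poly_scale c a - poly_scale c b = poly_scale c (a - b)"
  by (rule poly_mapping_eqI) (simp add: lookup_minus algebra_simps)

lemma U_smult: assumes s: "s \<in> CS" shows "c \<odot>\<^bsub>U\<^esub> cls s = cls (\<lambda>n. poly_scale c (s n))"
proof -
  have "congruent (null_rel G R) (\<lambda>s. cls (\<lambda>n. poly_scale c (s n)))"
  proof (rule congruentI, unfold null_rel_iff, elim conjE)
    fix s s' assume *: "s \<in> CS" "s' \<in> CS" "(\<lambda>n. N (s n - s' n)) \<longlonglongrightarrow> 0"
    have "(\<lambda>n. N (poly_scale c (s n) - poly_scale c (s' n))) \<longlonglongrightarrow> 0"
      using tendsto_mult_right_zero[OF *(3), of "cmod c"] *(1,2)[THEN CS_free] by (simp add: scale_diff sn_scale)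
    then show "cls (\<lambda>n. poly_scale c (s n)) = cls (\<lambda>n. poly_scale c (s' n))" using * by (simp add: cls_eq CS_scale)
  qed
  from UN_equiv_class[OF equiv_null this s] show ?thesis by (simp add: universal_cstar_def)
qed

lemma U_adj: assumes s: "s \<in> CS" shows "(cls s)\<^sup>\<star>\<^bsub>U\<^esub> = cls (\<lambda>n. poly_adj (s n))"
proof -
  have "congruent (null_rel G R) (\<lambda>s. cls (\<lambda>n. poly_adj (s n)))"
  proof (rule congruentI, unfold null_rel_iff, elim conjE)
    fix s s' assume *: "s \<in> CS" "s' \<in> CS" "(\<lambda>n. N (s n - s' n)) \<longlonglongrightarrow> 0"
    have "(\<lambda>n. N (poly_adj (s n) - poly_adj (s' n))) \<longlonglongrightarrow> 0"
      using *(3) *(1,2)[THEN CS_free] by (simp flip: poly_adj_diff add: sn_adj)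
    then show "cls (\<lambda>n. poly_adj (s n)) = cls (\<lambda>n. poly_adj (s' n))" using * by (simp add: cls_eq CS_adj)
  qed
  from UN_equiv_class[OF equiv_null this s] show ?thesis by (simp add: universal_cstar_def)
qed

lemma U_zero: "\<zero>\<^bsub>U\<^esub> = cls (\<lambda>n. 0)"
  by (simp add: universal_cstar_def)

text \<open>The norm is defined through an arbitrary representative; the limit does not depend on its
  choice.\<close>

lemma U_norm: assumes s: "s \<in> CS" shows "(\<lambda>n. N (s n)) \<longlonglongrightarrow> \<parallel>cls s\<parallel>\<^bsub>U\<^esub>"
proof -
  define t where "t = (SOME t. t \<in> cls s)"
  have "s \<in> cls s" using s by (simp add: null_rel_iff)
  then have "t \<in> cls s" unfolding t_def by (rule someI[of "\<lambda>t. t \<in> cls s"])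
  then have t: "t \<in> CS" and st: "(\<lambda>n. N (s n - t n)) \<longlonglongrightarrow> 0" by (auto simp: null_rel_iff)
  have "(\<lambda>n. N (t n)) \<longlonglongrightarrow> \<parallel>cls s\<parallel>\<^bsub>U\<^esub>"
    using CS_convergent[OF t] by (simp add: universal_cstar_def t_def convergent_LIMSEQ_iff)
  moreover have "(\<lambda>n. N (s n) - N (t n)) \<longlonglongrightarrow> 0"
    by (rule tendsto_rabs_zero_cancel, rule null_squeeze[OF _ _ st])
      (use sn_bound CS_free[OF s] CS_free[OF t] in simp_all)
  ultimately show ?thesis using tendsto_add[of "\<lambda>n. N (s n) - N (t n)" 0 _ "\<lambda>n. N (t n)"] by simp
qed

lemma U_norm_const: "a \<in> FG \<Longrightarrow> \<parallel>cls (\<lambda>n. a)\<parallel>\<^bsub>U\<^esub> = N a"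
  using U_norm[OF CS_const, of a] by (simp add: LIMSEQ_const_iff)

lemmas U_ops = U_add U_mult U_smult U_adj U_zero CS_add CS_mult CS_scale CS_adj CS_const

lemma abelian_group_U: "abelian_group U"
proof (rule abelian_groupI)
  show "\<exists>y\<in>carrier U. y \<oplus>\<^bsub>U\<^esub> x = \<zero>\<^bsub>U\<^esub>" if x: "x \<in> carrier U" for x
  proof -
    obtain s where s: "s \<in> CS" "x = cls s" by (rule carrier_cls[OF x])
    have "cls (\<lambda>n. poly_scale (-1) (s n)) \<oplus>\<^bsub>U\<^esub> x = cls (\<lambda>n. poly_scale (-1) (s n) + s n)"
      using s by (simp add: U_add CS_scale)
    also have "\<dots> = \<zero>\<^bsub>U\<^esub>" by (simp add: U_zero poly_scale_minus)
    finally have "cls (\<lambda>n. poly_scale (-1) (s n)) \<oplus>\<^bsub>U\<^esub> x = \<zero>\<^bsub>U\<^esub>" .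
    then show ?thesis using s by (intro bexI[of _ "cls (\<lambda>n. poly_scale (-1) (s n))"]) (simp_all add: CS_scale)
  qed
qed (auto elim!: carrier_cls simp: U_ops add_ac)

lemma U_uminus: "s \<in> CS \<Longrightarrow> \<ominus>\<^bsub>U\<^esub> cls s = cls (\<lambda>n. - s n)"
proof -
  assume s: "s \<in> CS"
  interpret abelian_group U by (rule abelian_group_U)
  have m: "(\<lambda>n. - s n) \<in> CS" using CS_scale[OF s, of "-1"] by (simp add: poly_scale_minus)
  show ?thesis using s m by (intro minus_equality) (simp_all add: U_ops)
qed

lemma CS_diff: "s \<in> CS \<Longrightarrow> t \<in> CS \<Longrightarrow> (\<lambda>n. s n - t n) \<in> CS"
  using CS_add[OF _ CS_scale[of t "-1"], of s] by (simp add: poly_scale_minus)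

lemma U_diff: "s \<in> CS \<Longrightarrow> t \<in> CS \<Longrightarrow> cls s \<ominus>\<^bsub>U\<^esub> cls t = cls (\<lambda>n. s n - t n)"
  using CS_scale[of t "-1"] by (simp add: a_minus_def U_uminus U_add poly_scale_minus)

lemma U_norm_add: "x \<in> carrier U \<Longrightarrow> y \<in> carrier U \<Longrightarrow> \<parallel>x \<oplus>\<^bsub>U\<^esub> y\<parallel>\<^bsub>U\<^esub> \<le> \<parallel>x\<parallel>\<^bsub>U\<^esub> + \<parallel>y\<parallel>\<^bsub>U\<^esub>"
proof (elim carrier_cls)
  fix s t assume *: "s \<in> CS" "x = cls s" "t \<in> CS" "y = cls t"
  have "(\<lambda>n. N (s n + t n)) \<longlonglongrightarrow> \<parallel>x \<oplus>\<^bsub>U\<^esub> y\<parallel>\<^bsub>U\<^esub>" using U_norm[OF CS_add[OF *(1,3)]] * by (simp add: U_add)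
  moreover have "N (s n + t n) \<le> N (s n) + N (t n)" for n using *(1,3)[THEN CS_free] by (rule sn_add)
  ultimately show ?thesis
    using LIMSEQ_le[OF _ tendsto_add[OF U_norm[OF *(1)] U_norm[OF *(3)]]] unfolding *(2,4) by blast
qed

lemma U_approx:
  assumes s: "s \<in> CS" shows "(\<lambda>n. \<parallel>cls (\<lambda>_. s n) \<ominus>\<^bsub>U\<^esub> cls s\<parallel>\<^bsub>U\<^esub>) \<longlonglongrightarrow> 0"
proof (rule LIMSEQ_I)
  fix e :: real assume e: "0 < e"
  obtain M where M: "\<forall>m\<ge>M. \<forall>n\<ge>M. N (s m - s n) < e / 2" using CS_D[OF s, of "e/2"] e by (metis half_gt_zero)
  have "norm (\<parallel>cls (\<lambda>_. s n) \<ominus>\<^bsub>U\<^esub> cls s\<parallel>\<^bsub>U\<^esub> - 0) < e" if n: "n \<ge> M" for n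
  proof -
    have c: "(\<lambda>k. s n) \<in> CS" using CS_const CS_free[OF s] by blast
    note l = U_norm[OF CS_diff[OF c s]]
    have "\<parallel>cls (\<lambda>_. s n) \<ominus>\<^bsub>U\<^esub> cls s\<parallel>\<^bsub>U\<^esub> \<le> e / 2"
      unfolding U_diff[OF c s] by (rule LIMSEQ_le_const2[OF l]) (use M n in \<open>force intro: less_imp_le\<close>)
    moreover have "0 \<le> \<parallel>cls (\<lambda>_. s n) \<ominus>\<^bsub>U\<^esub> cls s\<parallel>\<^bsub>U\<^esub>"
      unfolding U_diff[OF c s] by (rule LIMSEQ_le_const[OF l]) (use CS_free[OF s] sn_nonneg in simp)
    ultimately show ?thesis using e by simp
  qed
  then show "\<exists>M. \<forall>n\<ge>M. norm (\<parallel>cls (\<lambda>_. s n) \<ominus>\<^bsub>U\<^esub> cls s\<parallel>\<^bsub>U\<^esub> - 0) < e" by blast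
qed

text \<open>Approximate the \<open>n\<close>-th class up to \<open>1 / (n + 1)\<close> by a constant sequence,
  that is, by a polynomial; these polynomials form a representative of the limit.\<close>

lemma U_complete:
  assumes X: "range X \<subseteq> carrier U"
    and C: "\<And>e. e > 0 \<Longrightarrow> \<exists>M. \<forall>m\<ge>M. \<forall>n\<ge>M. \<parallel>X m \<ominus>\<^bsub>U\<^esub> X n\<parallel>\<^bsub>U\<^esub> < e"
  shows "\<exists>x\<in>carrier U. (\<lambda>n. \<parallel>X n \<ominus>\<^bsub>U\<^esub> x\<parallel>\<^bsub>U\<^esub>) \<longlonglongrightarrow> 0"
proof -
  interpret ag: abelian_group U by (rule abelian_group_U)
  have tri: "\<parallel>x \<ominus>\<^bsub>U\<^esub> z\<parallel>\<^bsub>U\<^esub> \<le> \<parallel>x \<ominus>\<^bsub>U\<^esub> y\<parallel>\<^bsub>U\<^esub> + \<parallel>y \<ominus>\<^bsub>U\<^esub> z\<parallel>\<^bsub>U\<^esub>"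
    if "x \<in> carrier U" "y \<in> carrier U" "z \<in> carrier U" for x y z
  proof -
    have "x \<ominus>\<^bsub>U\<^esub> z = (x \<ominus>\<^bsub>U\<^esub> y) \<oplus>\<^bsub>U\<^esub> (y \<ominus>\<^bsub>U\<^esub> z)"
      using that by (simp add: ag.minus_eq ag.a_assoc ag.r_neg1)
    then show ?thesis using U_norm_add[of "x \<ominus>\<^bsub>U\<^esub> y" "y \<ominus>\<^bsub>U\<^esub> z"] that by simp
  qed
  have nn: "0 \<le> \<parallel>x\<parallel>\<^bsub>U\<^esub>" if x: "x \<in> carrier U" for x
  proof -
    obtain s where s: "s \<in> CS" "x = cls s" by (rule carrier_cls[OF x])
    show ?thesis unfolding s(2) by (rule LIMSEQ_le_const[OF U_norm[OF s(1)]]) (use CS_free[OF s(1)] sn_nonneg in simp)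
  qed
  have com: "\<parallel>x \<ominus>\<^bsub>U\<^esub> y\<parallel>\<^bsub>U\<^esub> = \<parallel>y \<ominus>\<^bsub>U\<^esub> x\<parallel>\<^bsub>U\<^esub>" if x: "x \<in> carrier U" and y: "y \<in> carrier U" for x y
  proof -
    obtain s where s: "s \<in> CS" "x = cls s" by (rule carrier_cls[OF x])
    obtain t where t: "t \<in> CS" "y = cls t" by (rule carrier_cls[OF y])
    have "(\<lambda>n. N (s n - t n)) = (\<lambda>n. N (t n - s n))" using sn_comm[OF CS_free[OF s(1)] CS_free[OF t(1)]] by simp
    then show ?thesis
      using U_norm[OF CS_diff[OF s(1) t(1)]] U_norm[OF CS_diff[OF t(1) s(1)]] s t
      by (simp add: U_diff LIMSEQ_unique)
  qed
  have "\<exists>a. a \<in> FG \<and> \<parallel>cls (\<lambda>_. a) \<ominus>\<^bsub>U\<^esub> X k\<parallel>\<^bsub>U\<^esub> < 1 / real (Suc k)" for k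
  proof -
    have "X k \<in> carrier U" using X by blast
    then obtain s where s: "s \<in> CS" "X k = cls s" by (rule carrier_cls)
    have "0 < 1 / real (Suc k)" by simp
    from LIMSEQ_D[OF U_approx[OF s(1)] this] obtain n where
      "norm (\<parallel>cls (\<lambda>_. s n) \<ominus>\<^bsub>U\<^esub> cls s\<parallel>\<^bsub>U\<^esub> - 0) < 1 / real (Suc k)" by blast
    then show ?thesis using s CS_free[OF s(1), of n] by (intro exI[of _ "s n"]) simp
  qed
  then obtain a where a: "\<And>k. a k \<in> FG" "\<And>k. \<parallel>cls (\<lambda>_. a k) \<ominus>\<^bsub>U\<^esub> X k\<parallel>\<^bsub>U\<^esub> < 1 / real (Suc k)" by metis
  have ca: "cls (\<lambda>_. a k) \<in> carrier U" for k using a CS_const by simp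
  have XU: "X k \<in> carrier U" for k using X by (simp add: image_subset_iff)
  have "a \<in> CS" unfolding cauchy_seqs_def
  proof (intro CollectI conjI allI impI a)
    fix e :: real assume e: "0 < e"
    have e3: "0 < e / 3" using e by simp
    from C[OF e3] obtain M1 where M1: "\<forall>m\<ge>M1. \<forall>n\<ge>M1. \<parallel>X m \<ominus>\<^bsub>U\<^esub> X n\<parallel>\<^bsub>U\<^esub> < e / 3" by blast
    obtain M2 where M2: "1 / real (Suc M2) < e / 3" by (rule nat_approx_posE[OF e3])
    show "\<exists>M. \<forall>m\<ge>M. \<forall>n\<ge>M. N (a m - a n) < e"
    proof (intro exI[of _ "max M1 M2"] allI impI)
      fix m n assume mn: "max M1 M2 \<le> m" "max M1 M2 \<le> n"
      have le: "1 / real (Suc k) \<le> 1 / real (Suc M2)" if "M2 \<le> k" for k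
        using that by (intro divide_left_mono) simp_all
      have 1: "N (a m - a n) = \<parallel>cls (\<lambda>_. a m) \<ominus>\<^bsub>U\<^esub> cls (\<lambda>_. a n)\<parallel>\<^bsub>U\<^esub>"
        using a by (simp add: U_diff CS_const U_norm_const)
      have 2: "\<parallel>cls (\<lambda>_. a m) \<ominus>\<^bsub>U\<^esub> cls (\<lambda>_. a n)\<parallel>\<^bsub>U\<^esub> \<le>
          \<parallel>cls (\<lambda>_. a m) \<ominus>\<^bsub>U\<^esub> X m\<parallel>\<^bsub>U\<^esub> + \<parallel>X m \<ominus>\<^bsub>U\<^esub> cls (\<lambda>_. a n)\<parallel>\<^bsub>U\<^esub>" by (rule tri[OF ca XU ca])
      have 3: "\<parallel>X m \<ominus>\<^bsub>U\<^esub> cls (\<lambda>_. a n)\<parallel>\<^bsub>U\<^esub> \<le>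
          \<parallel>X m \<ominus>\<^bsub>U\<^esub> X n\<parallel>\<^bsub>U\<^esub> + \<parallel>X n \<ominus>\<^bsub>U\<^esub> cls (\<lambda>_. a n)\<parallel>\<^bsub>U\<^esub>" by (rule tri[OF XU XU ca])
      have 4: "\<parallel>cls (\<lambda>_. a n) \<ominus>\<^bsub>U\<^esub> X n\<parallel>\<^bsub>U\<^esub> = \<parallel>X n \<ominus>\<^bsub>U\<^esub> cls (\<lambda>_. a n)\<parallel>\<^bsub>U\<^esub>" by (rule com[OF ca XU])
      have 5: "\<parallel>X m \<ominus>\<^bsub>U\<^esub> X n\<parallel>\<^bsub>U\<^esub> < e / 3" using M1 mn by simp
      have 6: "1 / real (Suc m) \<le> 1 / real (Suc M2)" "1 / real (Suc n) \<le> 1 / real (Suc M2)"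
        using le mn by simp_all
      show "N (a m - a n) < e"
        using 1 2 3 4 5 6 a(2)[of m] a(2)[of n] M2 by linarith
    qed
  qed
  have "(\<lambda>n. \<parallel>X n \<ominus>\<^bsub>U\<^esub> cls a\<parallel>\<^bsub>U\<^esub>) \<longlonglongrightarrow> 0"
  proof (rule null_squeeze)
    show "\<parallel>X n \<ominus>\<^bsub>U\<^esub> cls a\<parallel>\<^bsub>U\<^esub> \<le> 1 / real (Suc n) + \<parallel>cls (\<lambda>_. a n) \<ominus>\<^bsub>U\<^esub> cls a\<parallel>\<^bsub>U\<^esub>" for n
    proof -
      have "\<parallel>X n \<ominus>\<^bsub>U\<^esub> cls a\<parallel>\<^bsub>U\<^esub> \<le> \<parallel>X n \<ominus>\<^bsub>U\<^esub> cls (\<lambda>_. a n)\<parallel>\<^bsub>U\<^esub> + \<parallel>cls (\<lambda>_. a n) \<ominus>\<^bsub>U\<^esub> cls a\<parallel>\<^bsub>U\<^esub>"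
        by (rule tri[OF XU ca cls_carrier[OF \<open>a \<in> CS\<close>]])
      moreover have "\<parallel>cls (\<lambda>_. a n) \<ominus>\<^bsub>U\<^esub> X n\<parallel>\<^bsub>U\<^esub> = \<parallel>X n \<ominus>\<^bsub>U\<^esub> cls (\<lambda>_. a n)\<parallel>\<^bsub>U\<^esub>" by (rule com[OF ca XU])
      ultimately show ?thesis using a(2)[of n] by linarith
    qed
    show "(\<lambda>n. 1 / real (Suc n) + \<parallel>cls (\<lambda>_. a n) \<ominus>\<^bsub>U\<^esub> cls a\<parallel>\<^bsub>U\<^esub>) \<longlonglongrightarrow> 0"
      using tendsto_add[OF LIMSEQ_Suc[OF lim_1_over_n] U_approx[OF \<open>a \<in> CS\<close>]] by simp
    show "0 \<le> \<parallel>X n \<ominus>\<^bsub>U\<^esub> cls a\<parallel>\<^bsub>U\<^esub>" for n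
      by (intro nn ag.minus_closed XU cls_carrier[OF \<open>a \<in> CS\<close>])
  qed
  then show ?thesis using cls_carrier[OF \<open>a \<in> CS\<close>] by blast
qed

lemma cring_complex: "cring complex_ring"
proof (rule cringI)
  show "abelian_group complex_ring"
    by (rule abelian_groupI) (auto simp: algebra_simps intro: exI[of _ "- x" for x])
  show "comm_monoid complex_ring"
    by (rule comm_monoidI) (auto simp: algebra_simps)
qed (simp add: algebra_simps)

lemma U_mult_norm: "x \<in> carrier U \<Longrightarrow> y \<in> carrier U \<Longrightarrow> \<parallel>x \<otimes>\<^bsub>U\<^esub> y\<parallel>\<^bsub>U\<^esub> \<le> \<parallel>x\<parallel>\<^bsub>U\<^esub> * \<parallel>y\<parallel>\<^bsub>U\<^esub>"
proof (elim carrier_cls)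
  fix s t assume *: "s \<in> CS" "x = cls s" "t \<in> CS" "y = cls t"
  have "(\<lambda>n. N (s n * t n)) \<longlonglongrightarrow> \<parallel>x \<otimes>\<^bsub>U\<^esub> y\<parallel>\<^bsub>U\<^esub>" using U_norm[OF CS_mult[OF *(1,3)]] * by (simp add: U_mult)
  moreover have "N (s n * t n) \<le> N (s n) * N (t n)" for n using *(1,3)[THEN CS_free] by (rule sn_mult)
  ultimately show ?thesis
    using LIMSEQ_le[OF _ tendsto_mult[OF U_norm[OF *(1)] U_norm[OF *(3)]]] unfolding *(2,4) by blast
qed

lemma cstar_algebra_U: "cstar_algebra U"
proof (intro cstar_algebra.intro cstar_algebra_axioms.intro)
  show "Module.module complex_ring U"
    by (rule moduleI[OF cring_complex abelian_group_U])
      (auto elim!: carrier_cls simp: U_ops poly_scale_add poly_scale_add_left)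
  fix x assume x: "x \<in> carrier U"
  then obtain s where s: "s \<in> CS" "x = cls s" by (rule carrier_cls)
  show "(\<parallel>x\<parallel>\<^bsub>U\<^esub> = 0) = (x = \<zero>\<^bsub>U\<^esub>)"
    using s U_norm[OF s(1)] by (auto simp: U_zero cls_eq CS_const LIMSEQ_unique)
  show "\<parallel>c \<odot>\<^bsub>U\<^esub> x\<parallel>\<^bsub>U\<^esub> = cmod c * \<parallel>x\<parallel>\<^bsub>U\<^esub>" for c
    using LIMSEQ_unique[OF U_norm[OF CS_scale[OF s(1), of c]]] tendsto_mult_left[OF U_norm[OF s(1)], of "cmod c"] s CS_free[OF s(1)]
    by (simp add: U_smult sn_scale)
  show "\<parallel>x\<^sup>\<star>\<^bsub>U\<^esub> \<otimes>\<^bsub>U\<^esub> x\<parallel>\<^bsub>U\<^esub> = (\<parallel>x\<parallel>\<^bsub>U\<^esub>)\<^sup>2"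
    using LIMSEQ_unique[OF U_norm[OF CS_mult[OF CS_adj[OF s(1)] s(1)]]] tendsto_power[OF U_norm[OF s(1)], of 2] s CS_free[OF s(1)]
    by (simp add: U_adj U_mult CS_adj sn_star)
next
  show "\<And>s. range s \<subseteq> carrier U \<Longrightarrow> (\<And>e. e > 0 \<Longrightarrow> \<exists>M. \<forall>m\<ge>M. \<forall>n\<ge>M. \<parallel>s m \<ominus>\<^bsub>U\<^esub> s n\<parallel>\<^bsub>U\<^esub> < e) \<Longrightarrow>
      \<exists>x\<in>carrier U. (\<lambda>n. \<parallel>s n \<ominus>\<^bsub>U\<^esub> x\<parallel>\<^bsub>U\<^esub>) \<longlonglongrightarrow> 0" by (rule U_complete)
qed (auto elim!: carrier_cls simp: U_ops U_norm_add U_mult_norm algebra_simps poly_scale_add poly_adj_add poly_adj_mult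
  poly_adj_scale poly_scale_mult_left poly_scale_mult_right)

end

section \<open>Homomorphisms and generated subalgebras\<close>

locale star_hom = A: cstar_algebra A + B: cstar_algebra B
  for A :: "('a, 'm) cstar_scheme" and B :: "('b, 'n) cstar_scheme" +
  fixes h :: "'a \<Rightarrow> 'b"
  assumes hom: "h \<in> star_homs A B"
begin

lemma closed [simp, intro]: "x \<in> carrier A \<Longrightarrow> h x \<in> carrier B"
  and add: "x \<in> carrier A \<Longrightarrow> y \<in> carrier A \<Longrightarrow> h (x \<oplus>\<^bsub>A\<^esub> y) = h x \<oplus>\<^bsub>B\<^esub> h y"
  and scale: "x \<in> carrier A \<Longrightarrow> h (c \<odot>\<^bsub>A\<^esub> x) = c \<odot>\<^bsub>B\<^esub> h x"
  and mult: "x \<in> carrier A \<Longrightarrow> y \<in> carrier A \<Longrightarrow> h (x \<otimes>\<^bsub>A\<^esub> y) = h x \<otimes>\<^bsub>B\<^esub> h y"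
  and adj: "x \<in> carrier A \<Longrightarrow> h (x\<^sup>\<star>\<^bsub>A\<^esub>) = (h x)\<^sup>\<star>\<^bsub>B\<^esub>"
  and ext: "x \<notin> carrier A \<Longrightarrow> h x = undefined"
  using hom by (auto simp: star_homs_def PiE_def extensional_def)

lemma zero [simp]: "h \<zero>\<^bsub>A\<^esub> = \<zero>\<^bsub>B\<^esub>"
  using scale[of "\<zero>\<^bsub>A\<^esub>" 0] by simp

lemma diff: "x \<in> carrier A \<Longrightarrow> y \<in> carrier A \<Longrightarrow> h (x \<ominus>\<^bsub>A\<^esub> y) = h x \<ominus>\<^bsub>B\<^esub> h y"
  by (simp add: A.diff_sc B.diff_sc add scale)

lemma contractive: "x \<in> carrier A \<Longrightarrow> \<parallel>h x\<parallel>\<^bsub>B\<^esub> \<le> \<parallel>x\<parallel>\<^bsub>A\<^esub>"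
  by (rule star_hom_contractive[OF A.cstar_algebra_axioms B.cstar_algebra_axioms A.closed_star_subalgebra_carrier])
    (simp_all add: star_hom_on_def add scale mult adj)

lemma conv: assumes "conv A s x" shows "conv B (\<lambda>n. h (s n)) (h x)"
proof (rule B.conv_bound)
  note [simp] = A.convD(1,2)[OF assms]
  show "\<parallel>h (s n) \<ominus>\<^bsub>B\<^esub> h x\<parallel>\<^bsub>B\<^esub> \<le> \<parallel>s n \<ominus>\<^bsub>A\<^esub> x\<parallel>\<^bsub>A\<^esub>" for n
    using contractive[of "s n \<ominus>\<^bsub>A\<^esub> x"] by (simp add: diff)
  show "h (s n) \<in> carrier B" for n by simp
  show "h x \<in> carrier B" by simp
qed (rule A.convD(3)[OF assms])

lemma finsum: "finite I \<Longrightarrow> (\<And>i. i \<in> I \<Longrightarrow> f i \<in> carrier A) \<Longrightarrow>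
    h (\<Oplus>\<^bsub>A\<^esub>i\<in>I. f i) = (\<Oplus>\<^bsub>B\<^esub>i\<in>I. h (f i))"
proof (induction I rule: finite_induct)
  case (insert i I)
  then have "f \<in> I \<rightarrow> carrier A" "f i \<in> carrier A" "(\<lambda>i. h (f i)) \<in> I \<rightarrow> carrier B" by auto
  then show ?case using insert by (simp add: add)
qed simp

end

lemma star_homI:
  assumes "cstar_algebra A" "cstar_algebra B"
    and "\<And>x. x \<in> carrier A \<Longrightarrow> h x \<in> carrier B"
    and "\<And>x. x \<notin> carrier A \<Longrightarrow> h x = undefined"
    and "\<And>x y. x \<in> carrier A \<Longrightarrow> y \<in> carrier A \<Longrightarrow> h (x \<oplus>\<^bsub>A\<^esub> y) = h x \<oplus>\<^bsub>B\<^esub> h y"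
    and "\<And>c x. x \<in> carrier A \<Longrightarrow> h (c \<odot>\<^bsub>A\<^esub> x) = c \<odot>\<^bsub>B\<^esub> h x"
    and "\<And>x y. x \<in> carrier A \<Longrightarrow> y \<in> carrier A \<Longrightarrow> h (x \<otimes>\<^bsub>A\<^esub> y) = h x \<otimes>\<^bsub>B\<^esub> h y"
    and "\<And>x. x \<in> carrier A \<Longrightarrow> h (x\<^sup>\<star>\<^bsub>A\<^esub>) = (h x)\<^sup>\<star>\<^bsub>B\<^esub>"
  shows "star_hom A B h"
  unfolding star_hom_def star_hom_axioms_def star_homs_def PiE_def extensional_def
  using assms by simp

lemma star_hom_compose:
  assumes "star_hom A B h" "star_hom B C k"
  shows "star_hom A C (compose (carrier A) k h)"
proof -
  interpret h: star_hom A B h by fact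
  interpret k: star_hom B C k by fact
  show ?thesis
    by (rule star_homI[OF h.A.cstar_algebra_axioms k.B.cstar_algebra_axioms])
      (simp_all add: compose_def h.add h.scale h.mult h.adj k.add k.scale k.mult k.adj)
qed

text \<open>The closed *-subalgebra generated by a set, as an induction principle: what holds for the
  generators and is preserved by the operations and by limits holds everywhere.\<close>

inductive_set star_closure :: "('a, 'm) cstar_scheme \<Rightarrow> 'a set \<Rightarrow> 'a set" for A S where
  base: "x \<in> S \<Longrightarrow> x \<in> star_closure A S"
| zero: "\<zero>\<^bsub>A\<^esub> \<in> star_closure A S"
| add: "x \<in> star_closure A S \<Longrightarrow> y \<in> star_closure A S \<Longrightarrow> x \<oplus>\<^bsub>A\<^esub> y \<in> star_closure A S"
| scale: "x \<in> star_closure A S \<Longrightarrow> c \<odot>\<^bsub>A\<^esub> x \<in> star_closure A S"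
| mult: "x \<in> star_closure A S \<Longrightarrow> y \<in> star_closure A S \<Longrightarrow> x \<otimes>\<^bsub>A\<^esub> y \<in> star_closure A S"
| adj: "x \<in> star_closure A S \<Longrightarrow> x\<^sup>\<star>\<^bsub>A\<^esub> \<in> star_closure A S"
| lim: "(\<And>n. s n \<in> star_closure A S) \<Longrightarrow> conv A s x \<Longrightarrow> x \<in> star_closure A S"

inductive_set closed_ideal :: "('a, 'm) cstar_scheme \<Rightarrow> 'a set \<Rightarrow> 'a set" for A S where
  base: "x \<in> S \<Longrightarrow> x \<in> closed_ideal A S"
| zero: "\<zero>\<^bsub>A\<^esub> \<in> closed_ideal A S"
| add: "x \<in> closed_ideal A S \<Longrightarrow> y \<in> closed_ideal A S \<Longrightarrow> x \<oplus>\<^bsub>A\<^esub> y \<in> closed_ideal A S"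
| scale: "x \<in> closed_ideal A S \<Longrightarrow> c \<odot>\<^bsub>A\<^esub> x \<in> closed_ideal A S"
| left: "a \<in> carrier A \<Longrightarrow> x \<in> closed_ideal A S \<Longrightarrow> a \<otimes>\<^bsub>A\<^esub> x \<in> closed_ideal A S"
| right: "a \<in> carrier A \<Longrightarrow> x \<in> closed_ideal A S \<Longrightarrow> x \<otimes>\<^bsub>A\<^esub> a \<in> closed_ideal A S"
| lim: "(\<And>n. s n \<in> closed_ideal A S) \<Longrightarrow> conv A s x \<Longrightarrow> x \<in> closed_ideal A S"

context cstar_algebra
begin

lemma closed_ideal_carrier: "x \<in> closed_ideal A S \<Longrightarrow> S \<subseteq> carrier A \<Longrightarrow> x \<in> carrier A"
  by (induction rule: closed_ideal.induct) (auto simp: convD)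

lemma closed_ideal_diff:
  "x \<in> closed_ideal A S \<Longrightarrow> y \<in> closed_ideal A S \<Longrightarrow> S \<subseteq> carrier A \<Longrightarrow> x \<ominus> y \<in> closed_ideal A S"
  using closed_ideal.add[OF _ closed_ideal.scale[of y A S "-1"], of x] closed_ideal_carrier
  by (simp add: diff_sc)

lemma closed_ideal_adj:
  assumes "x \<in> closed_ideal A S" and S: "S \<subseteq> carrier A" and sa: "\<And>x. x \<in> S \<Longrightarrow> x\<^sup>\<star> \<in> S"
  shows "x\<^sup>\<star> \<in> closed_ideal A S"
  using assms(1)
proof (induction rule: closed_ideal.induct)
  case (add x y)
  then show ?case using closed_ideal_carrier S closed_ideal.add by (metis adj_add)
next
  case (scale x c)
  then show ?case using closed_ideal_carrier S closed_ideal.scale by (metis adj_smult)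
next
  case (left a x)
  then show ?case using closed_ideal_carrier S closed_ideal.right adj_closed by (metis adj_mult)
next
  case (right a x)
  then show ?case using closed_ideal_carrier S closed_ideal.left adj_closed by (metis adj_mult)
next
  case (lim s x)
  from lim.IH conv_adj[OF lim.hyps(2)] show ?case by (rule closed_ideal.lim)
qed (simp_all add: closed_ideal.zero closed_ideal.base sa)

end

lemma (in star_hom) closed_ideal_image:
  assumes "x \<in> closed_ideal A S" "S \<subseteq> carrier A" "\<And>x. x \<in> S \<Longrightarrow> h x \<in> closed_ideal B T"
  shows "h x \<in> closed_ideal B T"
  using assms(1)
proof (induction rule: closed_ideal.induct)
  case (lim s x)
  from lim.IH conv[OF lim.hyps(2)] show ?case by (rule closed_ideal.lim)
qed (use A.closed_ideal_carrier[OF _ assms(2)] in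
    \<open>simp_all add: assms(3) add scale mult closed_ideal.zero closed_ideal.add closed_ideal.scale
      closed_ideal.left closed_ideal.right\<close>)

lemma (in star_hom) closed_ideal_kernel:
  assumes "x \<in> closed_ideal A S" "S \<subseteq> carrier A" "\<And>x. x \<in> S \<Longrightarrow> h x = \<zero>\<^bsub>B\<^esub>"
  shows "h x = \<zero>\<^bsub>B\<^esub>"
  using assms(1)
proof (induction rule: closed_ideal.induct)
  case (lim s x)
  have "conv B (\<lambda>_. \<zero>\<^bsub>B\<^esub>) (h x)" using conv[OF lim.hyps(2)] unfolding lim.IH .
  from this B.conv_const[OF B.M.zero_closed] show ?case by (rule B.conv_unique)
qed (use A.closed_ideal_carrier[OF _ assms(2)] in \<open>simp_all add: assms(3) add scale mult\<close>)

text \<open>The coincidence set of two homomorphisms is a closed *-subalgebra, as homomorphisms are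
  continuous.\<close>

lemma star_hom_eqI:
  assumes "star_hom A B h" "star_hom A B k" "carrier A = star_closure A S" "\<And>x. x \<in> S \<Longrightarrow> h x = k x"
  shows "h = k"
proof
  interpret h: star_hom A B h by fact
  interpret k: star_hom A B k by fact
  fix x
  show "h x = k x"
  proof (cases "x \<in> carrier A")
    case True
    then have "x \<in> star_closure A S" using assms(3) by simp
    then show ?thesis
    proof (induction rule: star_closure.induct)
      case (lim s x)
      have "conv B (\<lambda>n. k (s n)) (h x)" using h.conv[OF lim.hyps(2)] unfolding lim.IH .
      from this k.conv[OF lim.hyps(2)] show ?case by (rule h.B.conv_unique)
    qed (simp_all add: assms(3)[symmetric] assms(4) h.add k.add h.scale k.scale h.mult k.mult h.adj k.adj)
  qed (simp add: h.ext k.ext)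
qed

section \<open>Evaluation of *-polynomials and the universal property\<close>

definition letter :: "('a, 'm) cstar_scheme \<Rightarrow> ('g \<Rightarrow> 'a) \<Rightarrow> 'g \<times> bool \<Rightarrow> 'a" where
  "letter A f l = (if snd l then (f (fst l))\<^sup>\<star>\<^bsub>A\<^esub> else f (fst l))"

text \<open>The empty word is not a monomial of the non-unital algebra; its value is junk.\<close>

fun word_prod :: "('a, 'm) cstar_scheme \<Rightarrow> ('g \<Rightarrow> 'a) \<Rightarrow> ('g \<times> bool) list \<Rightarrow> 'a" where
  "word_prod A f [] = \<zero>\<^bsub>A\<^esub>"
| "word_prod A f [l] = letter A f l"
| "word_prod A f (l # m # w) = letter A f l \<otimes>\<^bsub>A\<^esub> word_prod A f (m # w)"

definition poly_eval :: "('a, 'm) cstar_scheme \<Rightarrow> ('g \<Rightarrow> 'a) \<Rightarrow> 'g star_poly \<Rightarrow> 'a" where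
  "poly_eval A f a = (\<Oplus>\<^bsub>A\<^esub>w\<in>Poly_Mapping.keys a. Poly_Mapping.lookup a w \<odot>\<^bsub>A\<^esub> word_prod A f (letters w))"

text \<open>An assignment of elements of a C*-algebra to the generators; it extends to *-polynomials by
  evaluation.\<close>

locale valuation = cstar_algebra A for A :: "('a, 'm) cstar_scheme" (structure) +
  fixes G :: "'g set" and f :: "'g \<Rightarrow> 'a"
  assumes f_closed: "g \<in> G \<Longrightarrow> f g \<in> carrier A"
begin

abbreviation "ev \<equiv> poly_eval A f"
abbreviation "FG \<equiv> free_star_algebra G"

lemma letter_closed: "fst l \<in> G \<Longrightarrow> letter A f l \<in> carrier A"
  by (simp add: letter_def f_closed)

lemma word_prod_closed [simp]: "fst ` set w \<subseteq> G \<Longrightarrow> word_prod A f w \<in> carrier A"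
  by (induction w rule: induct_list012) (simp_all add: letter_closed)

lemma word_prod_append: "u \<noteq> [] \<Longrightarrow> v \<noteq> [] \<Longrightarrow> fst ` set u \<subseteq> G \<Longrightarrow> fst ` set v \<subseteq> G \<Longrightarrow>
    word_prod A f (u @ v) = word_prod A f u \<otimes> word_prod A f v"
proof (induction u)
  case (Cons l u)
  obtain m v' where v: "v = m # v'" using Cons.prems by (cases v) auto
  show ?case
  proof (cases u)
    case Nil
    then show ?thesis using v by simp
  next
    case (Cons k u')
    then have "word_prod A f ((l # u) @ v) = letter A f l \<otimes> word_prod A f (u @ v)" by simp
    also have "\<dots> = letter A f l \<otimes> (word_prod A f u \<otimes> word_prod A f v)"
      using Cons Cons.IH Cons.prems by simp
    also have "\<dots> = (letter A f l \<otimes> word_prod A f u) \<otimes> word_prod A f v"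
      using Cons.prems by (simp add: mult_assoc letter_closed)
    finally show ?thesis using Cons by simp
  qed
qed simp

lemma word_prod_adj: "fst ` set w \<subseteq> G \<Longrightarrow>
    word_prod A f (rev (map (\<lambda>(g, b). (g, \<not> b)) w)) = (word_prod A f w)\<^sup>\<star>"
proof (induction w)
  case (Cons l w)
  have l: "letter A f (case l of (g, b) \<Rightarrow> (g, \<not> b)) = (letter A f l)\<^sup>\<star>"
    using Cons.prems by (cases l) (simp add: letter_def f_closed)
  show ?case
  proof (cases w)
    case Nil
    then show ?thesis using l by simp
  next
    case (Cons m w')
    let ?r = "rev (map (\<lambda>(g, b). (g, \<not> b)) w)"
    have r: "?r \<noteq> []" using Cons by simp
    have rG: "fst ` set ?r \<subseteq> G" using Cons.prems by force
    have lG: "fst (case l of (g, b) \<Rightarrow> (g, \<not> b)) \<in> G" using Cons.prems by (cases l) simp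
    have "word_prod A f (rev (map (\<lambda>(g, b). (g, \<not> b)) (l # w))) = word_prod A f ?r \<otimes> (letter A f l)\<^sup>\<star>"
      using word_prod_append[OF r _ rG, of "[case l of (g, b) \<Rightarrow> (g, \<not> b)]"] lG l
      by (simp del: rev_map)
    also have "\<dots> = (word_prod A f w)\<^sup>\<star> \<otimes> (letter A f l)\<^sup>\<star>" using Cons.IH Cons.prems by simp
    also have "\<dots> = (letter A f l \<otimes> word_prod A f w)\<^sup>\<star>" using Cons.prems by (simp add: adj_mult letter_closed)
    finally show ?thesis using Cons by simp
  qed
qed simp

lemma ev_superset:
  assumes "finite S" "Poly_Mapping.keys a \<subseteq> S" "\<And>w. w \<in> S \<Longrightarrow> fst ` set (letters w) \<subseteq> G"
  shows "ev a = (\<Oplus>w\<in>S. Poly_Mapping.lookup a w \<odot> word_prod A f (letters w))"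
  unfolding poly_eval_def
  by (rule M.add.finprod_mono_neutral_cong_left) (use assms in \<open>auto simp: in_keys_iff\<close>)

lemma ev_closed [simp]: "a \<in> FG \<Longrightarrow> ev a \<in> carrier A"
  unfolding poly_eval_def by (rule M.finsum_closed) (auto simp: free_star_algebra_def)

lemma ev_zero [simp]: "ev 0 = \<zero>"
  by (simp add: poly_eval_def)

lemma ev_add: "a \<in> FG \<Longrightarrow> b \<in> FG \<Longrightarrow> ev (a + b) = ev a \<oplus> ev b"
proof -
  assume ab: "a \<in> FG" "b \<in> FG"
  define S where "S = Poly_Mapping.keys a \<union> Poly_Mapping.keys b"
  define W where "W w = word_prod A f (letters w)" for w
  have w: "fst ` set (letters w) \<subseteq> G" if "w \<in> S" for w
    using that ab by (auto simp: free_star_algebra_def S_def)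
  then have W: "W w \<in> carrier A" if "w \<in> S" for w using that by (simp add: W_def)
  have e: "ev c = finsum A (\<lambda>w. Poly_Mapping.lookup c w \<odot> W w) S" if "Poly_Mapping.keys c \<subseteq> S" for c
    unfolding W_def by (rule ev_superset[OF _ that w]) (simp_all add: S_def)
  have "ev (a + b) = finsum A (\<lambda>w. Poly_Mapping.lookup (a + b) w \<odot> W w) S"
    by (rule e) (simp add: S_def Poly_Mapping.keys_add)
  also have "\<dots> = finsum A (\<lambda>w. (Poly_Mapping.lookup a w \<odot> W w) \<oplus> (Poly_Mapping.lookup b w \<odot> W w)) S"
    by (rule M.finsum_cong') (use W in \<open>auto simp: lookup_add sc_add_left\<close>)
  also have "\<dots> = finsum A (\<lambda>w. Poly_Mapping.lookup a w \<odot> W w) S \<oplus> finsum A (\<lambda>w. Poly_Mapping.lookup b w \<odot> W w) S"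
    by (rule M.finsum_addf) (use W in auto)
  also have "\<dots> = ev a \<oplus> ev b"
    using e[of a] e[of b] by (simp add: S_def)
  finally show ?thesis .
qed

lemma ev_single: "fst ` set (letters w) \<subseteq> G \<Longrightarrow> ev (Poly_Mapping.single w c) = c \<odot> word_prod A f (letters w)"
  using ev_superset[of "{w}" "Poly_Mapping.single w c"] by (simp add: M.finsum_insert)

lemma ev_gen: "g \<in> G \<Longrightarrow> ev (gen g) = f g"
  unfolding gen_def by (subst ev_single) (simp_all add: letter_def f_closed)

lemma ev_scale: "a \<in> FG \<Longrightarrow> ev (poly_scale c a) = c \<odot> ev a"
proof (induction rule: free_star_induct)
  case (add a b)
  then show ?case by (simp add: poly_scale_add ev_add sc_add_right)
qed (simp_all add: ev_single)

lemma ev_uminus: "a \<in> FG \<Longrightarrow> ev (- a) = (- 1) \<odot> ev a"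
  using ev_scale[of a "-1"] by (simp add: poly_scale_minus)

lemma ev_diff: "a \<in> FG \<Longrightarrow> b \<in> FG \<Longrightarrow> ev (a - b) = ev a \<ominus> ev b"
  using ev_add[of a "- b"] by (simp add: ev_uminus diff_sc)

lemma ev_mult: "a \<in> FG \<Longrightarrow> b \<in> FG \<Longrightarrow> ev (a * b) = ev a \<otimes> ev b"
proof (induction a rule: free_star_induct)
  case (single u c)
  show ?case using single(3)
  proof (induction b rule: free_star_induct)
    case (single v d)
    have "letters u \<noteq> []" "letters v \<noteq> []"
      using \<open>u \<noteq> 0\<close> single(1) by (cases u; cases v; simp add: zero_word_def)+
    then have "word_prod A f (letters (u + v)) = word_prod A f (letters u) \<otimes> word_prod A f (letters v)"
      using \<open>fst ` set (letters u) \<subseteq> G\<close> single(2) by (simp add: plus_word_def word_prod_append)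
    moreover have "fst ` set (letters (u + v)) \<subseteq> G"
      using \<open>fst ` set (letters u) \<subseteq> G\<close> single(2) by (simp add: plus_word_def image_Un)
    ultimately show ?case
      using \<open>fst ` set (letters u) \<subseteq> G\<close> single(2)
      by (simp add: mult_single ev_single smult_mult_left smult_mult_right mult.commute[of d c])
  next
    case (add a b)
    have "Poly_Mapping.single u c \<in> FG" using \<open>u \<noteq> 0\<close> \<open>fst ` set (letters u) \<subseteq> G\<close> by (rule free_single)
    then show ?case using add by (simp add: distrib_left ev_add mult_distrib_left)
  qed (use \<open>fst ` set (letters u) \<subseteq> G\<close> in \<open>simp add: ev_single\<close>)
next
  case (add a b')
  then show ?case by (simp add: distrib_right ev_add mult_distrib_right)
qed simp

lemma ev_adj: "a \<in> FG \<Longrightarrow> ev (poly_adj a) = (ev a)\<^sup>\<star>"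
proof (induction rule: free_star_induct)
  case (single w c)
  have "fst ` set (letters (word_adj w)) \<subseteq> G" using single by (simp add: letters_word_adj)
  moreover have "word_prod A f (letters (word_adj w)) = (word_prod A f (letters w))\<^sup>\<star>"
    using word_prod_adj[OF single(2)] by (simp add: word_adj_def)
  ultimately show ?case using single by (simp add: ev_single adj_smult)
next
  case (add a b)
  then show ?case by (simp add: poly_adj_add ev_add adj_add)
qed simp

lemma ev_sum: "finite I \<Longrightarrow> (\<And>i. i \<in> I \<Longrightarrow> r i \<in> FG) \<Longrightarrow> ev (\<Sum>i\<in>I. r i) = (\<Oplus>i\<in>I. ev (r i))"
proof (induction I rule: finite_induct)
  case (insert i I)
  then have "(\<lambda>i. ev (r i)) \<in> I \<rightarrow> carrier A" "ev (r i) \<in> carrier A" by auto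
  moreover have "(\<Sum>i\<in>I. r i) \<in> FG" using insert by (simp add: free_sum)
  ultimately show ?case using insert by (simp add: ev_add)
qed simp

end

lemma (in star_hom) hom_ev:
  assumes "valuation A G f" "\<And>g. g \<in> G \<Longrightarrow> h (f g) = k g" "a \<in> free_star_algebra G"
  shows "h (poly_eval A f a) = poly_eval B k a"
proof -
  interpret v: valuation A G f by fact
  interpret w: valuation B G k
    by unfold_locales (simp flip: assms(2) add: v.f_closed)
  have l: "fst l \<in> G \<Longrightarrow> h (letter A f l) = letter B k l" for l
    by (simp add: letter_def adj v.f_closed assms(2))
  have wp: "fst ` set w \<subseteq> G \<Longrightarrow> h (word_prod A f w) = word_prod B k w" for w
    by (induction w rule: induct_list012) (simp_all add: l mult v.letter_closed)
  note h_add = add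
  show ?thesis using assms(3)
  proof (induction rule: free_star_induct)
    case (single w c)
    then show ?case by (simp add: v.ev_single w.ev_single scale wp)
  next
    case (add a b)
    then show ?case by (simp add: v.ev_add w.ev_add h_add)
  qed simp
qed

context cstar_presentation
begin

abbreviation "ugen \<equiv> universal_gen G R"

sublocale U: cstar_algebra U by (rule cstar_algebra_U)

sublocale ug: valuation U G ugen
  by unfold_locales (simp add: universal_gen_def CS_const free_gen)

lemma letter_ugen: "fst l \<in> G \<Longrightarrow> letter U ugen l = cls (\<lambda>n. Poly_Mapping.single (Word [l]) 1)"
proof -
  assume l: "fst l \<in> G"
  obtain g b where gb: "l = (g, b)" by (cases l)
  have "poly_adj (gen g) = Poly_Mapping.single (Word [(g, True)]) 1"
    by (simp add: gen_def word_adj_def)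
  then have "(cls (\<lambda>n. gen g))\<^sup>\<star>\<^bsub>U\<^esub> = cls (\<lambda>n. Poly_Mapping.single (Word [(g, True)]) 1)"
    using U_adj[OF CS_const[OF free_gen[of g]]] l gb by simp
  then show ?thesis using gb by (cases b) (simp_all add: letter_def universal_gen_def gen_def)
qed

lemma word_ugen: "w \<noteq> [] \<Longrightarrow> fst ` set w \<subseteq> G \<Longrightarrow>
    word_prod U ugen w = cls (\<lambda>n. Poly_Mapping.single (Word w) 1)"
proof (induction w rule: induct_list012)
  case (2 l)
  then show ?case by (simp add: letter_ugen)
next
  case (3 l m w)
  have "letter U ugen l = cls (\<lambda>n. Poly_Mapping.single (Word [l]) 1)"
    using 3(4) by (simp add: letter_ugen)
  moreover have "Poly_Mapping.single (Word [l]) 1 \<in> FG" "Poly_Mapping.single (Word (m # w)) 1 \<in> FG"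
    using 3(4) by (simp_all add: free_single zero_word_def)
  ultimately show ?case using 3 by (simp add: U_mult CS_const mult_single plus_word_def)
qed simp

text \<open>Evaluating a polynomial at the universal generators gives the class of the polynomial
  itself.\<close>

lemma ev_ugen: "a \<in> FG \<Longrightarrow> poly_eval U ugen a = cls (\<lambda>n. a)"
proof (induction rule: free_star_induct)
  case (single w c)
  then have "letters w \<noteq> []" by (cases w) (simp add: zero_word_def)
  moreover have "Poly_Mapping.single w 1 \<in> FG" using single by (rule free_single)
  ultimately show ?case using single word_ugen[of "letters w"]
    by (simp add: ug.ev_single U_smult CS_const)
next
  case (add a b)
  then show ?case by (simp add: ug.ev_add U_add CS_const)
qed (simp add: U_zero)

lemma N_ev: "a \<in> FG \<Longrightarrow> \<parallel>poly_eval U ugen a\<parallel>\<^bsub>U\<^esub> = N a"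
  by (simp add: ev_ugen U_norm_const)

lemma ev_relation: "r \<in> R \<Longrightarrow> poly_eval U ugen r = \<zero>\<^bsub>U\<^esub>"
proof -
  assume r: "r \<in> R"
  then have "r \<in> FG" using relations_free by blast
  then show ?thesis using N_ev[of r] N_relation[OF r] U.cnorm_eq_zero[of "poly_eval U ugen r"] by simp
qed

lemma U_dense:
  assumes "x \<in> carrier U"
  obtains s where "\<forall>n. s n \<in> FG" "conv U (\<lambda>n. poly_eval U ugen (s n)) x"
proof -
  obtain s where s: "s \<in> CS" "x = cls s" using assms by (rule carrier_cls)
  have "conv U (\<lambda>n. poly_eval U ugen (s n)) x"
    unfolding conv_def using U_approx[OF s(1)] s CS_free[OF s(1)] by (simp add: ev_ugen CS_const)
  moreover have "\<forall>n. s n \<in> FG" using CS_free[OF s(1)] by simp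
  ultimately show ?thesis using that by blast
qed

lemma U_generated: "carrier U = star_closure U (ugen ` G)"
proof
  have w: "w \<noteq> [] \<Longrightarrow> fst ` set w \<subseteq> G \<Longrightarrow> word_prod U ugen w \<in> star_closure U (ugen ` G)" for w
    by (induction w rule: induct_list012)
      (auto simp: letter_def intro: star_closure.base star_closure.adj star_closure.mult)
  have e: "a \<in> FG \<Longrightarrow> poly_eval U ugen a \<in> star_closure U (ugen ` G)" for a
  proof (induction rule: free_star_induct)
    case (single v c)
    then have "letters v \<noteq> []" by (cases v) (simp add: zero_word_def)
    then show ?case using single w by (simp add: ug.ev_single star_closure.scale)
  qed (simp_all add: ug.ev_add star_closure.zero star_closure.add)
  show "carrier U \<subseteq> star_closure U (ugen ` G)"
  proof
    fix x assume "x \<in> carrier U"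
    then obtain s where s: "\<forall>n. s n \<in> FG" "conv U (\<lambda>n. poly_eval U ugen (s n)) x" by (rule U_dense)
    show "x \<in> star_closure U (ugen ` G)" by (rule star_closure.lim[OF e[OF s(1)[rule_format]] s(2)])
  qed
  show "star_closure U (ugen ` G) \<subseteq> carrier U"
  proof
    fix x assume "x \<in> star_closure U (ugen ` G)"
    then show "x \<in> carrier U"
      by (induction rule: star_closure.induct) (auto simp: ug.f_closed U.convD)
  qed
qed

text \<open>Evaluation followed by the norm is an admissible seminorm, and the universal seminorm is the
  largest one.\<close>

lemma seminorm_le:
  assumes "valuation D G f" "\<And>r. r \<in> R \<Longrightarrow> poly_eval D f r = \<zero>\<^bsub>D\<^esub>" "a \<in> FG"
  shows "\<parallel>poly_eval D f a\<parallel>\<^bsub>D\<^esub> \<le> N a"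
proof -
  interpret v: valuation D G f by fact
  have "(\<lambda>a. \<parallel>poly_eval D f a\<parallel>\<^bsub>D\<^esub>) \<in> adm"
    by (simp add: cstar_seminorm_def assms(2) v.ev_add v.ev_scale v.ev_mult v.ev_adj v.cnorm_add
        v.cnorm_mult v.cnorm_smult v.cstar_identity)
  from N_upper[OF this assms(3)] show ?thesis .
qed

text \<open>By the preceding estimate evaluation maps Cauchy sequences to Cauchy sequences; the homomorphism
  sends a class to the limit of the evaluations of a representative.\<close>

theorem universal_property:
  assumes v: "valuation D G f" and R: "\<And>r. r \<in> R \<Longrightarrow> poly_eval D f r = \<zero>\<^bsub>D\<^esub>"
  obtains h where "star_hom U D h" "\<And>g. g \<in> G \<Longrightarrow> h (ugen g) = f g"
proof -
  interpret v: valuation D G f by fact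
  have ex: "\<exists>y. conv D (\<lambda>n. v.ev (s n)) y" if s: "s \<in> CS" for s
  proof -
    have "\<exists>M. \<forall>m\<ge>M. \<forall>n\<ge>M. \<parallel>v.ev (s m) \<ominus>\<^bsub>D\<^esub> v.ev (s n)\<parallel>\<^bsub>D\<^esub> < e" if "e > 0" for e
    proof -
      obtain M where M: "\<forall>m\<ge>M. \<forall>n\<ge>M. N (s m - s n) < e" using CS_D[OF s \<open>e > 0\<close>] by blast
      have "\<parallel>v.ev (s m) \<ominus>\<^bsub>D\<^esub> v.ev (s n)\<parallel>\<^bsub>D\<^esub> < e" if "m \<ge> M" "n \<ge> M" for m n
        using seminorm_le[OF v R, of "s m - s n"] M that CS_free[OF s] by (fastforce simp: v.ev_diff)
      then show ?thesis by blast
    qed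
    moreover have "v.ev (s n) \<in> carrier D" for n using CS_free[OF s] by simp
    ultimately obtain y where "conv D (\<lambda>n. v.ev (s n)) y" using v.Cauchy_conv[of "\<lambda>n. v.ev (s n)"] by blast
    then show ?thesis by blast
  qed
  define L where "L s = (SOME y. conv D (\<lambda>n. v.ev (s n)) y)" for s
  have L: "conv D (\<lambda>n. v.ev (s n)) (L s)" if "s \<in> CS" for s
    unfolding L_def by (rule someI_ex[OF ex[OF that]])
  have L_eq: "L s = L t" if "s \<in> CS" "t \<in> CS" "cls s = cls t" for s t
  proof -
    have st: "(\<lambda>n. N (s n - t n)) \<longlonglongrightarrow> 0" using that by (simp add: cls_eq)
    have "conv D (\<lambda>n. v.ev (s n) \<ominus>\<^bsub>D\<^esub> v.ev (t n)) \<zero>\<^bsub>D\<^esub>"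
      by (rule v.conv_bound[OF _ _ _ st])
        (use seminorm_le[OF v R] CS_free[OF that(1)] CS_free[OF that(2)] in \<open>simp_all flip: v.ev_diff\<close>)
    moreover have "conv D (\<lambda>n. v.ev (s n) \<ominus>\<^bsub>D\<^esub> v.ev (t n)) (L s \<ominus>\<^bsub>D\<^esub> L t)"
      by (rule v.conv_diff[OF L[OF that(1)] L[OF that(2)]])
    ultimately have "\<zero>\<^bsub>D\<^esub> = L s \<ominus>\<^bsub>D\<^esub> L t" by (rule v.conv_unique)
    then show ?thesis
      using v.diff_eq_zero[OF v.convD(2)[OF L[OF that(1)]] v.convD(2)[OF L[OF that(2)]]] by simp
  qed
  define h where "h X = (if X \<in> carrier U then L (SOME s. s \<in> CS \<and> X = cls s) else undefined)" for X
  have h: "h (cls s) = L s" if s: "s \<in> CS" for s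
  proof -
    define t where "t = (SOME t. t \<in> CS \<and> cls s = cls t)"
    have "t \<in> CS \<and> cls s = cls t" unfolding t_def by (rule someI[of _ s]) (simp add: s)
    then have "L t = L s" using L_eq[of t s] s by simp
    then have "L (SOME t. t \<in> CS \<and> cls s = cls t) = L s" by (simp only: t_def)
    then show ?thesis using s by (simp add: h_def)
  qed
  note u = v.conv_unique
  have "star_hom U D h"
  proof (rule star_homI[OF cstar_algebra_U v.cstar_algebra_axioms])
    fix x y assume x: "x \<in> carrier U" and y: "y \<in> carrier U"
    obtain s where s: "s \<in> CS" "x = cls s" using x by (rule carrier_cls)
    obtain t where t: "t \<in> CS" "y = cls t" using y by (rule carrier_cls)
    have "conv D (\<lambda>n. v.ev (s n + t n)) (L s \<oplus>\<^bsub>D\<^esub> L t)"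
      using v.conv_add[OF L[OF s(1)] L[OF t(1)]] CS_free[OF s(1)] CS_free[OF t(1)] by (simp add: v.ev_add)
    then show "h (x \<oplus>\<^bsub>U\<^esub> y) = h x \<oplus>\<^bsub>D\<^esub> h y"
      using u[OF L[OF CS_add[OF s(1) t(1)]]] s t by (simp add: U_add CS_add h)
    have "conv D (\<lambda>n. v.ev (s n * t n)) (L s \<otimes>\<^bsub>D\<^esub> L t)"
      using v.conv_mult[OF L[OF s(1)] L[OF t(1)]] CS_free[OF s(1)] CS_free[OF t(1)] by (simp add: v.ev_mult)
    then show "h (x \<otimes>\<^bsub>U\<^esub> y) = h x \<otimes>\<^bsub>D\<^esub> h y"
      using u[OF L[OF CS_mult[OF s(1) t(1)]]] s t by (simp add: U_mult CS_mult h)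
  next
    fix x assume x: "x \<in> carrier U"
    obtain s where s: "s \<in> CS" "x = cls s" using x by (rule carrier_cls)
    show "h x \<in> carrier D" using s L by (simp add: h v.convD(2)[OF L])
    have "conv D (\<lambda>n. v.ev (poly_adj (s n))) ((L s)\<^sup>\<star>\<^bsub>D\<^esub>)"
      using v.conv_adj[OF L[OF s(1)]] CS_free[OF s(1)] by (simp add: v.ev_adj)
    then show "h (x\<^sup>\<star>\<^bsub>U\<^esub>) = (h x)\<^sup>\<star>\<^bsub>D\<^esub>"
      using u[OF L[OF CS_adj[OF s(1)]]] s by (simp add: U_adj CS_adj h)
    fix c
    have "conv D (\<lambda>n. v.ev (poly_scale c (s n))) (c \<odot>\<^bsub>D\<^esub> L s)"
      using v.conv_sc[OF L[OF s(1)]] CS_free[OF s(1)] by (simp add: v.ev_scale)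
    then show "h (c \<odot>\<^bsub>U\<^esub> x) = c \<odot>\<^bsub>D\<^esub> h x"
      using u[OF L[OF CS_scale[OF s(1)]]] s by (simp add: U_smult CS_scale h)
  qed (simp add: h_def)
  moreover have "h (ugen g) = f g" if g: "g \<in> G" for g
  proof -
    have "L (\<lambda>n. gen g) = f g"
      using u[OF L[OF CS_const[OF free_gen[OF g]]] v.conv_const] g by (simp add: v.ev_gen v.f_closed)
    then show ?thesis using h[OF CS_const[OF free_gen[OF g]]] by (simp add: universal_gen_def)
  qed
  ultimately show ?thesis using that by blast
qed

end

text \<open>A C*-seminorm on the universal algebra that kills further relations is dominated by the
  norm in the quotient by these relations, by maximality of the latter.\<close>

lemma seminorm_le_quotient:
  assumes P: "cstar_presentation G R" and P': "cstar_presentation G R'"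
    and h: "star_hom (universal_cstar G R) (universal_cstar G R') h"
    and hg: "\<And>g. g \<in> G \<Longrightarrow> h (universal_gen G R g) = universal_gen G R' g"
    and p_add: "\<And>x y. x \<in> carrier (universal_cstar G R) \<Longrightarrow> y \<in> carrier (universal_cstar G R) \<Longrightarrow>
      p (x \<oplus>\<^bsub>universal_cstar G R\<^esub> y) \<le> p x + p y"
    and p_scale: "\<And>c x. x \<in> carrier (universal_cstar G R) \<Longrightarrow> p (c \<odot>\<^bsub>universal_cstar G R\<^esub> x) = cmod c * p x"
    and p_mult: "\<And>x y. x \<in> carrier (universal_cstar G R) \<Longrightarrow> y \<in> carrier (universal_cstar G R) \<Longrightarrow>
      p (x \<otimes>\<^bsub>universal_cstar G R\<^esub> y) \<le> p x * p y"
    and p_star: "\<And>x. x \<in> carrier (universal_cstar G R) \<Longrightarrow>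
      p (x\<^sup>\<star>\<^bsub>universal_cstar G R\<^esub> \<otimes>\<^bsub>universal_cstar G R\<^esub> x) = (p x)\<^sup>2"
    and p_le: "\<And>x. x \<in> carrier (universal_cstar G R) \<Longrightarrow> p x \<le> \<parallel>x\<parallel>\<^bsub>universal_cstar G R\<^esub>"
    and p_kills: "\<And>r. r \<in> R' \<Longrightarrow> p (poly_eval (universal_cstar G R) (universal_gen G R) r) = 0"
    and x: "x \<in> carrier (universal_cstar G R)"
  shows "p x \<le> \<parallel>h x\<parallel>\<^bsub>universal_cstar G R'\<^esub>"
proof -
  interpret P: cstar_presentation G R by fact
  interpret P': cstar_presentation G R' by fact
  interpret h: star_hom P.U P'.U h by fact
  let ?e = "poly_eval P.U P.ugen"
  have "cstar_seminorm G (\<lambda>a. p (?e a))"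
    unfolding cstar_seminorm_def
    by (simp add: P.ug.ev_add P.ug.ev_scale P.ug.ev_mult P.ug.ev_adj p_add p_scale p_mult p_star)
  then have "(\<lambda>a. p (?e a)) \<in> P'.adm" using p_kills by simp
  then have le: "p (?e a) \<le> P'.N a" if "a \<in> P.FG" for a using P'.N_upper that by blast
  have he: "h (?e a) = poly_eval P'.U P'.ugen a" if a: "a \<in> P.FG" for a
    by (rule h.hom_ev[OF P.ug.valuation_axioms hg a])
  obtain s where s: "\<forall>n. s n \<in> P.FG" "conv P.U (\<lambda>n. ?e (s n)) x" using x by (rule P.U_dense)
  have bd: "p x \<le> \<parallel>x \<ominus>\<^bsub>P.U\<^esub> y\<parallel>\<^bsub>P.U\<^esub> + p y" if "y \<in> carrier P.U" for y
    using p_add[of "x \<ominus>\<^bsub>P.U\<^esub> y" y] p_le[of "x \<ominus>\<^bsub>P.U\<^esub> y"] x that by (simp add: P.U.diff_add_cancel)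
  have "p x \<le> \<parallel>?e (s n) \<ominus>\<^bsub>P.U\<^esub> x\<parallel>\<^bsub>P.U\<^esub> + \<parallel>h (?e (s n))\<parallel>\<^bsub>P'.U\<^esub>" for n
    using bd[of "?e (s n)"] le[OF s(1)[rule_format, of n]] s(1)[rule_format, of n] x P.U.norm_diff_comm[of x "?e (s n)"]
    by (simp add: he P'.N_ev)
  moreover have "(\<lambda>n. \<parallel>?e (s n) \<ominus>\<^bsub>P.U\<^esub> x\<parallel>\<^bsub>P.U\<^esub> + \<parallel>h (?e (s n))\<parallel>\<^bsub>P'.U\<^esub>) \<longlonglongrightarrow> 0 + \<parallel>h x\<parallel>\<^bsub>P'.U\<^esub>"
    by (rule tendsto_add[OF P.U.convD(3)[OF s(2)] P'.U.conv_norm[OF h.conv[OF s(2)]]])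
  ultimately have "p x \<le> 0 + \<parallel>h x\<parallel>\<^bsub>P'.U\<^esub>" by (intro LIMSEQ_le_const) auto
  then show ?thesis by simp
qed

section \<open>Cuntz-Krieger families\<close>

text \<open>The relations of the graph, satisfied in an arbitrary C*-algebra: these families correspond to the
  homomorphisms from the graph algebra.\<close>

locale ck_family = cstar_algebra D + wf_digraph E
  for D :: "('a, 'm) cstar_scheme" (structure) and E :: "('v, 'e) pre_digraph" +
  fixes P :: "'v \<Rightarrow> 'a" and S :: "'e \<Rightarrow> 'a"
  assumes P_closed [simp]: "v \<in> verts E \<Longrightarrow> P v \<in> carrier D"
    and P_adj: "v \<in> verts E \<Longrightarrow> (P v)\<^sup>\<star> = P v"
    and P_idem: "v \<in> verts E \<Longrightarrow> P v \<otimes> P v = P v"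
    and P_orth: "v \<in> verts E \<Longrightarrow> w \<in> verts E \<Longrightarrow> v \<noteq> w \<Longrightarrow> P v \<otimes> P w = \<zero>"
    and S_closed [simp]: "e \<in> arcs E \<Longrightarrow> S e \<in> carrier D"
    and S_partial: "e \<in> arcs E \<Longrightarrow> S e \<otimes> (S e)\<^sup>\<star> \<otimes> S e = S e"
    and S_star_S: "e \<in> arcs E \<Longrightarrow> f \<in> arcs E \<Longrightarrow> (S e)\<^sup>\<star> \<otimes> S f = (if e = f then P (head E e) else \<zero>)"
    and sum_ranges: "v \<in> verts E \<Longrightarrow> finite (out_arcs E v) \<Longrightarrow> out_arcs E v \<noteq> {} \<Longrightarrow>
      (\<Oplus>e\<in>out_arcs E v. S e \<otimes> (S e)\<^sup>\<star>) = P v"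
    and range_le: "e \<in> arcs E \<Longrightarrow> P (tail E e) \<otimes> (S e \<otimes> (S e)\<^sup>\<star>) = S e \<otimes> (S e)\<^sup>\<star>"
begin

lemma P_tail_S: "e \<in> arcs E \<Longrightarrow> P (tail E e) \<otimes> S e = S e"
proof -
  assume e: "e \<in> arcs E"
  have "P (tail E e) \<otimes> S e = P (tail E e) \<otimes> (S e \<otimes> (S e)\<^sup>\<star> \<otimes> S e)" using e by (simp add: S_partial)
  also have "\<dots> = P (tail E e) \<otimes> (S e \<otimes> (S e)\<^sup>\<star>) \<otimes> S e" using e by (simp add: mult_assoc)
  also have "\<dots> = S e" using e by (simp add: range_le S_partial)
  finally show ?thesis .
qed

lemma S_P_head: "e \<in> arcs E \<Longrightarrow> S e \<otimes> P (head E e) = S e"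
  using S_star_S[of e e] S_partial[of e] by (simp add: mult_assoc)

lemma P_S: "v \<in> verts E \<Longrightarrow> e \<in> arcs E \<Longrightarrow> P v \<otimes> S e = (if v = tail E e then S e else \<zero>)"
proof (cases "v = tail E e")
  case False
  assume v: "v \<in> verts E" and e: "e \<in> arcs E"
  have "P v \<otimes> S e = P v \<otimes> (P (tail E e) \<otimes> S e)" using e by (simp add: P_tail_S)
  also have "\<dots> = (P v \<otimes> P (tail E e)) \<otimes> S e" using v e by (simp add: mult_assoc)
  finally show ?thesis using v e False by (simp add: P_orth)
qed (simp add: P_tail_S)

lemma S_P: "v \<in> verts E \<Longrightarrow> e \<in> arcs E \<Longrightarrow> S e \<otimes> P v = (if v = head E e then S e else \<zero>)"
proof (cases "v = head E e")
  case False
  assume v: "v \<in> verts E" and e: "e \<in> arcs E"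
  have "S e \<otimes> P v = (S e \<otimes> P (head E e)) \<otimes> P v" using e by (simp add: S_P_head)
  also have "\<dots> = S e \<otimes> (P (head E e) \<otimes> P v)" using v e by (simp add: mult_assoc)
  finally show ?thesis using v e False by (simp add: P_orth)
qed (simp add: S_P_head)

lemma S_adj_P: "v \<in> verts E \<Longrightarrow> e \<in> arcs E \<Longrightarrow> (S e)\<^sup>\<star> \<otimes> P v = (if v = tail E e then (S e)\<^sup>\<star> else \<zero>)"
  using P_S[of v e] adj_mult[of "P v" "S e"] by (simp add: P_adj split: if_splits)

sublocale valuation D "verts E <+> arcs E" "case_sum P S"
  by unfold_locales auto

lemma gens_free:
  "v \<in> verts E \<Longrightarrow> gen (Inl v) \<in> FG" "e \<in> arcs E \<Longrightarrow> gen (Inr e) \<in> FG"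
  by (auto intro: free_gen)

lemma ev_gens: "v \<in> verts E \<Longrightarrow> ev (gen (Inl v)) = P v" "e \<in> arcs E \<Longrightarrow> ev (gen (Inr e)) = S e"
  by (simp_all add: ev_gen InlI InrI)

lemma ev_graph_relation: "r \<in> graph_relations E \<Longrightarrow> ev r = \<zero>"
  unfolding graph_relations_def
proof (elim UnE CollectE exE conjE)
  fix v assume *: "r = (\<Sum>e\<in>out_arcs E v. gen (Inr e) * poly_adj (gen (Inr e))) - gen (Inl v)" "v \<in> verts E"
    "finite (out_arcs E v)" "out_arcs E v \<noteq> {}"
  have "ev (\<Sum>e\<in>out_arcs E v. gen (Inr e) * poly_adj (gen (Inr e))) =
     (\<Oplus>e\<in>out_arcs E v. ev (gen (Inr e) * poly_adj (gen (Inr e))))"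
    by (rule ev_sum[OF *(3)]) (simp add: gens_free)
  also have "\<dots> = (\<Oplus>e\<in>out_arcs E v. S e \<otimes> (S e)\<^sup>\<star>)"
    by (rule M.finsum_cong') (auto simp: ev_mult ev_adj ev_gens gens_free)
  also have "\<dots> = P v" by (rule sum_ranges[OF *(2-4)])
  finally have "ev (\<Sum>e\<in>out_arcs E v. gen (Inr e) * poly_adj (gen (Inr e))) = P v" .
  moreover have "(\<Sum>e\<in>out_arcs E v. gen (Inr e) * poly_adj (gen (Inr e))) \<in> FG"
    by (intro free_sum free_mult free_adj gens_free) simp_all
  ultimately show "ev r = \<zero>"
    using *(2) unfolding *(1) by (simp add: ev_diff ev_gens gens_free)
next
  fix e f assume "r = poly_adj (gen (Inr e)) * gen (Inr f) - (if e = f then gen (Inl (head E e)) else 0)"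
    "e \<in> arcs E" "f \<in> arcs E"
  then show "ev r = \<zero>"
    by (simp add: ev_diff ev_mult ev_adj ev_gens gens_free S_star_S)
qed (simp_all add: ev_diff ev_mult ev_adj ev_gens gens_free P_adj P_idem P_orth S_partial range_le)

end

text \<open>The relations are algebraic, except that (GA2) involves finite sums, which homomorphisms
  preserve.\<close>

lemma ck_family_image:
  assumes "ck_family D E P S" "star_hom D D' h"
  shows "ck_family D' E (\<lambda>v. h (P v)) (\<lambda>e. h (S e))"
proof -
  interpret ck_family D E P S by fact
  interpret h: star_hom D D' h by fact
  show ?thesis
  proof unfold_locales
    fix v assume v: "v \<in> verts E" "finite (out_arcs E v)" "out_arcs E v \<noteq> {}"
    have "(\<Oplus>\<^bsub>D'\<^esub>e\<in>out_arcs E v. h (S e) \<otimes>\<^bsub>D'\<^esub> (h (S e))\<^sup>\<star>\<^bsub>D'\<^esub>) = (\<Oplus>\<^bsub>D'\<^esub>e\<in>out_arcs E v. h (S e \<otimes>\<^bsub>D\<^esub> (S e)\<^sup>\<star>\<^bsub>D\<^esub>))"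
      by (rule h.B.M.finsum_cong') (auto simp: h.mult h.adj)
    also have "\<dots> = h (P v)" using v by (subst h.finsum[symmetric]) (simp_all add: sum_ranges)
    finally show "(\<Oplus>\<^bsub>D'\<^esub>e\<in>out_arcs E v. h (S e) \<otimes>\<^bsub>D'\<^esub> (h (S e))\<^sup>\<star>\<^bsub>D'\<^esub>) = h (P v)" .
  qed (simp_all flip: h.mult h.adj add: P_adj P_idem P_orth S_partial S_star_S range_le)
qed

lemma graph_relations_free:
  assumes "wf_digraph E"
  shows "graph_relations E \<subseteq> free_star_algebra (verts E <+> arcs E)"
proof -
  interpret wf_digraph E by fact
  have f: "v \<in> verts E \<Longrightarrow> gen (Inl v) \<in> free_star_algebra (verts E <+> arcs E)"
    "e \<in> arcs E \<Longrightarrow> gen (Inr e) \<in> free_star_algebra (verts E <+> arcs E)" for v e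
    by (auto intro: free_gen)
  show ?thesis
  proof
    fix r assume "r \<in> graph_relations E"
    then show "r \<in> free_star_algebra (verts E <+> arcs E)"
      unfolding graph_relations_def
    proof (elim UnE CollectE exE conjE)
      fix v assume *: "r = (\<Sum>e\<in>out_arcs E v. gen (Inr e) * poly_adj (gen (Inr e))) - gen (Inl v)" "v \<in> verts E"
      show "r \<in> free_star_algebra (verts E <+> arcs E)"
        unfolding *(1) by (intro free_diff free_sum free_mult free_adj f *(2)) simp_all
    qed (simp_all add: f)
  qed
qed

text \<open>The relations make the generators partial isometries, so that admissible seminorms are
  bounded by the sum of the absolute values of the coefficients.\<close>

lemma graph_presentation:
  assumes "wf_digraph E" "R \<subseteq> free_star_algebra (verts E <+> arcs E)" "graph_relations E \<subseteq> R"
  shows "cstar_presentation (verts E <+> arcs E) R"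
proof
  interpret wf_digraph E by fact
  let ?G = "verts E <+> arcs E"
  have fP: "v \<in> verts E \<Longrightarrow> gen (Inl v) \<in> free_star_algebra ?G"
    and fS: "e \<in> arcs E \<Longrightarrow> gen (Inr e) \<in> free_star_algebra ?G" for v e
    by (auto intro: free_gen)
  {
    fix p assume p: "cstar_seminorm ?G p" "\<forall>r\<in>R. p r = 0"
    interpret poly_seminorm ?G p using p(1) by unfold_locales
    have rel: "r \<in> graph_relations E \<Longrightarrow> p r = 0" for r using p(2) assms(3) by blast
    have P: "p (gen (Inl v)) \<le> 1" if v: "v \<in> verts E" for v
    proof -
      let ?g = "gen (Inl v) :: ('a + 'b) star_poly"
      note [simp] = fP[OF v]
      have r1: "p (poly_adj ?g - ?g) = 0" and r2: "p (?g * ?g - ?g) = 0"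
        using v by (auto intro!: rel simp: graph_relations_def)
      have "p (poly_adj ?g * ?g - ?g * ?g) \<le> p (poly_adj ?g - ?g) * p ?g"
        using sn_mult[of "poly_adj ?g - ?g" ?g] by (simp add: left_diff_distrib)
      then have "p (poly_adj ?g * ?g - ?g * ?g) = 0"
        using r1 sn_nonneg[of "poly_adj ?g * ?g - ?g * ?g"] by simp
      then have "(p ?g)\<^sup>2 = p ?g"
        using sn_eq[of "poly_adj ?g * ?g" "?g * ?g"] sn_eq[OF _ _ r2] sn_star[of ?g] by simp
      then show ?thesis by (auto simp: power2_eq_square)
    qed
    have S: "p (gen (Inr e)) \<le> 1" if e: "e \<in> arcs E" for e
    proof -
      let ?g = "gen (Inr e) :: ('a + 'b) star_poly"
      note [simp] = fS[OF e] fP[OF head_in_verts[OF e]]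
      have "poly_adj ?g * ?g - gen (Inl (head E e)) \<in> graph_relations E"
        using e unfolding graph_relations_def by fastforce
      then have "p (poly_adj ?g * ?g) = p (gen (Inl (head E e)))" using sn_eq rel by simp
      then have "(p ?g)\<^sup>2 \<le> 1" using P[OF head_in_verts[OF e]] sn_star[of ?g] by simp
      then show ?thesis by (rule power2_le_imp_le[of _ 1, unfolded one_power2]) simp
    qed
    have l: "p (Poly_Mapping.single (Word [l]) 1) \<le> 1" if "fst l \<in> ?G" for l
    proof -
      obtain g b where l: "l = (g, b)" by (cases l)
      have g: "gen g \<in> free_star_algebra ?G" using that l by (simp add: free_gen)
      have "p (gen g) \<le> 1" using P S that l by auto
      moreover have "poly_adj (gen g) = Poly_Mapping.single (Word [(g, True)]) 1"
        by (simp add: gen_def word_adj_def)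
      ultimately show ?thesis using sn_adj[OF g] l by (cases b) (simp_all add: gen_def)
    qed
    have "w \<noteq> [] \<Longrightarrow> fst ` set w \<subseteq> ?G \<Longrightarrow> p (Poly_Mapping.single (Word w) 1) \<le> 1" for w
    proof (induction w rule: induct_list012)
      case (3 l m w)
      have "p (Poly_Mapping.single (Word [l]) 1 * Poly_Mapping.single (Word (m # w)) 1)
         \<le> p (Poly_Mapping.single (Word [l]) 1) * p (Poly_Mapping.single (Word (m # w)) 1)"
        using 3(4) by (intro sn_mult free_single) (simp_all add: zero_word_def)
      also have "\<dots> \<le> 1 * 1"
        using 3 l[of l] by (intro mult_mono sn_nonneg free_single) (simp_all add: zero_word_def)
      finally show ?case by (simp add: mult_single plus_word_def)
    qed (simp_all add: l)
  }
  note mon = this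
  fix a assume "a \<in> free_star_algebra ?G"
  then show "\<exists>C. \<forall>p. cstar_seminorm ?G p \<longrightarrow> (\<forall>r\<in>R. p r = 0) \<longrightarrow> p a \<le> C"
  proof (induction rule: free_star_induct)
    case zero
    have "p 0 \<le> 0" if p: "cstar_seminorm ?G p" for p
    proof -
      interpret poly_seminorm ?G p using p by unfold_locales
      show ?thesis by simp
    qed
    then show ?case by blast
  next
    case (single w c)
    have "p (Poly_Mapping.single w c) \<le> cmod c" if p: "cstar_seminorm ?G p" "\<forall>r\<in>R. p r = 0" for p
    proof -
      interpret poly_seminorm ?G p using p(1) by unfold_locales
      have w: "letters w \<noteq> []" "Word (letters w) = w" using single(1) by (cases w; simp add: zero_word_def)+
      have "p (poly_scale c (Poly_Mapping.single w 1)) = cmod c * p (Poly_Mapping.single w 1)"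
        using single by (intro sn_scale free_single)
      also have "\<dots> \<le> cmod c * 1" using mon[OF p w(1) single(2)] w(2) by (intro mult_left_mono) simp_all
      finally show ?thesis by simp
    qed
    then show ?case by blast
  next
    case (add a b)
    then obtain C D where CD: "\<forall>p. cstar_seminorm ?G p \<longrightarrow> (\<forall>r\<in>R. p r = 0) \<longrightarrow> p a \<le> C"
      "\<forall>p. cstar_seminorm ?G p \<longrightarrow> (\<forall>r\<in>R. p r = 0) \<longrightarrow> p b \<le> D" by blast
    have "p (a + b) \<le> C + D" if p: "cstar_seminorm ?G p" "\<forall>r\<in>R. p r = 0" for p
    proof -
      interpret poly_seminorm ?G p using p(1) by unfold_locales
      show ?thesis using sn_add[OF add.hyps] CD p by (meson add_mono order_trans)
    qed
    then show ?case by blast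
  qed
qed (rule assms(2))

text \<open>Relations beyond those of the graph are allowed, so that this also covers quotients.\<close>

lemma universal_ck_family:
  assumes "wf_digraph E" "R \<subseteq> free_star_algebra (verts E <+> arcs E)" "graph_relations E \<subseteq> R"
  shows "ck_family (universal_cstar (verts E <+> arcs E) R) E
    (\<lambda>v. universal_gen (verts E <+> arcs E) R (Inl v)) (\<lambda>e. universal_gen (verts E <+> arcs E) R (Inr e))"
proof -
  interpret wf_digraph E by fact
  interpret cstar_presentation "verts E <+> arcs E" R by (rule graph_presentation[OF assms])
  have rel: "r \<in> graph_relations E \<Longrightarrow> ug.ev r = \<zero>\<^bsub>U\<^esub>" for r
    using ev_relation assms(3) by blast
  have f: "v \<in> verts E \<Longrightarrow> gen (Inl v) \<in> FG" "e \<in> arcs E \<Longrightarrow> gen (Inr e) \<in> FG" for v e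
    by (auto intro: free_gen)
  have ev: "v \<in> verts E \<Longrightarrow> ug.ev (gen (Inl v)) = ugen (Inl v)" "e \<in> arcs E \<Longrightarrow> ug.ev (gen (Inr e)) = ugen (Inr e)" for v e
    by (simp_all add: ug.ev_gen InlI InrI)
  have c: "v \<in> verts E \<Longrightarrow> ugen (Inl v) \<in> carrier U" "e \<in> arcs E \<Longrightarrow> ugen (Inr e) \<in> carrier U" for v e
    by (auto intro: ug.f_closed)
  have eq: "ug.ev a = ug.ev b" if "a - b \<in> graph_relations E" "a \<in> FG" "b \<in> FG" for a b
    using rel[OF that(1)] that by (simp add: ug.ev_diff U.diff_eq_zero)
  note ev_simps = ug.ev_mult ug.ev_adj ev f
  show ?thesis
  proof unfold_locales
    fix v assume v: "v \<in> verts E"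
    show "ugen (Inl v) \<in> carrier U" by (rule c(1)[OF v])
    have "poly_adj (gen (Inl v)) - gen (Inl v) \<in> graph_relations E" using v unfolding graph_relations_def by blast
    from eq[OF this] show "(ugen (Inl v))\<^sup>\<star>\<^bsub>U\<^esub> = ugen (Inl v)" using v by (simp add: ev_simps)
    have "gen (Inl v) * gen (Inl v) - gen (Inl v) \<in> graph_relations E" using v unfolding graph_relations_def by blast
    from eq[OF this] show "ugen (Inl v) \<otimes>\<^bsub>U\<^esub> ugen (Inl v) = ugen (Inl v)" using v by (simp add: ev_simps)
    show "ugen (Inl v) \<otimes>\<^bsub>U\<^esub> ugen (Inl w) = \<zero>\<^bsub>U\<^esub>" if "w \<in> verts E" "v \<noteq> w" for w
    proof -
      have "gen (Inl v) * gen (Inl w) \<in> graph_relations E" using v that unfolding graph_relations_def by blast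
      from rel[OF this] show ?thesis using v that by (simp add: ev_simps)
    qed
    show "(\<Oplus>\<^bsub>U\<^esub>e\<in>out_arcs E v. ugen (Inr e) \<otimes>\<^bsub>U\<^esub> (ugen (Inr e))\<^sup>\<star>\<^bsub>U\<^esub>) = ugen (Inl v)"
      if fin: "finite (out_arcs E v)" "out_arcs E v \<noteq> {}"
    proof -
      have "(\<Sum>e\<in>out_arcs E v. gen (Inr e) * poly_adj (gen (Inr e))) - gen (Inl v) \<in> graph_relations E"
        using v fin unfolding graph_relations_def by blast
      moreover have "(\<Sum>e\<in>out_arcs E v. gen (Inr e) * poly_adj (gen (Inr e))) \<in> FG"
        by (intro free_sum free_mult free_adj f) simp_all
      ultimately have "ug.ev (\<Sum>e\<in>out_arcs E v. gen (Inr e) * poly_adj (gen (Inr e))) = ugen (Inl v)"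
        using eq v by (simp add: f ev)
      moreover have "ug.ev (\<Sum>e\<in>out_arcs E v. gen (Inr e) * poly_adj (gen (Inr e))) =
        (\<Oplus>\<^bsub>U\<^esub>e\<in>out_arcs E v. ug.ev (gen (Inr e) * poly_adj (gen (Inr e))))"
        by (rule ug.ev_sum[OF fin(1)]) (simp add: f)
      moreover have "\<dots> = (\<Oplus>\<^bsub>U\<^esub>e\<in>out_arcs E v. ugen (Inr e) \<otimes>\<^bsub>U\<^esub> (ugen (Inr e))\<^sup>\<star>\<^bsub>U\<^esub>)"
        by (rule U.M.finsum_cong') (auto simp: ev_simps c)
      ultimately show ?thesis by simp
    qed
  next
    fix e assume e: "e \<in> arcs E"
    show "ugen (Inr e) \<in> carrier U" by (rule c(2)[OF e])
    have "gen (Inr e) * poly_adj (gen (Inr e)) * gen (Inr e) - gen (Inr e) \<in> graph_relations E"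
      using e unfolding graph_relations_def by blast
    from eq[OF this] show "ugen (Inr e) \<otimes>\<^bsub>U\<^esub> (ugen (Inr e))\<^sup>\<star>\<^bsub>U\<^esub> \<otimes>\<^bsub>U\<^esub> ugen (Inr e) = ugen (Inr e)"
      using e by (simp add: ev_simps)
    have "gen (Inl (tail E e)) * (gen (Inr e) * poly_adj (gen (Inr e))) - gen (Inr e) * poly_adj (gen (Inr e)) \<in> graph_relations E"
      using e unfolding graph_relations_def by blast
    from eq[OF this] show "ugen (Inl (tail E e)) \<otimes>\<^bsub>U\<^esub> (ugen (Inr e) \<otimes>\<^bsub>U\<^esub> (ugen (Inr e))\<^sup>\<star>\<^bsub>U\<^esub>) = ugen (Inr e) \<otimes>\<^bsub>U\<^esub> (ugen (Inr e))\<^sup>\<star>\<^bsub>U\<^esub>"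
      using e by (simp add: ev_simps)
    show "(ugen (Inr e))\<^sup>\<star>\<^bsub>U\<^esub> \<otimes>\<^bsub>U\<^esub> ugen (Inr g) = (if e = g then ugen (Inl (head E e)) else \<zero>\<^bsub>U\<^esub>)"
      if "g \<in> arcs E" for g
    proof -
      have "poly_adj (gen (Inr e)) * gen (Inr g) - (if e = g then gen (Inl (head E e)) else 0) \<in> graph_relations E"
        using e that unfolding graph_relations_def by blast
      from eq[OF this] show ?thesis using e that by (simp add: ev_simps split: if_splits)
    qed
  qed
qed

lemma graph_cstar_algebra: "wf_digraph E \<Longrightarrow> cstar_algebra (graph_cstar E)"
  unfolding graph_cstar_def
  by (intro cstar_presentation.cstar_algebra_U graph_presentation graph_relations_free order_refl)

lemma graph_cstar_family: "wf_digraph E \<Longrightarrow> ck_family (graph_cstar E) E (vproj E) (eiso E)"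
  using universal_ck_family[of E "graph_relations E"] graph_relations_free[of E]
  unfolding graph_cstar_def vproj_def[abs_def] eiso_def[abs_def] by simp

definition graph_gens :: "('v, 'e) pre_digraph \<Rightarrow> (nat \<Rightarrow> ('v + 'e) star_poly) set set" where
  "graph_gens E = vproj E ` verts E \<union> eiso E ` arcs E"

lemma graph_cstar_generated: "wf_digraph E \<Longrightarrow> carrier (graph_cstar E) = star_closure (graph_cstar E) (graph_gens E)"
proof -
  assume "wf_digraph E"
  then interpret cstar_presentation "verts E <+> arcs E" "graph_relations E"
    by (intro graph_presentation graph_relations_free order_refl)
  have "ugen ` (verts E <+> arcs E) = graph_gens E"
    by (auto simp: graph_gens_def vproj_def eiso_def image_iff)
  then show ?thesis using U_generated by (simp add: graph_cstar_def)
qed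

lemma graph_cstar_hom:
  assumes "ck_family D E P S"
  obtains h where "star_hom (graph_cstar E) D h" "\<And>v. v \<in> verts E \<Longrightarrow> h (vproj E v) = P v"
    "\<And>e. e \<in> arcs E \<Longrightarrow> h (eiso E e) = S e"
proof -
  interpret ck_family D E P S by fact
  interpret U: cstar_presentation "verts E <+> arcs E" "graph_relations E"
    by (intro graph_presentation graph_relations_free order_refl wf_digraph_axioms)
  obtain h where "star_hom U.U D h" "\<And>g. g \<in> verts E <+> arcs E \<Longrightarrow> h (U.ugen g) = case_sum P S g"
    using U.universal_property[OF valuation_axioms ev_graph_relation] by blast
  then have "star_hom (graph_cstar E) D h" "\<And>v. v \<in> verts E \<Longrightarrow> h (vproj E v) = P v"
    "\<And>e. e \<in> arcs E \<Longrightarrow> h (eiso E e) = S e"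
    by (simp_all add: graph_cstar_def vproj_def eiso_def InlI InrI)
  then show ?thesis by (rule that)
qed

lemma graph_cstar_hom_eqI:
  assumes "wf_digraph E" "star_hom (graph_cstar E) D h" "star_hom (graph_cstar E) D k"
    "\<And>v. v \<in> verts E \<Longrightarrow> h (vproj E v) = k (vproj E v)" "\<And>e. e \<in> arcs E \<Longrightarrow> h (eiso E e) = k (eiso E e)"
  shows "h = k"
  by (rule star_hom_eqI[OF assms(2,3) graph_cstar_generated[OF assms(1)]])
    (use assms(4,5) in \<open>auto simp: graph_gens_def\<close>)

section \<open>Pushouts of graphs\<close>

locale gluing = E: wf_digraph E + H: wf_digraph H
  for E :: "('v, 'e) pre_digraph" and H :: "('w, 'f) pre_digraph" +
  fixes X :: "'x set" and \<iota> :: "'x \<Rightarrow> 'v" and \<kappa> :: "'x \<Rightarrow> 'w"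
  assumes inj_i: "inj_on \<iota> X" and inj_k: "inj_on \<kappa> X"
    and E_countable: "countable (verts E)" "countable (arcs E)"
    and i_sinks: "\<iota> ` X \<subseteq> sinks E" and k_verts: "\<kappa> ` X \<subseteq> verts H"
begin

abbreviation "G \<equiv> pushout_graph E H X \<iota> \<kappa>"
abbreviation "cl \<equiv> glue_class E H X \<iota> \<kappa>"

lemma i_verts: "x \<in> X \<Longrightarrow> \<iota> x \<in> verts E" and k_vert: "x \<in> X \<Longrightarrow> \<kappa> x \<in> verts H"
  using i_sinks k_verts by (auto simp: sinks_def)

lemma tail_not_glued: "e \<in> arcs E \<Longrightarrow> x \<in> X \<Longrightarrow> tail E e \<noteq> \<iota> x"
  using i_sinks by (auto simp: sinks_def out_arcs_def)

text \<open>Injectivity of both maps keeps the generated equivalence relation from linking more than two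
  vertices.\<close>

lemma glue_rel_iff:
  "(a, b) \<in> glue_rel E H X \<iota> \<kappa> \<longleftrightarrow> a \<in> verts E <+> verts H \<and> b \<in> verts E <+> verts H \<and>
    (a = b \<or> (\<exists>x\<in>X. a = Inl (\<iota> x) \<and> b = Inr (\<kappa> x) \<or> a = Inr (\<kappa> x) \<and> b = Inl (\<iota> x)))"
proof -
  define r :: "(('v + 'w) \<times> ('v + 'w)) set" where "r = {(Inl (\<iota> x), Inr (\<kappa> x)) | x. x \<in> X}"
  have "(r \<union> r\<inverse>)\<^sup>* = Id \<union> (r \<union> r\<inverse>)"
  proof
    show "(r \<union> r\<inverse>)\<^sup>* \<subseteq> Id \<union> (r \<union> r\<inverse>)"
    proof
      fix p assume "p \<in> (r \<union> r\<inverse>)\<^sup>*"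
      then obtain a b where p: "p = (a, b)" and "(a, b) \<in> (r \<union> r\<inverse>)\<^sup>*" by (cases p) auto
      from this(2) have "(a, b) \<in> Id \<union> (r \<union> r\<inverse>)"
      proof (induction rule: rtrancl_induct)
        case (step y z)
        then show ?case unfolding r_def using inj_i inj_k by (auto dest: inj_onD)
      qed simp
      then show "p \<in> Id \<union> (r \<union> r\<inverse>)" using p by simp
    qed
  qed auto
  then have "glue_rel E H X \<iota> \<kappa> = Restr (Id \<union> (r \<union> r\<inverse>)) (verts E <+> verts H)"
    unfolding glue_rel_def r_def Let_def by simp
  then show ?thesis unfolding r_def by auto
qed

lemma equiv_glue: "equiv (verts E <+> verts H) (glue_rel E H X \<iota> \<kappa>)"
proof (rule equivI)
  show "trans (glue_rel E H X \<iota> \<kappa>)"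
    by (rule transI) (auto simp: glue_rel_iff dest: inj_onD[OF inj_i] inj_onD[OF inj_k])
qed (auto simp: glue_rel_iff refl_on_def sym_def)

lemma cl_eq_iff: "a \<in> verts E <+> verts H \<Longrightarrow> b \<in> verts E <+> verts H \<Longrightarrow> cl a = cl b \<longleftrightarrow> (a, b) \<in> glue_rel E H X \<iota> \<kappa>"
  unfolding glue_class_def by (rule eq_equiv_class_iff[OF equiv_glue])

lemma cl_Inl_Inl: "v \<in> verts E \<Longrightarrow> v' \<in> verts E \<Longrightarrow> cl (Inl v) = cl (Inl v') \<longleftrightarrow> v = v'"
  and cl_Inr_Inr: "w \<in> verts H \<Longrightarrow> w' \<in> verts H \<Longrightarrow> cl (Inr w) = cl (Inr w') \<longleftrightarrow> w = w'"
  and cl_Inl_Inr: "v \<in> verts E \<Longrightarrow> w \<in> verts H \<Longrightarrow> cl (Inl v) = cl (Inr w) \<longleftrightarrow> (\<exists>x\<in>X. v = \<iota> x \<and> w = \<kappa> x)"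
  by (simp_all add: cl_eq_iff InlI InrI glue_rel_iff)

lemma verts_G: "verts G = cl ` (verts E <+> verts H)"
  by (auto simp: pushout_graph_def quotient_def glue_class_def)

lemma arcs_G: "arcs G = arcs E <+> arcs H"
  and tail_G: "tail G (Inl e) = cl (Inl (tail E e))" "tail G (Inr f) = cl (Inr (tail H f))"
  and head_G: "head G (Inl e) = cl (Inl (head E e))" "head G (Inr f) = cl (Inr (head H f))"
  by (simp_all add: pushout_graph_def)

lemma cl_verts: "v \<in> verts E \<Longrightarrow> cl (Inl v) \<in> verts G" "w \<in> verts H \<Longrightarrow> cl (Inr w) \<in> verts G"
  by (auto simp: verts_G)

sublocale G: wf_digraph G
  by unfold_locales (auto simp: arcs_G tail_G head_G cl_verts)

lemma tail_cl: "e \<in> arcs E \<Longrightarrow> w \<in> verts H \<Longrightarrow> cl (Inl (tail E e)) \<noteq> cl (Inr w)"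
  using tail_not_glued by (auto simp: cl_Inl_Inr)

text \<open>As the glued vertices are sinks of \<open>E\<close>, their arcs in the pushout all come from
  \<open>H\<close>. This is what makes (GA2) for the pushout equivalent to (GA2) for the two graphs.\<close>

lemma out_arcs_right: "w \<in> verts H \<Longrightarrow> out_arcs G (cl (Inr w)) = Inr ` out_arcs H w"
proof -
  assume w: "w \<in> verts H"
  have "cl (Inl (tail E e)) \<noteq> cl (Inr w)" if "e \<in> arcs E" for e using tail_cl[OF that w] .
  then show ?thesis using w by (auto simp: out_arcs_def arcs_G tail_G cl_Inr_Inr)
qed

lemma out_arcs_left: "v \<in> verts E \<Longrightarrow> v \<notin> \<iota> ` X \<Longrightarrow> out_arcs G (cl (Inl v)) = Inl ` out_arcs E v"
proof -
  assume v: "v \<in> verts E" "v \<notin> \<iota> ` X"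
  have "cl (Inr (tail H f)) \<noteq> cl (Inl v)" if "f \<in> arcs H" for f
    using cl_Inl_Inr[OF v(1) H.tail_in_verts[OF that]] v(2) by auto
  then show ?thesis using v(1) by (auto simp: out_arcs_def arcs_G tail_G cl_Inl_Inl)
qed

text \<open>A vertex of \<open>E\<close> that emits arcs is not glued, so that (GA2) at this vertex is
  unaffected by the gluing.\<close>

lemma restrict_families:
  assumes "ck_family D G P S"
  shows "ck_family D E (\<lambda>v. P (cl (Inl v))) (\<lambda>e. S (Inl e))" "ck_family D H (\<lambda>w. P (cl (Inr w))) (\<lambda>f. S (Inr f))"
proof -
  interpret ck_family D G P S by fact
  have a: "e \<in> arcs E \<Longrightarrow> Inl e \<in> arcs G" "f \<in> arcs H \<Longrightarrow> Inr f \<in> arcs G" for e f by (simp_all add: arcs_G InlI InrI)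
  show "ck_family D E (\<lambda>v. P (cl (Inl v))) (\<lambda>e. S (Inl e))"
  proof unfold_locales
    fix v assume v: "v \<in> verts E" "finite (out_arcs E v)" "out_arcs E v \<noteq> {}"
    have vX: "v \<notin> \<iota> ` X" using v(3) i_sinks by (auto simp: sinks_def)
    note o = out_arcs_left[OF v(1) vX]
    have "(\<Oplus>\<^bsub>D\<^esub>e\<in>out_arcs G (cl (Inl v)). S e \<otimes>\<^bsub>D\<^esub> (S e)\<^sup>\<star>\<^bsub>D\<^esub>) = P (cl (Inl v))"
      by (rule sum_ranges) (use v in \<open>simp_all add: cl_verts o\<close>)
    then show "(\<Oplus>\<^bsub>D\<^esub>e\<in>out_arcs E v. S (Inl e) \<otimes>\<^bsub>D\<^esub> (S (Inl e))\<^sup>\<star>\<^bsub>D\<^esub>) = P (cl (Inl v))"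
      unfolding o by (subst (asm) M.finsum_reindex) (auto simp: a)
  qed (simp_all add: a cl_verts P_adj P_idem P_orth cl_Inl_Inl S_partial S_star_S head_G range_le flip: tail_G)
  show "ck_family D H (\<lambda>w. P (cl (Inr w))) (\<lambda>f. S (Inr f))"
  proof unfold_locales
    fix v assume v: "v \<in> verts H" "finite (out_arcs H v)" "out_arcs H v \<noteq> {}"
    note o = out_arcs_right[OF v(1)]
    have "(\<Oplus>\<^bsub>D\<^esub>e\<in>out_arcs G (cl (Inr v)). S e \<otimes>\<^bsub>D\<^esub> (S e)\<^sup>\<star>\<^bsub>D\<^esub>) = P (cl (Inr v))"
      by (rule sum_ranges) (use v in \<open>simp_all add: cl_verts o\<close>)
    then show "(\<Oplus>\<^bsub>D\<^esub>e\<in>out_arcs H v. S (Inr e) \<otimes>\<^bsub>D\<^esub> (S (Inr e))\<^sup>\<star>\<^bsub>D\<^esub>) = P (cl (Inr v))"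
      unfolding o by (subst (asm) M.finsum_reindex) (auto simp: a)
  qed (simp_all add: a cl_verts P_adj P_idem P_orth cl_Inr_Inr S_partial S_star_S head_G range_le flip: tail_G)
qed

text \<open>Families for the two graphs combine when they agree on the glued vertices and are orthogonal
  elsewhere. Ranges of arcs of \<open>E\<close> and of \<open>H\<close> are then orthogonal because the
  sources are different vertices of the pushout.\<close>

lemma glue_families:
  assumes FE: "ck_family D E P S" and FH: "ck_family D H Q T"
    and agree: "\<And>x. x \<in> X \<Longrightarrow> P (\<iota> x) = Q (\<kappa> x)"
    and orth: "\<And>v w. v \<in> verts E \<Longrightarrow> w \<in> verts H \<Longrightarrow> \<not> (\<exists>x\<in>X. v = \<iota> x \<and> w = \<kappa> x) \<Longrightarrow> P v \<otimes>\<^bsub>D\<^esub> Q w = \<zero>\<^bsub>D\<^esub>"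
  obtains PG where "ck_family D G PG (case_sum S T)"
    "\<And>v. v \<in> verts E \<Longrightarrow> PG (cl (Inl v)) = P v" "\<And>w. w \<in> verts H \<Longrightarrow> PG (cl (Inr w)) = Q w"
proof -
  interpret e: ck_family D E P S by fact
  interpret h: ck_family D H Q T by fact
  \<comment> \<open>Any representative may be chosen, since the families agree on glued vertices.\<close>
  define PG where "PG c = case_sum P Q (SOME a. a \<in> verts E <+> verts H \<and> c = cl a)" for c
  have PG: "PG (cl a) = case_sum P Q a" if a: "a \<in> verts E <+> verts H" for a
  proof -
    define b where "b = (SOME b. b \<in> verts E <+> verts H \<and> cl a = cl b)"
    have "b \<in> verts E <+> verts H \<and> cl a = cl b" unfolding b_def by (rule someI[of _ a]) (simp add: a)
    then have "(a, b) \<in> glue_rel E H X \<iota> \<kappa>" using cl_eq_iff[OF a] by blast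
    then have "case_sum P Q b = case_sum P Q a" unfolding glue_rel_iff using agree by auto
    then show ?thesis by (simp add: PG_def b_def)
  qed
  have PL: "PG (cl (Inl v)) = P v" if "v \<in> verts E" for v using PG[of "Inl v"] that by auto
  have PR: "PG (cl (Inr w)) = Q w" if "w \<in> verts H" for w using PG[of "Inr w"] that by auto
  have orth': "Q w \<otimes>\<^bsub>D\<^esub> P v = \<zero>\<^bsub>D\<^esub>" if "v \<in> verts E" "w \<in> verts H" "\<not> (\<exists>x\<in>X. v = \<iota> x \<and> w = \<kappa> x)" for v w
    using orth[OF that] e.adj_mult[of "P v" "Q w"] that by (simp add: e.P_adj h.P_adj)
  have ST: "(S e)\<^sup>\<star>\<^bsub>D\<^esub> \<otimes>\<^bsub>D\<^esub> T f = \<zero>\<^bsub>D\<^esub>" if "e \<in> arcs E" "f \<in> arcs H" for e f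
  proof -
    have "(S e)\<^sup>\<star>\<^bsub>D\<^esub> \<otimes>\<^bsub>D\<^esub> T f = ((S e)\<^sup>\<star>\<^bsub>D\<^esub> \<otimes>\<^bsub>D\<^esub> P (tail E e)) \<otimes>\<^bsub>D\<^esub> (Q (tail H f) \<otimes>\<^bsub>D\<^esub> T f)"
      using that by (simp add: e.S_adj_P h.P_tail_S)
    also have "\<dots> = (S e)\<^sup>\<star>\<^bsub>D\<^esub> \<otimes>\<^bsub>D\<^esub> ((P (tail E e) \<otimes>\<^bsub>D\<^esub> Q (tail H f)) \<otimes>\<^bsub>D\<^esub> T f)"
      using that by (simp add: e.mult_assoc)
    also have "\<dots> = \<zero>\<^bsub>D\<^esub>" using that tail_not_glued by (subst orth) auto
    finally show ?thesis .
  qed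
  have TS: "(T f)\<^sup>\<star>\<^bsub>D\<^esub> \<otimes>\<^bsub>D\<^esub> S e = \<zero>\<^bsub>D\<^esub>" if "e \<in> arcs E" "f \<in> arcs H" for e f
    using ST[OF that] e.adj_mult[of "(S e)\<^sup>\<star>\<^bsub>D\<^esub>" "T f"] that by simp
  have sumR: "(\<Oplus>\<^bsub>D\<^esub>e\<in>out_arcs G (cl (Inr w)). case_sum S T e \<otimes>\<^bsub>D\<^esub> (case_sum S T e)\<^sup>\<star>\<^bsub>D\<^esub>) = PG (cl (Inr w))"
    if w: "w \<in> verts H" "finite (out_arcs G (cl (Inr w)))" "out_arcs G (cl (Inr w)) \<noteq> {}" for w
  proof -
    note o = out_arcs_right[OF w(1)]
    have "finite (out_arcs H w)" "out_arcs H w \<noteq> {}"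
      using w(2,3) unfolding o by (simp_all add: finite_image_iff)
    from h.sum_ranges[OF w(1) this] show ?thesis
      unfolding o by (subst e.M.finsum_reindex) (auto simp: PR w)
  qed
  have sumL: "(\<Oplus>\<^bsub>D\<^esub>e\<in>out_arcs G (cl (Inl v)). case_sum S T e \<otimes>\<^bsub>D\<^esub> (case_sum S T e)\<^sup>\<star>\<^bsub>D\<^esub>) = PG (cl (Inl v))"
    if v: "v \<in> verts E" "v \<notin> \<iota> ` X" "finite (out_arcs G (cl (Inl v)))" "out_arcs G (cl (Inl v)) \<noteq> {}" for v
  proof -
    note o = out_arcs_left[OF v(1,2)]
    have "finite (out_arcs E v)" "out_arcs E v \<noteq> {}"
      using v(3,4) unfolding o by (simp_all add: finite_image_iff)
    from e.sum_ranges[OF v(1) this] show ?thesis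
      unfolding o by (subst e.M.finsum_reindex) (auto simp: PL v)
  qed
  have sums: "(\<Oplus>\<^bsub>D\<^esub>e\<in>out_arcs G c. case_sum S T e \<otimes>\<^bsub>D\<^esub> (case_sum S T e)\<^sup>\<star>\<^bsub>D\<^esub>) = PG c"
    if a: "a \<in> verts E <+> verts H" "c = cl a" and c: "finite (out_arcs G c)" "out_arcs G c \<noteq> {}" for a c
  proof (cases "\<exists>w\<in>verts H. c = cl (Inr w)")
    case True
    then show ?thesis using sumR c by blast
  next
    case False
    then obtain v where v: "v \<in> verts E" "c = cl (Inl v)" using a by auto
    have "v \<notin> \<iota> ` X" using False v cl_Inl_Inr[OF v(1)] k_vert by blast
    then show ?thesis using sumL[OF v(1)] c unfolding v(2) by blast
  qed
  have "ck_family D G PG (case_sum S T)"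
  proof unfold_locales
    fix c assume "c \<in> verts G"
    then obtain a where a: "a \<in> verts E <+> verts H" "c = cl a" by (auto simp: verts_G)
    show "PG c \<in> carrier D" "(PG c)\<^sup>\<star>\<^bsub>D\<^esub> = PG c" "PG c \<otimes>\<^bsub>D\<^esub> PG c = PG c"
      using a by (auto simp: PL PR e.P_adj h.P_adj e.P_idem h.P_idem)
    show "PG c \<otimes>\<^bsub>D\<^esub> PG d = \<zero>\<^bsub>D\<^esub>" if d: "d \<in> verts G" "c \<noteq> d" for d
    proof -
      obtain b where b: "b \<in> verts E <+> verts H" "d = cl b" using d(1) by (auto simp: verts_G)
      have ne: "cl a \<noteq> cl b" using a b d(2) by simp
      show ?thesis
      proof (cases a; cases b)
        fix v v' assume "a = Inl v" "b = Inl v'"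
        then show ?thesis using a b ne by (auto simp: PL intro!: e.P_orth)
      next
        fix v w assume "a = Inl v" "b = Inr w"
        moreover from this have "v \<in> verts E" "w \<in> verts H" using a(1) b(1) by auto
        ultimately show ?thesis using a(2) b(2) ne cl_Inl_Inr[of v w] by (simp add: PL PR orth)
      next
        fix w v assume "a = Inr w" "b = Inl v"
        moreover from this have "v \<in> verts E" "w \<in> verts H" using a(1) b(1) by auto
        ultimately show ?thesis using a(2) b(2) ne[symmetric] cl_Inl_Inr[of v w] by (simp add: PL PR orth')
      next
        fix w w' assume "a = Inr w" "b = Inr w'"
        then show ?thesis using a b ne by (auto simp: PR intro!: h.P_orth)
      qed
    qed
    show "(\<Oplus>\<^bsub>D\<^esub>e\<in>out_arcs G c. case_sum S T e \<otimes>\<^bsub>D\<^esub> (case_sum S T e)\<^sup>\<star>\<^bsub>D\<^esub>) = PG c"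
      if "finite (out_arcs G c)" "out_arcs G c \<noteq> {}" by (rule sums[OF a that])
  next
    fix g assume g: "g \<in> arcs G"
    show "case_sum S T g \<in> carrier D"
      "case_sum S T g \<otimes>\<^bsub>D\<^esub> (case_sum S T g)\<^sup>\<star>\<^bsub>D\<^esub> \<otimes>\<^bsub>D\<^esub> case_sum S T g = case_sum S T g"
      "PG (tail G g) \<otimes>\<^bsub>D\<^esub> (case_sum S T g \<otimes>\<^bsub>D\<^esub> (case_sum S T g)\<^sup>\<star>\<^bsub>D\<^esub>) = case_sum S T g \<otimes>\<^bsub>D\<^esub> (case_sum S T g)\<^sup>\<star>\<^bsub>D\<^esub>"
      using g by (auto simp: arcs_G tail_G PL PR e.S_partial h.S_partial e.range_le h.range_le)
    show "(case_sum S T g)\<^sup>\<star>\<^bsub>D\<^esub> \<otimes>\<^bsub>D\<^esub> case_sum S T g' = (if g = g' then PG (head G g) else \<zero>\<^bsub>D\<^esub>)" if "g' \<in> arcs G" for g'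
      using g that by (auto simp: arcs_G head_G PL PR ST TS e.S_star_S h.S_star_S split: if_splits)
  qed
  then show ?thesis using that PL PR by blast
qed

end

section \<open>The algebra of a glued graph\<close>

context gluing
begin

lemma left_hom:
  obtains j where "star_hom (graph_cstar E) (graph_cstar G) j" "pushout_left_homs E H X \<iota> \<kappa> = {j}"
    "\<And>v. v \<in> verts E \<Longrightarrow> j (vproj E v) = vproj G (cl (Inl v))" "\<And>e. e \<in> arcs E \<Longrightarrow> j (eiso E e) = eiso G (Inl e)"
proof -
  obtain j where j: "star_hom (graph_cstar E) (graph_cstar G) j"
    "\<And>v. v \<in> verts E \<Longrightarrow> j (vproj E v) = vproj G (cl (Inl v))" "\<And>e. e \<in> arcs E \<Longrightarrow> j (eiso E e) = eiso G (Inl e)"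
    using graph_cstar_hom[OF restrict_families(1)[OF graph_cstar_family[OF G.wf_digraph_axioms]]] by blast
  have "k = j" if "k \<in> pushout_left_homs E H X \<iota> \<kappa>" for k
  proof (rule graph_cstar_hom_eqI[OF E.wf_digraph_axioms _ j(1)])
    show "star_hom (graph_cstar E) (graph_cstar G) k"
      using that j(1) by (auto simp: pushout_left_homs_def label_homs_def star_hom_def star_hom_axioms_def)
  qed (use that j in \<open>auto simp: pushout_left_homs_def label_homs_def\<close>)
  moreover have "j \<in> pushout_left_homs E H X \<iota> \<kappa>"
    using j by (auto simp: pushout_left_homs_def label_homs_def star_hom_def star_hom_axioms_def)
  ultimately have "pushout_left_homs E H X \<iota> \<kappa> = {j}" by blast
  from j(1) this j(2,3) show ?thesis by (rule that)
qed

lemma right_hom: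
  obtains j where "star_hom (graph_cstar H) (graph_cstar G) j" "pushout_right_homs E H X \<iota> \<kappa> = {j}"
    "\<And>w. w \<in> verts H \<Longrightarrow> j (vproj H w) = vproj G (cl (Inr w))" "\<And>f. f \<in> arcs H \<Longrightarrow> j (eiso H f) = eiso G (Inr f)"
proof -
  obtain j where j: "star_hom (graph_cstar H) (graph_cstar G) j"
    "\<And>w. w \<in> verts H \<Longrightarrow> j (vproj H w) = vproj G (cl (Inr w))" "\<And>f. f \<in> arcs H \<Longrightarrow> j (eiso H f) = eiso G (Inr f)"
    using graph_cstar_hom[OF restrict_families(2)[OF graph_cstar_family[OF G.wf_digraph_axioms]]] by blast
  have "k = j" if "k \<in> pushout_right_homs E H X \<iota> \<kappa>" for k
  proof (rule graph_cstar_hom_eqI[OF H.wf_digraph_axioms _ j(1)])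
    show "star_hom (graph_cstar H) (graph_cstar G) k"
      using that j(1) by (auto simp: pushout_right_homs_def label_homs_def star_hom_def star_hom_axioms_def)
  qed (use that j in \<open>auto simp: pushout_right_homs_def label_homs_def\<close>)
  moreover have "j \<in> pushout_right_homs E H X \<iota> \<kappa>"
    using j by (auto simp: pushout_right_homs_def label_homs_def star_hom_def star_hom_axioms_def)
  ultimately have "pushout_right_homs E H X \<iota> \<kappa> = {j}" by blast
  from j(1) this j(2,3) show ?thesis by (rule that)
qed

end

locale glued_algebra = gluing E H X \<iota> \<kappa> + jE: star_hom "graph_cstar E" "graph_cstar (pushout_graph E H X \<iota> \<kappa>)" jE
    + jH: star_hom "graph_cstar H" "graph_cstar (pushout_graph E H X \<iota> \<kappa>)" jH
  for E :: "('v, 'e) pre_digraph" and H :: "('w, 'f) pre_digraph" and X :: "'x set" and \<iota> \<kappa> jE jH +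
  assumes jE_P: "v \<in> verts E \<Longrightarrow> jE (vproj E v) = vproj G (cl (Inl v))"
    and jE_S: "e \<in> arcs E \<Longrightarrow> jE (eiso E e) = eiso G (Inl e)"
    and jH_P: "w \<in> verts H \<Longrightarrow> jH (vproj H w) = vproj G (cl (Inr w))"
    and jH_S: "f \<in> arcs H \<Longrightarrow> jH (eiso H f) = eiso G (Inr f)"
begin

sublocale FE: ck_family "graph_cstar E" E "vproj E" "eiso E" by (rule graph_cstar_family[OF E.wf_digraph_axioms])
sublocale FH: ck_family "graph_cstar H" H "vproj H" "eiso H" by (rule graph_cstar_family[OF H.wf_digraph_axioms])
sublocale FG: ck_family "graph_cstar G" G "vproj G" "eiso G" by (rule graph_cstar_family[OF G.wf_digraph_axioms])

lemma jE_jH_glued: "x \<in> X \<Longrightarrow> jE (vproj E (\<iota> x)) = jH (vproj H (\<kappa> x))"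
  using cl_Inl_Inr[OF i_verts k_vert, of x x] by (auto simp: jE_P jH_P i_verts k_vert)

lemma jE_jH_orth: "v \<in> verts E \<Longrightarrow> w \<in> verts H \<Longrightarrow> \<not> (\<exists>x\<in>X. v = \<iota> x \<and> w = \<kappa> x) \<Longrightarrow>
    jE (vproj E v) \<otimes>\<^bsub>graph_cstar G\<^esub> jH (vproj H w) = \<zero>\<^bsub>graph_cstar G\<^esub>"
  by (simp add: jE_P jH_P cl_verts FG.P_orth cl_Inl_Inr)

lemma glued_generators: "graph_gens G = jE ` graph_gens E \<union> jH ` graph_gens H"
  unfolding graph_gens_def verts_G arcs_G image_Un image_image
  by (auto simp: jE_P jE_S jH_P jH_S image_iff Plus_def image_Un cl_verts)

lemma glued_generated: "carrier (graph_cstar G) = star_closure (graph_cstar G) (jE ` graph_gens E \<union> jH ` graph_gens H)"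
  using graph_cstar_generated[OF G.wf_digraph_axioms] by (simp only: glued_generators)

lemma glued_hom_eqI:
  assumes h: "star_hom (graph_cstar G) D h" and k: "star_hom (graph_cstar G) D k"
    and "\<And>c. c \<in> carrier (graph_cstar E) \<Longrightarrow> h (jE c) = k (jE c)" "\<And>c. c \<in> carrier (graph_cstar H) \<Longrightarrow> h (jH c) = k (jH c)"
  shows "h = k"
  by (rule star_hom_eqI[OF h k glued_generated])
    (use assms(3,4) in \<open>auto simp: graph_gens_def\<close>)

text \<open>The universal property of the glued algebra in terms of its two parts, including the uniqueness
  that the definition of the induced maps requires.\<close>

lemma induced_hom:
  assumes f: "star_hom (graph_cstar E) D f" and g: "star_hom (graph_cstar H) D g"
    and agree: "\<And>x. x \<in> X \<Longrightarrow> f (vproj E (\<iota> x)) = g (vproj H (\<kappa> x))"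
    and orth: "\<And>v w. v \<in> verts E \<Longrightarrow> w \<in> verts H \<Longrightarrow> \<not> (\<exists>x\<in>X. v = \<iota> x \<and> w = \<kappa> x) \<Longrightarrow>
      f (vproj E v) \<otimes>\<^bsub>D\<^esub> g (vproj H w) = \<zero>\<^bsub>D\<^esub>"
  obtains h where "star_hom (graph_cstar G) D h" "induced_homs E H X \<iota> \<kappa> D jE jH f g = {h}"
    "\<forall>c\<in>carrier (graph_cstar E). h (jE c) = f c" "\<forall>c\<in>carrier (graph_cstar H). h (jH c) = g c"
proof -
  interpret f: star_hom "graph_cstar E" D f by fact
  interpret g: star_hom "graph_cstar H" D g by fact
  obtain PG where PG: "ck_family D G PG (case_sum (\<lambda>e. f (eiso E e)) (\<lambda>e. g (eiso H e)))"
    "\<And>v. v \<in> verts E \<Longrightarrow> PG (cl (Inl v)) = f (vproj E v)" "\<And>w. w \<in> verts H \<Longrightarrow> PG (cl (Inr w)) = g (vproj H w)"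
    using glue_families[OF ck_family_image[OF FE.ck_family_axioms f] ck_family_image[OF FH.ck_family_axioms g] agree orth]
    by blast
  obtain h where h: "star_hom (graph_cstar G) D h" "\<And>v. v \<in> verts G \<Longrightarrow> h (vproj G v) = PG v"
    "\<And>e. e \<in> arcs G \<Longrightarrow> h (eiso G e) = case_sum (\<lambda>e. f (eiso E e)) (\<lambda>e. g (eiso H e)) e"
    using graph_cstar_hom[OF PG(1)] by blast
  have hE: "compose (carrier (graph_cstar E)) h jE = f"
    by (rule graph_cstar_hom_eqI[OF E.wf_digraph_axioms star_hom_compose[OF jE.star_hom_axioms h(1)] f])
      (simp_all add: compose_def jE_P jE_S h PG cl_verts arcs_G InlI)
  have hH: "compose (carrier (graph_cstar H)) h jH = g"
    by (rule graph_cstar_hom_eqI[OF H.wf_digraph_axioms star_hom_compose[OF jH.star_hom_axioms h(1)] g])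
      (simp_all add: compose_def jH_P jH_S h PG cl_verts arcs_G InrI)
  have cE: "h (jE c) = f c" if "c \<in> carrier (graph_cstar E)" for c
    using fun_cong[OF hE, of c] that by (simp add: compose_def)
  have cH: "h (jH c) = g c" if "c \<in> carrier (graph_cstar H)" for c
    using fun_cong[OF hH, of c] that by (simp add: compose_def)
  have "k = h" if k: "k \<in> induced_homs E H X \<iota> \<kappa> D jE jH f g" for k
  proof (rule glued_hom_eqI[OF _ h(1)])
    show "star_hom (graph_cstar G) D k"
      using k h(1) by (simp add: induced_homs_def star_hom_def star_hom_axioms_def)
    have "compose (carrier (graph_cstar E)) k jE = f" "compose (carrier (graph_cstar H)) k jH = g"
      using k by (simp_all add: induced_homs_def)
    note eq = fun_cong[OF this(1)] fun_cong[OF this(2)]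
    show "k (jE c) = h (jE c)" if "c \<in> carrier (graph_cstar E)" for c
      using eq(1)[of c] that by (simp add: compose_def cE)
    show "k (jH c) = h (jH c)" if "c \<in> carrier (graph_cstar H)" for c
      using eq(2)[of c] that by (simp add: compose_def cH)
  qed
  moreover have "h \<in> induced_homs E H X \<iota> \<kappa> D jE jH f g"
    using h(1) hE hH by (simp add: induced_homs_def star_hom_def star_hom_axioms_def)
  ultimately have "induced_homs E H X \<iota> \<kappa> D jE jH f g = {h}" by blast
  from that[OF h(1) this] show ?thesis using cE cH by blast
qed

end

section \<open>Approximate units of projections\<close>

lemma le_of_square_le_mult: "0 \<le> a \<Longrightarrow> 0 \<le> b \<Longrightarrow> a * a \<le> b * a \<Longrightarrow> a \<le> (b :: real)"
  by (cases "0 < a") (auto simp: mult_le_cancel_right)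

context cstar_algebra
begin

lemma diff_diff: "\<lbrakk>a \<in> carrier A; b \<in> carrier A; c \<in> carrier A; d \<in> carrier A\<rbrakk> \<Longrightarrow>
    (a \<ominus> b) \<ominus> (c \<ominus> d) = (a \<ominus> c) \<ominus> (b \<ominus> d)"
  by (simp add: diff_sc sc_add_right M.a_ac)

lemma diff_diff_cancel: "a \<in> carrier A \<Longrightarrow> b \<in> carrier A \<Longrightarrow> a \<ominus> (a \<ominus> b) = b"
  by (simp add: M.minus_eq M.minus_add M.r_neg2)

lemma diff_diff_right: "\<lbrakk>a \<in> carrier A; b \<in> carrier A; c \<in> carrier A\<rbrakk> \<Longrightarrow> (a \<ominus> b) \<ominus> (c \<ominus> b) = a \<ominus> c"
  by (subst diff_diff) simp_all

lemma proj_mult_le: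
  assumes "p \<in> carrier A" "p\<^sup>\<star> = p" "p \<otimes> p = p" "x \<in> carrier A"
  shows "\<parallel>p \<otimes> x\<parallel> \<le> \<parallel>x\<parallel>"
proof -
  have "p \<otimes> (p \<otimes> x) = p \<otimes> x" using assms mult_assoc[of p p x] by simp
  then have "(p \<otimes> x)\<^sup>\<star> \<otimes> (p \<otimes> x) = x\<^sup>\<star> \<otimes> (p \<otimes> x)" using assms by (simp add: adj_mult mult_assoc)
  then have "\<parallel>p \<otimes> x\<parallel> * \<parallel>p \<otimes> x\<parallel> \<le> \<parallel>x\<parallel> * \<parallel>p \<otimes> x\<parallel>"
    using cstar_identity[of "p \<otimes> x"] cnorm_mult[of "x\<^sup>\<star>" "p \<otimes> x"] assms by (simp add: power2_eq_square)
  then show ?thesis by (rule le_of_square_le_mult[rotated 2]) (use assms in simp_all)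
qed

text \<open>Multiplication by \<open>1 - p\<close> is contractive; it is written without the unit.\<close>

lemma proj_compl_le:
  assumes "p \<in> carrier A" "p\<^sup>\<star> = p" "p \<otimes> p = p" "x \<in> carrier A"
  shows "\<parallel>x \<ominus> p \<otimes> x\<parallel> \<le> \<parallel>x\<parallel>"
proof -
  let ?z = "x \<ominus> p \<otimes> x"
  have z: "?z \<in> carrier A" using assms by simp
  have pz: "p \<otimes> ?z = \<zero>" using assms mult_assoc[of p p x] by (simp add: mult_diff_right)
  have "?z\<^sup>\<star> \<otimes> ?z = x\<^sup>\<star> \<otimes> ?z \<ominus> x\<^sup>\<star> \<otimes> (p \<otimes> ?z)"
    using assms z by (simp add: adj_diff adj_mult mult_diff_left mult_assoc)
  then have "\<parallel>?z\<parallel> * \<parallel>?z\<parallel> \<le> \<parallel>x\<parallel> * \<parallel>?z\<parallel>"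
    using cstar_identity[OF z] cnorm_mult[of "x\<^sup>\<star>" ?z] assms z pz by (simp add: power2_eq_square)
  then show ?thesis by (rule le_of_square_le_mult[rotated 2]) (use assms z in simp_all)
qed

lemma proj_compl_right_le:
  assumes "p \<in> carrier A" "p\<^sup>\<star> = p" "p \<otimes> p = p" "x \<in> carrier A"
  shows "\<parallel>x \<ominus> x \<otimes> p\<parallel> \<le> \<parallel>x\<parallel>"
proof -
  have "(x \<ominus> x \<otimes> p)\<^sup>\<star> = x\<^sup>\<star> \<ominus> p \<otimes> x\<^sup>\<star>" using assms by (simp add: adj_diff adj_mult)
  then show ?thesis
    using proj_compl_le[OF assms(1-3), of "x\<^sup>\<star>"] norm_adj[of "x \<ominus> x \<otimes> p"] assms by simp
qed

end

text \<open>An increasing sequence of projections, a candidate for an approximate unit.\<close>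

locale proj_seq = cstar_algebra A for A :: "('a, 'm) cstar_scheme" (structure) +
  fixes u :: "nat \<Rightarrow> 'a"
  assumes u_closed [simp]: "u n \<in> carrier A" and u_adj: "(u n)\<^sup>\<star> = u n"
    and u_mono: "m \<le> n \<Longrightarrow> u m \<otimes> u n = u m"
begin

lemma u_idem: "u n \<otimes> u n = u n" by (simp add: u_mono)

text \<open>The elements on which the sequence acts as a left approximate unit; they form a closed right
  ideal.\<close>

definition unit_for :: "'a \<Rightarrow> bool" where
  "unit_for y \<longleftrightarrow> y \<in> carrier A \<and> conv A (\<lambda>n. u n \<otimes> y) y"

lemma unit_forD: "unit_for y \<Longrightarrow> y \<in> carrier A" "unit_for y \<Longrightarrow> conv A (\<lambda>n. u n \<otimes> y) y"
  by (simp_all add: unit_for_def)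

lemma unit_for_zero: "unit_for \<zero>"
  by (simp add: unit_for_def)

lemma unit_for_add: "unit_for x \<Longrightarrow> unit_for y \<Longrightarrow> unit_for (x \<oplus> y)"
  using conv_add[of "\<lambda>n. u n \<otimes> x" x "\<lambda>n. u n \<otimes> y" y] by (simp add: unit_for_def mult_distrib_left)

lemma unit_for_sc: "unit_for x \<Longrightarrow> unit_for (c \<odot> x)"
  using conv_sc[of "\<lambda>n. u n \<otimes> x" x c] by (simp add: unit_for_def smult_mult_right)

text \<open>The maps \<open>x \<mapsto> x - u\<^sub>n x\<close> are contractive, hence pointwise convergence
  to zero passes to limits.\<close>

lemma unit_for_lim:
  assumes s: "\<And>k. unit_for (s k)" and lim: "conv A s x"
  shows "unit_for x"
proof -
  note [simp] = convD(1,2)[OF lim]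
  have "(\<lambda>n. \<parallel>u n \<otimes> x \<ominus> x\<parallel>) \<longlonglongrightarrow> 0"
  proof (rule LIMSEQ_I)
    fix e :: real assume e: "0 < e"
    then have e3: "0 < e / 2" by simp
    from LIMSEQ_D[OF convD(3)[OF lim] e3] obtain k where k: "\<parallel>s k \<ominus> x\<parallel> < e / 2" by auto
    from LIMSEQ_D[OF convD(3)[OF unit_forD(2)[OF s[of k]]] e3] obtain M where
      M: "\<And>n. n \<ge> M \<Longrightarrow> \<parallel>u n \<otimes> s k \<ominus> s k\<parallel> < e / 2" by auto
    have "norm (\<parallel>u n \<otimes> x \<ominus> x\<parallel> - 0) < e" if "n \<ge> M" for n
    proof -
      let ?z = "s k \<ominus> x"
      have "x \<ominus> u n \<otimes> x = (s k \<ominus> u n \<otimes> s k) \<ominus> (?z \<ominus> u n \<otimes> ?z)"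
        using diff_diff[of "s k" x "u n \<otimes> s k" "u n \<otimes> x"] by (simp add: mult_diff_right diff_diff_cancel)
      then have "\<parallel>x \<ominus> u n \<otimes> x\<parallel> \<le> \<parallel>s k \<ominus> u n \<otimes> s k\<parallel> + \<parallel>?z \<ominus> u n \<otimes> ?z\<parallel>"
        using norm_diff_le[of "s k \<ominus> u n \<otimes> s k" "?z \<ominus> u n \<otimes> ?z"] by simp
      also have "\<dots> < e / 2 + e / 2"
        using M[OF that] k proj_compl_le[OF u_closed u_adj u_idem, of ?z n] norm_diff_comm[of "s k" "u n \<otimes> s k"]
        by (intro add_strict_mono) simp_all
      finally show ?thesis using norm_diff_comm[of x "u n \<otimes> x"] by simp
    qed
    then show "\<exists>M. \<forall>n\<ge>M. norm (\<parallel>u n \<otimes> x \<ominus> x\<parallel> - 0) < e" by blast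
  qed
  then show ?thesis by (simp add: unit_for_def conv_def)
qed

end

text \<open>A self-adjoint ideal with an approximate unit of projections: the quotient norm is a
  C*-seminorm, given by compressing with the complementary projections.\<close>

locale unital_ideal = proj_seq A u for A :: "('a, 'm) cstar_scheme" (structure) and u +
  fixes T :: "'a set"
  assumes T_carrier: "T \<subseteq> carrier A" and T_adj: "x \<in> T \<Longrightarrow> x\<^sup>\<star> \<in> T"
    and u_ideal: "u n \<in> closed_ideal A T" and u_unit: "y \<in> closed_ideal A T \<Longrightarrow> unit_for y"
begin

abbreviation "J \<equiv> closed_ideal A T"

lemma I_carrier: "y \<in> J \<Longrightarrow> y \<in> carrier A"
  using closed_ideal_carrier T_carrier by blast

lemma I_adj: "y \<in> J \<Longrightarrow> y\<^sup>\<star> \<in> J"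
  using closed_ideal_adj T_carrier T_adj by blast

lemma right_unit: "y \<in> J \<Longrightarrow> conv A (\<lambda>n. y \<otimes> u n) y"
  using conv_adj[OF unit_forD(2)[OF u_unit[OF I_adj]]] by (simp add: adj_mult u_adj I_carrier)

text \<open>The norm of \<open>c\<close> modulo the ideal. That it is a limit and not an infimum makes the
  C*-identity and submultiplicativity accessible.\<close>

definition qnorm :: "'a \<Rightarrow> real" where
  "qnorm c = lim (\<lambda>n. \<parallel>c \<ominus> c \<otimes> u n\<parallel>)"

lemma qnorm_decreasing:
  assumes c: "c \<in> carrier A" and "m \<le> n" shows "\<parallel>c \<ominus> c \<otimes> u n\<parallel> \<le> \<parallel>c \<ominus> c \<otimes> u m\<parallel>"
proof -
  let ?x = "c \<ominus> c \<otimes> u m"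
  have "?x \<otimes> u n = c \<otimes> u n \<ominus> c \<otimes> u m" using assms by (simp add: mult_diff_left mult_assoc u_mono)
  then have "?x \<ominus> ?x \<otimes> u n = (c \<ominus> c \<otimes> u m) \<ominus> (c \<otimes> u n \<ominus> c \<otimes> u m)" by simp
  also have "\<dots> = c \<ominus> c \<otimes> u n"
    using c by (simp add: diff_diff_right)
  finally show ?thesis using proj_compl_right_le[OF u_closed u_adj u_idem, of ?x n] c by simp
qed

lemma qnorm_lim: assumes c: "c \<in> carrier A" shows "(\<lambda>n. \<parallel>c \<ominus> c \<otimes> u n\<parallel>) \<longlonglongrightarrow> qnorm c"
proof -
  have "decseq (\<lambda>n. \<parallel>c \<ominus> c \<otimes> u n\<parallel>)" using qnorm_decreasing[OF c] by (simp add: decseq_def)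
  moreover have "0 \<le> \<parallel>c \<ominus> c \<otimes> u n\<parallel>" for n using c by simp
  ultimately obtain L where "(\<lambda>n. \<parallel>c \<ominus> c \<otimes> u n\<parallel>) \<longlonglongrightarrow> L"
    using decseq_convergent[of "\<lambda>n. \<parallel>c \<ominus> c \<otimes> u n\<parallel>" 0] by blast
  then have "convergent (\<lambda>n. \<parallel>c \<ominus> c \<otimes> u n\<parallel>)" by (rule convergentI)
  then show ?thesis unfolding qnorm_def by (simp add: convergent_LIMSEQ_iff)
qed

lemma qnorm_nonneg: "c \<in> carrier A \<Longrightarrow> 0 \<le> qnorm c"
  by (rule LIMSEQ_le_const[OF qnorm_lim]) simp_all

lemma qnorm_le: "c \<in> carrier A \<Longrightarrow> qnorm c \<le> \<parallel>c\<parallel>"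
  by (rule LIMSEQ_le_const2[OF qnorm_lim]) (simp_all add: proj_compl_right_le[OF u_closed u_adj u_idem])

lemma qnorm_add: "a \<in> carrier A \<Longrightarrow> b \<in> carrier A \<Longrightarrow> qnorm (a \<oplus> b) \<le> qnorm a + qnorm b"
proof -
  assume a: "a \<in> carrier A" and b: "b \<in> carrier A"
  have "\<parallel>(a \<oplus> b) \<ominus> (a \<oplus> b) \<otimes> u n\<parallel> \<le> \<parallel>a \<ominus> a \<otimes> u n\<parallel> + \<parallel>b \<ominus> b \<otimes> u n\<parallel>" for n
    using a b cnorm_add[of "a \<ominus> a \<otimes> u n" "b \<ominus> b \<otimes> u n"] by (simp add: mult_distrib_right add_diff_add)
  then show ?thesis
    using LIMSEQ_le[OF qnorm_lim tendsto_add[OF qnorm_lim[OF a] qnorm_lim[OF b]], of "a \<oplus> b"] a b by simp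
qed

lemma qnorm_sc: "a \<in> carrier A \<Longrightarrow> qnorm (c \<odot> a) = cmod c * qnorm a"
proof -
  assume a: "a \<in> carrier A"
  have "(\<lambda>n. \<parallel>c \<odot> a \<ominus> (c \<odot> a) \<otimes> u n\<parallel>) = (\<lambda>n. cmod c * \<parallel>a \<ominus> a \<otimes> u n\<parallel>)"
    using a by (simp add: smult_mult_left norm_sc flip: sc_diff_right)
  then show ?thesis
    using LIMSEQ_unique[OF qnorm_lim[of "c \<odot> a"]] tendsto_mult_left[OF qnorm_lim[OF a], of "cmod c"] a by simp
qed

lemma qnorm_zero_I: "y \<in> J \<Longrightarrow> qnorm y = 0"
proof -
  assume y: "y \<in> J"
  have "(\<lambda>n. \<parallel>y \<otimes> u n \<ominus> y\<parallel>) = (\<lambda>n. \<parallel>y \<ominus> y \<otimes> u n\<parallel>)"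
    using I_carrier[OF y] by (simp add: norm_diff_comm)
  then show ?thesis using LIMSEQ_unique[OF qnorm_lim[OF I_carrier[OF y]]] convD(3)[OF right_unit[OF y]] by simp
qed

lemma qnorm_approx:
  assumes c: "c \<in> carrier A" and "qnorm c < e" obtains y where "y \<in> J" "\<parallel>c \<ominus> y\<parallel> < e"
proof -
  obtain n where "\<parallel>c \<ominus> c \<otimes> u n\<parallel> < e"
    using order_tendstoD(2)[OF qnorm_lim[OF c] assms(2)] by (auto simp: eventually_sequentially)
  then show ?thesis using that[of "c \<otimes> u n"] closed_ideal.left[OF c u_ideal] by blast
qed

lemma qnorm_zero_iff: "c \<in> carrier A \<Longrightarrow> qnorm c = 0 \<longleftrightarrow> c \<in> J"
proof
  assume c: "c \<in> carrier A" and "qnorm c = 0"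
  then have "(\<lambda>n. \<parallel>c \<otimes> u n \<ominus> c\<parallel>) \<longlonglongrightarrow> 0" using qnorm_lim[OF c] by (simp add: norm_diff_comm)
  then have "conv A (\<lambda>n. c \<otimes> u n) c" using c by (simp add: conv_def)
  moreover have "c \<otimes> u n \<in> J" for n by (rule closed_ideal.left[OF c u_ideal])
  ultimately show "c \<in> J" by (rule closed_ideal.lim[rotated])
qed (rule qnorm_zero_I)

text \<open>Up to an element of the ideal, which disappears in the limit, \<open>a\<close> can be replaced by
  \<open>a - a u\<^sub>m\<close>.\<close>

lemma qnorm_mult: "a \<in> carrier A \<Longrightarrow> b \<in> carrier A \<Longrightarrow> qnorm (a \<otimes> b) \<le> qnorm a * qnorm b"
proof -
  assume a: "a \<in> carrier A" and b: "b \<in> carrier A"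
  have *: "qnorm (a \<otimes> b) \<le> \<parallel>a \<ominus> a \<otimes> u m\<parallel> * qnorm b" for m
  proof -
    let ?y = "u m \<otimes> b"
    have y: "?y \<in> J" by (rule closed_ideal.right[OF b u_ideal])
    have "\<parallel>a \<otimes> b \<ominus> (a \<otimes> b) \<otimes> u n\<parallel> \<le> \<parallel>a \<ominus> a \<otimes> u m\<parallel> * \<parallel>b \<ominus> b \<otimes> u n\<parallel> + \<parallel>a\<parallel> * \<parallel>?y \<otimes> u n \<ominus> ?y\<parallel>" for n
    proof -
      let ?b = "b \<ominus> b \<otimes> u n"
      have "a \<otimes> b \<ominus> (a \<otimes> b) \<otimes> u n = a \<otimes> ?b" using a b by (simp add: mult_diff_right mult_assoc)
      also have "\<dots> = (a \<ominus> a \<otimes> u m) \<otimes> ?b \<oplus> (a \<otimes> u m) \<otimes> ?b"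
        using a b by (simp add: diff_add_cancel flip: mult_distrib_right)
      also have "(a \<otimes> u m) \<otimes> ?b = a \<otimes> (?y \<ominus> ?y \<otimes> u n)" using a b by (simp add: mult_diff_right mult_assoc)
      finally have "\<parallel>a \<otimes> b \<ominus> (a \<otimes> b) \<otimes> u n\<parallel> \<le> \<parallel>(a \<ominus> a \<otimes> u m) \<otimes> ?b\<parallel> + \<parallel>a \<otimes> (?y \<ominus> ?y \<otimes> u n)\<parallel>"
        using cnorm_add[of "(a \<ominus> a \<otimes> u m) \<otimes> ?b" "a \<otimes> (?y \<ominus> ?y \<otimes> u n)"] a b by simp
      then show ?thesis
        using cnorm_mult[of "a \<ominus> a \<otimes> u m" ?b] cnorm_mult[of a "?y \<ominus> ?y \<otimes> u n"] a b
          norm_diff_comm[of ?y "?y \<otimes> u n"] by simp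
    qed
    moreover have "(\<lambda>n. \<parallel>a \<ominus> a \<otimes> u m\<parallel> * \<parallel>b \<ominus> b \<otimes> u n\<parallel> + \<parallel>a\<parallel> * \<parallel>?y \<otimes> u n \<ominus> ?y\<parallel>)
      \<longlonglongrightarrow> \<parallel>a \<ominus> a \<otimes> u m\<parallel> * qnorm b + \<parallel>a\<parallel> * 0"
      by (rule tendsto_add[OF tendsto_mult_left[OF qnorm_lim[OF b]] tendsto_mult_left[OF convD(3)[OF right_unit[OF y]]]])
    ultimately show ?thesis using LIMSEQ_le[OF qnorm_lim[of "a \<otimes> b"]] a b by simp
  qed
  show ?thesis
    by (rule LIMSEQ_le_const[OF tendsto_mult_right[OF qnorm_lim[OF a]]]) (use * in blast)
qed

text \<open>\<open>a - a u\<^sub>n\<close> has \<open>(1 - u\<^sub>n) a\<^sup>\<star> a (1 -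
  u\<^sub>n)\<close> as its square, which is dominated by \<open>a\<^sup>\<star> a - a\<^sup>\<star> a
  u\<^sub>n\<close>. The reverse inequality follows from submultiplicativity as soon as the adjoint is
  isometric.\<close>

lemma qnorm_star: "a \<in> carrier A \<Longrightarrow> qnorm (a\<^sup>\<star> \<otimes> a) = (qnorm a)\<^sup>2"
proof -
  have low: "(qnorm a)\<^sup>2 \<le> qnorm (a\<^sup>\<star> \<otimes> a)" if a: "a \<in> carrier A" for a
  proof -
    have "\<parallel>a \<ominus> a \<otimes> u n\<parallel>\<^sup>2 \<le> \<parallel>a\<^sup>\<star> \<otimes> a \<ominus> (a\<^sup>\<star> \<otimes> a) \<otimes> u n\<parallel>" for n
    proof -
      let ?z = "a\<^sup>\<star> \<otimes> a \<ominus> (a\<^sup>\<star> \<otimes> a) \<otimes> u n"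
      have "(a \<ominus> a \<otimes> u n)\<^sup>\<star> \<otimes> (a \<ominus> a \<otimes> u n) = ?z \<ominus> u n \<otimes> ?z"
        using a diff_diff[of "a\<^sup>\<star> \<otimes> a" "u n \<otimes> (a\<^sup>\<star> \<otimes> a)" "a\<^sup>\<star> \<otimes> (a \<otimes> u n)" "u n \<otimes> (a\<^sup>\<star> \<otimes> (a \<otimes> u n))"]
        by (simp add: adj_diff adj_mult u_adj mult_diff_left mult_diff_right mult_assoc)
      then show ?thesis
        using cstar_identity[of "a \<ominus> a \<otimes> u n"] proj_compl_le[OF u_closed u_adj u_idem, of ?z n] a by simp
    qed
    then show ?thesis
      using LIMSEQ_le[OF tendsto_power[OF qnorm_lim[OF a], of 2] qnorm_lim[of "a\<^sup>\<star> \<otimes> a"]] a by simp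
  qed
  have adj_le: "qnorm a \<le> qnorm (a\<^sup>\<star>)" if a: "a \<in> carrier A" for a
  proof (cases "qnorm a = 0")
    case False
    then have "0 < qnorm a" using qnorm_nonneg[OF a] by simp
    moreover have "qnorm a * qnorm a \<le> qnorm (a\<^sup>\<star>) * qnorm a"
      using low[OF a] qnorm_mult[of "a\<^sup>\<star>" a] a by (simp add: power2_eq_square)
    ultimately show ?thesis by simp
  qed (use qnorm_nonneg[of "a\<^sup>\<star>"] a in simp)
  assume a: "a \<in> carrier A"
  have "qnorm (a\<^sup>\<star>) = qnorm a" using adj_le[OF a] adj_le[of "a\<^sup>\<star>"] a by simp
  then show ?thesis using low[OF a] qnorm_mult[of "a\<^sup>\<star>" a] a by (simp add: power2_eq_square)
qed

end

section \<open>The ideal generated by sinks\<close>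

inductive_set closed_span :: "('a, 'm) cstar_scheme \<Rightarrow> 'a set \<Rightarrow> 'a set" for A S where
  base: "x \<in> S \<Longrightarrow> x \<in> closed_span A S"
| zero: "\<zero>\<^bsub>A\<^esub> \<in> closed_span A S"
| add: "x \<in> closed_span A S \<Longrightarrow> y \<in> closed_span A S \<Longrightarrow> x \<oplus>\<^bsub>A\<^esub> y \<in> closed_span A S"
| scale: "x \<in> closed_span A S \<Longrightarrow> c \<odot>\<^bsub>A\<^esub> x \<in> closed_span A S"
| lim: "(\<And>n. s n \<in> closed_span A S) \<Longrightarrow> conv A s x \<Longrightarrow> x \<in> closed_span A S"

lemma (in cstar_algebra) closed_span_carrier: "x \<in> closed_span A S \<Longrightarrow> S \<subseteq> carrier A \<Longrightarrow> x \<in> carrier A"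
  by (induction rule: closed_span.induct) (auto simp: convD)

locale sink_ideal = wf_digraph E for E :: "('v, 'e) pre_digraph" +
  fixes Y :: "'v set"
  assumes Y_sinks: "Y \<subseteq> sinks E" and countable_E: "countable (verts E)" "countable (arcs E)"
begin

abbreviation "C \<equiv> graph_cstar E"
abbreviation "P \<equiv> vproj E"
abbreviation "S \<equiv> eiso E"

sublocale ck_family C E P S by (rule graph_cstar_family[OF wf_digraph_axioms])

lemma Y_verts: "y \<in> Y \<Longrightarrow> y \<in> verts E" and Y_tail: "y \<in> Y \<Longrightarrow> e \<in> arcs E \<Longrightarrow> tail E e \<noteq> y"
  using Y_sinks by (auto simp: sinks_def out_arcs_def)

text \<open>Paths are recorded together with their source, so that trivial paths are covered.\<close>

definition paths :: "('v \<times> 'e list) set" where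
  "paths = {(u, p). \<exists>y\<in>Y. awalk u p y}"

definition path_op :: "'v \<times> 'e list \<Rightarrow> (nat \<Rightarrow> ('v + 'e) star_poly) set" where
  "path_op a = path_iso E (fst a) (snd a)"

lemma countable_paths: "countable paths"
proof (rule countable_subset)
  show "paths \<subseteq> verts E \<times> lists (arcs E)" by (auto simp: paths_def awalk_def)
  show "countable (verts E \<times> lists (arcs E))" using countable_E by simp
qed

lemma path_iso_Cons: "e \<in> arcs E \<Longrightarrow> path_iso E u (e # p) = S e \<otimes>\<^bsub>C\<^esub> path_iso E (head E e) p"
  by (cases p) (simp_all add: S_P_head)

lemma paths_Nil: "(u, []) \<in> paths \<longleftrightarrow> u \<in> Y"
  using Y_verts by (auto simp: paths_def awalk_def)

lemma paths_Cons: "(u, e # p) \<in> paths \<longleftrightarrow> e \<in> arcs E \<and> u = tail E e \<and> (head E e, p) \<in> paths"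
  by (auto simp: paths_def awalk_def)

lemma paths_source: "(u, p) \<in> paths \<Longrightarrow> u \<in> verts E"
  by (auto simp: paths_def awalk_def)

lemma paths_sink: "(u, p) \<in> paths \<Longrightarrow> u \<in> Y \<Longrightarrow> p = []"
  using Y_tail by (cases p) (auto simp: paths_Cons)

lemma path_closed: "(u, p) \<in> paths \<Longrightarrow> path_iso E u p \<in> carrier C"
proof (induction p arbitrary: u)
  case Nil
  then show ?case by (simp add: paths_Nil Y_verts)
next
  case (Cons e p)
  then show ?case by (simp add: paths_Cons path_iso_Cons)
qed

lemma path_op_closed [simp]: "a \<in> paths \<Longrightarrow> path_op a \<in> carrier C"
  using path_closed by (cases a) (simp add: path_op_def)

lemma P_path: "v \<in> verts E \<Longrightarrow> (u, p) \<in> paths \<Longrightarrow>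
    P v \<otimes>\<^bsub>C\<^esub> path_iso E u p = (if v = u then path_iso E u p else \<zero>\<^bsub>C\<^esub>)"
proof (cases p)
  case (Cons e q)
  assume a: "v \<in> verts E" "(u, p) \<in> paths"
  then have q: "e \<in> arcs E" "u = tail E e" "(head E e, q) \<in> paths" using Cons by (simp_all add: paths_Cons)
  have "P v \<otimes>\<^bsub>C\<^esub> path_iso E u p = (P v \<otimes>\<^bsub>C\<^esub> S e) \<otimes>\<^bsub>C\<^esub> path_iso E (head E e) q"
    using Cons q a path_closed by (simp add: path_iso_Cons mult_assoc)
  then show ?thesis using Cons q a path_closed by (simp add: path_iso_Cons P_S)
qed (simp add: paths_Nil P_idem P_orth Y_verts)

lemma S_path: "e \<in> arcs E \<Longrightarrow> (u, p) \<in> paths \<Longrightarrow>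
    S e \<otimes>\<^bsub>C\<^esub> path_iso E u p = (if u = head E e then path_iso E (tail E e) (e # p) else \<zero>\<^bsub>C\<^esub>)"
proof (cases "u = head E e")
  case False
  assume e: "e \<in> arcs E" and u: "(u, p) \<in> paths"
  have "S e \<otimes>\<^bsub>C\<^esub> path_iso E u p = (S e \<otimes>\<^bsub>C\<^esub> P u) \<otimes>\<^bsub>C\<^esub> path_iso E u p"
    using e u paths_source[OF u] path_closed[OF u] P_path[of u u p] by (simp add: mult_assoc)
  then show ?thesis using False e paths_source[OF u] path_closed[OF u] by (simp add: S_P)
qed (simp add: path_iso_Cons)

lemma S_adj_path_Cons: "e \<in> arcs E \<Longrightarrow> (u, f # p) \<in> paths \<Longrightarrow>
    (S e)\<^sup>\<star>\<^bsub>C\<^esub> \<otimes>\<^bsub>C\<^esub> path_iso E u (f # p) = (if e = f then path_iso E (head E f) p else \<zero>\<^bsub>C\<^esub>)"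
proof -
  assume e: "e \<in> arcs E" and u: "(u, f # p) \<in> paths"
  then have q: "f \<in> arcs E" "(head E f, p) \<in> paths" by (simp_all add: paths_Cons)
  have "(S e)\<^sup>\<star>\<^bsub>C\<^esub> \<otimes>\<^bsub>C\<^esub> path_iso E u (f # p) = ((S e)\<^sup>\<star>\<^bsub>C\<^esub> \<otimes>\<^bsub>C\<^esub> S f) \<otimes>\<^bsub>C\<^esub> path_iso E (head E f) p"
    using e q path_closed by (simp add: path_iso_Cons mult_assoc)
  then show ?thesis using e q path_closed P_path[of "head E f" "head E f" p] by (simp add: S_star_S)
qed

lemma S_adj_path_Nil: "e \<in> arcs E \<Longrightarrow> (u, []) \<in> paths \<Longrightarrow> (S e)\<^sup>\<star>\<^bsub>C\<^esub> \<otimes>\<^bsub>C\<^esub> path_iso E u [] = \<zero>\<^bsub>C\<^esub>"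
  using Y_tail[of u e] by (auto simp: paths_Nil S_adj_P Y_verts)

text \<open>Paths ending in sinks cannot extend each other, hence have orthogonal ranges.\<close>

lemma path_orth:
  assumes "a \<in> paths" "b \<in> paths"
  shows "(path_op a)\<^sup>\<star>\<^bsub>C\<^esub> \<otimes>\<^bsub>C\<^esub> path_op b =
    (if a = b then (path_op a)\<^sup>\<star>\<^bsub>C\<^esub> \<otimes>\<^bsub>C\<^esub> path_op a else \<zero>\<^bsub>C\<^esub>)"
    and "path_op a \<otimes>\<^bsub>C\<^esub> ((path_op a)\<^sup>\<star>\<^bsub>C\<^esub> \<otimes>\<^bsub>C\<^esub> path_op a) = path_op a"
proof -
  have orth: "(path_iso E u p)\<^sup>\<star>\<^bsub>C\<^esub> \<otimes>\<^bsub>C\<^esub> path_iso E u' p' = \<zero>\<^bsub>C\<^esub>"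
    if "(u, p) \<in> paths" "(u', p') \<in> paths" "(u, p) \<noteq> (u', p')" for u p u' p'
    using that
  proof (induction p arbitrary: u u' p')
    case Nil
    then have u: "u \<in> Y" "u \<in> verts E" by (simp_all add: paths_Nil Y_verts)
    have "u \<noteq> u'" using Nil paths_sink[of u' p'] u by auto
    then show ?case using P_path[OF u(2) Nil.prems(2)] u by (simp add: P_adj)
  next
    case (Cons e p)
    then have e: "e \<in> arcs E" "u = tail E e" "(head E e, p) \<in> paths" by (simp_all add: paths_Cons)
    have *: "(path_iso E u (e # p))\<^sup>\<star>\<^bsub>C\<^esub> \<otimes>\<^bsub>C\<^esub> path_iso E u' p' =
      (path_iso E (head E e) p)\<^sup>\<star>\<^bsub>C\<^esub> \<otimes>\<^bsub>C\<^esub> ((S e)\<^sup>\<star>\<^bsub>C\<^esub> \<otimes>\<^bsub>C\<^esub> path_iso E u' p')"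
      using e path_closed Cons.prems by (simp add: path_iso_Cons adj_mult mult_assoc)
    show ?case
    proof (cases p')
      case Nil
      then show ?thesis using * S_adj_path_Nil[OF e(1)] Cons.prems path_closed[OF e(3)] by (simp del: path_iso.simps)
    next
      case (Cons f q)
      then have f: "f \<in> arcs E" "u' = tail E f" "(head E f, q) \<in> paths" using \<open>(u', p') \<in> paths\<close> by (simp_all add: paths_Cons)
      show ?thesis
      proof (cases "e = f")
        case True
        then have "(head E e, p) \<noteq> (head E f, q)" using Cons.prems(3) Cons e f by simp
        from Cons.IH[OF e(3) f(3) this] show ?thesis
          using * S_adj_path_Cons[OF e(1), of u' f q] Cons True Cons.prems by simp
      next
        case False
        then show ?thesis
          using * S_adj_path_Cons[OF e(1), of u' f q] Cons Cons.prems path_closed[OF e(3)] by simp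
      qed
    qed
  qed
  have part: "path_iso E u p \<otimes>\<^bsub>C\<^esub> ((path_iso E u p)\<^sup>\<star>\<^bsub>C\<^esub> \<otimes>\<^bsub>C\<^esub> path_iso E u p) = path_iso E u p"
    if "(u, p) \<in> paths" for u p
    using that
  proof (induction p arbitrary: u)
    case Nil
    then show ?case by (simp add: paths_Nil P_adj P_idem Y_verts)
  next
    case (Cons e p)
    then have e: "e \<in> arcs E" "u = tail E e" "(head E e, p) \<in> paths" by (simp_all add: paths_Cons)
    have "(path_iso E u (e # p))\<^sup>\<star>\<^bsub>C\<^esub> \<otimes>\<^bsub>C\<^esub> path_iso E u (e # p) =
      (path_iso E (head E e) p)\<^sup>\<star>\<^bsub>C\<^esub> \<otimes>\<^bsub>C\<^esub> ((S e)\<^sup>\<star>\<^bsub>C\<^esub> \<otimes>\<^bsub>C\<^esub> path_iso E u (e # p))"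
      using e path_closed[OF e(3)] path_closed[OF Cons.prems] by (simp add: path_iso_Cons adj_mult mult_assoc)
    also have "\<dots> = (path_iso E (head E e) p)\<^sup>\<star>\<^bsub>C\<^esub> \<otimes>\<^bsub>C\<^esub> path_iso E (head E e) p"
      using S_adj_path_Cons[OF e(1) Cons.prems] by simp
    finally show ?case using Cons.IH[OF e(3)] e path_closed[OF e(3)] by (simp add: path_iso_Cons mult_assoc)
  qed
  show "(path_op a)\<^sup>\<star>\<^bsub>C\<^esub> \<otimes>\<^bsub>C\<^esub> path_op b =
    (if a = b then (path_op a)\<^sup>\<star>\<^bsub>C\<^esub> \<otimes>\<^bsub>C\<^esub> path_op a else \<zero>\<^bsub>C\<^esub>)"
    using orth assms by (cases a; cases b) (auto simp: path_op_def)
  show "path_op a \<otimes>\<^bsub>C\<^esub> ((path_op a)\<^sup>\<star>\<^bsub>C\<^esub> \<otimes>\<^bsub>C\<^esub> path_op a) = path_op a"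
    using part assms by (cases a) (simp add: path_op_def)
qed

abbreviation "I \<equiv> closed_ideal C (P ` Y)"

lemma PY_carrier: "P ` Y \<subseteq> carrier C"
  using Y_verts by auto

lemma path_ideal: "a \<in> paths \<Longrightarrow> path_op a \<in> I"
proof -
  have "(u, p) \<in> paths \<Longrightarrow> path_iso E u p \<in> I" for u p
  proof (induction p arbitrary: u)
    case Nil
    then show ?case by (auto simp: paths_Nil intro: closed_ideal.base)
  next
    case (Cons e p)
    then show ?case by (simp add: paths_Cons path_iso_Cons closed_ideal.left)
  qed
  then show "a \<in> paths \<Longrightarrow> path_op a \<in> I" by (cases a) (simp add: path_op_def)
qed

definition matrix_units :: "(nat \<Rightarrow> ('v + 'e) star_poly) set set" where
  "matrix_units = {path_op a \<otimes>\<^bsub>C\<^esub> (path_op b)\<^sup>\<star>\<^bsub>C\<^esub> | a b. a \<in> paths \<and> b \<in> paths}"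

abbreviation "K \<equiv> closed_span C matrix_units"

lemma matrix_units_carrier: "matrix_units \<subseteq> carrier C"
  by (auto simp: matrix_units_def)

lemma matrix_unit_K: "a \<in> paths \<Longrightarrow> b \<in> paths \<Longrightarrow> path_op a \<otimes>\<^bsub>C\<^esub> (path_op b)\<^sup>\<star>\<^bsub>C\<^esub> \<in> K"
  unfolding matrix_units_def by (intro closed_span.base) blast

lemma K_carrier: "x \<in> K \<Longrightarrow> x \<in> carrier C"
  by (rule closed_span_carrier[OF _ matrix_units_carrier])

lemma K_adj: "x \<in> K \<Longrightarrow> x\<^sup>\<star>\<^bsub>C\<^esub> \<in> K"
proof (induction rule: closed_span.induct)
  case (base x)
  then obtain a b where ab: "a \<in> paths" "b \<in> paths" "x = path_op a \<otimes>\<^bsub>C\<^esub> (path_op b)\<^sup>\<star>\<^bsub>C\<^esub>"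
    by (auto simp: matrix_units_def)
  then have "x\<^sup>\<star>\<^bsub>C\<^esub> = path_op b \<otimes>\<^bsub>C\<^esub> (path_op a)\<^sup>\<star>\<^bsub>C\<^esub>" by (simp add: adj_mult)
  then show ?case using ab unfolding matrix_units_def by (intro closed_span.base) blast
next
  case (lim s x)
  from lim.IH conv_adj[OF lim.hyps(2)] show ?case by (rule closed_span.lim)
qed (simp_all add: K_carrier adj_add adj_smult closed_span.zero closed_span.add closed_span.scale)

lemma path_mult_K:
  assumes "x \<in> carrier C" "\<And>a. a \<in> paths \<Longrightarrow> x \<otimes>\<^bsub>C\<^esub> path_op a = \<zero>\<^bsub>C\<^esub> \<or> (\<exists>b\<in>paths. x \<otimes>\<^bsub>C\<^esub> path_op a = path_op b)"
    and "y \<in> K"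
  shows "x \<otimes>\<^bsub>C\<^esub> y \<in> K"
  using assms(3)
proof (induction rule: closed_span.induct)
  case (base y)
  then obtain a b where ab: "a \<in> paths" "b \<in> paths" "y = path_op a \<otimes>\<^bsub>C\<^esub> (path_op b)\<^sup>\<star>\<^bsub>C\<^esub>"
    by (auto simp: matrix_units_def)
  have xy: "x \<otimes>\<^bsub>C\<^esub> y = (x \<otimes>\<^bsub>C\<^esub> path_op a) \<otimes>\<^bsub>C\<^esub> (path_op b)\<^sup>\<star>\<^bsub>C\<^esub>" using ab assms(1) by (simp add: mult_assoc)
  from assms(2)[OF ab(1)] show ?case
  proof
    assume "x \<otimes>\<^bsub>C\<^esub> path_op a = \<zero>\<^bsub>C\<^esub>"
    then show ?thesis using xy ab by (simp add: closed_span.zero)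
  next
    assume "\<exists>c\<in>paths. x \<otimes>\<^bsub>C\<^esub> path_op a = path_op c"
    then obtain c where "c \<in> paths" "x \<otimes>\<^bsub>C\<^esub> path_op a = path_op c" by blast
    then show ?thesis using xy ab by (simp add: matrix_unit_K)
  qed
next
  case (lim s y)
  from lim.IH conv_mult[OF conv_const[OF assms(1)] lim.hyps(2)] show ?case by (rule closed_span.lim)
qed (simp_all add: assms(1) K_carrier mult_distrib_left smult_mult_right closed_span.zero closed_span.add closed_span.scale)

text \<open>Left multiplication by a vertex, an arc or the adjoint of an arc sends a path to a path or to
  zero. For the adjoint of an arc applied to a trivial path this uses that the path sits at a sink, so that
  the product vanishes.\<close>

lemma K_left:
  assumes "x \<in> carrier C" "y \<in> K" shows "x \<otimes>\<^bsub>C\<^esub> y \<in> K"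
proof -
  have "x \<in> star_closure C (graph_gens E)" using assms(1) graph_cstar_generated[OF wf_digraph_axioms] by simp
  then have "x \<in> carrier C \<and> (\<forall>y\<in>K. x \<otimes>\<^bsub>C\<^esub> y \<in> K \<and> x\<^sup>\<star>\<^bsub>C\<^esub> \<otimes>\<^bsub>C\<^esub> y \<in> K)"
  proof (induction rule: star_closure.induct)
    case (base x)
    then consider v where "v \<in> verts E" "x = P v" | e where "e \<in> arcs E" "x = S e"
      by (auto simp: graph_gens_def)
    then show ?case
    proof cases
      case 1
      have "P v \<otimes>\<^bsub>C\<^esub> path_op a = \<zero>\<^bsub>C\<^esub> \<or> (\<exists>b\<in>paths. P v \<otimes>\<^bsub>C\<^esub> path_op a = path_op b)" if "a \<in> paths" for a
      proof -
        have "P v \<otimes>\<^bsub>C\<^esub> path_op a = (if v = fst a then path_op a else \<zero>\<^bsub>C\<^esub>)"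
          using P_path[OF 1(1), of "fst a" "snd a"] that by (simp add: path_op_def)
        then show ?thesis using that by (cases "v = fst a") (simp_all, blast)
      qed
      then show ?thesis using path_mult_K[of "P v"] 1 by (simp add: P_adj)
    next
      case 2
      have 3: "S e \<otimes>\<^bsub>C\<^esub> path_op a = \<zero>\<^bsub>C\<^esub> \<or> (\<exists>b\<in>paths. S e \<otimes>\<^bsub>C\<^esub> path_op a = path_op b)" if a: "a \<in> paths" for a
      proof (cases "fst a = head E e")
        case True
        then have "(tail E e, e # snd a) \<in> paths" using a 2 by (cases a) (auto simp: paths_Cons)
        moreover have "S e \<otimes>\<^bsub>C\<^esub> path_op a = path_op (tail E e, e # snd a)"
          using S_path[OF 2(1), of "fst a" "snd a"] a True by (cases a) (simp add: path_op_def)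
        ultimately show ?thesis by blast
      next
        case False
        then show ?thesis using S_path[OF 2(1), of "fst a" "snd a"] a by (simp add: path_op_def)
      qed
      have 4: "(S e)\<^sup>\<star>\<^bsub>C\<^esub> \<otimes>\<^bsub>C\<^esub> path_op a = \<zero>\<^bsub>C\<^esub> \<or> (\<exists>b\<in>paths. (S e)\<^sup>\<star>\<^bsub>C\<^esub> \<otimes>\<^bsub>C\<^esub> path_op a = path_op b)"
        if a: "a \<in> paths" for a
      proof (cases "snd a")
        case Nil
        then show ?thesis using S_adj_path_Nil[OF 2(1), of "fst a"] a by (cases a) (simp add: path_op_def del: path_iso.simps)
      next
        case (Cons f p)
        then have fp: "(fst a, f # p) \<in> paths" using a by (cases a) simp
        then have hp: "(head E f, p) \<in> paths" by (simp add: paths_Cons)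
        have "(S e)\<^sup>\<star>\<^bsub>C\<^esub> \<otimes>\<^bsub>C\<^esub> path_op a = (if e = f then path_op (head E f, p) else \<zero>\<^bsub>C\<^esub>)"
          using S_adj_path_Cons[OF 2(1) fp] by (simp add: path_op_def Cons)
        then show ?thesis using hp by (cases "e = f") (simp_all, blast)
      qed
      have "S e \<otimes>\<^bsub>C\<^esub> y \<in> K" "(S e)\<^sup>\<star>\<^bsub>C\<^esub> \<otimes>\<^bsub>C\<^esub> y \<in> K" if "y \<in> K" for y
        using path_mult_K[OF _ 3 that] path_mult_K[OF _ 4 that] 2(1) by simp_all
      then show ?thesis using 2 by simp
    qed
  next
    case (add x y)
    then show ?case by (simp add: adj_add mult_distrib_right K_carrier closed_span.add)
  next
    case (scale x c)
    then show ?case by (simp add: adj_smult smult_mult_left K_carrier closed_span.scale)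
  next
    case (mult x y)
    then show ?case by (simp add: adj_mult mult_assoc K_carrier)
  next
    case (lim s x)
    have "x \<otimes>\<^bsub>C\<^esub> y \<in> K" "x\<^sup>\<star>\<^bsub>C\<^esub> \<otimes>\<^bsub>C\<^esub> y \<in> K" if y: "y \<in> K" for y
    proof -
      have "s n \<otimes>\<^bsub>C\<^esub> y \<in> K" "(s n)\<^sup>\<star>\<^bsub>C\<^esub> \<otimes>\<^bsub>C\<^esub> y \<in> K" for n using lim.IH y by simp_all
      note * = this
      show "x \<otimes>\<^bsub>C\<^esub> y \<in> K"
        by (rule closed_span.lim[OF *(1) conv_mult[OF lim.hyps(2) conv_const[OF K_carrier[OF y]]]])
      show "x\<^sup>\<star>\<^bsub>C\<^esub> \<otimes>\<^bsub>C\<^esub> y \<in> K"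
        by (rule closed_span.lim[OF *(2) conv_mult[OF conv_adj[OF lim.hyps(2)] conv_const[OF K_carrier[OF y]]]])
    qed
    then show ?case using convD(2)[OF lim.hyps(2)] by simp
  qed (simp_all add: K_carrier closed_span.zero)
  then show ?thesis using assms(2) by blast
qed

text \<open>The closed span of the products \<open>S\<^sub>\<alpha> S\<^sub>\<beta>\<^sup>*\<close> is an
  ideal and contains the projections of the sinks, as trivial paths.\<close>

lemma ideal_subset_K: "y \<in> I \<Longrightarrow> y \<in> K"
proof (induction rule: closed_ideal.induct)
  case (base x)
  then obtain y where y: "y \<in> Y" "x = P y" by blast
  then have "x = path_op (y, []) \<otimes>\<^bsub>C\<^esub> (path_op (y, []))\<^sup>\<star>\<^bsub>C\<^esub>"
    by (simp add: path_op_def P_adj P_idem Y_verts)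
  moreover have "(y, []) \<in> paths" using y by (simp add: paths_Nil)
  ultimately show ?case unfolding matrix_units_def by (intro closed_span.base) blast
next
  case (right a x)
  have "x \<otimes>\<^bsub>C\<^esub> a = (a\<^sup>\<star>\<^bsub>C\<^esub> \<otimes>\<^bsub>C\<^esub> x\<^sup>\<star>\<^bsub>C\<^esub>)\<^sup>\<star>\<^bsub>C\<^esub>" using right K_carrier by (simp add: adj_mult)
  then show ?case using K_adj[OF K_left[OF adj_closed[OF right.hyps(1)] K_adj[OF right.IH]]] by simp
next
  case (lim s x)
  from lim.IH lim.hyps(2) show ?case by (rule closed_span.lim)
qed (simp_all add: closed_span.zero closed_span.add closed_span.scale K_left)

definition range_sum :: "('v \<times> 'e list) set \<Rightarrow> (nat \<Rightarrow> ('v + 'e) star_poly) set" where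
  "range_sum F = (\<Oplus>\<^bsub>C\<^esub>a\<in>F. path_op a \<otimes>\<^bsub>C\<^esub> (path_op a)\<^sup>\<star>\<^bsub>C\<^esub>)"

lemma range_sum_empty [simp]: "range_sum {} = \<zero>\<^bsub>C\<^esub>"
  by (simp add: range_sum_def)

lemma range_sum_insert: "finite F \<Longrightarrow> F \<subseteq> paths \<Longrightarrow> a \<in> paths \<Longrightarrow> a \<notin> F \<Longrightarrow>
    range_sum (insert a F) = path_op a \<otimes>\<^bsub>C\<^esub> (path_op a)\<^sup>\<star>\<^bsub>C\<^esub> \<oplus>\<^bsub>C\<^esub> range_sum F"
  unfolding range_sum_def by (rule M.finsum_insert) auto

lemma range_sum_props:
  assumes "finite F" "F \<subseteq> paths"
  shows "range_sum F \<in> I \<and> range_sum F \<in> carrier C \<and> (range_sum F)\<^sup>\<star>\<^bsub>C\<^esub> = range_sum F \<and>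
    (\<forall>b\<in>paths. range_sum F \<otimes>\<^bsub>C\<^esub> path_op b = (if b \<in> F then path_op b else \<zero>\<^bsub>C\<^esub>))"
  using assms
proof (induction F rule: finite_induct)
  case (insert a F)
  then have a: "a \<in> paths" "F \<subseteq> paths" and IH: "range_sum F \<in> I" "range_sum F \<in> carrier C" "(range_sum F)\<^sup>\<star>\<^bsub>C\<^esub> = range_sum F"
    "\<And>b. b \<in> paths \<Longrightarrow> range_sum F \<otimes>\<^bsub>C\<^esub> path_op b = (if b \<in> F then path_op b else \<zero>\<^bsub>C\<^esub>)" by auto
  note ins = range_sum_insert[OF insert.hyps(1) a(2,1) insert.hyps(2)]
  have "range_sum (insert a F) \<otimes>\<^bsub>C\<^esub> path_op b = (if b \<in> insert a F then path_op b else \<zero>\<^bsub>C\<^esub>)" if b: "b \<in> paths" for b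
  proof -
    have "range_sum (insert a F) \<otimes>\<^bsub>C\<^esub> path_op b =
      path_op a \<otimes>\<^bsub>C\<^esub> ((path_op a)\<^sup>\<star>\<^bsub>C\<^esub> \<otimes>\<^bsub>C\<^esub> path_op b) \<oplus>\<^bsub>C\<^esub> range_sum F \<otimes>\<^bsub>C\<^esub> path_op b"
      using a b IH(2) by (simp add: ins mult_distrib_right mult_assoc)
    also have "\<dots> = (if b \<in> insert a F then path_op b else \<zero>\<^bsub>C\<^esub>)"
      using path_orth(1)[OF a(1) b] path_orth(2)[OF a(1) a(1)] IH(4)[OF b] a b insert.hyps(2) by (cases "a = b") auto
    finally show ?thesis .
  qed
  moreover have "range_sum (insert a F) \<in> I"
    unfolding ins using a IH by (intro closed_ideal.add closed_ideal.right path_ideal) simp_all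
  moreover have "(range_sum (insert a F))\<^sup>\<star>\<^bsub>C\<^esub> = range_sum (insert a F)"
    unfolding ins using a IH by (simp add: adj_add adj_mult)
  ultimately show ?case using a IH by (simp add: ins)
qed (auto intro: closed_ideal.zero)

lemma range_sum_mult:
  assumes "finite F'" "F \<subseteq> F'" "F' \<subseteq> paths"
  shows "range_sum F' \<otimes>\<^bsub>C\<^esub> range_sum F = range_sum F"
proof -
  have "finite F" using assms by (meson finite_subset)
  then show ?thesis using assms(2)
  proof (induction F rule: finite_induct)
    case (insert a F)
    have a: "a \<in> paths" "F \<subseteq> paths" "a \<in> F'" using insert assms by auto
    note ins = range_sum_insert[OF insert.hyps(1) a(2,1) insert.hyps(2)]
    have c: "range_sum F' \<in> carrier C" "range_sum F \<in> carrier C"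
      using range_sum_props[OF assms(1,3)] range_sum_props[OF insert.hyps(1) a(2)] by simp_all
    have "range_sum F' \<otimes>\<^bsub>C\<^esub> (path_op a \<otimes>\<^bsub>C\<^esub> (path_op a)\<^sup>\<star>\<^bsub>C\<^esub>) = path_op a \<otimes>\<^bsub>C\<^esub> (path_op a)\<^sup>\<star>\<^bsub>C\<^esub>"
      using range_sum_props[OF assms(1,3)] a c by (simp flip: mult_assoc)
    then show ?case using insert a c by (simp add: ins mult_distrib_left)
  qed (use range_sum_props[OF assms(1,3)] in simp)
qed

text \<open>The range projections of the first \<open>n\<close> paths in an enumeration of the countable set
  of paths.\<close>

definition unit_seq :: "nat \<Rightarrow> (nat \<Rightarrow> ('v + 'e) star_poly) set" where
  "unit_seq n = range_sum {a \<in> paths. to_nat_on paths a < n}"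

lemma finite_initial: "finite {a \<in> paths. to_nat_on paths a < n}"
  by (rule finite_imageD[of "to_nat_on paths"])
    (auto intro: inj_on_subset[OF inj_on_to_nat_on[OF countable_paths]] finite_subset[of _ "{..<n}"])

sublocale unital_ideal C unit_seq "P ` Y"
proof unfold_locales
  note fin = range_sum_props[OF finite_initial, folded unit_seq_def]
  show "unit_seq n \<in> carrier C" for n using fin by blast
  show sa: "(unit_seq n)\<^sup>\<star>\<^bsub>C\<^esub> = unit_seq n" for n using fin by blast
  show "unit_seq m \<otimes>\<^bsub>C\<^esub> unit_seq n = unit_seq m" if "m \<le> n" for m n
  proof -
    have "unit_seq n \<otimes>\<^bsub>C\<^esub> unit_seq m = unit_seq m"
      unfolding unit_seq_def by (rule range_sum_mult[OF finite_initial]) (use that in auto)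
    then have "(unit_seq n \<otimes>\<^bsub>C\<^esub> unit_seq m)\<^sup>\<star>\<^bsub>C\<^esub> = unit_seq m" using sa by simp
    then show ?thesis using fin sa by (simp add: adj_mult)
  qed
  then interpret proj_seq C unit_seq using fin by unfold_locales blast+
  show "P ` Y \<subseteq> carrier C" by (rule PY_carrier)
  show "x\<^sup>\<star>\<^bsub>C\<^esub> \<in> P ` Y" if "x \<in> P ` Y" for x using that by (auto simp: P_adj Y_verts)
  show "unit_seq n \<in> I" for n using fin by blast
  fix y assume "y \<in> I"
  then have "y \<in> K" by (rule ideal_subset_K)
  then show "unit_for y"
  proof (induction rule: closed_span.induct)
    case (base x)
    then obtain a b where ab: "a \<in> paths" "b \<in> paths" "x = path_op a \<otimes>\<^bsub>C\<^esub> (path_op b)\<^sup>\<star>\<^bsub>C\<^esub>"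
      by (auto simp: matrix_units_def)
    have x: "x \<in> carrier C" using ab by simp
    have "unit_seq n \<otimes>\<^bsub>C\<^esub> x = x" if "n \<ge> Suc (to_nat_on paths a)" for n
    proof -
      have "unit_seq n \<otimes>\<^bsub>C\<^esub> x = (unit_seq n \<otimes>\<^bsub>C\<^esub> path_op a) \<otimes>\<^bsub>C\<^esub> (path_op b)\<^sup>\<star>\<^bsub>C\<^esub>" using ab by (simp add: mult_assoc)
      also have "unit_seq n \<otimes>\<^bsub>C\<^esub> path_op a = path_op a" using fin[of n] ab that by simp
      finally show ?thesis using ab by simp
    qed
    then show ?case unfolding unit_for_def using x by (intro conjI conv_eventually) simp_all
  next
    case (lim s x)
    from lim.IH lim.hyps(2) show ?case by (rule unit_for_lim)
  qed (simp_all add: unit_for_zero unit_for_add unit_for_sc)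
qed

text \<open>The norm modulo the ideal is an admissible seminorm for the presentation with the further relations
  \<open>P\<^sub>y = 0\<close>, hence it is dominated by the largest one.\<close>

lemma quotient_algebra:
  obtains R :: "('v + 'e) star_poly set" and q where "star_hom C (universal_cstar (verts E <+> arcs E) R) q"
    "\<forall>y\<in>Y. q (P y) = \<zero>\<^bsub>universal_cstar (verts E <+> arcs E) R\<^esub>"
    "\<forall>c\<in>carrier C. qnorm c \<le> \<parallel>q c\<parallel>\<^bsub>universal_cstar (verts E <+> arcs E) R\<^esub>"
proof -
  let ?G = "verts E <+> arcs E"
  define R where "R = graph_relations E \<union> (\<lambda>y. gen (Inl y)) ` Y"
  have R: "R \<subseteq> free_star_algebra ?G" "graph_relations E \<subseteq> R"
    using graph_relations_free[OF wf_digraph_axioms] Y_verts unfolding R_def by (auto intro: free_gen)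
  have P0: "cstar_presentation ?G (graph_relations E)"
    by (rule graph_presentation[OF wf_digraph_axioms graph_relations_free[OF wf_digraph_axioms] order_refl])
  have PR: "cstar_presentation ?G R" by (rule graph_presentation[OF wf_digraph_axioms R])
  interpret P0: cstar_presentation ?G "graph_relations E" by fact
  interpret PR: cstar_presentation ?G R by fact
  note fam = universal_ck_family[OF wf_digraph_axioms R]
  obtain q where q: "star_hom C PR.U q" "\<And>v. v \<in> verts E \<Longrightarrow> q (P v) = PR.ugen (Inl v)"
    "\<And>e. e \<in> arcs E \<Longrightarrow> q (S e) = PR.ugen (Inr e)" using graph_cstar_hom[OF fam] by blast
  have qY: "q (P y) = \<zero>\<^bsub>PR.U\<^esub>" if y: "y \<in> Y" for y
  proof -
    have "gen (Inl y) \<in> R" using y by (simp add: R_def)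
    from PR.ev_relation[OF this] show ?thesis
      using Y_verts[OF y] PR.ug.ev_gen[of "Inl y"] by (simp only: q(2) InlI)
  qed
  have C: "C = P0.U" by (simp add: graph_cstar_def)
  have "qnorm c \<le> \<parallel>q c\<parallel>\<^bsub>PR.U\<^esub>" if "c \<in> carrier C" for c
  proof (rule seminorm_le_quotient[OF P0 PR, of q qnorm, folded C])
    show "star_hom C PR.U q" by (rule q(1))
    show "q (P0.ugen g) = PR.ugen g" if "g \<in> ?G" for g
      using that q(2,3) by (auto simp: vproj_def eiso_def)
    show "qnorm (poly_eval C P0.ugen r) = 0" if r: "r \<in> R" for r
    proof (cases "r \<in> graph_relations E")
      case True
      then show ?thesis using P0.ev_relation qnorm_sc[of "\<zero>\<^bsub>C\<^esub>" 0] by (simp flip: C)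
    next
      case False
      then obtain y where y: "y \<in> Y" "r = gen (Inl y)" using r by (auto simp: R_def)
      then have "poly_eval C P0.ugen r = P y"
        using P0.ug.ev_gen[of "Inl y"] Y_verts by (simp add: C vproj_def InlI)
      then show ?thesis using y by (auto intro!: qnorm_zero_I closed_ideal.base)
    qed
  qed (simp_all add: that qnorm_add qnorm_sc qnorm_mult qnorm_star qnorm_le)
  then show ?thesis using that[OF q(1)] qY by blast
qed

end

section \<open>The ideal generated by the attached graph\<close>

lemma zero_star_hom: "cstar_algebra A \<Longrightarrow> cstar_algebra B \<Longrightarrow> star_hom A B (zero_hom A B)"
proof -
  assume "cstar_algebra A" "cstar_algebra B"
  then interpret A: cstar_algebra A + B: cstar_algebra B by simp_all
  show ?thesis
    by (rule star_homI[OF A.cstar_algebra_axioms B.cstar_algebra_axioms]) (simp_all add: zero_hom_def)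
qed

context glued_algebra
begin

abbreviation "CE \<equiv> graph_cstar E"
abbreviation "CH \<equiv> graph_cstar H"
abbreviation "CG \<equiv> graph_cstar G"

sublocale EI: sink_ideal E "\<iota> ` X"
  by unfold_locales (use i_sinks E_countable in auto)

abbreviation "J \<equiv> closed_ideal CG (jH ` vproj H ` verts H)"

lemma J_gens: "jH ` vproj H ` verts H \<subseteq> carrier CG"
  by auto

lemma J_carrier: "y \<in> J \<Longrightarrow> y \<in> carrier CG"
  by (rule jE.B.closed_ideal_carrier[OF _ J_gens])

lemma J_adj: "y \<in> J \<Longrightarrow> y\<^sup>\<star>\<^bsub>CG\<^esub> \<in> J"
  by (rule jE.B.closed_ideal_adj[OF _ J_gens]) (auto simp: FH.P_adj simp flip: jH.adj)

lemma jH_P_J: "w \<in> verts H \<Longrightarrow> jH (vproj H w) \<in> J"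
  by (rule closed_ideal.base) simp

text \<open>The projections of glued vertices are vertex projections of both graphs.\<close>

lemma jE_ideal: "c \<in> EI.I \<Longrightarrow> jE c \<in> J"
  by (rule jE.closed_ideal_image[OF _ EI.PY_carrier]) (auto simp: jE_jH_glued jH_P_J k_vert)

text \<open>Adding the relations \<open>P\<^sub>y = 0\<close> for the sinks gives a quotient of
  \<open>CE\<close> in which \<open>c\<close> has at least its quotient norm. Extended by zero on
  \<open>CH\<close>, the quotient map becomes a homomorphism on \<open>CG\<close> that kills
  \<open>J\<close>.\<close>

lemma qnorm_le_dist:
  assumes c: "c \<in> carrier CE" and y: "y \<in> J"
  shows "EI.qnorm c \<le> \<parallel>jE c \<oplus>\<^bsub>CG\<^esub> y\<parallel>\<^bsub>CG\<^esub>"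
proof -
  obtain R q where R: "star_hom CE (universal_cstar (verts E <+> arcs E) R) q"
    "\<forall>y\<in>\<iota> ` X. q (vproj E y) = \<zero>\<^bsub>universal_cstar (verts E <+> arcs E) R\<^esub>"
    "\<forall>c\<in>carrier CE. EI.qnorm c \<le> \<parallel>q c\<parallel>\<^bsub>universal_cstar (verts E <+> arcs E) R\<^esub>"
    by (rule EI.quotient_algebra)
  define U where "U = universal_cstar (verts E <+> arcs E) R"
  note R = R[folded U_def]
  interpret q: star_hom CE U q by (rule R(1))
  interpret z: star_hom CH U "zero_hom CH U"
    by (rule zero_star_hom[OF jH.A.cstar_algebra_axioms q.B.cstar_algebra_axioms])
  have z: "b \<in> carrier CH \<Longrightarrow> zero_hom CH U b = \<zero>\<^bsub>U\<^esub>" for b by (simp add: zero_hom_def)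
  have a1: "q (vproj E (\<iota> x)) = zero_hom CH U (vproj H (\<kappa> x))" if "x \<in> X" for x
    using R(2) that by (simp add: z k_vert)
  have a2: "q (vproj E v) \<otimes>\<^bsub>U\<^esub> zero_hom CH U (vproj H w) = \<zero>\<^bsub>U\<^esub>" if "v \<in> verts E" "w \<in> verts H" for v w
    using that by (simp add: z)
  obtain h where h: "star_hom CG U h" "induced_homs E H X \<iota> \<kappa> U jE jH q (zero_hom CH U) = {h}"
    "\<forall>c\<in>carrier CE. h (jE c) = q c" "\<forall>b\<in>carrier CH. h (jH b) = zero_hom CH U b"
    by (rule induced_hom[OF R(1) z.star_hom_axioms a1 a2])
  interpret h: star_hom CG U h by (rule h(1))
  have "h y = \<zero>\<^bsub>U\<^esub>" by (rule h.closed_ideal_kernel[OF y J_gens]) (auto simp: h z)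
  then have "h (jE c \<oplus>\<^bsub>CG\<^esub> y) = q c" using c J_carrier[OF y] by (simp add: h.add h)
  then show ?thesis using h.contractive[of "jE c \<oplus>\<^bsub>CG\<^esub> y"] R(3) c J_carrier[OF y] by fastforce
qed

lemma ideal_detect: "c \<in> carrier CE \<Longrightarrow> jE c \<in> J \<Longrightarrow> c \<in> EI.I"
proof -
  assume c: "c \<in> carrier CE" and j: "jE c \<in> J"
  have "jE c \<oplus>\<^bsub>CG\<^esub> (- 1) \<odot>\<^bsub>CG\<^esub> jE c = \<zero>\<^bsub>CG\<^esub>"
    using c by (simp flip: jE.B.diff_sc)
  then have "EI.qnorm c \<le> 0" using qnorm_le_dist[OF c closed_ideal.scale[OF j, of "-1"]] by simp
  then show ?thesis using EI.qnorm_nonneg[OF c] EI.qnorm_zero_iff[OF c] by simp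
qed

text \<open>Elements of \<open>I\<close> can be moved from the first summand to the second, which brings the
  norm of the first arbitrarily close to its norm modulo \<open>I\<close>.\<close>

lemma small_representative:
  assumes c: "c \<in> carrier CE" and y: "y \<in> J" and e: "\<parallel>jE c \<oplus>\<^bsub>CG\<^esub> y\<parallel>\<^bsub>CG\<^esub> < e"
  obtains c' y' where "c' \<in> carrier CE" "y' \<in> J" "jE c \<oplus>\<^bsub>CG\<^esub> y = jE c' \<oplus>\<^bsub>CG\<^esub> y'" "\<parallel>c'\<parallel>\<^bsub>CE\<^esub> < e"
proof -
  have "EI.qnorm c < e" using qnorm_le_dist[OF c y] e by simp
  then obtain i where i: "i \<in> EI.I" "\<parallel>c \<ominus>\<^bsub>CE\<^esub> i\<parallel>\<^bsub>CE\<^esub> < e" using EI.qnorm_approx[OF c] by blast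
  note ic = EI.I_carrier[OF i(1)]
  have "jE c = jE (c \<ominus>\<^bsub>CE\<^esub> i) \<oplus>\<^bsub>CG\<^esub> jE i"
    using c ic by (simp add: jE.diff jE.B.diff_add_cancel)
  then have "jE c \<oplus>\<^bsub>CG\<^esub> y = jE (c \<ominus>\<^bsub>CE\<^esub> i) \<oplus>\<^bsub>CG\<^esub> (jE i \<oplus>\<^bsub>CG\<^esub> y)"
    using c ic J_carrier[OF y] by (simp add: jE.B.M.a_assoc)
  moreover have "jE i \<oplus>\<^bsub>CG\<^esub> y \<in> J" by (rule closed_ideal.add[OF jE_ideal[OF i(1)] y])
  ultimately show ?thesis using that c ic i(2) by (meson jE.A.M.minus_closed)
qed

text \<open>The sum of the subalgebra \<open>jE ` CE\<close> and the ideal \<open>J\<close> is closed, because small elements of the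
  sum have small representatives.\<close>

lemma sum_closed:
  assumes s: "\<And>n. \<exists>c\<in>carrier CE. \<exists>y\<in>J. s n = jE c \<oplus>\<^bsub>CG\<^esub> y" and lim: "conv CG s x"
  shows "\<exists>c\<in>carrier CE. \<exists>y\<in>J. x = jE c \<oplus>\<^bsub>CG\<^esub> y"
proof -
  note sC [simp] = jE.B.convD(1)[OF lim]
  have "\<exists>N. \<forall>m\<ge>N. \<forall>n\<ge>N. \<parallel>s m \<ominus>\<^bsub>CG\<^esub> s n\<parallel>\<^bsub>CG\<^esub> < (1 / 2) ^ k" for k :: nat
    by (rule jE.B.conv_Cauchy[OF lim]) simp
  then obtain N where N: "\<And>k m n. m \<ge> N k \<Longrightarrow> n \<ge> N k \<Longrightarrow> \<parallel>s m \<ominus>\<^bsub>CG\<^esub> s n\<parallel>\<^bsub>CG\<^esub> < (1 / 2) ^ (k :: nat)" by metis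
  \<comment> \<open>A subsequence whose consecutive differences decay geometrically; the summand
    \<open>k\<close> makes it strictly increasing.\<close>
  define f where "f k = k + (\<Sum>i\<le>k. N i)" for k
  have f_mono: "strict_mono f" by (simp add: strict_mono_Suc_iff f_def)
  have f_N: "N k \<le> f k" "N k \<le> f (Suc k)" for k by (simp_all add: f_def sum.atMost_Suc[of N k] lessThan_Suc_atMost[symmetric] lessThan_Suc)
  have "\<exists>c\<in>carrier CE. \<exists>y\<in>J. s (f (Suc k)) \<ominus>\<^bsub>CG\<^esub> s (f k) = jE c \<oplus>\<^bsub>CG\<^esub> y \<and> \<parallel>c\<parallel>\<^bsub>CE\<^esub> < (1 / 2) ^ k" for k
  proof -
    obtain a b where ab: "a \<in> carrier CE" "b \<in> J" "s (f (Suc k)) = jE a \<oplus>\<^bsub>CG\<^esub> b" using s by blast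
    obtain a' b' where ab': "a' \<in> carrier CE" "b' \<in> J" "s (f k) = jE a' \<oplus>\<^bsub>CG\<^esub> b'" using s by blast
    have eq: "s (f (Suc k)) \<ominus>\<^bsub>CG\<^esub> s (f k) = jE (a \<ominus>\<^bsub>CE\<^esub> a') \<oplus>\<^bsub>CG\<^esub> (b \<ominus>\<^bsub>CG\<^esub> b')"
      using ab ab' by (simp add: jE.diff jE.B.add_diff_add J_carrier)
    have "\<parallel>jE (a \<ominus>\<^bsub>CE\<^esub> a') \<oplus>\<^bsub>CG\<^esub> (b \<ominus>\<^bsub>CG\<^esub> b')\<parallel>\<^bsub>CG\<^esub> < (1 / 2) ^ k"
      using N[OF f_N(2)[of k] f_N(1)[of k]] unfolding eq .
    from small_representative[OF jE.A.M.minus_closed[OF ab(1) ab'(1)] jE.B.closed_ideal_diff[OF ab(2) ab'(2) J_gens] this]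
    show ?thesis unfolding eq by blast
  qed
  then obtain c where c: "\<And>k. c k \<in> carrier CE" "\<And>k. \<exists>y\<in>J. s (f (Suc k)) \<ominus>\<^bsub>CG\<^esub> s (f k) = jE (c k) \<oplus>\<^bsub>CG\<^esub> y"
    "\<And>k. \<parallel>c k\<parallel>\<^bsub>CE\<^esub> < (1 / 2) ^ k" by metis
  obtain c0 y0 where c0: "c0 \<in> carrier CE" "y0 \<in> J" "s (f 0) = jE c0 \<oplus>\<^bsub>CG\<^esub> y0" using s by blast
  \<comment> \<open>The first components, adjusted so that they converge.\<close>
  define a where "a = rec_nat c0 (\<lambda>k z. z \<oplus>\<^bsub>CE\<^esub> c k)"
  have a0: "a 0 = c0" and aS: "a (Suc k) = a k \<oplus>\<^bsub>CE\<^esub> c k" for k by (simp_all add: a_def)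
  have aC: "a k \<in> carrier CE" for k by (induction k) (simp_all add: a0 aS c0 c)
  have inJ: "s (f k) \<ominus>\<^bsub>CG\<^esub> jE (a k) \<in> J" for k
  proof (induction k)
    case 0
    have "s (f 0) \<ominus>\<^bsub>CG\<^esub> jE (a 0) = y0"
      using jE.B.add_diff_cancel[of y0 "jE c0"] c0 J_carrier[OF c0(2)] by (simp add: a0 jE.B.M.a_comm)
    then show ?case using c0 by simp
  next
    case (Suc k)
    obtain y where y: "y \<in> J" "s (f (Suc k)) \<ominus>\<^bsub>CG\<^esub> s (f k) = jE (c k) \<oplus>\<^bsub>CG\<^esub> y" using c(2) by blast
    have "s (f (Suc k)) = (jE (c k) \<oplus>\<^bsub>CG\<^esub> y) \<oplus>\<^bsub>CG\<^esub> s (f k)"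
      using jE.B.diff_add_cancel[of "s (f (Suc k))" "s (f k)"] by (simp add: y(2))
    then have "s (f (Suc k)) = (s (f k) \<oplus>\<^bsub>CG\<^esub> y) \<oplus>\<^bsub>CG\<^esub> jE (c k)"
      using J_carrier[OF y(1)] c(1)[of k] by (simp add: jE.B.M.a_ac)
    then have "s (f (Suc k)) \<ominus>\<^bsub>CG\<^esub> jE (a (Suc k)) = (s (f k) \<oplus>\<^bsub>CG\<^esub> y) \<ominus>\<^bsub>CG\<^esub> jE (a k)"
      using J_carrier[OF y(1)] c(1)[of k] aC[of k] by (simp add: aS jE.add jE.B.add_diff_add)
    also have "\<dots> = (s (f k) \<ominus>\<^bsub>CG\<^esub> jE (a k)) \<oplus>\<^bsub>CG\<^esub> y"
      using J_carrier[OF y(1)] aC[of k] by (simp add: jE.B.M.minus_eq jE.B.M.a_ac)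
    finally show ?case using Suc y(1) by (simp add: closed_ideal.add)
  qed
  have "\<parallel>a (Suc k) \<ominus>\<^bsub>CE\<^esub> a k\<parallel>\<^bsub>CE\<^esub> \<le> 1 * (1 / 2) ^ k" for k
  proof -
    have "a (Suc k) \<ominus>\<^bsub>CE\<^esub> a k = c k"
      using jE.A.add_diff_cancel[of "c k" "a k"] aC[of k] c(1)[of k] by (simp add: aS jE.A.M.a_comm)
    then show ?thesis using c(3)[of k] by simp
  qed
  then obtain z where z: "conv CE a z" using jE.A.geometric_conv[of a "1/2" 1] aC by auto
  have "conv CG (\<lambda>k. s (f k) \<ominus>\<^bsub>CG\<^esub> jE (a k)) (x \<ominus>\<^bsub>CG\<^esub> jE z)"
    by (rule jE.B.conv_diff[OF jE.B.conv_subseq[OF lim f_mono] jE.conv[OF z]])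
  from closed_ideal.lim[OF inJ this] have "x \<ominus>\<^bsub>CG\<^esub> jE z \<in> J" .
  moreover have "x = jE z \<oplus>\<^bsub>CG\<^esub> (x \<ominus>\<^bsub>CG\<^esub> jE z)"
    using jE.B.diff_add_cancel[of x "jE z"] jE.B.convD(2)[OF lim] jE.A.convD(2)[OF z] by (simp add: jE.B.M.a_comm)
  ultimately show ?thesis using jE.A.convD(2)[OF z] by blast
qed

lemma jH_J: assumes "f \<in> arcs H" shows "jH (eiso H f) \<in> J"
proof -
  have "jH (eiso H f) = jH (eiso H f) \<otimes>\<^bsub>CG\<^esub> jH (vproj H (head H f))"
    using assms by (simp add: FH.S_P_head flip: jH.mult)
  then show ?thesis using assms jH_P_J[of "head H f"] by (metis H.head_in_verts FH.S_closed closed_ideal.left jH.closed)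
qed

text \<open>The sum of the subalgebra and the ideal is a closed *-subalgebra and contains all
  generators.\<close>

lemma decompose:
  assumes "z \<in> carrier CG" shows "\<exists>c\<in>carrier CE. \<exists>y\<in>J. z = jE c \<oplus>\<^bsub>CG\<^esub> y"
proof -
  have "z \<in> star_closure CG (jE ` graph_gens E \<union> jH ` graph_gens H)" using assms glued_generated by simp
  then show ?thesis
  proof (induction rule: star_closure.induct)
    case (base z)
    then show ?case
    proof
      assume "z \<in> jE ` graph_gens E"
      then obtain c where "z = jE c" "c \<in> carrier CE" by (auto simp: graph_gens_def)
      then show ?thesis by (intro bexI[of _ c] bexI[of _ "\<zero>\<^bsub>CG\<^esub>"]) (simp_all add: closed_ideal.zero)
    next
      assume "z \<in> jH ` graph_gens H"
      then have "z \<in> J" using jH_P_J jH_J by (auto simp: graph_gens_def)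
      then show ?thesis by (intro bexI[of _ "\<zero>\<^bsub>CE\<^esub>"] bexI[of _ z]) (simp_all add: J_carrier)
    qed
  next
    case zero
    show ?case by (intro bexI[of _ "\<zero>\<^bsub>CE\<^esub>"] bexI[of _ "\<zero>\<^bsub>CG\<^esub>"]) (simp_all add: closed_ideal.zero)
  next
    case (add x x')
    then obtain c y c' y' where *: "c \<in> carrier CE" "y \<in> J" "x = jE c \<oplus>\<^bsub>CG\<^esub> y" "c' \<in> carrier CE" "y' \<in> J"
      "x' = jE c' \<oplus>\<^bsub>CG\<^esub> y'" by blast
    then show ?case
      by (intro bexI[of _ "c \<oplus>\<^bsub>CE\<^esub> c'"] bexI[of _ "y \<oplus>\<^bsub>CG\<^esub> y'"])
        (simp_all add: jE.add jE.B.M.a_ac J_carrier closed_ideal.add)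
  next
    case (scale x k)
    then obtain c y where *: "c \<in> carrier CE" "y \<in> J" "x = jE c \<oplus>\<^bsub>CG\<^esub> y" by blast
    then show ?case
      by (intro bexI[of _ "k \<odot>\<^bsub>CE\<^esub> c"] bexI[of _ "k \<odot>\<^bsub>CG\<^esub> y"])
        (simp_all add: jE.scale jE.B.sc_add_right J_carrier closed_ideal.scale)
  next
    case (mult x x')
    then obtain c y c' y' where *: "c \<in> carrier CE" "y \<in> J" "x = jE c \<oplus>\<^bsub>CG\<^esub> y" "c' \<in> carrier CE" "y' \<in> J"
      "x' = jE c' \<oplus>\<^bsub>CG\<^esub> y'" by blast
    have "jE c \<otimes>\<^bsub>CG\<^esub> y' \<oplus>\<^bsub>CG\<^esub> (y \<otimes>\<^bsub>CG\<^esub> jE c' \<oplus>\<^bsub>CG\<^esub> y \<otimes>\<^bsub>CG\<^esub> y') \<in> J"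
      using * by (intro closed_ideal.add closed_ideal.left closed_ideal.right) (simp_all add: J_carrier)
    then show ?case using *
      by (intro bexI[of _ "c \<otimes>\<^bsub>CE\<^esub> c'"] bexI[of _ "jE c \<otimes>\<^bsub>CG\<^esub> y' \<oplus>\<^bsub>CG\<^esub> (y \<otimes>\<^bsub>CG\<^esub> jE c' \<oplus>\<^bsub>CG\<^esub> y \<otimes>\<^bsub>CG\<^esub> y')"])
        (simp_all add: jE.mult jE.B.mult_distrib_left jE.B.mult_distrib_right jE.B.M.a_ac J_carrier)
  next
    case (adj x)
    then obtain c y where *: "c \<in> carrier CE" "y \<in> J" "x = jE c \<oplus>\<^bsub>CG\<^esub> y" by blast
    then show ?case
      by (intro bexI[of _ "c\<^sup>\<star>\<^bsub>CE\<^esub>"] bexI[of _ "y\<^sup>\<star>\<^bsub>CG\<^esub>"]) (simp_all add: jE.adj jE.B.adj_add J_carrier J_adj)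
  next
    case (lim s x)
    show ?case by (rule sum_closed[OF lim.IH lim.hyps(2)])
  qed
qed

text \<open>On the generators this is orthogonality of different vertices of the pushout; the star closure
  passes it to all of \<open>CE\<close>. The adjoint is carried along for the induction.\<close>

lemma jE_mult_unglued:
  assumes "c \<in> carrier CE" "w \<in> verts H" "w \<notin> \<kappa> ` X"
  shows "jE c \<otimes>\<^bsub>CG\<^esub> jH (vproj H w) = \<zero>\<^bsub>CG\<^esub>"
proof -
  let ?Q = "jH (vproj H w)"
  have Q: "?Q \<in> carrier CG" using assms by simp
  have vQ: "jE (vproj E v) \<otimes>\<^bsub>CG\<^esub> ?Q = \<zero>\<^bsub>CG\<^esub>" if "v \<in> verts E" for v
    by (rule jE_jH_orth) (use assms that in auto)
  have "c \<in> star_closure CE (graph_gens E)" using assms(1) graph_cstar_generated[OF E.wf_digraph_axioms] by simp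
  then have "c \<in> carrier CE \<and> jE c \<otimes>\<^bsub>CG\<^esub> ?Q = \<zero>\<^bsub>CG\<^esub> \<and> jE (c\<^sup>\<star>\<^bsub>CE\<^esub>) \<otimes>\<^bsub>CG\<^esub> ?Q = \<zero>\<^bsub>CG\<^esub>"
  proof (induction rule: star_closure.induct)
    case (base c)
    then consider v where "v \<in> verts E" "c = vproj E v" | e where "e \<in> arcs E" "c = eiso E e"
      by (auto simp: graph_gens_def)
    then show ?case
    proof cases
      case 2
      have "jE (eiso E e) \<otimes>\<^bsub>CG\<^esub> ?Q = jE (eiso E e \<otimes>\<^bsub>CE\<^esub> vproj E (head E e)) \<otimes>\<^bsub>CG\<^esub> ?Q"
        using 2 by (simp add: FE.S_P_head)
      moreover have "jE ((eiso E e)\<^sup>\<star>\<^bsub>CE\<^esub>) \<otimes>\<^bsub>CG\<^esub> ?Q = jE ((eiso E e)\<^sup>\<star>\<^bsub>CE\<^esub> \<otimes>\<^bsub>CE\<^esub> vproj E (tail E e)) \<otimes>\<^bsub>CG\<^esub> ?Q"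
        using 2 by (simp add: FE.S_adj_P)
      ultimately show ?thesis using 2 Q by (simp only: jE.mult FE.S_closed jE.A.adj_closed FE.P_closed E.head_in_verts E.tail_in_verts)
          (simp add: jE.B.mult_assoc vQ)
    qed (simp add: vQ FE.P_adj)
  next
    case (lim s c)
    have "conv CG (\<lambda>n. jE (s n) \<otimes>\<^bsub>CG\<^esub> ?Q) (jE c \<otimes>\<^bsub>CG\<^esub> ?Q)"
      "conv CG (\<lambda>n. jE ((s n)\<^sup>\<star>\<^bsub>CE\<^esub>) \<otimes>\<^bsub>CG\<^esub> ?Q) (jE (c\<^sup>\<star>\<^bsub>CE\<^esub>) \<otimes>\<^bsub>CG\<^esub> ?Q)"
      by (intro jE.B.conv_mult jE.conv jE.A.conv_adj lim.hyps(2) jE.B.conv_const Q)+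
    then have c0: "conv CG (\<lambda>n. \<zero>\<^bsub>CG\<^esub>) (jE c \<otimes>\<^bsub>CG\<^esub> ?Q)" "conv CG (\<lambda>n. \<zero>\<^bsub>CG\<^esub>) (jE (c\<^sup>\<star>\<^bsub>CE\<^esub>) \<otimes>\<^bsub>CG\<^esub> ?Q)"
      using lim.IH by simp_all
    show ?case
      using jE.B.conv_unique[OF c0(1) jE.B.conv_const[OF jE.B.M.zero_closed]] jE.B.conv_unique[OF c0(2) jE.B.conv_const[OF jE.B.M.zero_closed]]
        jE.A.convD(2)[OF lim.hyps(2)] by simp
  qed (simp_all add: Q jE.add jE.scale jE.mult jE.B.mult_distrib_right jE.B.smult_mult_left jE.B.mult_assoc jE.A.adj_add jE.A.adj_smult jE.A.adj_mult)
  then show ?thesis by blast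
qed

end

section \<open>Adjointable operators\<close>

text \<open>The algebra of adjointable operators on a closed subspace \<open>K\<close> of a C*-algebra \<open>A\<close>, with respect
  to the \<open>A\<close>-valued inner product \<open>x\<^sup>\<star> y\<close>. Linearity follows from adjointability.\<close>

definition adjoint_pair :: "('a, 'm) cstar_scheme \<Rightarrow> 'a set \<Rightarrow> ('a \<Rightarrow> 'a) \<Rightarrow> ('a \<Rightarrow> 'a) \<Rightarrow> bool" where
  "adjoint_pair A K S T \<longleftrightarrow> S \<in> K \<rightarrow>\<^sub>E K \<and> T \<in> K \<rightarrow>\<^sub>E K \<and>
     (\<forall>x\<in>K. \<forall>y\<in>K. (S x)\<^sup>\<star>\<^bsub>A\<^esub> \<otimes>\<^bsub>A\<^esub> y = x\<^sup>\<star>\<^bsub>A\<^esub> \<otimes>\<^bsub>A\<^esub> T y)"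

text \<open>Zero is a lower bound of this set, so that its infimum is the operator norm whenever the set is
  nonempty.\<close>

definition op_bounds :: "('a, 'm) cstar_scheme \<Rightarrow> 'a set \<Rightarrow> ('a \<Rightarrow> 'a) \<Rightarrow> real set" where
  "op_bounds A K S = {b. 0 \<le> b \<and> (\<forall>x\<in>K. \<parallel>S x\<parallel>\<^bsub>A\<^esub> \<le> b * \<parallel>x\<parallel>\<^bsub>A\<^esub>)}"

definition adjointables :: "('a, 'm) cstar_scheme \<Rightarrow> 'a set \<Rightarrow> ('a \<Rightarrow> 'a) cstar" where
  "adjointables A K =
    \<lparr>carrier = {S. (\<exists>T. adjoint_pair A K S T) \<and> op_bounds A K S \<noteq> {}},
     mult = (\<lambda>S T. \<lambda>x\<in>K. S (T x)),
     one = undefined,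
     zero = (\<lambda>x\<in>K. \<zero>\<^bsub>A\<^esub>),
     add = (\<lambda>S T. \<lambda>x\<in>K. S x \<oplus>\<^bsub>A\<^esub> T x),
     smult = (\<lambda>c S. \<lambda>x\<in>K. c \<odot>\<^bsub>A\<^esub> S x),
     adj = (\<lambda>S. THE T. adjoint_pair A K S T),
     cnorm = (\<lambda>S. Inf (op_bounds A K S))\<rparr>"

locale closed_subspace = cstar_algebra A for A :: "('a, 'm) cstar_scheme" (structure) +
  fixes K :: "'a set"
  assumes K_carrier: "x \<in> K \<Longrightarrow> x \<in> carrier A" and K_zero [simp]: "\<zero> \<in> K"
    and K_add: "x \<in> K \<Longrightarrow> y \<in> K \<Longrightarrow> x \<oplus> y \<in> K" and K_sc: "x \<in> K \<Longrightarrow> c \<odot> x \<in> K"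
    and K_lim: "(\<And>n. s n \<in> K) \<Longrightarrow> conv A s x \<Longrightarrow> x \<in> K"
begin

abbreviation "L \<equiv> adjointables A K"
abbreviation "AP \<equiv> adjoint_pair A K"

lemma K_diff: "x \<in> K \<Longrightarrow> y \<in> K \<Longrightarrow> x \<ominus> y \<in> K"
  using K_add[OF _ K_sc[of y "-1"], of x] by (simp add: diff_sc K_carrier)

lemma AP_closed: "AP S T \<Longrightarrow> x \<in> K \<Longrightarrow> S x \<in> K" "AP S T \<Longrightarrow> x \<in> K \<Longrightarrow> T x \<in> K"
  by (auto simp: adjoint_pair_def)

lemma AP_eq: "AP S T \<Longrightarrow> x \<in> K \<Longrightarrow> y \<in> K \<Longrightarrow> (S x)\<^sup>\<star> \<otimes> y = x\<^sup>\<star> \<otimes> T y"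
  by (auto simp: adjoint_pair_def)

lemma AP_sym: "AP S T \<Longrightarrow> AP T S"
proof -
  assume a: "AP S T"
  have "(T x)\<^sup>\<star> \<otimes> y = x\<^sup>\<star> \<otimes> S y" if "x \<in> K" "y \<in> K" for x y
  proof -
    have "((S y)\<^sup>\<star> \<otimes> x)\<^sup>\<star> = (y\<^sup>\<star> \<otimes> T x)\<^sup>\<star>" using AP_eq[OF a that(2,1)] by simp
    then show ?thesis using that AP_closed[OF a] by (simp add: adj_mult K_carrier)
  qed
  then show ?thesis using a by (simp add: adjoint_pair_def)
qed

lemma inner_eqI:
  assumes "y \<in> K" "z \<in> K" "\<And>x. x \<in> K \<Longrightarrow> x\<^sup>\<star> \<otimes> y = x\<^sup>\<star> \<otimes> z" shows "y = z"
proof -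
  have d: "y \<ominus> z \<in> K" using assms by (simp add: K_diff)
  have "(y \<ominus> z)\<^sup>\<star> \<otimes> (y \<ominus> z) = \<zero>"
    using assms(3)[OF d] assms(1,2) K_carrier[OF d] by (simp add: mult_diff_right K_carrier)
  then have "y \<ominus> z = \<zero>" by (rule cstar_zero[OF K_carrier[OF d]])
  then show ?thesis using assms by (simp add: diff_eq_zero K_carrier)
qed

lemma AP_unique: assumes "AP S T" "AP S T'" shows "T = T'"
proof
  fix y
  show "T y = T' y"
  proof (cases "y \<in> K")
    case True
    show ?thesis
    proof (rule inner_eqI)
      show "T y \<in> K" "T' y \<in> K" using assms AP_closed True by blast+
      show "x\<^sup>\<star> \<otimes> T y = x\<^sup>\<star> \<otimes> T' y" if "x \<in> K" for x
        using AP_eq[OF assms(1) that True] AP_eq[OF assms(2) that True] by simp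
    qed
  next
    case False
    then show ?thesis using assms by (auto simp: adjoint_pair_def PiE_def extensional_def)
  qed
qed

lemma AP_add: assumes "AP S T" "x \<in> K" "y \<in> K" shows "S (x \<oplus> y) = S x \<oplus> S y"
proof (rule inner_eqI)
  note c = AP_closed(1)[OF assms(1)] AP_closed(2)[OF assms(1)]
  show "S (x \<oplus> y) \<in> K" "S x \<oplus> S y \<in> K" using assms c by (simp_all add: K_add)
  show "w\<^sup>\<star> \<otimes> S (x \<oplus> y) = w\<^sup>\<star> \<otimes> (S x \<oplus> S y)" if w: "w \<in> K" for w
    using AP_eq[OF AP_sym[OF assms(1)] w, symmetric] assms(2,3) c w
    by (simp add: mult_distrib_left K_carrier K_add)
qed

lemma AP_sc: assumes "AP S T" "x \<in> K" shows "S (c \<odot> x) = c \<odot> S x"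
proof (rule inner_eqI)
  note c = AP_closed(1)[OF assms(1)] AP_closed(2)[OF assms(1)]
  show "S (c \<odot> x) \<in> K" "c \<odot> S x \<in> K" using assms c by (simp_all add: K_sc)
  show "w\<^sup>\<star> \<otimes> S (c \<odot> x) = w\<^sup>\<star> \<otimes> (c \<odot> S x)" if w: "w \<in> K" for w
    using AP_eq[OF AP_sym[OF assms(1)] w, symmetric] assms(2) c w
    by (simp add: smult_mult_right K_carrier K_sc)
qed

text \<open>\<open>\<parallel>T y\<parallel>\<^sup>2 = \<parallel>y\<^sup>\<star> S (T y)\<parallel> \<le>
  \<parallel>y\<parallel> b \<parallel>T y\<parallel>\<close>.\<close>

lemma AP_bounds: assumes "AP S T" "b \<in> op_bounds A K S" shows "b \<in> op_bounds A K T"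
proof -
  have b: "0 \<le> b" "\<And>x. x \<in> K \<Longrightarrow> \<parallel>S x\<parallel> \<le> b * \<parallel>x\<parallel>" using assms(2) by (auto simp: op_bounds_def)
  have "\<parallel>T y\<parallel> \<le> b * \<parallel>y\<parallel>" if y: "y \<in> K" for y
  proof (rule le_of_square_le_mult)
    have Ty: "T y \<in> K" "S (T y) \<in> K" using y AP_closed[OF assms(1)] by simp_all
    note [simp] = K_carrier[OF Ty(1)] K_carrier[OF Ty(2)] K_carrier[OF y]
    show "0 \<le> \<parallel>T y\<parallel>" "0 \<le> b * \<parallel>y\<parallel>" using b(1) by simp_all
    have "\<parallel>T y\<parallel> * \<parallel>T y\<parallel> = \<parallel>y\<^sup>\<star> \<otimes> S (T y)\<parallel>"
      using cstar_identity[of "T y"] AP_eq[OF AP_sym[OF assms(1)] y Ty(1)] by (simp add: power2_eq_square)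
    also have "\<dots> \<le> \<parallel>y\<parallel> * (b * \<parallel>T y\<parallel>)"
      using cnorm_mult[of "y\<^sup>\<star>" "S (T y)"] mult_left_mono[OF b(2)[OF Ty(1)], of "\<parallel>y\<parallel>"] by simp
    finally show "\<parallel>T y\<parallel> * \<parallel>T y\<parallel> \<le> b * \<parallel>y\<parallel> * \<parallel>T y\<parallel>" by (simp add: mult_ac)
  qed
  then show ?thesis using b(1) by (simp add: op_bounds_def)
qed

lemma L_iff: "S \<in> carrier L \<longleftrightarrow> (\<exists>T. AP S T) \<and> op_bounds A K S \<noteq> {}"
  by (simp add: adjointables_def)

lemma L_intro: "AP S T \<Longrightarrow> b \<in> op_bounds A K S \<Longrightarrow> S \<in> carrier L"
  by (auto simp: L_iff)

lemma L_closed: "S \<in> carrier L \<Longrightarrow> x \<in> K \<Longrightarrow> S x \<in> K"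
  using AP_closed by (auto simp: L_iff)

lemma L_carrier [simp]: "S \<in> carrier L \<Longrightarrow> x \<in> K \<Longrightarrow> S x \<in> carrier A"
  by (rule K_carrier[OF L_closed])

lemma L_eqI: "S \<in> carrier L \<Longrightarrow> T \<in> carrier L \<Longrightarrow> (\<And>x. x \<in> K \<Longrightarrow> S x = T x) \<Longrightarrow> S = T"
proof (rule ext)
  fix x
  assume S: "S \<in> carrier L" and T: "T \<in> carrier L" and eq: "\<And>x. x \<in> K \<Longrightarrow> S x = T x"
  have u: "R x = undefined" if R: "R \<in> carrier L" and x: "x \<notin> K" for R
  proof -
    obtain R' where "adjoint_pair A K R R'" using R unfolding L_iff by blast
    then have "R \<in> extensional K" by (simp add: adjoint_pair_def PiE_def)
    then show ?thesis using x by (simp add: extensional_def)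
  qed
  show "S x = T x" by (cases "x \<in> K") (simp_all add: eq u S T)
qed

lemma L_adj: "S \<in> carrier L \<Longrightarrow> AP S (S\<^sup>\<star>\<^bsub>L\<^esub>)"
proof -
  assume "S \<in> carrier L"
  then obtain T where T: "AP S T" by (auto simp: L_iff)
  have "S\<^sup>\<star>\<^bsub>L\<^esub> = T" unfolding adjointables_def cstar.simps
    by (rule the_equality[where P = "AP S", OF T]) (rule AP_unique[OF _ T])
  then show ?thesis using T by simp
qed

lemma L_adj_eqI: "S \<in> carrier L \<Longrightarrow> AP S T \<Longrightarrow> S\<^sup>\<star>\<^bsub>L\<^esub> = T"
  using AP_unique[OF L_adj] by blast

lemma L_norm: "\<parallel>S\<parallel>\<^bsub>L\<^esub> = Inf (op_bounds A K S)"
  by (simp add: adjointables_def)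

lemma L_norm_le: "b \<in> op_bounds A K S \<Longrightarrow> \<parallel>S\<parallel>\<^bsub>L\<^esub> \<le> b"
  unfolding L_norm by (rule cInf_lower) (auto simp: bdd_below_def op_bounds_def)

lemma L_norm_leI: "0 \<le> b \<Longrightarrow> (\<And>x. x \<in> K \<Longrightarrow> \<parallel>S x\<parallel> \<le> b * \<parallel>x\<parallel>) \<Longrightarrow> \<parallel>S\<parallel>\<^bsub>L\<^esub> \<le> b"
  by (rule L_norm_le) (simp add: op_bounds_def)

lemma L_norm_bound: assumes S: "S \<in> carrier L" shows "\<parallel>S\<parallel>\<^bsub>L\<^esub> \<in> op_bounds A K S"
proof -
  have ne: "op_bounds A K S \<noteq> {}" using S by (simp add: L_iff)
  have nn: "0 \<le> \<parallel>S\<parallel>\<^bsub>L\<^esub>" unfolding L_norm by (rule cInf_greatest[OF ne]) (simp add: op_bounds_def)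
  have "\<parallel>S x\<parallel> \<le> \<parallel>S\<parallel>\<^bsub>L\<^esub> * \<parallel>x\<parallel>" if x: "x \<in> K" for x
  proof (cases "\<parallel>x\<parallel> = 0")
    case True
    obtain b where "b \<in> op_bounds A K S" using ne by blast
    then have "\<parallel>S x\<parallel> \<le> b * \<parallel>x\<parallel>" using x by (simp add: op_bounds_def)
    then show ?thesis using True by simp
  next
    case False
    then have pos: "0 < \<parallel>x\<parallel>" using norm_nonneg[OF K_carrier[OF x]] by simp
    have "\<parallel>S x\<parallel> / \<parallel>x\<parallel> \<le> \<parallel>S\<parallel>\<^bsub>L\<^esub>" unfolding L_norm
      by (rule cInf_greatest[OF ne]) (use x pos in \<open>simp add: op_bounds_def pos_divide_le_eq\<close>)
    then show ?thesis using pos by (simp add: pos_divide_le_eq)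
  qed
  then show ?thesis using nn by (simp add: op_bounds_def)
qed

lemma L_norm_app: "S \<in> carrier L \<Longrightarrow> x \<in> K \<Longrightarrow> \<parallel>S x\<parallel> \<le> \<parallel>S\<parallel>\<^bsub>L\<^esub> * \<parallel>x\<parallel>"
  and L_norm_nonneg: "S \<in> carrier L \<Longrightarrow> 0 \<le> \<parallel>S\<parallel>\<^bsub>L\<^esub>"
  using L_norm_bound[of S] by (simp_all add: op_bounds_def)

lemma L_zero_app [simp]: "x \<in> K \<Longrightarrow> \<zero>\<^bsub>L\<^esub> x = \<zero>"
  and L_add_app [simp]: "x \<in> K \<Longrightarrow> (S \<oplus>\<^bsub>L\<^esub> T) x = S x \<oplus> T x"
  and L_mult_app [simp]: "x \<in> K \<Longrightarrow> (S \<otimes>\<^bsub>L\<^esub> T) x = S (T x)"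
  and L_sc_app [simp]: "x \<in> K \<Longrightarrow> (c \<odot>\<^bsub>L\<^esub> S) x = c \<odot> S x"
  by (simp_all add: adjointables_def)

lemma AP_zero: "AP \<zero>\<^bsub>L\<^esub> \<zero>\<^bsub>L\<^esub>"
  by (simp add: adjoint_pair_def adjointables_def K_carrier)

lemma AP_plus: "AP S S' \<Longrightarrow> AP T T' \<Longrightarrow> AP (S \<oplus>\<^bsub>L\<^esub> T) (S' \<oplus>\<^bsub>L\<^esub> T')"
proof -
  assume S: "AP S S'" and T: "AP T T'"
  have "(S x \<oplus> T x)\<^sup>\<star> \<otimes> y = x\<^sup>\<star> \<otimes> (S' y \<oplus> T' y)" if "x \<in> K" "y \<in> K" for x y
    using that AP_eq[OF S that] AP_eq[OF T that] AP_closed[OF S] AP_closed[OF T]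
    by (simp add: adj_add mult_distrib_left mult_distrib_right K_carrier)
  then show ?thesis using AP_closed[OF S] AP_closed[OF T]
    by (simp add: adjoint_pair_def adjointables_def K_add)
qed

lemma AP_mult: "AP S S' \<Longrightarrow> AP T T' \<Longrightarrow> AP (S \<otimes>\<^bsub>L\<^esub> T) (T' \<otimes>\<^bsub>L\<^esub> S')"
  by (simp add: adjoint_pair_def adjointables_def PiE_def Pi_def)

lemma AP_scale: "AP S S' \<Longrightarrow> AP (c \<odot>\<^bsub>L\<^esub> S) (cnj c \<odot>\<^bsub>L\<^esub> S')"
proof -
  assume S: "AP S S'"
  have "(c \<odot> S x)\<^sup>\<star> \<otimes> y = x\<^sup>\<star> \<otimes> (cnj c \<odot> S' y)" if "x \<in> K" "y \<in> K" for x y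
    using that AP_eq[OF S that] AP_closed[OF S] by (simp add: adj_smult smult_mult_left smult_mult_right K_carrier)
  then show ?thesis using AP_closed[OF S] by (simp add: adjoint_pair_def adjointables_def K_sc)
qed

lemma bounds_zero: "0 \<in> op_bounds A K \<zero>\<^bsub>L\<^esub>"
  by (simp add: op_bounds_def)

lemma bounds_add: "S \<in> carrier L \<Longrightarrow> T \<in> carrier L \<Longrightarrow> \<parallel>S\<parallel>\<^bsub>L\<^esub> + \<parallel>T\<parallel>\<^bsub>L\<^esub> \<in> op_bounds A K (S \<oplus>\<^bsub>L\<^esub> T)"
proof -
  assume S: "S \<in> carrier L" and T: "T \<in> carrier L"
  have "\<parallel>S x \<oplus> T x\<parallel> \<le> (\<parallel>S\<parallel>\<^bsub>L\<^esub> + \<parallel>T\<parallel>\<^bsub>L\<^esub>) * \<parallel>x\<parallel>" if x: "x \<in> K" for x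
    using cnorm_add[of "S x" "T x"] L_norm_app[OF S x] L_norm_app[OF T x] S T x by (simp add: distrib_right)
  then show ?thesis using L_norm_nonneg[OF S] L_norm_nonneg[OF T] by (simp add: op_bounds_def)
qed

lemma bounds_mult: "S \<in> carrier L \<Longrightarrow> T \<in> carrier L \<Longrightarrow> \<parallel>S\<parallel>\<^bsub>L\<^esub> * \<parallel>T\<parallel>\<^bsub>L\<^esub> \<in> op_bounds A K (S \<otimes>\<^bsub>L\<^esub> T)"
proof -
  assume S: "S \<in> carrier L" and T: "T \<in> carrier L"
  have "\<parallel>S (T x)\<parallel> \<le> \<parallel>S\<parallel>\<^bsub>L\<^esub> * \<parallel>T\<parallel>\<^bsub>L\<^esub> * \<parallel>x\<parallel>" if x: "x \<in> K" for x
    using L_norm_app[OF S L_closed[OF T x]] mult_left_mono[OF L_norm_app[OF T x] L_norm_nonneg[OF S]]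
    by (simp add: mult.assoc)
  then show ?thesis using L_norm_nonneg[OF S] L_norm_nonneg[OF T] by (simp add: op_bounds_def)
qed

lemma bounds_scale: "S \<in> carrier L \<Longrightarrow> cmod c * \<parallel>S\<parallel>\<^bsub>L\<^esub> \<in> op_bounds A K (c \<odot>\<^bsub>L\<^esub> S)"
proof -
  assume S: "S \<in> carrier L"
  have "\<parallel>c \<odot> S x\<parallel> \<le> cmod c * \<parallel>S\<parallel>\<^bsub>L\<^esub> * \<parallel>x\<parallel>" if x: "x \<in> K" for x
    using mult_left_mono[OF L_norm_app[OF S x], of "cmod c"] S x by (simp add: norm_sc mult.assoc)
  then show ?thesis using L_norm_nonneg[OF S] by (simp add: op_bounds_def)
qed

lemma L_zero_closed: "\<zero>\<^bsub>L\<^esub> \<in> carrier L"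
  by (rule L_intro[OF AP_zero bounds_zero])

lemma L_add_closed: "S \<in> carrier L \<Longrightarrow> T \<in> carrier L \<Longrightarrow> S \<oplus>\<^bsub>L\<^esub> T \<in> carrier L"
  by (rule L_intro[OF AP_plus[OF L_adj L_adj] bounds_add])

lemma L_mult_closed: "S \<in> carrier L \<Longrightarrow> T \<in> carrier L \<Longrightarrow> S \<otimes>\<^bsub>L\<^esub> T \<in> carrier L"
  by (rule L_intro[OF AP_mult[OF L_adj L_adj] bounds_mult])

lemma L_sc_closed: "S \<in> carrier L \<Longrightarrow> c \<odot>\<^bsub>L\<^esub> S \<in> carrier L"
  by (rule L_intro[OF AP_scale[OF L_adj] bounds_scale])

lemma L_adj_closed: "S \<in> carrier L \<Longrightarrow> S\<^sup>\<star>\<^bsub>L\<^esub> \<in> carrier L"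
  by (rule L_intro[OF AP_sym[OF L_adj] AP_bounds[OF L_adj L_norm_bound]])

lemmas L_closures = L_zero_closed L_add_closed L_mult_closed L_sc_closed L_adj_closed

lemma L_norm_adj_le: "S \<in> carrier L \<Longrightarrow> \<parallel>S\<^sup>\<star>\<^bsub>L\<^esub>\<parallel>\<^bsub>L\<^esub> \<le> \<parallel>S\<parallel>\<^bsub>L\<^esub>"
  by (rule L_norm_le[OF AP_bounds[OF L_adj L_norm_bound]])

text \<open>\<open>\<parallel>S x\<parallel>\<^sup>2 = \<parallel>x\<^sup>\<star> (S\<^sup>\<star> S)
  x\<parallel>\<close>, exactly as for Hilbert space operators.\<close>

lemma L_cstar: assumes S: "S \<in> carrier L" shows "\<parallel>S\<^sup>\<star>\<^bsub>L\<^esub> \<otimes>\<^bsub>L\<^esub> S\<parallel>\<^bsub>L\<^esub> = (\<parallel>S\<parallel>\<^bsub>L\<^esub>)\<^sup>2"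
proof (rule antisym)
  let ?n = "\<parallel>S\<^sup>\<star>\<^bsub>L\<^esub> \<otimes>\<^bsub>L\<^esub> S\<parallel>\<^bsub>L\<^esub>"
  note SS = L_mult_closed[OF L_adj_closed[OF S] S]
  have "?n \<le> \<parallel>S\<^sup>\<star>\<^bsub>L\<^esub>\<parallel>\<^bsub>L\<^esub> * \<parallel>S\<parallel>\<^bsub>L\<^esub>" by (rule L_norm_le[OF bounds_mult[OF L_adj_closed[OF S] S]])
  also have "\<dots> \<le> \<parallel>S\<parallel>\<^bsub>L\<^esub> * \<parallel>S\<parallel>\<^bsub>L\<^esub>" by (rule mult_right_mono[OF L_norm_adj_le[OF S] L_norm_nonneg[OF S]])
  finally show "?n \<le> (\<parallel>S\<parallel>\<^bsub>L\<^esub>)\<^sup>2" by (simp add: power2_eq_square)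
  have "\<parallel>S x\<parallel> \<le> sqrt ?n * \<parallel>x\<parallel>" if x: "x \<in> K" for x
  proof -
    have Sx: "S x \<in> K" using L_closed[OF S x] .
    have "(S x)\<^sup>\<star> \<otimes> S x = x\<^sup>\<star> \<otimes> (S\<^sup>\<star>\<^bsub>L\<^esub> \<otimes>\<^bsub>L\<^esub> S) x" using AP_eq[OF L_adj[OF S] x Sx] x by simp
    then have "\<parallel>S x\<parallel>\<^sup>2 \<le> \<parallel>x\<parallel> * \<parallel>(S\<^sup>\<star>\<^bsub>L\<^esub> \<otimes>\<^bsub>L\<^esub> S) x\<parallel>"
      using cstar_identity[of "S x"] cnorm_mult[of "x\<^sup>\<star>" "(S\<^sup>\<star>\<^bsub>L\<^esub> \<otimes>\<^bsub>L\<^esub> S) x"] S SS x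
      by (simp add: K_carrier del: L_mult_app)
    also have "\<dots> \<le> \<parallel>x\<parallel> * (?n * \<parallel>x\<parallel>)" by (rule mult_left_mono[OF L_norm_app[OF SS x]]) (simp add: K_carrier[OF x])
    also have "\<dots> = (sqrt ?n * \<parallel>x\<parallel>)\<^sup>2" using L_norm_nonneg[OF SS] by (simp add: power2_eq_square)
    finally show ?thesis
      by (rule power2_le_imp_le) (use L_norm_nonneg[OF SS] K_carrier[OF x] in simp)
  qed
  then have "\<parallel>S\<parallel>\<^bsub>L\<^esub> \<le> sqrt ?n" using L_norm_nonneg[OF SS] by (intro L_norm_leI) simp_all
  then have "(\<parallel>S\<parallel>\<^bsub>L\<^esub>)\<^sup>2 \<le> (sqrt ?n)\<^sup>2" using L_norm_nonneg[OF S] by (intro power_mono)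
  then show "(\<parallel>S\<parallel>\<^bsub>L\<^esub>)\<^sup>2 \<le> ?n" using L_norm_nonneg[OF SS] by simp
qed

lemma L_abelian: "abelian_group L"
proof (rule abelian_groupI)
  fix S assume S: "S \<in> carrier L"
  have "(- 1) \<odot>\<^bsub>L\<^esub> S \<oplus>\<^bsub>L\<^esub> S = \<zero>\<^bsub>L\<^esub>"
  proof (rule L_eqI)
    fix x assume x: "x \<in> K"
    have "(- 1) \<odot> S x \<oplus> S x = \<zero>" using S x by (simp add: M.l_neg flip: minus_sc)
    then show "((- 1) \<odot>\<^bsub>L\<^esub> S \<oplus>\<^bsub>L\<^esub> S) x = \<zero>\<^bsub>L\<^esub> x" using S x by simp
  qed (simp_all add: L_closures S)
  then show "\<exists>T\<in>carrier L. T \<oplus>\<^bsub>L\<^esub> S = \<zero>\<^bsub>L\<^esub>" using L_sc_closed[OF S] by blast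
next
  fix S T W assume S: "S \<in> carrier L" and T: "T \<in> carrier L" and W: "W \<in> carrier L"
  show "S \<oplus>\<^bsub>L\<^esub> T \<in> carrier L" by (rule L_add_closed[OF S T])
  show "S \<oplus>\<^bsub>L\<^esub> T \<oplus>\<^bsub>L\<^esub> W = S \<oplus>\<^bsub>L\<^esub> (T \<oplus>\<^bsub>L\<^esub> W)" by (rule L_eqI) (simp_all add: L_closures S T W M.a_assoc)
  show "S \<oplus>\<^bsub>L\<^esub> T = T \<oplus>\<^bsub>L\<^esub> S" by (rule L_eqI) (simp_all add: L_closures S T M.a_comm)
  show "\<zero>\<^bsub>L\<^esub> \<oplus>\<^bsub>L\<^esub> S = S" by (rule L_eqI) (simp_all add: L_closures S)
qed (rule L_zero_closed)

lemma L_diff_app: "S \<in> carrier L \<Longrightarrow> T \<in> carrier L \<Longrightarrow> x \<in> K \<Longrightarrow> (S \<ominus>\<^bsub>L\<^esub> T) x = S x \<ominus> T x"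
proof -
  assume S: "S \<in> carrier L" and T: "T \<in> carrier L" and x: "x \<in> K"
  interpret L: abelian_group L by (rule L_abelian)
  have "(S \<ominus>\<^bsub>L\<^esub> T) \<oplus>\<^bsub>L\<^esub> T = S" using S T by (simp add: L.minus_eq L.a_assoc L.l_neg)
  then have "(S \<ominus>\<^bsub>L\<^esub> T) x \<oplus> T x = S x" using L_add_app[OF x, of "S \<ominus>\<^bsub>L\<^esub> T" T] by simp
  then show ?thesis
    using add_diff_cancel[of "(S \<ominus>\<^bsub>L\<^esub> T) x" "T x"] L.minus_closed[OF S T] T x by simp
qed

text \<open>Both the operators and their adjoints converge pointwise, because taking adjoints does not
  increase bounds; hence the pointwise limit is adjointable.\<close>

lemma L_complete:
  assumes s: "range s \<subseteq> carrier L"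
    and C: "\<And>e. e > 0 \<Longrightarrow> \<exists>N. \<forall>m\<ge>N. \<forall>n\<ge>N. \<parallel>s m \<ominus>\<^bsub>L\<^esub> s n\<parallel>\<^bsub>L\<^esub> < e"
  shows "\<exists>S\<in>carrier L. (\<lambda>n. \<parallel>s n \<ominus>\<^bsub>L\<^esub> S\<parallel>\<^bsub>L\<^esub>) \<longlonglongrightarrow> 0"
proof -
  interpret L: abelian_group L by (rule L_abelian)
  have sL: "s n \<in> carrier L" for n using s by (simp add: image_subset_iff)
  define t where "t n = (s n)\<^sup>\<star>\<^bsub>L\<^esub>" for n
  have st: "AP (s n) (t n)" for n unfolding t_def by (rule L_adj[OF sL])
  have tL: "t n \<in> carrier L" for n unfolding t_def by (rule L_adj_closed[OF sL])
  have app: "\<parallel>s m x \<ominus> s n x\<parallel> \<le> \<parallel>s m \<ominus>\<^bsub>L\<^esub> s n\<parallel>\<^bsub>L\<^esub> * \<parallel>x\<parallel>"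
    "\<parallel>t m x \<ominus> t n x\<parallel> \<le> \<parallel>s m \<ominus>\<^bsub>L\<^esub> s n\<parallel>\<^bsub>L\<^esub> * \<parallel>x\<parallel>" if x: "x \<in> K" for m n x
  proof -
    note d = L.minus_closed[OF sL[of m] sL[of n]]
    show "\<parallel>s m x \<ominus> s n x\<parallel> \<le> \<parallel>s m \<ominus>\<^bsub>L\<^esub> s n\<parallel>\<^bsub>L\<^esub> * \<parallel>x\<parallel>"
      using L_norm_app[OF d x] L_diff_app[OF sL sL x] by simp
    have "AP (s m \<ominus>\<^bsub>L\<^esub> s n) (t m \<ominus>\<^bsub>L\<^esub> t n)"
      unfolding adjoint_pair_def
    proof (intro conjI ballI)
      show "s m \<ominus>\<^bsub>L\<^esub> s n \<in> K \<rightarrow>\<^sub>E K" "t m \<ominus>\<^bsub>L\<^esub> t n \<in> K \<rightarrow>\<^sub>E K"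
        using L_adj[OF d] L_adj[OF L.minus_closed[OF tL[of m] tL[of n]]] by (simp_all add: adjoint_pair_def)
      fix y z assume y: "y \<in> K" and z: "z \<in> K"
      show "((s m \<ominus>\<^bsub>L\<^esub> s n) y)\<^sup>\<star> \<otimes> z = y\<^sup>\<star> \<otimes> (t m \<ominus>\<^bsub>L\<^esub> t n) z"
        using AP_eq[OF st y z] sL tL y z
        by (simp add: L_diff_app adj_diff mult_diff_left mult_diff_right K_carrier)
    qed
    from AP_bounds[OF this L_norm_bound[OF d]]
    have "\<parallel>(t m \<ominus>\<^bsub>L\<^esub> t n) x\<parallel> \<le> \<parallel>s m \<ominus>\<^bsub>L\<^esub> s n\<parallel>\<^bsub>L\<^esub> * \<parallel>x\<parallel>"
      unfolding op_bounds_def using x by blast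
    then show "\<parallel>t m x \<ominus> t n x\<parallel> \<le> \<parallel>s m \<ominus>\<^bsub>L\<^esub> s n\<parallel>\<^bsub>L\<^esub> * \<parallel>x\<parallel>"
      unfolding L_diff_app[OF tL[of m] tL[of n] x] .
  qed
  have cau: "\<exists>y. conv A (\<lambda>n. f n x) y"
    if x: "x \<in> K" and f: "\<And>n. f n x \<in> carrier A" "\<And>m n. \<parallel>f m x \<ominus> f n x\<parallel> \<le> \<parallel>s m \<ominus>\<^bsub>L\<^esub> s n\<parallel>\<^bsub>L\<^esub> * \<parallel>x\<parallel>"
    for f :: "nat \<Rightarrow> 'a \<Rightarrow> 'a" and x
  proof -
    have "\<exists>N. \<forall>m\<ge>N. \<forall>n\<ge>N. \<parallel>f m x \<ominus> f n x\<parallel> < e" if e: "e > 0" for e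
    proof -
      have pos: "0 < \<parallel>x\<parallel> + 1" using norm_nonneg[OF K_carrier[OF x]] by simp
      have "0 < e / (\<parallel>x\<parallel> + 1)" using e pos by simp
      from C[OF this] obtain N where N: "\<And>m n. m \<ge> N \<Longrightarrow> n \<ge> N \<Longrightarrow> \<parallel>s m \<ominus>\<^bsub>L\<^esub> s n\<parallel>\<^bsub>L\<^esub> < e / (\<parallel>x\<parallel> + 1)" by blast
      have "\<parallel>f m x \<ominus> f n x\<parallel> < e" if mn: "m \<ge> N" "n \<ge> N" for m n
      proof -
        have "\<parallel>s m \<ominus>\<^bsub>L\<^esub> s n\<parallel>\<^bsub>L\<^esub> * \<parallel>x\<parallel> \<le> \<parallel>s m \<ominus>\<^bsub>L\<^esub> s n\<parallel>\<^bsub>L\<^esub> * (\<parallel>x\<parallel> + 1)"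
          using L_norm_nonneg[OF L.minus_closed[OF sL sL]] by (intro mult_left_mono) simp_all
        also have "\<dots> < e" using N[OF mn] pos by (simp add: pos_less_divide_eq)
        finally show ?thesis using f(2)[of m n] by simp
      qed
      then show ?thesis by blast
    qed
    then show ?thesis using Cauchy_conv[of "\<lambda>n. f n x", OF f(1)] by blast
  qed
  have "\<exists>y. conv A (\<lambda>n. s n x) y" "\<exists>y. conv A (\<lambda>n. t n x) y" if x: "x \<in> K" for x
    using cau[OF x, of s] cau[OF x, of t] app[OF x] sL tL x by simp_all
  then obtain S0 T0 where S0: "\<And>x. x \<in> K \<Longrightarrow> conv A (\<lambda>n. s n x) (S0 x)"
    and T0: "\<And>x. x \<in> K \<Longrightarrow> conv A (\<lambda>n. t n x) (T0 x)" by metis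
  define S where "S = restrict S0 K"
  define T where "T = restrict T0 K"
  have S: "conv A (\<lambda>n. s n x) (S x)" and T: "conv A (\<lambda>n. t n x) (T x)" if "x \<in> K" for x
    using S0 T0 that by (simp_all add: S_def T_def)
  have SK: "S x \<in> K" and TK: "T x \<in> K" if "x \<in> K" for x
    using K_lim[OF L_closed[OF sL that] S[OF that]] K_lim[OF L_closed[OF tL that] T[OF that]] .
  have AP: "AP S T"
    unfolding adjoint_pair_def
  proof (intro conjI ballI)
    show "S \<in> K \<rightarrow>\<^sub>E K" "T \<in> K \<rightarrow>\<^sub>E K" using SK TK by (auto simp: S_def T_def)
    fix x y assume x: "x \<in> K" and y: "y \<in> K"
    have "conv A (\<lambda>n. (s n x)\<^sup>\<star> \<otimes> y) ((S x)\<^sup>\<star> \<otimes> y)"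
      by (rule conv_mult[OF conv_adj[OF S[OF x]] conv_const[OF K_carrier[OF y]]])
    moreover have "conv A (\<lambda>n. x\<^sup>\<star> \<otimes> t n y) (x\<^sup>\<star> \<otimes> T y)"
      by (rule conv_mult[OF conv_const T[OF y]]) (simp add: K_carrier[OF x])
    ultimately show "(S x)\<^sup>\<star> \<otimes> y = x\<^sup>\<star> \<otimes> T y"
      using conv_unique unfolding AP_eq[OF st x y] by blast
  qed
  have close: "\<exists>N. \<forall>n\<ge>N. \<forall>x\<in>K. \<parallel>s n x \<ominus> S x\<parallel> \<le> e * \<parallel>x\<parallel>" if e: "e > 0" for e
  proof -
    obtain N where N: "\<And>m n. m \<ge> N \<Longrightarrow> n \<ge> N \<Longrightarrow> \<parallel>s m \<ominus>\<^bsub>L\<^esub> s n\<parallel>\<^bsub>L\<^esub> < e" using C[OF e] by blast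
    have "\<parallel>s n x \<ominus> S x\<parallel> \<le> e * \<parallel>x\<parallel>" if n: "n \<ge> N" and x: "x \<in> K" for n x
    proof (rule LIMSEQ_le_const2[OF conv_norm[OF conv_diff[OF conv_const S[OF x]]]])
      show "s n x \<in> carrier A" using sL x by simp
      show "\<exists>M. \<forall>m\<ge>M. \<parallel>s n x \<ominus> s m x\<parallel> \<le> e * \<parallel>x\<parallel>"
      proof (intro exI[of _ N] allI impI)
        fix m assume m: "N \<le> m"
        have "\<parallel>s n \<ominus>\<^bsub>L\<^esub> s m\<parallel>\<^bsub>L\<^esub> * \<parallel>x\<parallel> \<le> e * \<parallel>x\<parallel>"
          using N[OF n m] norm_nonneg[OF K_carrier[OF x]] by (intro mult_right_mono) simp_all
        then show "\<parallel>s n x \<ominus> s m x\<parallel> \<le> e * \<parallel>x\<parallel>" using app(1)[OF x, of n m] by simp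
      qed
    qed
    then show ?thesis by blast
  qed
  have SL: "S \<in> carrier L"
  proof -
    obtain N where N: "\<And>x. x \<in> K \<Longrightarrow> \<parallel>s N x \<ominus> S x\<parallel> \<le> 1 * \<parallel>x\<parallel>" using close[of 1] by auto
    have "\<parallel>S x\<parallel> \<le> (\<parallel>s N\<parallel>\<^bsub>L\<^esub> + 1) * \<parallel>x\<parallel>" if x: "x \<in> K" for x
    proof -
      have "\<parallel>S x\<parallel> \<le> \<parallel>s N x\<parallel> + \<parallel>s N x \<ominus> S x\<parallel>"
        using norm_diff_bound[of "s N x" "S x"] sL x K_carrier[OF SK[OF x]] by simp
      then show ?thesis using N[OF x] L_norm_app[OF sL x, of N] by (simp add: distrib_right)
    qed
    then have "\<parallel>s N\<parallel>\<^bsub>L\<^esub> + 1 \<in> op_bounds A K S" using L_norm_nonneg[OF sL[of N]] by (simp add: op_bounds_def)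
    then show ?thesis by (rule L_intro[OF AP])
  qed
  have "(\<lambda>n. \<parallel>s n \<ominus>\<^bsub>L\<^esub> S\<parallel>\<^bsub>L\<^esub>) \<longlonglongrightarrow> 0"
  proof (rule LIMSEQ_I)
    fix e :: real assume "0 < e"
    then have e: "0 < e / 2" by simp
    obtain N where N: "\<forall>n\<ge>N. \<forall>x\<in>K. \<parallel>s n x \<ominus> S x\<parallel> \<le> e / 2 * \<parallel>x\<parallel>" using close[OF e] by blast
    have "norm (\<parallel>s n \<ominus>\<^bsub>L\<^esub> S\<parallel>\<^bsub>L\<^esub> - 0) < e" if n: "n \<ge> N" for n
    proof -
      have "\<parallel>s n \<ominus>\<^bsub>L\<^esub> S\<parallel>\<^bsub>L\<^esub> \<le> e / 2"
        using N n e by (intro L_norm_leI) (simp_all add: L_diff_app sL SL)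
      then show ?thesis using L_norm_nonneg[OF L.minus_closed[OF sL[of n] SL]] \<open>0 < e\<close> by simp
    qed
    then show "\<exists>N. \<forall>n\<ge>N. norm (\<parallel>s n \<ominus>\<^bsub>L\<^esub> S\<parallel>\<^bsub>L\<^esub> - 0) < e" by blast
  qed
  then show ?thesis by (rule bexI[OF _ SL])
qed

lemma L_module: "Module.module complex_ring L"
proof (rule moduleI[OF R.is_cring L_abelian])
  fix a b :: complex and S T assume S: "S \<in> carrier L" and T: "T \<in> carrier L"
  show "a \<odot>\<^bsub>L\<^esub> S \<in> carrier L" by (rule L_sc_closed[OF S])
  show "(a \<oplus>\<^bsub>complex_ring\<^esub> b) \<odot>\<^bsub>L\<^esub> S = a \<odot>\<^bsub>L\<^esub> S \<oplus>\<^bsub>L\<^esub> b \<odot>\<^bsub>L\<^esub> S"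
    by (rule L_eqI) (simp_all add: L_closures S sc_add_left)
  show "a \<odot>\<^bsub>L\<^esub> (S \<oplus>\<^bsub>L\<^esub> T) = a \<odot>\<^bsub>L\<^esub> S \<oplus>\<^bsub>L\<^esub> a \<odot>\<^bsub>L\<^esub> T"
    by (rule L_eqI) (simp_all add: L_closures S T sc_add_right)
  show "(a \<otimes>\<^bsub>complex_ring\<^esub> b) \<odot>\<^bsub>L\<^esub> S = a \<odot>\<^bsub>L\<^esub> (b \<odot>\<^bsub>L\<^esub> S)"
    by (rule L_eqI) (simp_all add: L_closures S)
  show "\<one>\<^bsub>complex_ring\<^esub> \<odot>\<^bsub>L\<^esub> S = S"
    by (rule L_eqI) (simp_all add: L_closures S)
qed

lemma cstar_algebra_L: "cstar_algebra L"
proof (rule cstar_algebra.intro[OF _ cstar_algebra_axioms.intro])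
  show "Module.module complex_ring L" by (rule L_module)
  fix S assume S: "S \<in> carrier L"
  show "S\<^sup>\<star>\<^bsub>L\<^esub> \<in> carrier L" by (rule L_adj_closed[OF S])
  show "(S\<^sup>\<star>\<^bsub>L\<^esub>)\<^sup>\<star>\<^bsub>L\<^esub> = S" by (rule L_adj_eqI[OF L_adj_closed[OF S] AP_sym[OF L_adj[OF S]]])
  show "(c \<odot>\<^bsub>L\<^esub> S)\<^sup>\<star>\<^bsub>L\<^esub> = cnj c \<odot>\<^bsub>L\<^esub> S\<^sup>\<star>\<^bsub>L\<^esub>" for c by (rule L_adj_eqI[OF L_sc_closed[OF S] AP_scale[OF L_adj[OF S]]])
  show "(\<parallel>S\<parallel>\<^bsub>L\<^esub> = 0) = (S = \<zero>\<^bsub>L\<^esub>)"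
  proof
    assume 0: "\<parallel>S\<parallel>\<^bsub>L\<^esub> = 0"
    show "S = \<zero>\<^bsub>L\<^esub>"
    proof (rule L_eqI[OF S L_zero_closed])
      fix x assume x: "x \<in> K"
      then have "\<parallel>S x\<parallel> = 0" using L_norm_app[OF S x] 0 norm_nonneg[OF L_carrier[OF S x]] by simp
      then show "S x = \<zero>\<^bsub>L\<^esub> x" using S x by (simp add: cnorm_eq_zero)
    qed
  next
    assume "S = \<zero>\<^bsub>L\<^esub>"
    then show "\<parallel>S\<parallel>\<^bsub>L\<^esub> = 0" using L_norm_le[OF bounds_zero] L_norm_nonneg[OF S] by simp
  qed
  show "\<parallel>c \<odot>\<^bsub>L\<^esub> S\<parallel>\<^bsub>L\<^esub> = cmod c * \<parallel>S\<parallel>\<^bsub>L\<^esub>" for c :: complex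
  proof (rule antisym)
    show "\<parallel>c \<odot>\<^bsub>L\<^esub> S\<parallel>\<^bsub>L\<^esub> \<le> cmod c * \<parallel>S\<parallel>\<^bsub>L\<^esub>" by (rule L_norm_le[OF bounds_scale[OF S]])
    show "cmod c * \<parallel>S\<parallel>\<^bsub>L\<^esub> \<le> \<parallel>c \<odot>\<^bsub>L\<^esub> S\<parallel>\<^bsub>L\<^esub>"
    proof (cases "c = 0")
      case False
      have "(1 / c) \<odot>\<^bsub>L\<^esub> (c \<odot>\<^bsub>L\<^esub> S) = S"
        by (rule L_eqI) (use False S in \<open>simp_all add: L_closures\<close>)
      then have "\<parallel>S\<parallel>\<^bsub>L\<^esub> \<le> cmod (1 / c) * \<parallel>c \<odot>\<^bsub>L\<^esub> S\<parallel>\<^bsub>L\<^esub>"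
        using L_norm_le[OF bounds_scale[OF L_sc_closed[OF S, of c], of "1 / c"]] by simp
      then show ?thesis using False by (simp add: norm_divide field_simps)
    qed (use L_norm_nonneg[OF L_sc_closed[OF S]] in simp)
  qed
  show "\<parallel>S\<^sup>\<star>\<^bsub>L\<^esub> \<otimes>\<^bsub>L\<^esub> S\<parallel>\<^bsub>L\<^esub> = (\<parallel>S\<parallel>\<^bsub>L\<^esub>)\<^sup>2" by (rule L_cstar[OF S])
  fix T assume T: "T \<in> carrier L"
  show "S \<otimes>\<^bsub>L\<^esub> T \<in> carrier L" by (rule L_mult_closed[OF S T])
  show "(S \<oplus>\<^bsub>L\<^esub> T)\<^sup>\<star>\<^bsub>L\<^esub> = S\<^sup>\<star>\<^bsub>L\<^esub> \<oplus>\<^bsub>L\<^esub> T\<^sup>\<star>\<^bsub>L\<^esub>" by (rule L_adj_eqI[OF L_add_closed[OF S T] AP_plus[OF L_adj[OF S] L_adj[OF T]]])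
  show "(S \<otimes>\<^bsub>L\<^esub> T)\<^sup>\<star>\<^bsub>L\<^esub> = T\<^sup>\<star>\<^bsub>L\<^esub> \<otimes>\<^bsub>L\<^esub> S\<^sup>\<star>\<^bsub>L\<^esub>" by (rule L_adj_eqI[OF L_mult_closed[OF S T] AP_mult[OF L_adj[OF S] L_adj[OF T]]])
  show "\<parallel>S \<oplus>\<^bsub>L\<^esub> T\<parallel>\<^bsub>L\<^esub> \<le> \<parallel>S\<parallel>\<^bsub>L\<^esub> + \<parallel>T\<parallel>\<^bsub>L\<^esub>" by (rule L_norm_le[OF bounds_add[OF S T]])
  show "\<parallel>S \<otimes>\<^bsub>L\<^esub> T\<parallel>\<^bsub>L\<^esub> \<le> \<parallel>S\<parallel>\<^bsub>L\<^esub> * \<parallel>T\<parallel>\<^bsub>L\<^esub>" by (rule L_norm_le[OF bounds_mult[OF S T]])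
  show "(c \<odot>\<^bsub>L\<^esub> S) \<otimes>\<^bsub>L\<^esub> T = c \<odot>\<^bsub>L\<^esub> (S \<otimes>\<^bsub>L\<^esub> T)" "S \<otimes>\<^bsub>L\<^esub> (c \<odot>\<^bsub>L\<^esub> T) = c \<odot>\<^bsub>L\<^esub> (S \<otimes>\<^bsub>L\<^esub> T)" for c
    by (rule L_eqI; simp add: L_closures S T L_closed AP_sc[OF L_adj[OF S]])+
  fix W assume W: "W \<in> carrier L"
  show "S \<otimes>\<^bsub>L\<^esub> T \<otimes>\<^bsub>L\<^esub> W = S \<otimes>\<^bsub>L\<^esub> (T \<otimes>\<^bsub>L\<^esub> W)" "(S \<oplus>\<^bsub>L\<^esub> T) \<otimes>\<^bsub>L\<^esub> W = S \<otimes>\<^bsub>L\<^esub> W \<oplus>\<^bsub>L\<^esub> T \<otimes>\<^bsub>L\<^esub> W"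
    "S \<otimes>\<^bsub>L\<^esub> (T \<oplus>\<^bsub>L\<^esub> W) = S \<otimes>\<^bsub>L\<^esub> T \<oplus>\<^bsub>L\<^esub> S \<otimes>\<^bsub>L\<^esub> W"
    by (rule L_eqI; simp add: L_closures S T W L_closed AP_add[OF L_adj[OF S]])+
next
  show "\<And>s. range s \<subseteq> carrier L \<Longrightarrow> (\<And>e. e > 0 \<Longrightarrow> \<exists>N. \<forall>m\<ge>N. \<forall>n\<ge>N. \<parallel>s m \<ominus>\<^bsub>L\<^esub> s n\<parallel>\<^bsub>L\<^esub> < e) \<Longrightarrow>
      \<exists>x\<in>carrier L. (\<lambda>n. \<parallel>s n \<ominus>\<^bsub>L\<^esub> x\<parallel>\<^bsub>L\<^esub>) \<longlonglongrightarrow> 0" by (rule L_complete)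
qed

end

section \<open>Extending a homomorphism on an ideal to an action\<close>

text \<open>For a bounded sequence the set of \<open>y\<close> for which \<open>t\<^sub>n y\<close> converges
  is a closed subspace.\<close>

lemma (in cstar_algebra) mult_limit_closed_span:
  assumes "y \<in> closed_span A S" and S: "S \<subseteq> carrier A" and t: "\<And>n. t n \<in> carrier A" "\<And>n. \<parallel>t n\<parallel> \<le> C"
    and base: "\<And>x. x \<in> S \<Longrightarrow> \<exists>l. conv A (\<lambda>n. t n \<otimes> x) l"
  shows "\<exists>l. conv A (\<lambda>n. t n \<otimes> y) l"
  using assms(1)
proof (induction rule: closed_span.induct)
  case zero
  have "conv A (\<lambda>n. t n \<otimes> \<zero>) \<zero>" using t by simp
  then show ?case by blast
next
  case (add x y)
  then obtain k l where "conv A (\<lambda>n. t n \<otimes> x) k" "conv A (\<lambda>n. t n \<otimes> y) l" by blast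
  from conv_add[OF this] show ?case
    using t closed_span_carrier[OF add.hyps(1) S] closed_span_carrier[OF add.hyps(2) S]
    by (auto simp: mult_distrib_left)
next
  case (scale x c)
  then obtain k where "conv A (\<lambda>n. t n \<otimes> x) k" by blast
  from conv_sc[OF this, of c] show ?case
    using t closed_span_carrier[OF scale.hyps S] by (auto simp: smult_mult_right)
next
  case (lim s y)
  note [simp] = convD(1,2)[OF lim.hyps(2)]
  have C: "0 \<le> C" using order_trans[OF norm_nonneg[OF t(1)] t(2)] .
  have "\<exists>N. \<forall>m\<ge>N. \<forall>n\<ge>N. \<parallel>t m \<otimes> y \<ominus> t n \<otimes> y\<parallel> < e" if e: "e > 0" for e
  proof -
    have C1: "0 < C + 1" using C by simp
    then have "0 < e / 4 / (C + 1)" using e by simp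
    from LIMSEQ_D[OF convD(3)[OF lim.hyps(2)] this] obtain k where k: "\<parallel>s k \<ominus> y\<parallel> < e / 4 / (C + 1)" by auto
    have close: "\<parallel>t n \<otimes> s k \<ominus> t n \<otimes> y\<parallel> < e / 4" for n
    proof -
      have "\<parallel>t n \<otimes> (s k \<ominus> y)\<parallel> \<le> (C + 1) * \<parallel>s k \<ominus> y\<parallel>"
        using cnorm_mult[of "t n" "s k \<ominus> y"] mult_right_mono[of "\<parallel>t n\<parallel>" "C + 1" "\<parallel>s k \<ominus> y\<parallel>"] t(1)[of n] t(2)[of n] by simp
      also have "\<dots> < e / 4" using iffD1[OF pos_less_divide_eq[OF C1] k] by (simp add: mult.commute)
      finally show ?thesis using t by (simp add: mult_diff_right)
    qed
    obtain l where "conv A (\<lambda>n. t n \<otimes> s k) l" using lim.IH by blast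
    from conv_Cauchy[OF this, of "e / 4"] e obtain N where
      N: "\<And>m n. m \<ge> N \<Longrightarrow> n \<ge> N \<Longrightarrow> \<parallel>t m \<otimes> s k \<ominus> t n \<otimes> s k\<parallel> < e / 4" by auto
    have "\<parallel>t m \<otimes> y \<ominus> t n \<otimes> y\<parallel> < e" if "m \<ge> N" "n \<ge> N" for m n
    proof -
      have "\<parallel>t m \<otimes> y \<ominus> t n \<otimes> y\<parallel> \<le> \<parallel>t m \<otimes> y \<ominus> t m \<otimes> s k\<parallel> + \<parallel>t m \<otimes> s k \<ominus> t n \<otimes> y\<parallel>"
        by (rule norm_triangle) (simp_all add: t)
      moreover have "\<parallel>t m \<otimes> s k \<ominus> t n \<otimes> y\<parallel> \<le> \<parallel>t m \<otimes> s k \<ominus> t n \<otimes> s k\<parallel> + \<parallel>t n \<otimes> s k \<ominus> t n \<otimes> y\<parallel>"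
        by (rule norm_triangle) (simp_all add: t)
      moreover have "\<parallel>t m \<otimes> y \<ominus> t m \<otimes> s k\<parallel> = \<parallel>t m \<otimes> s k \<ominus> t m \<otimes> y\<parallel>"
        by (rule norm_diff_comm) (simp_all add: t)
      ultimately show ?thesis using N[OF that] close[of m] close[of n] e by simp
    qed
    then show ?thesis by blast
  qed
  moreover have "t n \<otimes> y \<in> carrier A" for n using t by simp
  ultimately show ?case using Cauchy_conv[of "\<lambda>n. t n \<otimes> y"] by blast
qed (rule base)

lemma (in cstar_algebra) closed_subspace_span: "S \<subseteq> carrier A \<Longrightarrow> closed_subspace A (closed_span A S)"
  by unfold_locales (simp_all add: closed_span_carrier closed_span.zero closed_span.add closed_span.scale, rule closed_span.lim)

lemma (in closed_subspace) left_mult_hom: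
  assumes left: "\<And>a x. a \<in> carrier A \<Longrightarrow> x \<in> K \<Longrightarrow> a \<otimes> x \<in> K"
  shows "star_hom A L (\<lambda>a\<in>carrier A. \<lambda>x\<in>K. a \<otimes> x)"
proof -
  have AP: "AP (\<lambda>x\<in>K. a \<otimes> x) (\<lambda>x\<in>K. a\<^sup>\<star> \<otimes> x)" if "a \<in> carrier A" for a
    using that left by (simp add: adjoint_pair_def adj_mult mult_assoc K_carrier)
  have L: "(\<lambda>x\<in>K. a \<otimes> x) \<in> carrier L" if "a \<in> carrier A" for a
    by (rule L_intro[OF AP[OF that], of "\<parallel>a\<parallel>"]) (simp add: op_bounds_def that cnorm_mult K_carrier)
  show ?thesis
  proof (rule star_homI[OF cstar_algebra_axioms cstar_algebra_L])
    fix x assume x: "x \<in> carrier A"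
    show "(\<lambda>a\<in>carrier A. \<lambda>x\<in>K. a \<otimes> x) x \<in> carrier L" using L x by simp
    show "(\<lambda>a\<in>carrier A. \<lambda>x\<in>K. a \<otimes> x) (x\<^sup>\<star>) = ((\<lambda>a\<in>carrier A. \<lambda>x\<in>K. a \<otimes> x) x)\<^sup>\<star>\<^bsub>L\<^esub>"
      using x L_adj_eqI[OF L[OF x] AP[OF x]] by simp
    show "(\<lambda>a\<in>carrier A. \<lambda>x\<in>K. a \<otimes> x) (c \<odot> x) = c \<odot>\<^bsub>L\<^esub> (\<lambda>a\<in>carrier A. \<lambda>x\<in>K. a \<otimes> x) x" for c
      using x by (intro L_eqI) (simp_all add: L L_closures smult_mult_left K_carrier)
    fix y assume y: "y \<in> carrier A"
    show "(\<lambda>a\<in>carrier A. \<lambda>x\<in>K. a \<otimes> x) (x \<oplus> y) = (\<lambda>a\<in>carrier A. \<lambda>x\<in>K. a \<otimes> x) x \<oplus>\<^bsub>L\<^esub> (\<lambda>a\<in>carrier A. \<lambda>x\<in>K. a \<otimes> x) y"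
      using x y by (intro L_eqI) (simp_all add: L L_closures mult_distrib_right K_carrier)
    show "(\<lambda>a\<in>carrier A. \<lambda>x\<in>K. a \<otimes> x) (x \<otimes> y) = (\<lambda>a\<in>carrier A. \<lambda>x\<in>K. a \<otimes> x) x \<otimes>\<^bsub>L\<^esub> (\<lambda>a\<in>carrier A. \<lambda>x\<in>K. a \<otimes> x) y"
      using x y by (intro L_eqI) (simp_all add: L L_closures mult_assoc K_carrier left)
  qed simp
qed

text \<open>A homomorphism \<open>h\<close> from an ideal of \<open>C\<close> to \<open>D\<close>, and a set
  \<open>Z\<close> that its range annihilates from the left. On the closed span of the right multiples of the
  range and of \<open>Z\<close>, all of \<open>C\<close> acts by \<open>c \<cdot> h x y = h (c x) y\<close>
  and \<open>c \<cdot> z = 0\<close>.\<close>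

locale ideal_action = I: unital_ideal C u T + D: cstar_algebra D
  for C :: "('c, 'm) cstar_scheme" and u T and D :: "('d, 'n) cstar_scheme" +
  fixes h :: "'c \<Rightarrow> 'd" and Z :: "'d set"
  assumes h_closed [simp]: "x \<in> I.J \<Longrightarrow> h x \<in> carrier D"
    and h_add: "x \<in> I.J \<Longrightarrow> y \<in> I.J \<Longrightarrow> h (x \<oplus>\<^bsub>C\<^esub> y) = h x \<oplus>\<^bsub>D\<^esub> h y"
    and h_scale: "x \<in> I.J \<Longrightarrow> h (c \<odot>\<^bsub>C\<^esub> x) = c \<odot>\<^bsub>D\<^esub> h x"
    and h_mult: "x \<in> I.J \<Longrightarrow> y \<in> I.J \<Longrightarrow> h (x \<otimes>\<^bsub>C\<^esub> y) = h x \<otimes>\<^bsub>D\<^esub> h y"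
    and h_adj: "x \<in> I.J \<Longrightarrow> h (x\<^sup>\<star>\<^bsub>C\<^esub>) = (h x)\<^sup>\<star>\<^bsub>D\<^esub>"
    and h_contractive: "x \<in> I.J \<Longrightarrow> \<parallel>h x\<parallel>\<^bsub>D\<^esub> \<le> \<parallel>x\<parallel>\<^bsub>C\<^esub>"
    and Z_carrier: "Z \<subseteq> carrier D" and h_Z: "x \<in> I.J \<Longrightarrow> z \<in> Z \<Longrightarrow> h x \<otimes>\<^bsub>D\<^esub> z = \<zero>\<^bsub>D\<^esub>"
begin

definition generators :: "'d set" where
  "generators = {h x \<otimes>\<^bsub>D\<^esub> y | x y. x \<in> I.J \<and> y \<in> carrier D} \<union> Z"

abbreviation "K \<equiv> closed_span D generators"

lemma generators_carrier: "generators \<subseteq> carrier D"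
  using Z_carrier by (auto simp: generators_def)

sublocale K: closed_subspace D K
  by (rule D.closed_subspace_span[OF generators_carrier])

lemma cu_ideal: "c \<in> carrier C \<Longrightarrow> c \<otimes>\<^bsub>C\<^esub> u n \<in> I.J"
  by (rule closed_ideal.left[OF _ I.u_ideal])

lemma h_diff: "x \<in> I.J \<Longrightarrow> y \<in> I.J \<Longrightarrow> h (x \<ominus>\<^bsub>C\<^esub> y) = h x \<ominus>\<^bsub>D\<^esub> h y"
  by (simp add: I.diff_sc D.diff_sc I.I_carrier h_add h_scale closed_ideal.scale)

lemma h_conv:
  assumes "\<And>n. s n \<in> I.J" "x \<in> I.J" "conv C s x" shows "conv D (\<lambda>n. h (s n)) (h x)"
proof (rule D.conv_bound[OF _ _ _ I.convD(3)[OF assms(3)]])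
  show "\<parallel>h (s n) \<ominus>\<^bsub>D\<^esub> h x\<parallel>\<^bsub>D\<^esub> \<le> \<parallel>s n \<ominus>\<^bsub>C\<^esub> x\<parallel>\<^bsub>C\<^esub>" for n
    using h_contractive[OF I.closed_ideal_diff[OF assms(1)[of n] assms(2) I.T_carrier]] assms(1,2)
    by (simp add: h_diff)
qed (use assms in simp_all)

lemma cux_conv:
  assumes c: "c \<in> carrier C" and x: "x \<in> I.J" and y: "y \<in> carrier D"
  shows "conv D (\<lambda>n. h (c \<otimes>\<^bsub>C\<^esub> u n) \<otimes>\<^bsub>D\<^esub> (h x \<otimes>\<^bsub>D\<^esub> y)) (h (c \<otimes>\<^bsub>C\<^esub> x) \<otimes>\<^bsub>D\<^esub> y)"
proof -
  have "conv C (\<lambda>n. c \<otimes>\<^bsub>C\<^esub> (u n \<otimes>\<^bsub>C\<^esub> x)) (c \<otimes>\<^bsub>C\<^esub> x)"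
    by (rule I.conv_mult[OF I.conv_const[OF c] I.unit_forD(2)[OF I.u_unit[OF x]]])
  then have "conv D (\<lambda>n. h (c \<otimes>\<^bsub>C\<^esub> (u n \<otimes>\<^bsub>C\<^esub> x)) \<otimes>\<^bsub>D\<^esub> y) (h (c \<otimes>\<^bsub>C\<^esub> x) \<otimes>\<^bsub>D\<^esub> y)"
    using c x y by (intro D.conv_mult h_conv D.conv_const closed_ideal.left closed_ideal.right[OF _ I.u_ideal])
      (simp_all add: I.I_carrier)
  moreover have "h (c \<otimes>\<^bsub>C\<^esub> u n) \<otimes>\<^bsub>D\<^esub> (h x \<otimes>\<^bsub>D\<^esub> y) = h (c \<otimes>\<^bsub>C\<^esub> (u n \<otimes>\<^bsub>C\<^esub> x)) \<otimes>\<^bsub>D\<^esub> y" for n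
  proof -
    have "h (c \<otimes>\<^bsub>C\<^esub> (u n \<otimes>\<^bsub>C\<^esub> x)) = h (c \<otimes>\<^bsub>C\<^esub> u n) \<otimes>\<^bsub>D\<^esub> h x"
      using h_mult[OF cu_ideal[OF c, of n] x] I.mult_assoc[OF c I.u_closed[of n] I.I_carrier[OF x]] by simp
    then show ?thesis using x y cu_ideal[OF c, of n] by (simp add: D.mult_assoc)
  qed
  ultimately show ?thesis by simp
qed

lemma cu_bound: "c \<in> carrier C \<Longrightarrow> \<parallel>h (c \<otimes>\<^bsub>C\<^esub> u n)\<parallel>\<^bsub>D\<^esub> \<le> \<parallel>c\<parallel>\<^bsub>C\<^esub>"
proof -
  assume c: "c \<in> carrier C"
  have "\<parallel>c \<otimes>\<^bsub>C\<^esub> u n\<parallel>\<^bsub>C\<^esub> = \<parallel>u n \<otimes>\<^bsub>C\<^esub> c\<^sup>\<star>\<^bsub>C\<^esub>\<parallel>\<^bsub>C\<^esub>"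
    using I.norm_adj[of "c \<otimes>\<^bsub>C\<^esub> u n"] c by (simp add: I.adj_mult I.u_adj)
  then have "\<parallel>c \<otimes>\<^bsub>C\<^esub> u n\<parallel>\<^bsub>C\<^esub> \<le> \<parallel>c\<parallel>\<^bsub>C\<^esub>"
    using I.proj_mult_le[OF I.u_closed I.u_adj I.u_idem, of "c\<^sup>\<star>\<^bsub>C\<^esub>"] c by simp
  then show ?thesis using h_contractive[OF cu_ideal[OF c, of n]] by simp
qed

text \<open>Using the limit along the approximate unit avoids having to show that the formula on the
  generators is well defined and bounded.\<close>

definition act :: "'c \<Rightarrow> 'd \<Rightarrow> 'd" where
  "act c = (\<lambda>y\<in>K. THE l. conv D (\<lambda>n. h (c \<otimes>\<^bsub>C\<^esub> u n) \<otimes>\<^bsub>D\<^esub> y) l)"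

lemma act_limit:
  assumes c: "c \<in> carrier C" and y: "y \<in> K"
  shows "conv D (\<lambda>n. h (c \<otimes>\<^bsub>C\<^esub> u n) \<otimes>\<^bsub>D\<^esub> y) (act c y)"
proof -
  have "\<exists>l. conv D (\<lambda>n. h (c \<otimes>\<^bsub>C\<^esub> u n) \<otimes>\<^bsub>D\<^esub> y) l"
  proof (rule D.mult_limit_closed_span[OF y generators_carrier _ cu_bound[OF c]])
    show "h (c \<otimes>\<^bsub>C\<^esub> u n) \<in> carrier D" for n using cu_ideal[OF c] by simp
    fix g assume "g \<in> generators"
    then consider x y where "g = h x \<otimes>\<^bsub>D\<^esub> y" "x \<in> I.J" "y \<in> carrier D" | "g \<in> Z"
      unfolding generators_def by blast
    then show "\<exists>l. conv D (\<lambda>n. h (c \<otimes>\<^bsub>C\<^esub> u n) \<otimes>\<^bsub>D\<^esub> g) l"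
    proof cases
      case 1
      show ?thesis unfolding 1(1) by (rule exI, rule cux_conv[OF c 1(2,3)])
    next
      case 2
      have "h (c \<otimes>\<^bsub>C\<^esub> u n) \<otimes>\<^bsub>D\<^esub> g = \<zero>\<^bsub>D\<^esub>" for n by (rule h_Z[OF cu_ideal[OF c] 2])
      then show ?thesis by (intro exI[of _ "\<zero>\<^bsub>D\<^esub>"]) simp
    qed
  qed
  then obtain l where l: "conv D (\<lambda>n. h (c \<otimes>\<^bsub>C\<^esub> u n) \<otimes>\<^bsub>D\<^esub> y) l" by blast
  have "act c y = l" unfolding act_def using y
    by (simp, intro the_equality[where P = "conv D (\<lambda>n. h (c \<otimes>\<^bsub>C\<^esub> u n) \<otimes>\<^bsub>D\<^esub> y)"] l D.conv_unique[OF _ l])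
  then show ?thesis using l by simp
qed

lemma act_eqI: "c \<in> carrier C \<Longrightarrow> y \<in> K \<Longrightarrow> conv D (\<lambda>n. h (c \<otimes>\<^bsub>C\<^esub> u n) \<otimes>\<^bsub>D\<^esub> y) l \<Longrightarrow> act c y = l"
  by (rule D.conv_unique[OF act_limit])

lemma generator_K: "x \<in> I.J \<Longrightarrow> y \<in> carrier D \<Longrightarrow> h x \<otimes>\<^bsub>D\<^esub> y \<in> K"
  by (rule closed_span.base) (auto simp: generators_def)

lemma Z_K: "z \<in> Z \<Longrightarrow> z \<in> K"
  by (rule closed_span.base) (simp add: generators_def)

lemma act_gen: "c \<in> carrier C \<Longrightarrow> x \<in> I.J \<Longrightarrow> y \<in> carrier D \<Longrightarrow> act c (h x \<otimes>\<^bsub>D\<^esub> y) = h (c \<otimes>\<^bsub>C\<^esub> x) \<otimes>\<^bsub>D\<^esub> y"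
  by (rule act_eqI[OF _ generator_K cux_conv])

lemma act_Z: "c \<in> carrier C \<Longrightarrow> z \<in> Z \<Longrightarrow> act c z = \<zero>\<^bsub>D\<^esub>"
  by (rule act_eqI[OF _ Z_K]) (simp_all add: h_Z[OF cu_ideal])

lemma act_carrier [simp]: "c \<in> carrier C \<Longrightarrow> y \<in> K \<Longrightarrow> act c y \<in> carrier D"
  by (rule D.convD(2)[OF act_limit])

lemma cu_carrier [simp]: "c \<in> carrier C \<Longrightarrow> h (c \<otimes>\<^bsub>C\<^esub> u n) \<in> carrier D"
  by (rule h_closed[OF cu_ideal])

lemma act_add: "c \<in> carrier C \<Longrightarrow> x \<in> K \<Longrightarrow> y \<in> K \<Longrightarrow> act c (x \<oplus>\<^bsub>D\<^esub> y) = act c x \<oplus>\<^bsub>D\<^esub> act c y"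
proof (rule act_eqI[OF _ K.K_add])
  assume *: "c \<in> carrier C" "x \<in> K" "y \<in> K"
  show "conv D (\<lambda>n. h (c \<otimes>\<^bsub>C\<^esub> u n) \<otimes>\<^bsub>D\<^esub> (x \<oplus>\<^bsub>D\<^esub> y)) (act c x \<oplus>\<^bsub>D\<^esub> act c y)"
    using D.conv_add[OF act_limit[OF *(1,2)] act_limit[OF *(1,3)]] * by (simp add: D.mult_distrib_left K.K_carrier)
qed

lemma act_scale: "c \<in> carrier C \<Longrightarrow> x \<in> K \<Longrightarrow> act c (k \<odot>\<^bsub>D\<^esub> x) = k \<odot>\<^bsub>D\<^esub> act c x"
proof (rule act_eqI[OF _ K.K_sc])
  assume *: "c \<in> carrier C" "x \<in> K"
  show "conv D (\<lambda>n. h (c \<otimes>\<^bsub>C\<^esub> u n) \<otimes>\<^bsub>D\<^esub> (k \<odot>\<^bsub>D\<^esub> x)) (k \<odot>\<^bsub>D\<^esub> act c x)"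
    using D.conv_sc[OF act_limit[OF *], of k] * by (simp add: D.smult_mult_right K.K_carrier)
qed

lemma act_bound: "c \<in> carrier C \<Longrightarrow> y \<in> K \<Longrightarrow> \<parallel>act c y\<parallel>\<^bsub>D\<^esub> \<le> \<parallel>c\<parallel>\<^bsub>C\<^esub> * \<parallel>y\<parallel>\<^bsub>D\<^esub>"
proof (rule D.conv_norm_le[OF act_limit])
  fix n assume *: "c \<in> carrier C" "y \<in> K"
  note y = K.K_carrier[OF *(2)]
  have "\<parallel>h (c \<otimes>\<^bsub>C\<^esub> u n)\<parallel>\<^bsub>D\<^esub> * \<parallel>y\<parallel>\<^bsub>D\<^esub> \<le> \<parallel>c\<parallel>\<^bsub>C\<^esub> * \<parallel>y\<parallel>\<^bsub>D\<^esub>"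
    by (rule mult_right_mono[OF cu_bound[OF *(1)] D.norm_nonneg[OF y]])
  then show "\<parallel>h (c \<otimes>\<^bsub>C\<^esub> u n) \<otimes>\<^bsub>D\<^esub> y\<parallel>\<^bsub>D\<^esub> \<le> \<parallel>c\<parallel>\<^bsub>C\<^esub> * \<parallel>y\<parallel>\<^bsub>D\<^esub>"
    using D.cnorm_mult[of "h (c \<otimes>\<^bsub>C\<^esub> u n)" y] * y by simp
qed

lemma act_conv:
  assumes c: "c \<in> carrier C" and s: "\<And>n. s n \<in> K" and lim: "conv D s y"
  shows "conv D (\<lambda>n. act c (s n)) (act c y)"
proof -
  have y: "y \<in> K" by (rule K.K_lim[OF s lim])
  have "(\<lambda>n. \<parallel>c\<parallel>\<^bsub>C\<^esub> * \<parallel>s n \<ominus>\<^bsub>D\<^esub> y\<parallel>\<^bsub>D\<^esub>) \<longlonglongrightarrow> 0"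
    using tendsto_mult_left[OF D.convD(3)[OF lim], of "\<parallel>c\<parallel>\<^bsub>C\<^esub>"] by simp
  moreover have "act c (s n) \<ominus>\<^bsub>D\<^esub> act c y = act c (s n \<ominus>\<^bsub>D\<^esub> y)" for n
    using act_add[OF c s K.K_sc[OF y], of n "-1"] act_scale[OF c y, of "-1"] c s y
    by (simp add: D.diff_sc K.K_carrier)
  then have "\<parallel>act c (s n) \<ominus>\<^bsub>D\<^esub> act c y\<parallel>\<^bsub>D\<^esub> \<le> \<parallel>c\<parallel>\<^bsub>C\<^esub> * \<parallel>s n \<ominus>\<^bsub>D\<^esub> y\<parallel>\<^bsub>D\<^esub>" for n
    using act_bound[OF c K.K_diff[OF s y]] by simp
  ultimately show ?thesis using c s y by (intro D.conv_bound) simp_all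
qed

lemma act_closed: "c \<in> carrier C \<Longrightarrow> y \<in> K \<Longrightarrow> act c y \<in> K"
proof (rule K.K_lim[OF _ act_limit])
  show "h (c \<otimes>\<^bsub>C\<^esub> u n) \<otimes>\<^bsub>D\<^esub> y \<in> K" if "c \<in> carrier C" "y \<in> K" for n
    by (rule generator_K[OF cu_ideal[OF that(1)] K.K_carrier[OF that(2)]])
qed

text \<open>The form in which identities between continuous linear maps on \<open>K\<close> are checked on the two kinds of
  generators.\<close>

lemma K_induct [consumes 1, case_names gen null add scale lim]:
  assumes "y \<in> K"
    and "\<And>x y. x \<in> I.J \<Longrightarrow> y \<in> carrier D \<Longrightarrow> Q (h x \<otimes>\<^bsub>D\<^esub> y)"
    and "\<And>z. z \<in> Z \<Longrightarrow> Q z"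
    and "\<And>x y. x \<in> K \<Longrightarrow> y \<in> K \<Longrightarrow> Q x \<Longrightarrow> Q y \<Longrightarrow> Q (x \<oplus>\<^bsub>D\<^esub> y)"
    and "\<And>c x. x \<in> K \<Longrightarrow> Q x \<Longrightarrow> Q (c \<odot>\<^bsub>D\<^esub> x)"
    and "\<And>s x. (\<And>n. s n \<in> K) \<Longrightarrow> (\<And>n. Q (s n)) \<Longrightarrow> conv D s x \<Longrightarrow> x \<in> K \<Longrightarrow> Q x"
  shows "Q y"
  using assms(1)
proof (induction rule: closed_span.induct)
  case (base x)
  then show ?case using assms(2,3) unfolding generators_def by blast
next
  case zero
  \<comment> \<open>Zero is itself a generator of the first kind.\<close>
  have u0: "u 0 \<in> I.J" by (rule I.u_ideal)
  have "h (u 0) \<otimes>\<^bsub>D\<^esub> \<zero>\<^bsub>D\<^esub> = \<zero>\<^bsub>D\<^esub>" using u0 by simp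
  then show ?case using assms(2)[OF u0 D.M.zero_closed] by simp
next
  case (lim s x)
  show ?case by (rule assms(6)[OF lim.hyps(1) lim.IH lim.hyps(2) K.K_lim[OF lim.hyps]])
qed (rule assms(4,5); assumption)+

lemma act_mult:
  assumes c: "c \<in> carrier C" and d: "d \<in> carrier C" and y: "y \<in> K"
  shows "act (c \<otimes>\<^bsub>C\<^esub> d) y = act c (act d y)"
  using y
proof (induction rule: K_induct)
  case (gen x y)
  then show ?case using c d by (simp add: act_gen closed_ideal.left I.mult_assoc I.I_carrier)
next
  case (null z)
  then show ?case using c d act_scale[OF c K.K_zero, of 0] by (simp add: act_Z)
next
  case (lim s x)
  have "conv D (\<lambda>n. act (c \<otimes>\<^bsub>C\<^esub> d) (s n)) (act (c \<otimes>\<^bsub>C\<^esub> d) x)"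
    by (rule act_conv[OF I.mult_closed[OF c d] lim.hyps(1,2)])
  moreover have "conv D (\<lambda>n. act c (act d (s n))) (act c (act d x))"
    by (rule act_conv[OF c act_closed[OF d lim.hyps(1)] act_conv[OF d lim.hyps(1,2)]])
  ultimately show ?case using D.conv_unique unfolding lim.IH by blast
qed (use c d in \<open>simp_all add: act_add act_scale act_closed\<close>)

text \<open>The left-hand side is the limit of \<open>x\<^sup>\<star> h (u\<^sub>n c\<^sup>\<star>) y\<close>,
  the right-hand side that of \<open>x\<^sup>\<star> h (c\<^sup>\<star> u\<^sub>n) y\<close>. On the
  generators \<open>y = h z y'\<close> both are \<open>x\<^sup>\<star> h (c\<^sup>\<star> z)
  y'\<close>.\<close>

lemma act_adj:
  assumes c: "c \<in> carrier C" and x: "x \<in> K" and y: "y \<in> K"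
  shows "(act c x)\<^sup>\<star>\<^bsub>D\<^esub> \<otimes>\<^bsub>D\<^esub> y = x\<^sup>\<star>\<^bsub>D\<^esub> \<otimes>\<^bsub>D\<^esub> act (c\<^sup>\<star>\<^bsub>C\<^esub>) y"
proof -
  note xc = K.K_carrier[OF x] and ac = act_carrier[OF c x] and c' = I.adj_closed[OF c]
  have lim: "conv D (\<lambda>n. x\<^sup>\<star>\<^bsub>D\<^esub> \<otimes>\<^bsub>D\<^esub> (h (u n \<otimes>\<^bsub>C\<^esub> c\<^sup>\<star>\<^bsub>C\<^esub>) \<otimes>\<^bsub>D\<^esub> y)) ((act c x)\<^sup>\<star>\<^bsub>D\<^esub> \<otimes>\<^bsub>D\<^esub> y)" if "y \<in> carrier D" for y
  proof -
    have "(h (c \<otimes>\<^bsub>C\<^esub> u n) \<otimes>\<^bsub>D\<^esub> x)\<^sup>\<star>\<^bsub>D\<^esub> \<otimes>\<^bsub>D\<^esub> y = x\<^sup>\<star>\<^bsub>D\<^esub> \<otimes>\<^bsub>D\<^esub> (h (u n \<otimes>\<^bsub>C\<^esub> c\<^sup>\<star>\<^bsub>C\<^esub>) \<otimes>\<^bsub>D\<^esub> y)" for n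
      using h_adj[OF cu_ideal[OF c, of n]] c xc that D.adj_closed[OF cu_carrier[OF c, of n]]
      by (simp add: D.adj_mult I.adj_mult I.u_adj D.mult_assoc)
    then show ?thesis using D.conv_mult[OF D.conv_adj[OF act_limit[OF c x]] D.conv_const[OF that]] by simp
  qed
  have uc: "u n \<otimes>\<^bsub>C\<^esub> c\<^sup>\<star>\<^bsub>C\<^esub> \<in> I.J" for n by (rule closed_ideal.right[OF c' I.u_ideal])
  show ?thesis using y
  proof (induction rule: K_induct)
    case (gen z y)
    note cz = closed_ideal.left[OF c' gen(1)]
    have "conv C (\<lambda>n. u n \<otimes>\<^bsub>C\<^esub> (c\<^sup>\<star>\<^bsub>C\<^esub> \<otimes>\<^bsub>C\<^esub> z)) (c\<^sup>\<star>\<^bsub>C\<^esub> \<otimes>\<^bsub>C\<^esub> z)" by (rule I.unit_forD(2)[OF I.u_unit[OF cz]])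
    from h_conv[OF closed_ideal.left[OF I.u_closed cz] cz this]
    have "conv D (\<lambda>n. x\<^sup>\<star>\<^bsub>D\<^esub> \<otimes>\<^bsub>D\<^esub> (h (u n \<otimes>\<^bsub>C\<^esub> (c\<^sup>\<star>\<^bsub>C\<^esub> \<otimes>\<^bsub>C\<^esub> z)) \<otimes>\<^bsub>D\<^esub> y)) (x\<^sup>\<star>\<^bsub>D\<^esub> \<otimes>\<^bsub>D\<^esub> (h (c\<^sup>\<star>\<^bsub>C\<^esub> \<otimes>\<^bsub>C\<^esub> z) \<otimes>\<^bsub>D\<^esub> y))"
      using xc gen(2) by (intro D.conv_mult D.conv_const) simp_all
    moreover have "h (u n \<otimes>\<^bsub>C\<^esub> (c\<^sup>\<star>\<^bsub>C\<^esub> \<otimes>\<^bsub>C\<^esub> z)) = h (u n \<otimes>\<^bsub>C\<^esub> c\<^sup>\<star>\<^bsub>C\<^esub>) \<otimes>\<^bsub>D\<^esub> h z" for n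
      using h_mult[OF uc[of n] gen(1)] I.mult_assoc[OF I.u_closed[of n] c' I.I_carrier[OF gen(1)]] by simp
    then have "h (u n \<otimes>\<^bsub>C\<^esub> (c\<^sup>\<star>\<^bsub>C\<^esub> \<otimes>\<^bsub>C\<^esub> z)) \<otimes>\<^bsub>D\<^esub> y = h (u n \<otimes>\<^bsub>C\<^esub> c\<^sup>\<star>\<^bsub>C\<^esub>) \<otimes>\<^bsub>D\<^esub> (h z \<otimes>\<^bsub>D\<^esub> y)" for n
      using uc[of n] gen by (simp add: D.mult_assoc)
    ultimately have "conv D (\<lambda>n. x\<^sup>\<star>\<^bsub>D\<^esub> \<otimes>\<^bsub>D\<^esub> (h (u n \<otimes>\<^bsub>C\<^esub> c\<^sup>\<star>\<^bsub>C\<^esub>) \<otimes>\<^bsub>D\<^esub> (h z \<otimes>\<^bsub>D\<^esub> y))) (x\<^sup>\<star>\<^bsub>D\<^esub> \<otimes>\<^bsub>D\<^esub> (h (c\<^sup>\<star>\<^bsub>C\<^esub> \<otimes>\<^bsub>C\<^esub> z) \<otimes>\<^bsub>D\<^esub> y))"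
      by simp
    from D.conv_unique[OF lim this] show ?case using gen c' by (simp add: act_gen)
  next
    case (null z)
    have zc: "z \<in> carrier D" using Z_carrier null by blast
    have "h (u n \<otimes>\<^bsub>C\<^esub> c\<^sup>\<star>\<^bsub>C\<^esub>) \<otimes>\<^bsub>D\<^esub> z = \<zero>\<^bsub>D\<^esub>" for n by (rule h_Z[OF uc null])
    then have "conv D (\<lambda>n. x\<^sup>\<star>\<^bsub>D\<^esub> \<otimes>\<^bsub>D\<^esub> (h (u n \<otimes>\<^bsub>C\<^esub> c\<^sup>\<star>\<^bsub>C\<^esub>) \<otimes>\<^bsub>D\<^esub> z)) \<zero>\<^bsub>D\<^esub>" using xc by simp
    from D.conv_unique[OF lim[OF zc] this] show ?case using null c' xc by (simp add: act_Z)
  next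
    case (lim s y)
    have 1: "conv D (\<lambda>n. (act c x)\<^sup>\<star>\<^bsub>D\<^esub> \<otimes>\<^bsub>D\<^esub> s n) ((act c x)\<^sup>\<star>\<^bsub>D\<^esub> \<otimes>\<^bsub>D\<^esub> y)"
      by (rule D.conv_mult[OF D.conv_const[OF D.adj_closed[OF ac]] lim.hyps(2)])
    have 2: "conv D (\<lambda>n. x\<^sup>\<star>\<^bsub>D\<^esub> \<otimes>\<^bsub>D\<^esub> act (c\<^sup>\<star>\<^bsub>C\<^esub>) (s n)) (x\<^sup>\<star>\<^bsub>D\<^esub> \<otimes>\<^bsub>D\<^esub> act (c\<^sup>\<star>\<^bsub>C\<^esub>) y)"
      by (rule D.conv_mult[OF D.conv_const[OF D.adj_closed[OF xc]] act_conv[OF c' lim.hyps(1,2)]])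
    show ?case by (rule D.conv_unique[OF 1[unfolded lim.IH] 2])
  qed (use c' xc ac in \<open>simp_all add: act_add act_scale D.mult_distrib_left D.smult_mult_right K.K_carrier\<close>)
qed

lemma act_extensional: "c \<in> carrier C \<Longrightarrow> act c \<in> K \<rightarrow>\<^sub>E K"
  using act_closed by (simp add: PiE_def Pi_def extensional_def act_def)

lemma act_AP: "c \<in> carrier C \<Longrightarrow> K.AP (act c) (act (c\<^sup>\<star>\<^bsub>C\<^esub>))"
  unfolding adjoint_pair_def
proof (intro conjI ballI)
  assume c: "c \<in> carrier C"
  show "act c \<in> K \<rightarrow>\<^sub>E K" "act (c\<^sup>\<star>\<^bsub>C\<^esub>) \<in> K \<rightarrow>\<^sub>E K"
    by (rule act_extensional[OF c] act_extensional[OF I.adj_closed[OF c]])+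
qed (rule act_adj)

lemma act_L: "c \<in> carrier C \<Longrightarrow> act c \<in> carrier K.L"
  by (rule K.L_intro[OF act_AP, of _ "\<parallel>c\<parallel>\<^bsub>C\<^esub>"]) (simp_all add: op_bounds_def act_bound)

lemma act_add_left: "c \<in> carrier C \<Longrightarrow> d \<in> carrier C \<Longrightarrow> y \<in> K \<Longrightarrow> act (c \<oplus>\<^bsub>C\<^esub> d) y = act c y \<oplus>\<^bsub>D\<^esub> act d y"
proof (rule act_eqI)
  assume *: "c \<in> carrier C" "d \<in> carrier C" "y \<in> K"
  have "h ((c \<oplus>\<^bsub>C\<^esub> d) \<otimes>\<^bsub>C\<^esub> u n) = h (c \<otimes>\<^bsub>C\<^esub> u n) \<oplus>\<^bsub>D\<^esub> h (d \<otimes>\<^bsub>C\<^esub> u n)" for n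
    using * by (simp add: I.mult_distrib_right h_add cu_ideal)
  then show "conv D (\<lambda>n. h ((c \<oplus>\<^bsub>C\<^esub> d) \<otimes>\<^bsub>C\<^esub> u n) \<otimes>\<^bsub>D\<^esub> y) (act c y \<oplus>\<^bsub>D\<^esub> act d y)"
    using D.conv_add[OF act_limit[OF *(1,3)] act_limit[OF *(2,3)]] * by (simp add: D.mult_distrib_right K.K_carrier)
qed simp_all

lemma act_scale_left: "c \<in> carrier C \<Longrightarrow> y \<in> K \<Longrightarrow> act (k \<odot>\<^bsub>C\<^esub> c) y = k \<odot>\<^bsub>D\<^esub> act c y"
proof (rule act_eqI)
  assume *: "c \<in> carrier C" "y \<in> K"
  have "h ((k \<odot>\<^bsub>C\<^esub> c) \<otimes>\<^bsub>C\<^esub> u n) = k \<odot>\<^bsub>D\<^esub> h (c \<otimes>\<^bsub>C\<^esub> u n)" for n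
    using * by (simp add: I.smult_mult_left h_scale cu_ideal)
  then show "conv D (\<lambda>n. h ((k \<odot>\<^bsub>C\<^esub> c) \<otimes>\<^bsub>C\<^esub> u n) \<otimes>\<^bsub>D\<^esub> y) (k \<odot>\<^bsub>D\<^esub> act c y)"
    using D.conv_sc[OF act_limit[OF *], of k] * by (simp add: D.smult_mult_left K.K_carrier)
qed simp_all

lemma act_hom: "star_hom C K.L (\<lambda>c\<in>carrier C. act c)"
proof (rule star_homI[OF I.cstar_algebra_axioms K.cstar_algebra_L])
  fix c assume c: "c \<in> carrier C"
  show "(\<lambda>c\<in>carrier C. act c) c \<in> carrier K.L" using act_L[OF c] c by simp
  show "(\<lambda>c\<in>carrier C. act c) (c\<^sup>\<star>\<^bsub>C\<^esub>) = ((\<lambda>c\<in>carrier C. act c) c)\<^sup>\<star>\<^bsub>K.L\<^esub>"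
    using c K.L_adj_eqI[OF act_L[OF c] act_AP[OF c]] by simp
  show "(\<lambda>c\<in>carrier C. act c) (k \<odot>\<^bsub>C\<^esub> c) = k \<odot>\<^bsub>K.L\<^esub> (\<lambda>c\<in>carrier C. act c) c" for k
    using c by (intro K.L_eqI) (simp_all add: act_L K.L_closures act_scale_left)
  fix d assume d: "d \<in> carrier C"
  show "(\<lambda>c\<in>carrier C. act c) (c \<oplus>\<^bsub>C\<^esub> d) = (\<lambda>c\<in>carrier C. act c) c \<oplus>\<^bsub>K.L\<^esub> (\<lambda>c\<in>carrier C. act c) d"
    using c d by (intro K.L_eqI) (simp_all add: act_L K.L_closures act_add_left)
  show "(\<lambda>c\<in>carrier C. act c) (c \<otimes>\<^bsub>C\<^esub> d) = (\<lambda>c\<in>carrier C. act c) c \<otimes>\<^bsub>K.L\<^esub> (\<lambda>c\<in>carrier C. act c) d"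
    using c d by (intro K.L_eqI) (simp_all add: act_L K.L_closures act_mult)
qed simp

end

section \<open>Comparing two glued algebras\<close>

text \<open>The map \<open>g\<close> is the inverse of \<open>\<phi>\<close> on the ideal generated by the
  sinks \<open>\<iota>\<^sub>2 X\<close>.\<close>

locale glued_pair =
  p1: glued_algebra E\<^sub>1 H X \<iota>\<^sub>1 \<kappa> jE\<^sub>1 jH\<^sub>1 + p2: glued_algebra E\<^sub>2 H X \<iota>\<^sub>2 \<kappa> jE\<^sub>2 jH\<^sub>2 +
  phi: star_hom "graph_cstar E\<^sub>1" "graph_cstar E\<^sub>2" \<phi> +
  psi: star_hom "graph_cstar (pushout_graph E\<^sub>1 H X \<iota>\<^sub>1 \<kappa>)" "graph_cstar (pushout_graph E\<^sub>2 H X \<iota>\<^sub>2 \<kappa>)" \<psi>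
  for E\<^sub>1 :: "('v1, 'e1) pre_digraph" and E\<^sub>2 :: "('v2, 'e2) pre_digraph" and H :: "('w, 'f) pre_digraph"
    and X :: "'x set" and \<iota>\<^sub>1 \<iota>\<^sub>2 \<kappa> jE\<^sub>1 jH\<^sub>1 jE\<^sub>2 jH\<^sub>2 \<phi> \<psi> +
  fixes g
  assumes phi_inj: "inj_on \<phi> (carrier (graph_cstar E\<^sub>1))"
    and phi_X: "x \<in> X \<Longrightarrow> \<phi> (vproj E\<^sub>1 (\<iota>\<^sub>1 x)) = vproj E\<^sub>2 (\<iota>\<^sub>2 x)"
    and psi_E: "c \<in> carrier (graph_cstar E\<^sub>1) \<Longrightarrow> \<psi> (jE\<^sub>1 c) = jE\<^sub>2 (\<phi> c)"
    and psi_H: "b \<in> carrier (graph_cstar H) \<Longrightarrow> \<psi> (jH\<^sub>1 b) = jH\<^sub>2 b"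
    and g_ideal: "y \<in> p2.EI.I \<Longrightarrow> g y \<in> p1.EI.I"
    and phi_g: "y \<in> p2.EI.I \<Longrightarrow> \<phi> (g y) = y"
    and g_contractive: "y \<in> p2.EI.I \<Longrightarrow> \<parallel>g y\<parallel>\<^bsub>graph_cstar E\<^sub>1\<^esub> \<le> \<parallel>y\<parallel>\<^bsub>graph_cstar E\<^sub>2\<^esub>"
begin

abbreviation "C1 \<equiv> graph_cstar E\<^sub>1"
abbreviation "C2 \<equiv> graph_cstar E\<^sub>2"
abbreviation "D1 \<equiv> graph_cstar (pushout_graph E\<^sub>1 H X \<iota>\<^sub>1 \<kappa>)"
abbreviation "D2 \<equiv> graph_cstar (pushout_graph E\<^sub>2 H X \<iota>\<^sub>2 \<kappa>)"
abbreviation "h y \<equiv> jE\<^sub>1 (g y)"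

text \<open>The right multiples of the projections of the vertices of \<open>H\<close> that are not glued; the
  algebra of \<open>E\<^sub>2\<close> has to act on them by zero.\<close>

definition unglued :: "_ set" where
  "unglued = {jH\<^sub>1 (vproj H w) \<otimes>\<^bsub>D1\<^esub> y | w y. w \<in> verts H - \<kappa> ` X \<and> y \<in> carrier D1}"

lemma g_closed [simp]: "y \<in> p2.EI.I \<Longrightarrow> g y \<in> carrier C1"
  by (rule p1.EI.I_carrier[OF g_ideal])

lemma g_eqI: "y \<in> p2.EI.I \<Longrightarrow> p \<in> carrier C1 \<Longrightarrow> \<phi> p = y \<Longrightarrow> g y = p"
  by (rule inj_onD[OF phi_inj]) (simp_all add: phi_g)

lemma g_phi_left: "p \<in> carrier C1 \<Longrightarrow> x \<in> p2.EI.I \<Longrightarrow> g (\<phi> p \<otimes>\<^bsub>C2\<^esub> x) = p \<otimes>\<^bsub>C1\<^esub> g x"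
  by (rule g_eqI) (simp_all add: closed_ideal.left phi.mult phi_g)

sublocale act: ideal_action C2 p2.EI.unit_seq "vproj E\<^sub>2 ` (\<iota>\<^sub>2 ` X)" D1 h unglued
proof (unfold_locales, goal_cases)
  case (2 x y)
  then have "g (x \<oplus>\<^bsub>C2\<^esub> y) = g x \<oplus>\<^bsub>C1\<^esub> g y" by (intro g_eqI) (simp_all add: closed_ideal.add phi.add phi_g)
  then show ?case using 2 by (simp add: p1.jE.add)
next
  case (3 x c)
  then have "g (c \<odot>\<^bsub>C2\<^esub> x) = c \<odot>\<^bsub>C1\<^esub> g x" by (intro g_eqI) (simp_all add: closed_ideal.scale phi.scale phi_g)
  then show ?case using 3 by (simp add: p1.jE.scale)
next
  case (4 x y)
  then have "g (x \<otimes>\<^bsub>C2\<^esub> y) = g x \<otimes>\<^bsub>C1\<^esub> g y"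
    by (intro g_eqI) (simp_all add: closed_ideal.left p2.EI.I_carrier phi.mult phi_g)
  then show ?case using 4 by (simp add: p1.jE.mult)
next
  case (5 x)
  then have "g (x\<^sup>\<star>\<^bsub>C2\<^esub>) = (g x)\<^sup>\<star>\<^bsub>C1\<^esub>" by (intro g_eqI) (simp_all add: p2.EI.I_adj phi.adj phi_g)
  then show ?case using 5 by (simp add: p1.jE.adj)
next
  case (6 x)
  then show ?case using p1.jE.contractive[of "g x"] g_contractive[OF 6] by simp
next
  case 7
  then show ?case by (auto simp: unglued_def)
next
  case (8 x z)
  then obtain w y where z: "z = jH\<^sub>1 (vproj H w) \<otimes>\<^bsub>D1\<^esub> y" "w \<in> verts H" "w \<notin> \<kappa> ` X" "y \<in> carrier D1"
    unfolding unglued_def by blast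
  have "h x \<otimes>\<^bsub>D1\<^esub> (jH\<^sub>1 (vproj H w) \<otimes>\<^bsub>D1\<^esub> y) = (h x \<otimes>\<^bsub>D1\<^esub> jH\<^sub>1 (vproj H w)) \<otimes>\<^bsub>D1\<^esub> y"
    using 8 z by (simp add: p1.jE.B.mult_assoc)
  then show ?case using p1.jE_mult_unglued[OF g_closed[OF 8(1)] z(2,3)] z by simp
qed simp

abbreviation "K \<equiv> act.K"

lemma jE_mult_h: "p \<in> carrier C1 \<Longrightarrow> x \<in> p2.EI.I \<Longrightarrow> jE\<^sub>1 p \<otimes>\<^bsub>D1\<^esub> h x = h (\<phi> p \<otimes>\<^bsub>C2\<^esub> x)"
  by (simp add: g_phi_left p1.jE.mult)

lemma jE_mult_h': "p \<in> carrier C1 \<Longrightarrow> x \<in> p2.EI.I \<Longrightarrow> y \<in> carrier D1 \<Longrightarrow>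
    jE\<^sub>1 p \<otimes>\<^bsub>D1\<^esub> (h x \<otimes>\<^bsub>D1\<^esub> y) = h (\<phi> p \<otimes>\<^bsub>C2\<^esub> x) \<otimes>\<^bsub>D1\<^esub> y"
  using p1.jE.B.mult_assoc[of "jE\<^sub>1 p" "h x" y] by (simp add: jE_mult_h)

lemma jE_mult_unglued: "p \<in> carrier C1 \<Longrightarrow> z \<in> unglued \<Longrightarrow> jE\<^sub>1 p \<otimes>\<^bsub>D1\<^esub> z = \<zero>\<^bsub>D1\<^esub>"
proof -
  assume p: "p \<in> carrier C1" and "z \<in> unglued"
  then obtain w y where z: "z = jH\<^sub>1 (vproj H w) \<otimes>\<^bsub>D1\<^esub> y" "w \<in> verts H" "w \<notin> \<kappa> ` X" "y \<in> carrier D1"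
    unfolding unglued_def by blast
  then have "jE\<^sub>1 p \<otimes>\<^bsub>D1\<^esub> z = (jE\<^sub>1 p \<otimes>\<^bsub>D1\<^esub> jH\<^sub>1 (vproj H w)) \<otimes>\<^bsub>D1\<^esub> y"
    using p by (simp add: p1.jE.B.mult_assoc)
  then show ?thesis using p1.jE_mult_unglued[OF p z(2,3)] z by simp
qed

lemma vertex_I: "x \<in> X \<Longrightarrow> vproj E\<^sub>2 (\<iota>\<^sub>2 x) \<in> p2.EI.I"
  by (rule closed_ideal.base) simp

lemma h_vertex: "x \<in> X \<Longrightarrow> h (vproj E\<^sub>2 (\<iota>\<^sub>2 x)) = jH\<^sub>1 (vproj H (\<kappa> x))"
  by (simp add: g_eqI[OF vertex_I _ phi_X] p1.i_verts p1.jE_jH_glued)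

text \<open>A glued vertex contributes through \<open>h\<close>, any other vertex of \<open>H\<close> through
  \<open>unglued\<close>.\<close>

lemma vertex_mult_K: "w \<in> verts H \<Longrightarrow> y \<in> carrier D1 \<Longrightarrow> jH\<^sub>1 (vproj H w) \<otimes>\<^bsub>D1\<^esub> y \<in> K"
proof (cases "w \<in> \<kappa> ` X")
  case True
  assume y: "y \<in> carrier D1"
  from True obtain x where x: "x \<in> X" "w = \<kappa> x" by blast
  show ?thesis using act.generator_K[OF vertex_I[OF x(1)] y] by (simp add: h_vertex x)
next
  case False
  assume "w \<in> verts H" "y \<in> carrier D1"
  then show ?thesis using False by (intro act.Z_K) (auto simp: unglued_def)
qed

lemma jE_mult_K: "p \<in> carrier C1 \<Longrightarrow> y \<in> K \<Longrightarrow> jE\<^sub>1 p \<otimes>\<^bsub>D1\<^esub> y = act.act (\<phi> p) y"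
proof -
  assume p: "p \<in> carrier C1" and y: "y \<in> K"
  show ?thesis using y
  proof (induction rule: act.K_induct)
    case (lim s y)
    have "conv D1 (\<lambda>n. jE\<^sub>1 p \<otimes>\<^bsub>D1\<^esub> s n) (jE\<^sub>1 p \<otimes>\<^bsub>D1\<^esub> y)"
      by (rule p1.jE.B.conv_mult[OF p1.jE.B.conv_const lim.hyps(2)]) (simp add: p)
    then have "conv D1 (\<lambda>n. act.act (\<phi> p) (s n)) (jE\<^sub>1 p \<otimes>\<^bsub>D1\<^esub> y)" unfolding lim.IH .
    from p1.jE.B.conv_unique[OF this act.act_conv[OF _ lim.hyps(1,2)]] show ?case using p by simp
  qed (simp_all add: p act.act_gen act.act_Z act.act_add act.act_scale jE_mult_h' jE_mult_unglued
        p1.jE.B.mult_distrib_left p1.jE.B.smult_mult_right act.K.K_carrier)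
qed

lemma K_right: "y \<in> K \<Longrightarrow> a \<in> carrier D1 \<Longrightarrow> y \<otimes>\<^bsub>D1\<^esub> a \<in> K"
proof (induction rule: act.K_induct)
  case (gen x y)
  then show ?case using act.generator_K[of x "y \<otimes>\<^bsub>D1\<^esub> a"] by (simp add: p1.jE.B.mult_assoc)
next
  case (null z)
  then obtain w y where z: "z = jH\<^sub>1 (vproj H w) \<otimes>\<^bsub>D1\<^esub> y" "w \<in> verts H" "y \<in> carrier D1"
    unfolding unglued_def by blast
  then show ?case using null vertex_mult_K[of w "y \<otimes>\<^bsub>D1\<^esub> a"] by (simp add: p1.jE.B.mult_assoc)
next
  case (lim s y)
  show ?case
    by (rule act.K.K_lim[OF lim.IH[OF lim.prems] p1.jE.B.conv_mult[OF lim.hyps(2) p1.jE.B.conv_const[OF lim.prems]]])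
qed (simp_all add: p1.jE.B.mult_distrib_right p1.jE.B.smult_mult_left act.K.K_carrier act.K.K_add act.K.K_sc)

text \<open>Products with generators from \<open>H\<close> start with a vertex projection of \<open>H\<close>,
  which already places them in \<open>K\<close>; generators from \<open>E\<^sub>1\<close> act as their images
  under \<open>\<phi>\<close>.\<close>

lemma K_left:
  assumes "a \<in> carrier D1" shows "\<forall>y\<in>K. a \<otimes>\<^bsub>D1\<^esub> y \<in> K \<and> a\<^sup>\<star>\<^bsub>D1\<^esub> \<otimes>\<^bsub>D1\<^esub> y \<in> K"
proof -
  have "a \<in> star_closure D1 (jE\<^sub>1 ` graph_gens E\<^sub>1 \<union> jH\<^sub>1 ` graph_gens H)" using assms p1.glued_generated by simp
  then have "a \<in> carrier D1 \<and> (\<forall>y\<in>K. a \<otimes>\<^bsub>D1\<^esub> y \<in> K \<and> a\<^sup>\<star>\<^bsub>D1\<^esub> \<otimes>\<^bsub>D1\<^esub> y \<in> K)"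
  proof (induction rule: star_closure.induct)
    case (base a)
    have gE: "graph_gens E\<^sub>1 \<subseteq> carrier C1" by (auto simp: graph_gens_def)
    have gH: "graph_gens H = vproj H ` verts H \<union> eiso H ` arcs H" by (simp add: graph_gens_def)
    have "a \<in> jE\<^sub>1 ` graph_gens E\<^sub>1 \<or> a \<in> (\<lambda>v. jH\<^sub>1 (vproj H v)) ` verts H \<or> a \<in> (\<lambda>f. jH\<^sub>1 (eiso H f)) ` arcs H"
      using base by (simp only: gH image_Un Un_iff image_image)
    then show ?case
    proof (elim disjE imageE)
      fix c assume c: "c \<in> graph_gens E\<^sub>1" "a = jE\<^sub>1 c"
      show ?thesis unfolding c(2) using subsetD[OF gE c(1)] by (simp add: jE_mult_K act.act_closed flip: p1.jE.adj)
    next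
      fix v assume "v \<in> verts H" "a = jH\<^sub>1 (vproj H v)"
      then show ?thesis by (simp add: vertex_mult_K act.K.K_carrier p1.FH.P_adj flip: p1.jH.adj)
    next
      fix f assume 3: "f \<in> arcs H" "a = jH\<^sub>1 (eiso H f)"
      have "jH\<^sub>1 (eiso H f) \<otimes>\<^bsub>D1\<^esub> y \<in> K" "jH\<^sub>1 ((eiso H f)\<^sup>\<star>\<^bsub>graph_cstar H\<^esub>) \<otimes>\<^bsub>D1\<^esub> y \<in> K" if y: "y \<in> K" for y
      proof -
        note [simp] = act.K.K_carrier[OF y] 3(1)
        have "jH\<^sub>1 (eiso H f) = jH\<^sub>1 (vproj H (tail H f)) \<otimes>\<^bsub>D1\<^esub> jH\<^sub>1 (eiso H f)"
          by (simp add: p1.FH.P_tail_S flip: p1.jH.mult)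
        then have "jH\<^sub>1 (eiso H f) \<otimes>\<^bsub>D1\<^esub> y = jH\<^sub>1 (vproj H (tail H f)) \<otimes>\<^bsub>D1\<^esub> (jH\<^sub>1 (eiso H f) \<otimes>\<^bsub>D1\<^esub> y)"
          using p1.jE.B.mult_assoc[of "jH\<^sub>1 (vproj H (tail H f))" "jH\<^sub>1 (eiso H f)" y] by simp
        then show "jH\<^sub>1 (eiso H f) \<otimes>\<^bsub>D1\<^esub> y \<in> K"
          using vertex_mult_K[of "tail H f" "jH\<^sub>1 (eiso H f) \<otimes>\<^bsub>D1\<^esub> y"] by simp
        let ?s = "(eiso H f)\<^sup>\<star>\<^bsub>graph_cstar H\<^esub>"
        have "(eiso H f \<otimes>\<^bsub>graph_cstar H\<^esub> vproj H (head H f))\<^sup>\<star>\<^bsub>graph_cstar H\<^esub> = vproj H (head H f) \<otimes>\<^bsub>graph_cstar H\<^esub> ?s"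
          by (simp add: p1.jH.A.adj_mult p1.FH.P_adj)
        then have "?s = vproj H (head H f) \<otimes>\<^bsub>graph_cstar H\<^esub> ?s" by (simp add: p1.FH.S_P_head)
        then have "jH\<^sub>1 ?s = jH\<^sub>1 (vproj H (head H f)) \<otimes>\<^bsub>D1\<^esub> jH\<^sub>1 ?s"
          using p1.jH.mult[of "vproj H (head H f)" ?s] by simp
        then have "jH\<^sub>1 ?s \<otimes>\<^bsub>D1\<^esub> y = jH\<^sub>1 (vproj H (head H f)) \<otimes>\<^bsub>D1\<^esub> (jH\<^sub>1 ?s \<otimes>\<^bsub>D1\<^esub> y)"
          using p1.jE.B.mult_assoc[of "jH\<^sub>1 (vproj H (head H f))" "jH\<^sub>1 ?s" y] by simp
        then show "jH\<^sub>1 ?s \<otimes>\<^bsub>D1\<^esub> y \<in> K"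
          using vertex_mult_K[of "head H f" "jH\<^sub>1 ?s \<otimes>\<^bsub>D1\<^esub> y"] by simp
      qed
      then show ?thesis using 3 by (simp flip: p1.jH.adj)
    qed
  next
    case (lim s a)
    have a: "a \<in> carrier D1" by (rule p1.jE.B.convD(2)[OF lim.hyps(2)])
    have "a \<otimes>\<^bsub>D1\<^esub> y \<in> K" "a\<^sup>\<star>\<^bsub>D1\<^esub> \<otimes>\<^bsub>D1\<^esub> y \<in> K" if y: "y \<in> K" for y
    proof -
      note yc = p1.jE.B.conv_const[OF act.K.K_carrier[OF y]]
      show "a \<otimes>\<^bsub>D1\<^esub> y \<in> K"
        by (rule act.K.K_lim[OF _ p1.jE.B.conv_mult[OF lim.hyps(2) yc]]) (use lim.IH y in blast)
      show "a\<^sup>\<star>\<^bsub>D1\<^esub> \<otimes>\<^bsub>D1\<^esub> y \<in> K"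
        by (rule act.K.K_lim[OF _ p1.jE.B.conv_mult[OF p1.jE.B.conv_adj[OF lim.hyps(2)] yc]]) (use lim.IH y in blast)
    qed
    then show ?case using a by blast
  qed (simp_all add: p1.jE.B.mult_distrib_right p1.jE.B.smult_mult_left p1.jE.B.mult_assoc act.K.K_carrier
      p1.jE.B.adj_add p1.jE.B.adj_smult p1.jE.B.adj_mult act.K.K_add act.K.K_sc)
  then show ?thesis by blast
qed

lemma J_subset_K: "y \<in> p1.J \<Longrightarrow> y \<in> K"
proof (induction rule: closed_ideal.induct)
  case (base y)
  then obtain w where w: "w \<in> verts H" "y = jH\<^sub>1 (vproj H w)" by blast
  have "y = jH\<^sub>1 (vproj H w) \<otimes>\<^bsub>D1\<^esub> jH\<^sub>1 (vproj H w)" using w by (simp add: p1.FH.P_idem flip: p1.jH.mult)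
  then show ?case using vertex_mult_K[OF w(1), of "jH\<^sub>1 (vproj H w)"] w(1) by simp
next
  case (lim s y)
  show ?case by (rule act.K.K_lim[OF lim.IH lim.hyps(2)])
qed (simp_all add: K_left K_right act.K.K_add act.K.K_sc)

lemma K_subset_J: "y \<in> K \<Longrightarrow> y \<in> p1.J"
proof (induction rule: act.K_induct)
  case (gen x y)
  then show ?case by (intro closed_ideal.right p1.jE_ideal g_ideal)
next
  case (null z)
  then obtain w y where z: "z = jH\<^sub>1 (vproj H w) \<otimes>\<^bsub>D1\<^esub> y" "w \<in> verts H" "y \<in> carrier D1"
    unfolding unglued_def by blast
  then show ?case using closed_ideal.right[OF z(3) p1.jH_P_J[OF z(2)]] by simp
next
  case (lim s y)
  show ?case by (rule closed_ideal.lim[OF lim.IH lim.hyps(2)])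
qed (simp_all add: closed_ideal.add closed_ideal.scale)

abbreviation "mult_op \<equiv> \<lambda>a\<in>carrier D1. \<lambda>y\<in>K. a \<otimes>\<^bsub>D1\<^esub> y"

lemma mult_op_hom: "star_hom D1 act.K.L mult_op"
  by (rule act.K.left_mult_hom) (simp add: K_left)

text \<open>Left multiplication of \<open>D1\<close> on the ideal factors through \<open>\<psi>\<close>: the
  action of \<open>C2\<close> and the multiplication by the algebra of \<open>H\<close> satisfy the
  compatibility conditions of the glued algebra \<open>D2\<close>.\<close>

lemma factor_mult_op:
  obtains \<mu> where "star_hom D2 act.K.L \<mu>" "\<forall>z\<in>carrier D1. \<mu> (\<psi> z) = mult_op z"
proof -
  interpret M: star_hom D1 act.K.L mult_op by (rule mult_op_hom)
  interpret T: star_hom C2 act.K.L "\<lambda>c\<in>carrier C2. act.act c" by (rule act.act_hom)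
  note H = star_hom_compose[OF p1.jH.star_hom_axioms mult_op_hom]
  have agree: "(\<lambda>c\<in>carrier C2. act.act c) (vproj E\<^sub>2 (\<iota>\<^sub>2 x)) = compose (carrier (graph_cstar H)) mult_op jH\<^sub>1 (vproj H (\<kappa> x))"
    if x: "x \<in> X" for x
  proof (rule act.K.L_eqI)
    note [simp] = p2.i_verts[OF x] p1.i_verts[OF x] p1.k_vert[OF x]
    show "(\<lambda>c\<in>carrier C2. act.act c) (vproj E\<^sub>2 (\<iota>\<^sub>2 x)) \<in> carrier act.K.L" by (rule T.closed) simp
    show "compose (carrier (graph_cstar H)) mult_op jH\<^sub>1 (vproj H (\<kappa> x)) \<in> carrier act.K.L"
      unfolding compose_def using M.closed[of "jH\<^sub>1 (vproj H (\<kappa> x))"] by simp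
    fix y assume y: "y \<in> K"
    have "act.act (\<phi> (vproj E\<^sub>1 (\<iota>\<^sub>1 x))) y = jE\<^sub>1 (vproj E\<^sub>1 (\<iota>\<^sub>1 x)) \<otimes>\<^bsub>D1\<^esub> y"
      using jE_mult_K[OF _ y, of "vproj E\<^sub>1 (\<iota>\<^sub>1 x)"] by simp
    then show "(\<lambda>c\<in>carrier C2. act.act c) (vproj E\<^sub>2 (\<iota>\<^sub>2 x)) y = compose (carrier (graph_cstar H)) mult_op jH\<^sub>1 (vproj H (\<kappa> x)) y"
      using y x by (simp add: compose_def phi_X p1.jE_jH_glued)
  qed
  have orth: "(\<lambda>c\<in>carrier C2. act.act c) (vproj E\<^sub>2 v) \<otimes>\<^bsub>act.K.L\<^esub> compose (carrier (graph_cstar H)) mult_op jH\<^sub>1 (vproj H w) = \<zero>\<^bsub>act.K.L\<^esub>"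
    if v: "v \<in> verts E\<^sub>2" and w: "w \<in> verts H" and vw: "\<not> (\<exists>x\<in>X. v = \<iota>\<^sub>2 x \<and> w = \<kappa> x)" for v w
  proof (rule act.K.L_eqI)
    have c: "compose (carrier (graph_cstar H)) mult_op jH\<^sub>1 (vproj H w) = mult_op (jH\<^sub>1 (vproj H w))"
      using w by (simp add: compose_def)
    have "mult_op (jH\<^sub>1 (vproj H w)) \<in> carrier act.K.L" by (rule M.closed) (simp add: w)
    moreover have "act.act (vproj E\<^sub>2 v) \<in> carrier act.K.L" by (rule act.act_L) (simp add: v)
    ultimately show "(\<lambda>c\<in>carrier C2. act.act c) (vproj E\<^sub>2 v) \<otimes>\<^bsub>act.K.L\<^esub> compose (carrier (graph_cstar H)) mult_op jH\<^sub>1 (vproj H w) \<in> carrier act.K.L"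
      unfolding c using v act.K.L_mult_closed by simp
    show "\<zero>\<^bsub>act.K.L\<^esub> \<in> carrier act.K.L" by (rule act.K.L_zero_closed)
    fix y assume y: "y \<in> K"
    note yc = act.K.K_carrier[OF y]
    have "act.act (vproj E\<^sub>2 v) (jH\<^sub>1 (vproj H w) \<otimes>\<^bsub>D1\<^esub> y) = \<zero>\<^bsub>D1\<^esub>"
    proof (cases "w \<in> \<kappa> ` X")
      case True
      then obtain x where x: "x \<in> X" "w = \<kappa> x" by blast
      then have "v \<noteq> \<iota>\<^sub>2 x" using vw by blast
      then have "vproj E\<^sub>2 v \<otimes>\<^bsub>C2\<^esub> vproj E\<^sub>2 (\<iota>\<^sub>2 x) = \<zero>\<^bsub>C2\<^esub>" using v x by (simp add: p2.FE.P_orth p2.i_verts)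
      moreover have "g \<zero>\<^bsub>C2\<^esub> = \<zero>\<^bsub>C1\<^esub>" by (rule g_eqI) (simp_all add: closed_ideal.zero)
      ultimately show ?thesis
        using act.act_gen[of "vproj E\<^sub>2 v", OF _ vertex_I[OF x(1)] yc] v yc x by (simp add: h_vertex)
    next
      case False
      then have "jH\<^sub>1 (vproj H w) \<otimes>\<^bsub>D1\<^esub> y \<in> unglued" using w yc unfolding unglued_def by blast
      then show ?thesis by (rule act.act_Z[rotated]) (simp add: v)
    qed
    then show "((\<lambda>c\<in>carrier C2. act.act c) (vproj E\<^sub>2 v) \<otimes>\<^bsub>act.K.L\<^esub> compose (carrier (graph_cstar H)) mult_op jH\<^sub>1 (vproj H w)) y = \<zero>\<^bsub>act.K.L\<^esub> y"
      unfolding c using v w y by simp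
  qed
  obtain \<mu> where mu: "star_hom D2 act.K.L \<mu>"
    "induced_homs E\<^sub>2 H X \<iota>\<^sub>2 \<kappa> act.K.L jE\<^sub>2 jH\<^sub>2 (\<lambda>c\<in>carrier C2. act.act c) (compose (carrier (graph_cstar H)) mult_op jH\<^sub>1) = {\<mu>}"
    "\<forall>c\<in>carrier C2. \<mu> (jE\<^sub>2 c) = (\<lambda>c\<in>carrier C2. act.act c) c"
    "\<forall>b\<in>carrier (graph_cstar H). \<mu> (jH\<^sub>2 b) = compose (carrier (graph_cstar H)) mult_op jH\<^sub>1 b"
    by (rule p2.induced_hom[OF act.act_hom H agree orth])
  have "compose (carrier D1) \<mu> \<psi> = mult_op"
  proof (rule p1.glued_hom_eqI[OF star_hom_compose[OF psi.star_hom_axioms mu(1)] mult_op_hom])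
    fix c assume c: "c \<in> carrier C1"
    have "act.act (\<phi> c) = mult_op (jE\<^sub>1 c)"
    proof (rule act.K.L_eqI)
      show "act.act (\<phi> c) \<in> carrier act.K.L" by (rule act.act_L) (simp add: c)
      show "mult_op (jE\<^sub>1 c) \<in> carrier act.K.L" by (rule M.closed) (simp add: c)
    qed (simp add: c jE_mult_K)
    then show "compose (carrier D1) \<mu> \<psi> (jE\<^sub>1 c) = mult_op (jE\<^sub>1 c)"
      using c mu(3) by (simp add: compose_def psi_E)
  next
    fix b assume "b \<in> carrier (graph_cstar H)"
    then show "compose (carrier D1) \<mu> \<psi> (jH\<^sub>1 b) = mult_op (jH\<^sub>1 b)"
      using mu(4) by (simp add: compose_def psi_H)
  qed
  note eq = this
  have "\<mu> (\<psi> z) = mult_op z" if "z \<in> carrier D1" for z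
  proof -
    have "\<mu> (\<psi> z) = compose (carrier D1) \<mu> \<psi> z" using that by (simp only: compose_def restrict_apply' )
    then show ?thesis unfolding eq .
  qed
  then have "\<forall>z\<in>carrier D1. \<mu> (\<psi> z) = mult_op z" by (rule ballI)
  from mu(1) this show ?thesis by (rule that)
qed

text \<open>\<open>\<parallel>z\<parallel>\<^sup>2 = \<parallel>z z\<^sup>\<star>\<parallel> \<le>
  \<parallel>\<psi> z\<parallel> \<parallel>z\<parallel>\<close>, as left multiplication by \<open>z\<close>
  is the image of \<open>\<psi> z\<close> under a contraction and \<open>z\<^sup>\<star>\<close> belongs to
  the ideal.\<close>

lemma psi_isometric:
  assumes z: "z \<in> p1.J" shows "\<parallel>\<psi> z\<parallel>\<^bsub>D2\<^esub> = \<parallel>z\<parallel>\<^bsub>D1\<^esub>"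
proof (rule antisym)
  note zc = p1.J_carrier[OF z] and z' = J_subset_K[OF p1.J_adj[OF z]]
  show "\<parallel>\<psi> z\<parallel>\<^bsub>D2\<^esub> \<le> \<parallel>z\<parallel>\<^bsub>D1\<^esub>" by (rule psi.contractive[OF zc])
  obtain \<mu> where mu: "star_hom D2 act.K.L \<mu>" "\<forall>z\<in>carrier D1. \<mu> (\<psi> z) = mult_op z" by (rule factor_mult_op)
  interpret mu: star_hom D2 act.K.L \<mu> by (rule mu(1))
  have L: "mult_op z \<in> carrier act.K.L" by (rule star_hom.closed[OF mult_op_hom zc])
  have "\<parallel>z\<parallel>\<^bsub>D1\<^esub> * \<parallel>z\<parallel>\<^bsub>D1\<^esub> = \<parallel>mult_op z (z\<^sup>\<star>\<^bsub>D1\<^esub>)\<parallel>\<^bsub>D1\<^esub>"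
    using p1.jE.B.cstar_identity[of "z\<^sup>\<star>\<^bsub>D1\<^esub>"] zc z' by (simp add: power2_eq_square)
  also have "\<dots> \<le> \<parallel>mult_op z\<parallel>\<^bsub>act.K.L\<^esub> * \<parallel>z\<^sup>\<star>\<^bsub>D1\<^esub>\<parallel>\<^bsub>D1\<^esub>" by (rule act.K.L_norm_app[OF L z'])
  also have "mult_op z = \<mu> (\<psi> z)" using mu(2) zc by (simp only:)
  also have "\<parallel>\<mu> (\<psi> z)\<parallel>\<^bsub>act.K.L\<^esub> * \<parallel>z\<^sup>\<star>\<^bsub>D1\<^esub>\<parallel>\<^bsub>D1\<^esub> \<le> \<parallel>\<psi> z\<parallel>\<^bsub>D2\<^esub> * \<parallel>z\<parallel>\<^bsub>D1\<^esub>"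
    using mult_right_mono[OF mu.contractive[of "\<psi> z"], of "\<parallel>z\<parallel>\<^bsub>D1\<^esub>"] zc by simp
  finally show "\<parallel>z\<parallel>\<^bsub>D1\<^esub> \<le> \<parallel>\<psi> z\<parallel>\<^bsub>D2\<^esub>" by (rule le_of_square_le_mult[rotated 2]) (simp_all add: zc)
qed

abbreviation "M \<equiv> \<psi> ` p1.J"

text \<open>An isometric image of a complete space is closed.\<close>

lemma image_lim:
  assumes s: "\<And>n. s n \<in> M" and lim: "conv D2 s y" shows "y \<in> M"
proof -
  obtain z where z: "\<And>n. z n \<in> p1.J" "\<And>n. s n = \<psi> (z n)" using s unfolding image_iff by metis
  note zc = p1.J_carrier[OF z(1)]
  have "\<parallel>s m \<ominus>\<^bsub>D2\<^esub> s n\<parallel>\<^bsub>D2\<^esub> = \<parallel>z m \<ominus>\<^bsub>D1\<^esub> z n\<parallel>\<^bsub>D1\<^esub>" for m n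
    using psi_isometric[OF p1.jE.B.closed_ideal_diff[OF z(1)[of m] z(1)[of n] p1.J_gens]]
    by (simp add: z(2) psi.diff zc)
  then have "\<exists>N. \<forall>m\<ge>N. \<forall>n\<ge>N. \<parallel>z m \<ominus>\<^bsub>D1\<^esub> z n\<parallel>\<^bsub>D1\<^esub> < e" if "e > 0" for e
    using p2.jE.B.conv_Cauchy[OF lim that] by simp
  then obtain w where w: "conv D1 z w" using p1.jE.B.Cauchy_conv[of z] zc by blast
  have "conv D2 s (\<psi> w)" using psi.conv[OF w] unfolding z(2) .
  then have "y = \<psi> w" by (rule p2.jE.B.conv_unique[OF lim])
  then show ?thesis using closed_ideal.lim[OF z(1) w] by blast
qed

text \<open>The action on the ideal was built from multiplication in \<open>C2\<close>, and
  \<open>\<psi>\<close> turns it back into multiplication in \<open>D2\<close>.\<close>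

lemma image_jE: "c \<in> carrier C2 \<Longrightarrow> y \<in> K \<Longrightarrow> jE\<^sub>2 c \<otimes>\<^bsub>D2\<^esub> \<psi> y = \<psi> (act.act c y)"
proof -
  assume c: "c \<in> carrier C2" and y: "y \<in> K"
  show ?thesis using y
  proof (induction rule: act.K_induct)
    case (gen x y)
    have "\<psi> (h (c \<otimes>\<^bsub>C2\<^esub> x) \<otimes>\<^bsub>D1\<^esub> y) = jE\<^sub>2 (c \<otimes>\<^bsub>C2\<^esub> x) \<otimes>\<^bsub>D2\<^esub> \<psi> y"
      using closed_ideal.left[OF c gen(1)] gen(2) by (simp add: psi.mult psi_E phi_g)
    then show ?case using c gen p2.EI.I_carrier[OF gen(1)]
      by (simp add: act.act_gen psi.mult psi_E phi_g p2.jE.mult p2.jE.B.mult_assoc)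
  next
    case (null z)
    then obtain w y where z: "z = jH\<^sub>1 (vproj H w) \<otimes>\<^bsub>D1\<^esub> y" "w \<in> verts H" "w \<notin> \<kappa> ` X" "y \<in> carrier D1"
      unfolding unglued_def by blast
    have "jE\<^sub>2 c \<otimes>\<^bsub>D2\<^esub> (jH\<^sub>2 (vproj H w) \<otimes>\<^bsub>D2\<^esub> \<psi> y) = (jE\<^sub>2 c \<otimes>\<^bsub>D2\<^esub> jH\<^sub>2 (vproj H w)) \<otimes>\<^bsub>D2\<^esub> \<psi> y"
      using c z by (simp add: p2.jE.B.mult_assoc)
    then have "jE\<^sub>2 c \<otimes>\<^bsub>D2\<^esub> \<psi> z = \<zero>\<^bsub>D2\<^esub>" using p2.jE_mult_unglued[OF c z(2,3)] z by (simp add: psi.mult psi_H)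
    then show ?case using act.act_Z[OF c null] by simp
  next
    case (lim s y)
    have "conv D2 (\<lambda>n. jE\<^sub>2 c \<otimes>\<^bsub>D2\<^esub> \<psi> (s n)) (jE\<^sub>2 c \<otimes>\<^bsub>D2\<^esub> \<psi> y)"
      by (rule p2.jE.B.conv_mult[OF p2.jE.B.conv_const psi.conv[OF lim.hyps(2)]]) (simp add: c)
    then have "conv D2 (\<lambda>n. \<psi> (act.act c (s n))) (jE\<^sub>2 c \<otimes>\<^bsub>D2\<^esub> \<psi> y)" unfolding lim.IH .
    then show ?case by (rule p2.jE.B.conv_unique[OF _ psi.conv[OF act.act_conv[OF c lim.hyps(1,2)]]])
  qed (simp_all add: c act.act_add act.act_scale psi.add psi.scale act.K.K_carrier p2.jE.B.mult_distrib_left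
        p2.jE.B.smult_mult_right)
qed

lemma M_carrier: "y \<in> M \<Longrightarrow> y \<in> carrier D2"
  using p1.J_carrier by auto

lemma M_zero: "\<zero>\<^bsub>D2\<^esub> \<in> M"
proof -
  have "\<psi> \<zero>\<^bsub>D1\<^esub> \<in> M" by (rule imageI[OF closed_ideal.zero])
  then show ?thesis unfolding psi.zero .
qed

lemma M_add: "x \<in> M \<Longrightarrow> y \<in> M \<Longrightarrow> x \<oplus>\<^bsub>D2\<^esub> y \<in> M"
proof -
  assume "x \<in> M" "y \<in> M"
  then obtain a b where "x = \<psi> a" "y = \<psi> b" "a \<in> p1.J" "b \<in> p1.J" by blast
  then have "x \<oplus>\<^bsub>D2\<^esub> y = \<psi> (a \<oplus>\<^bsub>D1\<^esub> b)" "a \<oplus>\<^bsub>D1\<^esub> b \<in> p1.J"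
    by (simp_all add: psi.add p1.J_carrier closed_ideal.add)
  then show ?thesis by blast
qed

lemma M_scale: "y \<in> M \<Longrightarrow> c \<odot>\<^bsub>D2\<^esub> y \<in> M"
proof -
  assume "y \<in> M"
  then obtain b where "y = \<psi> b" "b \<in> p1.J" by blast
  then have "c \<odot>\<^bsub>D2\<^esub> y = \<psi> (c \<odot>\<^bsub>D1\<^esub> b)" "c \<odot>\<^bsub>D1\<^esub> b \<in> p1.J"
    by (simp_all add: psi.scale p1.J_carrier closed_ideal.scale)
  then show ?thesis by blast
qed

lemma M_adj: "y \<in> M \<Longrightarrow> y\<^sup>\<star>\<^bsub>D2\<^esub> \<in> M"
proof -
  assume "y \<in> M"
  then obtain b where "y = \<psi> b" "b \<in> p1.J" by blast
  then have "y\<^sup>\<star>\<^bsub>D2\<^esub> = \<psi> (b\<^sup>\<star>\<^bsub>D1\<^esub>)" "b\<^sup>\<star>\<^bsub>D1\<^esub> \<in> p1.J"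
    by (simp_all add: psi.adj p1.J_carrier p1.J_adj)
  then show ?thesis by blast
qed

lemma M_left:
  assumes "a \<in> carrier D2" shows "\<forall>y\<in>M. a \<otimes>\<^bsub>D2\<^esub> y \<in> M \<and> a\<^sup>\<star>\<^bsub>D2\<^esub> \<otimes>\<^bsub>D2\<^esub> y \<in> M"
proof -
  have "a \<in> star_closure D2 (jE\<^sub>2 ` graph_gens E\<^sub>2 \<union> jH\<^sub>2 ` graph_gens H)" using assms p2.glued_generated by simp
  then have "a \<in> carrier D2 \<and> (\<forall>y\<in>M. a \<otimes>\<^bsub>D2\<^esub> y \<in> M \<and> a\<^sup>\<star>\<^bsub>D2\<^esub> \<otimes>\<^bsub>D2\<^esub> y \<in> M)"
  proof (induction rule: star_closure.induct)
    case (base a)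
    have E: "jE\<^sub>2 c \<otimes>\<^bsub>D2\<^esub> y \<in> M" if "c \<in> carrier C2" "y \<in> M" for c y
    proof -
      from that(2) obtain z where z: "y = \<psi> z" "z \<in> p1.J" by blast
      show ?thesis unfolding z(1) image_jE[OF that(1) J_subset_K[OF z(2)]]
        by (rule imageI[OF K_subset_J[OF act.act_closed[OF that(1) J_subset_K[OF z(2)]]]])
    qed
    have B: "jH\<^sub>2 b \<otimes>\<^bsub>D2\<^esub> y \<in> M" if "b \<in> carrier (graph_cstar H)" "y \<in> M" for b y
    proof -
      from that(2) obtain z where z: "y = \<psi> z" "z \<in> p1.J" by blast
      have "jH\<^sub>2 b \<otimes>\<^bsub>D2\<^esub> y = \<psi> (jH\<^sub>1 b \<otimes>\<^bsub>D1\<^esub> z)" using z that(1) by (simp add: psi.mult psi_H p1.J_carrier)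
      moreover have "jH\<^sub>1 b \<otimes>\<^bsub>D1\<^esub> z \<in> p1.J" by (rule closed_ideal.left[OF p1.jH.closed[OF that(1)] z(2)])
      ultimately show ?thesis by blast
    qed
    have gens: "graph_gens E\<^sub>2 \<subseteq> carrier C2" "graph_gens H \<subseteq> carrier (graph_cstar H)"
      by (auto simp: graph_gens_def)
    from base show ?case
    proof (elim UnE imageE)
      fix c assume c: "a = jE\<^sub>2 c" "c \<in> graph_gens E\<^sub>2"
      show ?thesis unfolding c(1) using subsetD[OF gens(1) c(2)] E[of c] E[of "c\<^sup>\<star>\<^bsub>C2\<^esub>"] by (simp flip: p2.jE.adj)
    next
      fix b assume b: "a = jH\<^sub>2 b" "b \<in> graph_gens H"
      show ?thesis unfolding b(1) using subsetD[OF gens(2) b(2)] B[of b] B[of "b\<^sup>\<star>\<^bsub>graph_cstar H\<^esub>"] by (simp flip: p2.jH.adj)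
    qed
  next
    case zero
    have "\<zero>\<^bsub>D2\<^esub> \<otimes>\<^bsub>D2\<^esub> y \<in> M" if "y \<in> M" for y
      unfolding p2.jE.B.mult_zero_left[OF M_carrier[OF that]] by (rule M_zero)
    then show ?case by simp
  next
    case (lim s a)
    have a: "a \<in> carrier D2" by (rule p2.jE.B.convD(2)[OF lim.hyps(2)])
    have "a \<otimes>\<^bsub>D2\<^esub> y \<in> M" "a\<^sup>\<star>\<^bsub>D2\<^esub> \<otimes>\<^bsub>D2\<^esub> y \<in> M" if y: "y \<in> M" for y
    proof -
      note yc = p2.jE.B.conv_const[OF M_carrier[OF y]]
      show "a \<otimes>\<^bsub>D2\<^esub> y \<in> M"
        by (rule image_lim[OF _ p2.jE.B.conv_mult[OF lim.hyps(2) yc]]) (use lim.IH y in blast)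
      show "a\<^sup>\<star>\<^bsub>D2\<^esub> \<otimes>\<^bsub>D2\<^esub> y \<in> M"
        by (rule image_lim[OF _ p2.jE.B.conv_mult[OF p2.jE.B.conv_adj[OF lim.hyps(2)] yc]]) (use lim.IH y in blast)
    qed
    then show ?case using a by blast
  next
    case (add x y)
    then show ?case by (simp add: p2.jE.B.mult_distrib_right p2.jE.B.adj_add M_carrier M_add del: image_iff ball_simps)
  next
    case (scale x c)
    then show ?case by (simp add: p2.jE.B.smult_mult_left p2.jE.B.adj_smult M_carrier M_scale del: image_iff ball_simps)
  next
    case (mult x y)
    then show ?case by (simp add: p2.jE.B.mult_assoc p2.jE.B.adj_mult M_carrier del: image_iff ball_simps)
  next
    case (adj x)
    then show ?case by (simp del: image_iff ball_simps)
  qed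
  then show ?thesis by blast
qed

lemma psi_onto: "y \<in> p2.J \<Longrightarrow> y \<in> M"
proof (induction rule: closed_ideal.induct)
  case (base y)
  then obtain w where w: "w \<in> verts H" "y = jH\<^sub>2 (vproj H w)" by blast
  then have "y = \<psi> (jH\<^sub>1 (vproj H w))" by (simp add: psi_H)
  then show ?case using p1.jH_P_J[OF w(1)] by blast
next
  case zero
  show ?case by (rule M_zero)
next
  case (left a y)
  show ?case by (rule conjunct1[OF bspec[OF M_left[OF left.hyps(1)] left.IH]])
next
  case (right a y)
  have "a\<^sup>\<star>\<^bsub>D2\<^esub> \<otimes>\<^bsub>D2\<^esub> y\<^sup>\<star>\<^bsub>D2\<^esub> \<in> M"
    by (rule conjunct2[OF bspec[OF M_left[OF right.hyps(1)] M_adj[OF right.IH]]])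
  from M_adj[OF this] show ?case using right.hyps(1) M_carrier[OF right.IH] by (simp add: p2.jE.B.adj_mult)
next
  case (lim s y)
  show ?case by (rule image_lim[OF lim.IH lim.hyps(2)])
next
  case (add x y)
  show ?case by (rule M_add[OF add.IH])
next
  case (scale x c)
  show ?case by (rule M_scale[OF scale.IH])
qed

end

section \<open>Pullback squares\<close>

lemma star_hom_of_homs: "cstar_algebra A \<Longrightarrow> cstar_algebra B \<Longrightarrow> h \<in> star_homs A B \<Longrightarrow> star_hom A B h"
  by (simp add: star_hom_def star_hom_axioms_def)

lemma fibre_product_simps:
  "carrier (fibre_product A C \<rho> \<theta>) = {(a, c) \<in> carrier A \<times> carrier C. \<rho> a = \<theta> c}"
  "(a, c) \<oplus>\<^bsub>fibre_product A C \<rho> \<theta>\<^esub> (a', c') = (a \<oplus>\<^bsub>A\<^esub> a', c \<oplus>\<^bsub>C\<^esub> c')"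
  "(a, c) \<otimes>\<^bsub>fibre_product A C \<rho> \<theta>\<^esub> (a', c') = (a \<otimes>\<^bsub>A\<^esub> a', c \<otimes>\<^bsub>C\<^esub> c')"
  "k \<odot>\<^bsub>fibre_product A C \<rho> \<theta>\<^esub> (a, c) = (k \<odot>\<^bsub>A\<^esub> a, k \<odot>\<^bsub>C\<^esub> c)"
  "(a, c)\<^sup>\<star>\<^bsub>fibre_product A C \<rho> \<theta>\<^esub> = (a\<^sup>\<star>\<^bsub>A\<^esub>, c\<^sup>\<star>\<^bsub>C\<^esub>)"
  by (simp_all add: fibre_product_def direct_sum_def)

text \<open>The pair inherits injectivity from \<open>\<phi>\<close>.\<close>

lemma pullback_diagramI:
  assumes d: "star_hom P A \<delta>" and f: "star_hom P C \<phi>" and r: "star_hom A B \<rho>" and t: "star_hom C B \<theta>"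
    and commutes: "\<And>p. p \<in> carrier P \<Longrightarrow> \<rho> (\<delta> p) = \<theta> (\<phi> p)"
    and lifting: "\<And>a c. a \<in> carrier A \<Longrightarrow> c \<in> carrier C \<Longrightarrow> \<rho> a = \<theta> c \<Longrightarrow> \<exists>p\<in>carrier P. \<delta> p = a \<and> \<phi> p = c"
    and kernel: "\<And>p. p \<in> carrier P \<Longrightarrow> \<phi> p = \<zero>\<^bsub>C\<^esub> \<Longrightarrow> p = \<zero>\<^bsub>P\<^esub>"
  shows "pullback_diagram P A C B \<delta> \<phi> \<rho> \<theta>"
proof -
  interpret d: star_hom P A \<delta> by fact
  interpret f: star_hom P C \<phi> by fact
  let ?F = "fibre_product A C \<rho> \<theta>" and ?h = "\<lambda>c\<in>carrier P. (\<delta> c, \<phi> c)"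
  have "compose (carrier P) \<rho> \<delta> = compose (carrier P) \<theta> \<phi>"
    unfolding compose_def by (rule restrict_ext) (rule commutes)
  moreover have "?h \<in> star_homs P ?F"
    unfolding star_homs_def
    by (simp add: fibre_product_simps d.add f.add d.scale f.scale d.mult f.mult d.adj f.adj commutes)
  moreover have "bij_betw ?h (carrier P) (carrier ?F)"
    unfolding bij_betw_def
  proof
    show "inj_on ?h (carrier P)"
    proof (rule inj_onI)
      fix p q assume p: "p \<in> carrier P" and q: "q \<in> carrier P" and "?h p = ?h q"
      then have "\<phi> (p \<ominus>\<^bsub>P\<^esub> q) = \<zero>\<^bsub>C\<^esub>" by (simp add: f.diff)
      then have "p \<ominus>\<^bsub>P\<^esub> q = \<zero>\<^bsub>P\<^esub>" using p q by (intro kernel) simp_all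
      then show "p = q" using p q by (simp add: d.A.diff_eq_zero)
    qed
    show "?h ` carrier P = carrier ?F"
    proof
      show "?h ` carrier P \<subseteq> carrier ?F" by (simp add: image_subset_iff fibre_product_simps commutes)
      show "carrier ?F \<subseteq> ?h ` carrier P"
      proof
        fix x assume "x \<in> carrier ?F"
        then obtain a c where x: "x = (a, c)" "a \<in> carrier A" "c \<in> carrier C" "\<rho> a = \<theta> c"
          by (cases x) (simp add: fibre_product_simps)
        from lifting[OF x(2-4)] obtain p where "p \<in> carrier P" "\<delta> p = a" "\<phi> p = c" by blast
        then have "?h p = x" "p \<in> carrier P" using x(1) by simp_all
        then show "x \<in> ?h ` carrier P" by blast
      qed
    qed
  qed
  ultimately show ?thesis
    using star_hom.hom[OF d] star_hom.hom[OF f] star_hom.hom[OF r] star_hom.hom[OF t]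
    by (simp add: pullback_diagram_def star_isos_def)
qed

locale pullback_square = delta: star_hom P A \<delta> + phi: star_hom P C \<phi> + rho: star_hom A B \<rho> + theta: star_hom C B \<theta>
  for P :: "('p, 'k) cstar_scheme" and A :: "('a, 'l) cstar_scheme" and C :: "('c, 'm) cstar_scheme"
    and B :: "('b, 'n) cstar_scheme" and \<delta> \<phi> \<rho> \<theta> +
  assumes commutes: "p \<in> carrier P \<Longrightarrow> \<rho> (\<delta> p) = \<theta> (\<phi> p)"
    and lifting: "a \<in> carrier A \<Longrightarrow> c \<in> carrier C \<Longrightarrow> \<rho> a = \<theta> c \<Longrightarrow> \<exists>p\<in>carrier P. \<delta> p = a \<and> \<phi> p = c"
    and phi_inj: "inj_on \<phi> (carrier P)"
begin

definition lift :: "'c \<Rightarrow> 'p" where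
  "lift = inv_into (carrier P) \<phi>"

definition kernel :: "'c set" where
  "kernel = {c \<in> carrier C. \<theta> c = \<zero>\<^bsub>B\<^esub>}"

lemma kernel_carrier: "c \<in> kernel \<Longrightarrow> c \<in> carrier C"
  by (simp add: kernel_def)

lemma lift_phi: "p \<in> carrier P \<Longrightarrow> lift (\<phi> p) = p"
  unfolding lift_def by (rule inv_into_f_f[OF phi_inj])

lemma lift_eqI: "p \<in> carrier P \<Longrightarrow> \<phi> p = c \<Longrightarrow> lift c = p"
  using lift_phi by blast

text \<open>The pullback property, applied to the pair \<open>(0, c)\<close>.\<close>

lemma lift: assumes "c \<in> kernel" shows "lift c \<in> carrier P \<and> \<phi> (lift c) = c"
proof -
  obtain p where p: "p \<in> carrier P" "\<phi> p = c"
    using lifting[of "\<zero>\<^bsub>A\<^esub>" c] assms by (auto simp: kernel_def)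
  then show ?thesis using lift_eqI[OF p] by simp
qed

lemma kernel_subalgebra: "closed_star_subalgebra C kernel"
  unfolding closed_star_subalgebra_def
proof (intro conjI allI impI)
  fix s x assume s: "\<forall>n. s n \<in> kernel" and lim: "conv C s x"
  have "conv B (\<lambda>n. \<zero>\<^bsub>B\<^esub>) (\<theta> x)" using theta.conv[OF lim] s by (simp add: kernel_def)
  from rho.B.conv_unique[OF this rho.B.conv_const] show "x \<in> kernel"
    using phi.B.convD(2)[OF lim] by (simp add: kernel_def)
qed (auto simp: kernel_def theta.add theta.scale theta.mult theta.adj)

lemma kernel_closures: "c \<in> kernel \<Longrightarrow> d \<in> kernel \<Longrightarrow> c \<oplus>\<^bsub>C\<^esub> d \<in> kernel" "c \<in> kernel \<Longrightarrow> k \<odot>\<^bsub>C\<^esub> c \<in> kernel"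
  "c \<in> kernel \<Longrightarrow> d \<in> carrier C \<Longrightarrow> c \<otimes>\<^bsub>C\<^esub> d \<in> kernel" "c \<in> kernel \<Longrightarrow> d \<in> carrier C \<Longrightarrow> d \<otimes>\<^bsub>C\<^esub> c \<in> kernel"
  "c \<in> kernel \<Longrightarrow> d \<in> kernel \<Longrightarrow> c \<ominus>\<^bsub>C\<^esub> d \<in> kernel" "c \<in> kernel \<Longrightarrow> c\<^sup>\<star>\<^bsub>C\<^esub> \<in> kernel"
  by (simp_all add: kernel_def theta.add theta.scale theta.mult theta.diff theta.adj)

text \<open>The inverse of \<open>\<phi>\<close> on the kernel of \<open>\<theta>\<close> is a homomorphism on
  a closed subalgebra.\<close>

lemma lift_contractive: "c \<in> kernel \<Longrightarrow> \<parallel>lift c\<parallel>\<^bsub>P\<^esub> \<le> \<parallel>c\<parallel>\<^bsub>C\<^esub>"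
proof (rule star_hom_contractive[OF phi.B.cstar_algebra_axioms delta.A.cstar_algebra_axioms kernel_subalgebra])
  show "star_hom_on kernel C P lift"
    unfolding star_hom_on_def
    by (intro conjI ballI allI lift_eqI) (simp_all add: lift phi.add phi.scale phi.mult phi.adj)
qed

lemma lift_conv: assumes s: "\<And>n. s n \<in> kernel" and x: "x \<in> kernel" and lim: "conv C s x"
  shows "conv P (\<lambda>n. lift (s n)) (lift x)"
proof (rule delta.A.conv_bound[OF _ _ _ phi.B.convD(3)[OF lim]])
  show "\<parallel>lift (s n) \<ominus>\<^bsub>P\<^esub> lift x\<parallel>\<^bsub>P\<^esub> \<le> \<parallel>s n \<ominus>\<^bsub>C\<^esub> x\<parallel>\<^bsub>C\<^esub>" for n
  proof -
    have "lift (s n \<ominus>\<^bsub>C\<^esub> x) = lift (s n) \<ominus>\<^bsub>P\<^esub> lift x"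
      by (rule lift_eqI) (simp_all add: lift s x phi.diff)
    then show ?thesis using lift_contractive[OF kernel_closures(5)[OF s x], of n] by simp
  qed
qed (simp_all add: lift s x)

text \<open>Let \<open>y = \<phi> p\<close> with \<open>p\<close> in the ideal. Then \<open>a y\<close> is the
  limit of \<open>a \<phi> (v\<^sub>n) \<phi> p\<close>, where \<open>a \<phi> (v\<^sub>n)\<close> lies in the
  kernel of \<open>\<theta>\<close> and thus has a preimage \<open>q\<^sub>n\<close>. The elements
  \<open>q\<^sub>n p\<close> of the ideal converge to the preimage of \<open>a y\<close>.\<close>

lemma lift_ideal:
  assumes v: "unital_ideal P v S" and S: "\<And>s. s \<in> S \<Longrightarrow> \<delta> s = \<zero>\<^bsub>A\<^esub>"
    and y: "y \<in> closed_ideal C (\<phi> ` S)"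
  shows "y \<in> kernel \<and> lift y \<in> closed_ideal P S"
proof -
  interpret v: unital_ideal P v S by (rule v)
  have ker: "\<phi> p \<in> kernel" if "p \<in> closed_ideal P S" for p
    using delta.closed_ideal_kernel[OF that v.T_carrier S] commutes[OF v.I_carrier[OF that]] v.I_carrier[OF that]
    by (simp add: kernel_def)
  show ?thesis using y
  proof (induction rule: closed_ideal.induct)
    case (base y)
    then obtain s where s: "s \<in> S" "y = \<phi> s" by blast
    then show ?case using ker[OF closed_ideal.base[OF s(1)]] closed_ideal.base[OF s(1)] v.T_carrier
      by (simp add: lift_phi subsetD)
  next
    case zero
    show ?case using ker[OF closed_ideal.zero] lift_phi[OF delta.A.M.zero_closed] by (simp add: closed_ideal.zero)
  next
    case (add x y)
    then have "lift (x \<oplus>\<^bsub>C\<^esub> y) = lift x \<oplus>\<^bsub>P\<^esub> lift y" by (intro lift_eqI) (simp_all add: lift phi.add)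
    then show ?case using add by (simp add: kernel_closures closed_ideal.add)
  next
    case (scale x c)
    then have "lift (c \<odot>\<^bsub>C\<^esub> x) = c \<odot>\<^bsub>P\<^esub> lift x" by (intro lift_eqI) (simp_all add: lift phi.scale)
    then show ?case using scale by (simp add: kernel_closures closed_ideal.scale)
  next
    case (left a y)
    let ?p = "lift y"
    note p = conjunct2[OF left.IH] and yk = conjunct1[OF left.IH]
    have q: "a \<otimes>\<^bsub>C\<^esub> \<phi> (v n) \<in> kernel" for n using left.hyps(1) ker[OF v.u_ideal] by (simp add: kernel_closures)
    have eq: "lift (a \<otimes>\<^bsub>C\<^esub> \<phi> (v n \<otimes>\<^bsub>P\<^esub> ?p)) = lift (a \<otimes>\<^bsub>C\<^esub> \<phi> (v n)) \<otimes>\<^bsub>P\<^esub> ?p" for n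
      using left.hyps(1) q[of n] yk by (intro lift_eqI) (simp_all add: lift phi.mult phi.B.mult_assoc kernel_carrier)
    have "conv C (\<lambda>n. a \<otimes>\<^bsub>C\<^esub> \<phi> (v n \<otimes>\<^bsub>P\<^esub> ?p)) (a \<otimes>\<^bsub>C\<^esub> \<phi> ?p)"
      by (rule phi.B.conv_mult[OF phi.B.conv_const[OF left.hyps(1)] phi.conv[OF v.unit_forD(2)[OF v.u_unit[OF p]]]])
    then have "conv P (\<lambda>n. lift (a \<otimes>\<^bsub>C\<^esub> \<phi> (v n)) \<otimes>\<^bsub>P\<^esub> ?p) (lift (a \<otimes>\<^bsub>C\<^esub> \<phi> ?p))"
      unfolding eq[symmetric]
      by (rule lift_conv[rotated 2])
        (simp_all add: left.hyps(1) kernel_closures ker closed_ideal.left p)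
    from closed_ideal.lim[OF closed_ideal.left[OF conjunct1[OF lift[OF q]] p] this]
    show ?case using left.hyps(1) yk by (simp add: lift kernel_closures)
  next
    case (right a y)
    let ?p = "lift y"
    note p = conjunct2[OF right.IH] and yk = conjunct1[OF right.IH]
    have q: "\<phi> (v n) \<otimes>\<^bsub>C\<^esub> a \<in> kernel" for n using right.hyps(1) ker[OF v.u_ideal] by (simp add: kernel_closures)
    have eq: "lift (\<phi> (?p \<otimes>\<^bsub>P\<^esub> v n) \<otimes>\<^bsub>C\<^esub> a) = ?p \<otimes>\<^bsub>P\<^esub> lift (\<phi> (v n) \<otimes>\<^bsub>C\<^esub> a)" for n
      using right.hyps(1) q[of n] yk by (intro lift_eqI) (simp_all add: lift phi.mult phi.B.mult_assoc kernel_carrier)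
    have "conv C (\<lambda>n. \<phi> (?p \<otimes>\<^bsub>P\<^esub> v n) \<otimes>\<^bsub>C\<^esub> a) (\<phi> ?p \<otimes>\<^bsub>C\<^esub> a)"
      by (rule phi.B.conv_mult[OF phi.conv[OF v.right_unit[OF p]] phi.B.conv_const[OF right.hyps(1)]])
    then have "conv P (\<lambda>n. ?p \<otimes>\<^bsub>P\<^esub> lift (\<phi> (v n) \<otimes>\<^bsub>C\<^esub> a)) (lift (\<phi> ?p \<otimes>\<^bsub>C\<^esub> a))"
      unfolding eq[symmetric]
      by (rule lift_conv[rotated 2])
        (simp_all add: right.hyps(1) kernel_closures ker closed_ideal.right p)
    from closed_ideal.lim[OF closed_ideal.right[OF conjunct1[OF lift[OF q]] p] this]
    show ?case using right.hyps(1) yk by (simp add: lift kernel_closures)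
  next
    case (lim s y)
    have s: "s n \<in> kernel" "lift (s n) \<in> closed_ideal P S" for n using lim.IH by simp_all
    have y: "y \<in> kernel" using kernel_subalgebra s(1) lim.hyps(2) unfolding closed_star_subalgebra_def by blast
    show ?case using closed_ideal.lim[OF s(2) lift_conv[OF s(1) y lim.hyps(2)]] y by simp
  qed
qed

end

lemma pullback_squareI:
  assumes pb: "pullback_diagram P A C B \<delta> \<phi> \<rho> \<theta>" and inj: "inj_on \<phi> (carrier P)"
    and algebras: "cstar_algebra P" "cstar_algebra A" "cstar_algebra C" "cstar_algebra B"
  shows "pullback_square P A C B \<delta> \<phi> \<rho> \<theta>"
proof (intro pullback_square.intro pullback_square_axioms.intro)
  show "star_hom P A \<delta>" "star_hom P C \<phi>" "star_hom A B \<rho>" "star_hom C B \<theta>"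
    using pb algebras by (simp_all add: pullback_diagram_def star_hom_of_homs)
  have eq: "compose (carrier P) \<rho> \<delta> = compose (carrier P) \<theta> \<phi>" using pb by (simp add: pullback_diagram_def)
  show "\<rho> (\<delta> p) = \<theta> (\<phi> p)" if "p \<in> carrier P" for p
    using fun_cong[OF eq, of p] that by (simp add: compose_def)
  show "\<exists>p\<in>carrier P. \<delta> p = a \<and> \<phi> p = c" if "a \<in> carrier A" "c \<in> carrier C" "\<rho> a = \<theta> c" for a c
  proof -
    have "(\<lambda>c\<in>carrier P. (\<delta> c, \<phi> c)) ` carrier P = carrier (fibre_product A C \<rho> \<theta>)"
      using pb by (simp add: pullback_diagram_def star_isos_def bij_betw_def)
    then have "(a, c) \<in> (\<lambda>c\<in>carrier P. (\<delta> c, \<phi> c)) ` carrier P"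
      using that by (simp add: fibre_product_simps)
    then obtain p where "p \<in> carrier P" "(a, c) = (\<lambda>c\<in>carrier P. (\<delta> c, \<phi> c)) p" by blast
    then show ?thesis by auto
  qed
qed (rule inj)

section \<open>Pullbacks of algebras of glued graphs\<close>

theorem theorem4p3:
  fixes E\<^sub>1 :: "('v1, 'e1) pre_digraph"
    and E\<^sub>2 :: "('v2, 'e2) pre_digraph"
    and H :: "('w, 'f) pre_digraph"
    and X :: "'x set"
    and \<iota>\<^sub>1 :: "'x \<Rightarrow> 'v1" and \<iota>\<^sub>2 :: "'x \<Rightarrow> 'v2" and \<iota>H :: "'x \<Rightarrow> 'w"
    and A :: "'a cstar" and B :: "'b cstar"
    and \<delta> \<phi> \<rho> \<theta>
  assumes graphs: "directed_graph E\<^sub>1" "directed_graph E\<^sub>2" "directed_graph H"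
    and inj: "inj_on \<iota>\<^sub>1 X" "inj_on \<iota>\<^sub>2 X" "inj_on \<iota>H X"
    and sinks: "\<iota>\<^sub>1 ` X \<subseteq> sinks E\<^sub>1" "\<iota>\<^sub>2 ` X \<subseteq> sinks E\<^sub>2"
    and verts_H: "\<iota>H ` X \<subseteq> verts H"
    and algebras: "cstar_algebra A" "cstar_algebra B"
    and pullback: "pullback_diagram (graph_cstar E\<^sub>1) A (graph_cstar E\<^sub>2) B \<delta> \<phi> \<rho> \<theta>"
    and i_inj: "inj_on \<phi> (carrier (graph_cstar E\<^sub>1))"
    and i_vert: "\<forall>v\<in>verts E\<^sub>1. \<exists>w\<in>verts E\<^sub>2. \<phi> (vproj E\<^sub>1 v) = vproj E\<^sub>2 w"
    and i_edge: "\<forall>e\<in>arcs E\<^sub>1. \<exists>u p w. pre_digraph.awalk E\<^sub>2 u p w \<and> \<phi> (eiso E\<^sub>1 e) = path_iso E\<^sub>2 u p"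
    and ii_X: "\<forall>x\<in>X. \<phi> (vproj E\<^sub>1 (\<iota>\<^sub>1 x)) = vproj E\<^sub>2 (\<iota>\<^sub>2 x)"
    and ii_compl: "\<forall>v\<in>verts E\<^sub>1 - \<iota>\<^sub>1 ` X. \<exists>w\<in>verts E\<^sub>2 - \<iota>\<^sub>2 ` X. \<phi> (vproj E\<^sub>1 v) = vproj E\<^sub>2 w"
    and iii: "\<forall>u p. \<forall>x\<in>X. pre_digraph.awalk E\<^sub>2 u p (\<iota>\<^sub>2 x) \<longrightarrow>
                path_iso E\<^sub>2 u p \<in> \<phi> ` carrier (graph_cstar E\<^sub>1)"
    and iv: "\<forall>x\<in>X. \<delta> (vproj E\<^sub>1 (\<iota>\<^sub>1 x)) = \<zero>\<^bsub>A\<^esub>"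
  shows "\<exists>jE\<^sub>1 jH\<^sub>1 jE\<^sub>2 jH\<^sub>2 \<delta>' \<psi> \<theta>'.
    pushout_left_homs E\<^sub>1 H X \<iota>\<^sub>1 \<iota>H = {jE\<^sub>1} \<and> pushout_right_homs E\<^sub>1 H X \<iota>\<^sub>1 \<iota>H = {jH\<^sub>1} \<and>
    pushout_left_homs E\<^sub>2 H X \<iota>\<^sub>2 \<iota>H = {jE\<^sub>2} \<and> pushout_right_homs E\<^sub>2 H X \<iota>\<^sub>2 \<iota>H = {jH\<^sub>2} \<and>
    induced_homs E\<^sub>1 H X \<iota>\<^sub>1 \<iota>H A jE\<^sub>1 jH\<^sub>1 \<delta> (zero_hom (graph_cstar H) A) = {\<delta>'} \<and>
    induced_homs E\<^sub>1 H X \<iota>\<^sub>1 \<iota>H (graph_cstar (pushout_graph E\<^sub>2 H X \<iota>\<^sub>2 \<iota>H)) jE\<^sub>1 jH\<^sub>1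
      (compose (carrier (graph_cstar E\<^sub>1)) jE\<^sub>2 \<phi>) jH\<^sub>2 = {\<psi>} \<and>
    induced_homs E\<^sub>2 H X \<iota>\<^sub>2 \<iota>H B jE\<^sub>2 jH\<^sub>2 \<theta> (zero_hom (graph_cstar H) B) = {\<theta>'} \<and>
    pullback_diagram (graph_cstar (pushout_graph E\<^sub>1 H X \<iota>\<^sub>1 \<iota>H)) A
      (graph_cstar (pushout_graph E\<^sub>2 H X \<iota>\<^sub>2 \<iota>H)) B \<delta>' \<psi> \<rho> \<theta>'"
proof -
  let ?C1 = "graph_cstar E\<^sub>1" and ?C2 = "graph_cstar E\<^sub>2" and ?CH = "graph_cstar H"
  let ?D1 = "graph_cstar (pushout_graph E\<^sub>1 H X \<iota>\<^sub>1 \<iota>H)" and ?D2 = "graph_cstar (pushout_graph E\<^sub>2 H X \<iota>\<^sub>2 \<iota>H)"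
  have wf: "wf_digraph E\<^sub>1" "wf_digraph E\<^sub>2" "wf_digraph H" using graphs by (simp_all add: directed_graph_def)
  have count: "countable (verts E\<^sub>1)" "countable (arcs E\<^sub>1)" "countable (verts E\<^sub>2)" "countable (arcs E\<^sub>2)"
    using graphs by (simp_all add: directed_graph_def)
  have gl1: "gluing E\<^sub>1 H X \<iota>\<^sub>1 \<iota>H"
    by (intro gluing.intro gluing_axioms.intro) (fact wf inj sinks verts_H count)+
  have gl2: "gluing E\<^sub>2 H X \<iota>\<^sub>2 \<iota>H"
    by (intro gluing.intro gluing_axioms.intro) (fact wf inj sinks verts_H count)+
  obtain jE\<^sub>1 where jE1: "pushout_left_homs E\<^sub>1 H X \<iota>\<^sub>1 \<iota>H = {jE\<^sub>1}" and p1E: "star_hom ?C1 ?D1 jE\<^sub>1"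
    "\<forall>v\<in>verts E\<^sub>1. jE\<^sub>1 (vproj E\<^sub>1 v) = vproj (pushout_graph E\<^sub>1 H X \<iota>\<^sub>1 \<iota>H) (glue_class E\<^sub>1 H X \<iota>\<^sub>1 \<iota>H (Inl v))"
    "\<forall>e\<in>arcs E\<^sub>1. jE\<^sub>1 (eiso E\<^sub>1 e) = eiso (pushout_graph E\<^sub>1 H X \<iota>\<^sub>1 \<iota>H) (Inl e)"
    using gluing.left_hom[OF gl1] by metis
  obtain jH\<^sub>1 where jH1: "pushout_right_homs E\<^sub>1 H X \<iota>\<^sub>1 \<iota>H = {jH\<^sub>1}" and p1H: "star_hom ?CH ?D1 jH\<^sub>1"
    "\<forall>v\<in>verts H. jH\<^sub>1 (vproj H v) = vproj (pushout_graph E\<^sub>1 H X \<iota>\<^sub>1 \<iota>H) (glue_class E\<^sub>1 H X \<iota>\<^sub>1 \<iota>H (Inr v))"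
    "\<forall>e\<in>arcs H. jH\<^sub>1 (eiso H e) = eiso (pushout_graph E\<^sub>1 H X \<iota>\<^sub>1 \<iota>H) (Inr e)"
    using gluing.right_hom[OF gl1] by metis
  obtain jE\<^sub>2 where jE2: "pushout_left_homs E\<^sub>2 H X \<iota>\<^sub>2 \<iota>H = {jE\<^sub>2}" and p2E: "star_hom ?C2 ?D2 jE\<^sub>2"
    "\<forall>v\<in>verts E\<^sub>2. jE\<^sub>2 (vproj E\<^sub>2 v) = vproj (pushout_graph E\<^sub>2 H X \<iota>\<^sub>2 \<iota>H) (glue_class E\<^sub>2 H X \<iota>\<^sub>2 \<iota>H (Inl v))"
    "\<forall>e\<in>arcs E\<^sub>2. jE\<^sub>2 (eiso E\<^sub>2 e) = eiso (pushout_graph E\<^sub>2 H X \<iota>\<^sub>2 \<iota>H) (Inl e)"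
    using gluing.left_hom[OF gl2] by metis
  obtain jH\<^sub>2 where jH2: "pushout_right_homs E\<^sub>2 H X \<iota>\<^sub>2 \<iota>H = {jH\<^sub>2}" and p2H: "star_hom ?CH ?D2 jH\<^sub>2"
    "\<forall>v\<in>verts H. jH\<^sub>2 (vproj H v) = vproj (pushout_graph E\<^sub>2 H X \<iota>\<^sub>2 \<iota>H) (glue_class E\<^sub>2 H X \<iota>\<^sub>2 \<iota>H (Inr v))"
    "\<forall>e\<in>arcs H. jH\<^sub>2 (eiso H e) = eiso (pushout_graph E\<^sub>2 H X \<iota>\<^sub>2 \<iota>H) (Inr e)"
    using gluing.right_hom[OF gl2] by metis
  interpret p1: glued_algebra E\<^sub>1 H X \<iota>\<^sub>1 \<iota>H jE\<^sub>1 jH\<^sub>1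
    by (intro glued_algebra.intro glued_algebra_axioms.intro gl1 p1E(1) p1H(1)) (simp_all add: p1E p1H)
  interpret p2: glued_algebra E\<^sub>2 H X \<iota>\<^sub>2 \<iota>H jE\<^sub>2 jH\<^sub>2
    by (intro glued_algebra.intro glued_algebra_axioms.intro gl2 p2E(1) p2H(1)) (simp_all add: p2E p2H)
  interpret sq: pullback_square ?C1 A ?C2 B \<delta> \<phi> \<rho> \<theta>
    by (rule pullback_squareI[OF pullback i_inj graph_cstar_algebra[OF wf(1)] algebras(1)
          graph_cstar_algebra[OF wf(2)] algebras(2)])
  note phi_X = bspec[OF ii_X]
  have theta_X: "\<theta> (vproj E\<^sub>2 (\<iota>\<^sub>2 x)) = \<zero>\<^bsub>B\<^esub>" if x: "x \<in> X" for x
    using sq.commutes[of "vproj E\<^sub>1 (\<iota>\<^sub>1 x)"] iv phi_X x p1.i_verts[OF x] by simp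
  have zero: "zero_hom ?CH D c = \<zero>\<^bsub>D\<^esub>" if "c \<in> carrier ?CH" for c and D :: "('z, 'k) cstar_scheme"
    using that by (simp add: zero_hom_def)
  have zA: "star_hom ?CH A (zero_hom ?CH A)" and zB: "star_hom ?CH B (zero_hom ?CH B)"
    by (rule zero_star_hom[OF graph_cstar_algebra[OF wf(3)] algebras(1)],
        rule zero_star_hom[OF graph_cstar_algebra[OF wf(3)] algebras(2)])
  obtain \<delta>' where d': "star_hom ?D1 A \<delta>'"
    "induced_homs E\<^sub>1 H X \<iota>\<^sub>1 \<iota>H A jE\<^sub>1 jH\<^sub>1 \<delta> (zero_hom ?CH A) = {\<delta>'}"
    "\<forall>c\<in>carrier ?C1. \<delta>' (jE\<^sub>1 c) = \<delta> c" "\<forall>c\<in>carrier ?CH. \<delta>' (jH\<^sub>1 c) = zero_hom ?CH A c"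
  proof (rule p1.induced_hom[OF sq.delta.star_hom_axioms zA])
    show "\<delta> (vproj E\<^sub>1 (\<iota>\<^sub>1 x)) = zero_hom ?CH A (vproj H (\<iota>H x))" if "x \<in> X" for x
      using iv that p1.k_vert[OF that] by (simp add: zero)
    show "\<delta> (vproj E\<^sub>1 v) \<otimes>\<^bsub>A\<^esub> zero_hom ?CH A (vproj H w) = \<zero>\<^bsub>A\<^esub>" if "v \<in> verts E\<^sub>1" "w \<in> verts H" for v w
      using that by (simp add: zero)
  qed blast
  obtain \<theta>' where t': "star_hom ?D2 B \<theta>'"
    "induced_homs E\<^sub>2 H X \<iota>\<^sub>2 \<iota>H B jE\<^sub>2 jH\<^sub>2 \<theta> (zero_hom ?CH B) = {\<theta>'}"
    "\<forall>c\<in>carrier ?C2. \<theta>' (jE\<^sub>2 c) = \<theta> c" "\<forall>c\<in>carrier ?CH. \<theta>' (jH\<^sub>2 c) = zero_hom ?CH B c"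
  proof (rule p2.induced_hom[OF sq.theta.star_hom_axioms zB])
    show "\<theta> (vproj E\<^sub>2 (\<iota>\<^sub>2 x)) = zero_hom ?CH B (vproj H (\<iota>H x))" if "x \<in> X" for x
      using theta_X that p1.k_vert[OF that] by (simp add: zero)
    show "\<theta> (vproj E\<^sub>2 v) \<otimes>\<^bsub>B\<^esub> zero_hom ?CH B (vproj H w) = \<zero>\<^bsub>B\<^esub>" if "v \<in> verts E\<^sub>2" "w \<in> verts H" for v w
      using that by (simp add: zero)
  qed blast
  obtain \<psi> where ps: "star_hom ?D1 ?D2 \<psi>"
    "induced_homs E\<^sub>1 H X \<iota>\<^sub>1 \<iota>H ?D2 jE\<^sub>1 jH\<^sub>1 (compose (carrier ?C1) jE\<^sub>2 \<phi>) jH\<^sub>2 = {\<psi>}"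
    "\<forall>c\<in>carrier ?C1. \<psi> (jE\<^sub>1 c) = compose (carrier ?C1) jE\<^sub>2 \<phi> c" "\<forall>c\<in>carrier ?CH. \<psi> (jH\<^sub>1 c) = jH\<^sub>2 c"
  proof (rule p1.induced_hom[OF star_hom_compose[OF sq.phi.star_hom_axioms p2E(1)] p2H(1)])
    show "compose (carrier ?C1) jE\<^sub>2 \<phi> (vproj E\<^sub>1 (\<iota>\<^sub>1 x)) = jH\<^sub>2 (vproj H (\<iota>H x))" if "x \<in> X" for x
      using p1.i_verts[OF that] phi_X[OF that] p2.jE_jH_glued[OF that] by (simp add: compose_def)
    show "compose (carrier ?C1) jE\<^sub>2 \<phi> (vproj E\<^sub>1 v) \<otimes>\<^bsub>?D2\<^esub> jH\<^sub>2 (vproj H w) = \<zero>\<^bsub>?D2\<^esub>"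
      if v: "v \<in> verts E\<^sub>1" and w: "w \<in> verts H" and vw: "\<not> (\<exists>x\<in>X. v = \<iota>\<^sub>1 x \<and> w = \<iota>H x)" for v w
    proof -
      \<comment> \<open>The vertex of \<open>E\<^sub>2\<close> that corresponds to \<open>v\<close> is glued
        to \<open>w\<close> only if \<open>v\<close> is.\<close>
      obtain u where u: "u \<in> verts E\<^sub>2" "\<phi> (vproj E\<^sub>1 v) = vproj E\<^sub>2 u" "\<not> (\<exists>x\<in>X. u = \<iota>\<^sub>2 x \<and> w = \<iota>H x)"
      proof (cases "v \<in> \<iota>\<^sub>1 ` X")
        case True
        then obtain x where x: "x \<in> X" "v = \<iota>\<^sub>1 x" by blast
        have "\<not> (\<exists>y\<in>X. \<iota>\<^sub>2 x = \<iota>\<^sub>2 y \<and> w = \<iota>H y)"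
          using vw x inj_onD[OF inj(2)] by metis
        then show ?thesis using that[of "\<iota>\<^sub>2 x"] x phi_X[OF x(1)] p2.i_verts[OF x(1)] by blast
      next
        case False
        then obtain u where "u \<in> verts E\<^sub>2 - \<iota>\<^sub>2 ` X" "\<phi> (vproj E\<^sub>1 v) = vproj E\<^sub>2 u" using ii_compl v by blast
        then show ?thesis using that[of u] by blast
      qed
      then show ?thesis using p2.jE_jH_orth[OF u(1) w u(3)] v by (simp add: compose_def)
    qed
  qed blast
  interpret d': star_hom ?D1 A \<delta>' by (rule d'(1))
  interpret t': star_hom ?D2 B \<theta>' by (rule t'(1))
  interpret ps: star_hom ?D1 ?D2 \<psi> by (rule ps(1))
  have psi_E: "\<psi> (jE\<^sub>1 c) = jE\<^sub>2 (\<phi> c)" if "c \<in> carrier ?C1" for c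
    using ps(3) that by (simp add: compose_def)
  \<comment> \<open>\<open>\<phi>\<close> carries the generators of \<open>I\<^sub>1\<close> to those of
    \<open>I\<^sub>2\<close>.\<close>
  have gens: "vproj E\<^sub>2 ` \<iota>\<^sub>2 ` X = \<phi> ` (vproj E\<^sub>1 ` \<iota>\<^sub>1 ` X)"
    by (simp add: image_image phi_X cong: image_cong_simp)
  have lift: "y \<in> sq.kernel \<and> sq.lift y \<in> p1.EI.I" if "y \<in> p2.EI.I" for y
    using sq.lift_ideal[OF p1.EI.unital_ideal_axioms _ that[unfolded gens]] iv by blast
  interpret gp: glued_pair E\<^sub>1 E\<^sub>2 H X \<iota>\<^sub>1 \<iota>\<^sub>2 \<iota>H jE\<^sub>1 jH\<^sub>1 jE\<^sub>2 jH\<^sub>2 \<phi> \<psi> sq.lift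
  proof (intro glued_pair.intro glued_pair_axioms.intro)
    show "sq.lift y \<in> p1.EI.I" "\<phi> (sq.lift y) = y" "\<parallel>sq.lift y\<parallel>\<^bsub>?C1\<^esub> \<le> \<parallel>y\<parallel>\<^bsub>?C2\<^esub>" if "y \<in> p2.EI.I" for y
      using lift[OF that] sq.lift sq.lift_contractive by blast+
  qed (use p1.glued_algebra_axioms p2.glued_algebra_axioms sq.phi.star_hom_axioms ps i_inj phi_X psi_E in simp_all)
  have d_J: "\<delta>' y = \<zero>\<^bsub>A\<^esub>" if "y \<in> p1.J" for y
    by (rule d'.closed_ideal_kernel[OF that p1.J_gens]) (use d'(4) in \<open>auto simp: zero\<close>)
  have t_J: "\<theta>' y = \<zero>\<^bsub>B\<^esub>" if "y \<in> p2.J" for y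
    by (rule t'.closed_ideal_kernel[OF that p2.J_gens]) (use t'(4) in \<open>auto simp: zero\<close>)
  have "pullback_diagram ?D1 A ?D2 B \<delta>' \<psi> \<rho> \<theta>'"
  proof (rule pullback_diagramI[OF d'(1) ps(1) sq.rho.star_hom_axioms t'(1)])
    fix z assume z: "z \<in> carrier ?D1"
    obtain c y where cy: "c \<in> carrier ?C1" "y \<in> p1.J" "z = jE\<^sub>1 c \<oplus>\<^bsub>?D1\<^esub> y" using p1.decompose[OF z] by blast
    note yc = p1.J_carrier[OF cy(2)]
    have y2: "\<psi> y \<in> p2.J"
      by (rule ps.closed_ideal_image[OF cy(2) p1.J_gens]) (use ps(4) p2.jH_P_J in auto)
    have psi_z: "\<psi> z = jE\<^sub>2 (\<phi> c) \<oplus>\<^bsub>?D2\<^esub> \<psi> y" using cy yc by (simp add: ps.add psi_E)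
    have "\<delta>' z = \<delta> c" using cy yc d'(3) d_J[OF cy(2)] by (simp add: d'.add)
    moreover have "\<theta>' (\<psi> z) = \<theta> (\<phi> c)"
      unfolding psi_z using cy(1) t'(3) t_J[OF y2] p2.J_carrier[OF y2] by (simp add: t'.add)
    ultimately show "\<rho> (\<delta>' z) = \<theta>' (\<psi> z)" using sq.commutes[OF cy(1)] by simp
    assume 0: "\<psi> z = \<zero>\<^bsub>?D2\<^esub>"
    \<comment> \<open>Since \<open>\<psi> y\<close> lies in \<open>J\<^sub>2\<close>, so does
      \<open>jE\<^sub>2 (\<phi> c)\<close>; this forces \<open>c\<close> into \<open>I\<^sub>1\<close> and
      \<open>z\<close> into \<open>J\<^sub>1\<close>.\<close>
    have sum0: "jE\<^sub>2 (\<phi> c) \<oplus>\<^bsub>?D2\<^esub> \<psi> y = \<zero>\<^bsub>?D2\<^esub>" using 0 unfolding psi_z .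
    have "jE\<^sub>2 (\<phi> c) = (- 1) \<odot>\<^bsub>?D2\<^esub> \<psi> y"
      using p2.jE.B.add_diff_cancel[of "jE\<^sub>2 (\<phi> c)" "\<psi> y", unfolded sum0] cy(1) yc by (simp add: p2.jE.B.zero_diff)
    then have "jE\<^sub>2 (\<phi> c) \<in> p2.J" using y2 by (simp add: closed_ideal.scale)
    then have "\<phi> c \<in> p2.EI.I" using p2.ideal_detect[of "\<phi> c"] cy(1) by simp
    then have "c \<in> p1.EI.I" using lift[of "\<phi> c"] sq.lift_phi[OF cy(1)] by simp
    then have "z \<in> p1.J" unfolding cy(3) by (rule closed_ideal.add[OF p1.jE_ideal cy(2)])
    then show "z = \<zero>\<^bsub>?D1\<^esub>"
      using gp.psi_isometric[of z] 0 z by (simp add: p1.jE.B.cnorm_eq_zero)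
  next
    fix a d assume a: "a \<in> carrier A" and d: "d \<in> carrier ?D2" and eq: "\<rho> a = \<theta>' d"
    obtain c y where cy: "c \<in> carrier ?C2" "y \<in> p2.J" "d = jE\<^sub>2 c \<oplus>\<^bsub>?D2\<^esub> y" using p2.decompose[OF d] by blast
    have "\<theta>' d = \<theta> c" using cy p2.J_carrier[OF cy(2)] t'(3) t_J[OF cy(2)] by (simp add: t'.add)
    then obtain p where p: "p \<in> carrier ?C1" "\<delta> p = a" "\<phi> p = c" using sq.lifting[OF a cy(1)] eq by auto
    obtain z where z: "z \<in> p1.J" "y = \<psi> z" using gp.psi_onto[OF cy(2)] by blast
    note zc = p1.J_carrier[OF z(1)]
    show "\<exists>q\<in>carrier ?D1. \<delta>' q = a \<and> \<psi> q = d"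
      by (rule bexI[of _ "jE\<^sub>1 p \<oplus>\<^bsub>?D1\<^esub> z"])
        (use p z zc cy(3) d'(3) d_J[OF z(1)] a in \<open>simp_all add: d'.add ps.add psi_E\<close>)
  qed
  then show ?thesis using jE1 jH1 jE2 jH2 d'(2) ps(2) t'(2) by blast
qed

end
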